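(* Let $\alpha\in(0,1)$ and let $N,m$ be positive integers. Then there exist $\varepsilon>0$ and constants $\mu_0,\kappa>0$, $\beta,\gamma\in\mathbb{R}\setminus\{0\}$, depending only on $N$ and $m$, and a smooth curve $$(-\varepsilon,\varepsilon)\to(0,+\infty)\times\mathcal{P}^{2,\alpha}_p(\mathbb{R}),\qquad s\mapsto(\mu_s,h_s)$$ with $\mu_s|_{s=0}=\mu_0$, $$h_s(x)=\kappa\sqrt{\mu_s}+s\beta\cos(x)+o(s)\qquad\text{as } s\to0 \text{ uniformly on } \mathbb{R},$$ and the property that for every $s\in(-\varepsilon,\varepsilon)$ the overdetermined boundary value problem $$\Delta w_s+\mu_s w_s=0\ \text{ in }\Omega_{h_s},\qquad w_s=1\ \text{ on }\partial\Omega_{h_s},\qquad |\nabla w_s|=0\ \text{ on }\partial\Omega_{h_s}$$ admits a classical solution $w_s$ which is radial in $t$ and $2\pi$-periodic and even in $x$. Moreover, $$w_s\Bigl(\frac{t}{h_s(x)},x\Bigr)=U_m(|t|)+s\bigl\{\phi_1(|t|)+\gamma\,|t|\,U_m'(|t|)\bigr\}\cos(x)+o(s)\qquad\text{as } s\to0$$ uniformly on $B_1\times\mathbb{R}$, where $t\mapsto U_m(|t|)$ is the $m$-th nonconstant radial Neumann eigenfunction of the Laplacian on the unit ball $B_1$ of $\mathbb{R}^N$, normalized such that $U_m(1)=1$, and $t\mapsto\phi_1(|t|)$ is a (suitably normalized) positive first Dirichlet eigenfunction of the Laplacian on $B_1$.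
   Context: $C^{2,\alpha}_p(\mathbb{R})$ denotes the Banach space of $2\pi$-periodic and even $C^{2,\alpha}$-functions on $\mathbb{R}$, and $\mathcal{P}^{2,\alpha}_p(\mathbb{R})$ is its open subset of strictly positive functions. For $h\in\mathcal{P}^{2,\alpha}_p(\mathbb{R})$, $$\Omega_h:=\Bigl\{(t,x)\in\mathbb{R}^N\times\mathbb{R}\;:\;|t|<\frac{1}{h(x)}\Bigr\}.$$ $B_1\subset\mathbb{R}^N$ is the open unit ball, and $\Delta$, $\nabla$ are the Laplacian and gradient in $\mathbb{R}^N\times\mathbb{R}$. Radial in $t$ means depending on $t\in\mathbb{R}^N$ only through $|t|$ (for $N=1$: even in $t$). *)

theory Defs
  imports "HOL-Analysis.Analysis"
begin

section \<open>Gradient, Laplacian, classical differentiability\<close>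

text \<open>
  All derivatives are taken within the set \<open>S\<close>.  For open \<open>S\<close> these are the ordinary ones.
  For the closure of a domain, \<open>grad\<close> at a boundary point is the one-sided gradient; it is unique
  on the sets used below (closed balls, closures of the domains \<open>Omega h\<close>).
\<close>

definition grad :: "'a::euclidean_space set \<Rightarrow> ('a \<Rightarrow> real) \<Rightarrow> 'a \<Rightarrow> 'a" where
  "grad S u z = (\<Sum>b\<in>Basis. frechet_derivative u (at z within S) b *\<^sub>R b)"

definition laplacian :: "'a::euclidean_space set \<Rightarrow> ('a \<Rightarrow> real) \<Rightarrow> 'a \<Rightarrow> real" where
  "laplacian S u z = (\<Sum>b\<in>Basis. grad S (\<lambda>y. grad S u y \<bullet> b) z \<bullet> b)"

definition C1_on :: "'a::euclidean_space set \<Rightarrow> ('a \<Rightarrow> real) \<Rightarrow> bool" where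
  "C1_on S u \<longleftrightarrow> u differentiable_on S \<and> continuous_on S (grad S u)"

definition C2_on :: "'a::euclidean_space set \<Rightarrow> ('a \<Rightarrow> real) \<Rightarrow> bool" where
  "C2_on S u \<longleftrightarrow> C1_on S u \<and> (\<forall>b\<in>Basis. C1_on S (\<lambda>z. grad S u z \<bullet> b))"


section \<open>Eigenfunctions of the Laplacian on the unit ball\<close>

definition neumann_eigenfunction :: "real \<Rightarrow> ('a::euclidean_space \<Rightarrow> real) \<Rightarrow> bool" where
  "neumann_eigenfunction ev u \<longleftrightarrow>
     C2_on (ball 0 1) u \<and> C1_on (cball 0 1) u \<and>
     (\<exists>t\<in>ball 0 1. u t \<noteq> 0) \<and>
     (\<forall>t\<in>ball 0 1. laplacian (ball 0 1) u t + ev * u t = 0) \<and>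
     (\<forall>t\<in>sphere 0 1. grad (cball 0 1) u t \<bullet> t = 0)"

definition dirichlet_eigenfunction :: "real \<Rightarrow> ('a::euclidean_space \<Rightarrow> real) \<Rightarrow> bool" where
  "dirichlet_eigenfunction ev u \<longleftrightarrow>
     C2_on (ball 0 1) u \<and> continuous_on (cball 0 1) u \<and>
     (\<exists>t\<in>ball 0 1. u t \<noteq> 0) \<and>
     (\<forall>t\<in>ball 0 1. laplacian (ball 0 1) u t + ev * u t = 0) \<and>
     (\<forall>t\<in>sphere 0 1. u t = 0)"

definition radial_neumann_eigenvalues :: "'a::euclidean_space itself \<Rightarrow> real set" where
  "radial_neumann_eigenvalues _ =
     {ev. \<exists>U. neumann_eigenfunction ev (\<lambda>t::'a. U (norm t))}"

text \<open>
  The eigenvalue 0 belongs to the constants, and the radial eigenvalues are simple, so the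
  \<open>m\<close>-th nonconstant radial eigenfunction (\<open>m \<ge> 1\<close>) is the one belonging to the \<open>m\<close>-th positive
  radial eigenvalue.  It is given by its profile \<open>U\<close>, which matters on \<open>{0..1}\<close> only.
\<close>

definition nth_radial_neumann_eigenfunction ::
    "'a::euclidean_space itself \<Rightarrow> nat \<Rightarrow> (real \<Rightarrow> real) \<Rightarrow> bool" where
  "nth_radial_neumann_eigenfunction T m U \<longleftrightarrow>
     (\<exists>ev>0. neumann_eigenfunction ev (\<lambda>t::'a. U (norm t)) \<and>
        finite {l \<in> radial_neumann_eigenvalues T. 0 < l \<and> l \<le> ev} \<and>
        card {l \<in> radial_neumann_eigenvalues T. 0 < l \<and> l \<le> ev} = m)"

definition positive_first_dirichlet_eigenfunction ::
    "('a::euclidean_space \<Rightarrow> real) \<Rightarrow> bool" where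
  "positive_first_dirichlet_eigenfunction u \<longleftrightarrow>
     (\<exists>ev. dirichlet_eigenfunction ev u \<and>
        (\<forall>l. \<forall>v::'a \<Rightarrow> real. dirichlet_eigenfunction l v \<longrightarrow> ev \<le> l)) \<and>
     (\<forall>t\<in>ball 0 1. 0 < u t)"


section \<open>Periodic even functions of class \<open>C\<^sup>2\<^sup>,\<^sup>\<alpha>\<close>\<close>

definition C2a_per :: "real \<Rightarrow> (real \<Rightarrow> real) set" where
  "C2a_per \<alpha> =
     {f. (\<forall>x. f differentiable (at x)) \<and> (\<forall>x. deriv f differentiable (at x)) \<and>
         (\<exists>C. \<forall>x y. \<bar>deriv (deriv f) x - deriv (deriv f) y\<bar> \<le> C * \<bar>x - y\<bar> powr \<alpha>) \<and>
         (\<forall>x. f (x + 2 * pi) = f x) \<and> (\<forall>x. f (- x) = f x)}"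

definition P2a_per :: "real \<Rightarrow> (real \<Rightarrow> real) set" where
  "P2a_per \<alpha> = {f \<in> C2a_per \<alpha>. \<forall>x. 0 < f x}"

text \<open>The suprema are finite for \<open>f \<in> C2a_per \<alpha>\<close>, the only case in which the norm is used.\<close>

definition C2a_norm :: "real \<Rightarrow> (real \<Rightarrow> real) \<Rightarrow> real" where
  "C2a_norm \<alpha> f =
     (SUP x. \<bar>f x\<bar>) + (SUP x. \<bar>deriv f x\<bar>) + (SUP x. \<bar>deriv (deriv f) x\<bar>) +
     (SUP p\<in>{(x, y). x \<noteq> y}.
        \<bar>deriv (deriv f) (fst p) - deriv (deriv f) (snd p)\<bar> / \<bar>fst p - snd p\<bar> powr \<alpha>)"

text \<open>
  Smoothness of a curve in the Banach space \<open>C2a_per \<alpha>\<close> on an open set \<open>I\<close> of parameters: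
  \<open>D k\<close> is the \<open>k\<close>-th derivative, all difference quotients converging in the norm of the space.
  The exponent is a term, so the space is not a type and the library derivative does not apply.
\<close>

definition smooth_curve_C2a :: "real \<Rightarrow> real set \<Rightarrow> (real \<Rightarrow> real \<Rightarrow> real) \<Rightarrow> bool" where
  "smooth_curve_C2a \<alpha> I h \<longleftrightarrow>
     (\<exists>D :: nat \<Rightarrow> real \<Rightarrow> real \<Rightarrow> real.
        (\<forall>s\<in>I. D 0 s = h s) \<and>
        (\<forall>k. \<forall>s\<in>I. D k s \<in> C2a_per \<alpha> \<and>
           ((\<lambda>r. C2a_norm \<alpha> (\<lambda>x. (D k r x - D k s x) / (r - s) - D (Suc k) s x))
              \<longlongrightarrow> 0) (at s)))"

definition smooth_real_on :: "real set \<Rightarrow> (real \<Rightarrow> real) \<Rightarrow> bool" where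
  "smooth_real_on I f \<longleftrightarrow> (\<forall>k. \<forall>s\<in>I. (deriv ^^ k) f differentiable (at s))"


section \<open>The overdetermined problem\<close>

definition Omega :: "(real \<Rightarrow> real) \<Rightarrow> ('a::euclidean_space \<times> real) set" where
  "Omega h = {(t, x). norm t < 1 / h x}"

text \<open>Classical means: twice continuously differentiable in the domain, \<open>C\<^sup>1\<close> up to the boundary.\<close>

definition overdetermined_solution ::
    "real \<Rightarrow> (real \<Rightarrow> real) \<Rightarrow> ('a::euclidean_space \<times> real \<Rightarrow> real) \<Rightarrow> bool" where
  "overdetermined_solution \<mu> h w \<longleftrightarrow>
     C2_on (Omega h) w \<and> C1_on (closure (Omega h)) w \<and>
     (\<forall>z\<in>Omega h. laplacian (Omega h) w z + \<mu> * w z = 0) \<and>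
     (\<forall>z\<in>frontier (Omega h). w z = 1) \<and>
     (\<forall>z\<in>frontier (Omega h). norm (grad (closure (Omega h)) w z) = 0)"

definition radial_periodic_even_on ::
    "('a::euclidean_space \<times> real) set \<Rightarrow> ('a \<times> real \<Rightarrow> real) \<Rightarrow> bool" where
  "radial_periodic_even_on S w \<longleftrightarrow>
     (\<forall>t t' x. (t, x) \<in> S \<and> (t', x) \<in> S \<and> norm t = norm t' \<longrightarrow> w (t, x) = w (t', x)) \<and>
     (\<forall>t x. (t, x) \<in> S \<longrightarrow> w (t, x + 2 * pi) = w (t, x) \<and> w (t, - x) = w (t, x))"

text \<open>
  \<open>R s z = o(s)\<close> as \<open>s \<rightarrow> 0\<close>, uniformly in \<open>z \<in> S\<close>.  The parameter \<open>s = 0\<close> is included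
  (\<open>nhds 0\<close>, not \<open>at 0\<close>), so that an expansion up to \<open>o(s)\<close> is an identity at \<open>s = 0\<close>.
\<close>

definition uniformly_small_o :: "'b set \<Rightarrow> (real \<Rightarrow> 'b \<Rightarrow> real) \<Rightarrow> bool" where
  "uniformly_small_o S R \<longleftrightarrow>
     (\<forall>e>0. \<forall>\<^sub>F s in nhds 0. \<forall>z\<in>S. \<bar>R s z\<bar> \<le> e * \<bar>s\<bar>)"

end

theory Submission imports Defs "HOL-Complex_Analysis.Complex_Analysis"
begin

text \<open>
  Write \<open>h = \<sigma> / g\<close> with a constant \<open>\<sigma> = 1 / sqrt M\<close> and flatten the domain by \<open>y = |t| h(x)\<close>.
  In the unknowns \<open>u = w\<close>, \<open>P = \<partial>\<^sub>r w / \<sigma>\<close> and \<open>v = \<partial>\<^sub>x w\<close> the problem becomes a first order system on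
  \<open>[0,1] \<times> \<real>\<close> with boundary values \<open>u = 1\<close>, \<open>P = v = 0\<close> at \<open>y = 1\<close>, in which only first derivatives of \<open>g\<close>
  occur. Hence there is no loss of derivatives, and it can be solved by a power series in \<open>s\<close> whose
  coefficients are trigonometric polynomials in \<open>x\<close>; no bifurcation theorem is needed.

  At each order and for each frequency \<open>k\<close> one has to solve a radial Bessel equation with zeroth order
  coefficient \<open>K = M\<^sub>0 k\<^sup>2 - \<Lambda>\<close>, where \<open>\<Lambda>\<close> is the Neumann eigenvalue and \<open>M\<^sub>0 = \<Lambda> - \<lambda>\<^sub>1\<close> with the
  first Dirichlet eigenvalue \<open>\<lambda>\<^sub>1\<close>. Its Dirichlet problem is uniquely solvable except for \<open>k = 1\<close>, where
  \<open>K = - \<lambda>\<^sub>1\<close> is resonant and the solvability condition determines the next coefficient of \<open>M\<close>. Bounds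
  uniform in \<open>k\<close> and a scalar majorant give convergence.
\<close>

section \<open>Radial solutions and their zeros\<close>

text \<open>For every \<open>M\<close> the cylinder \<open>g = 1\<close> with \<open>u = U\<close>,
  \<open>P = U'\<close>, \<open>v = 0\<close> solves the flattened system, so \<open>M\<close> is a
  free parameter and the branch leaves this trivial family. Since \<open>v\<close> is the derivative
  along the axis at fixed \<open>t\<close>, not at fixed \<open>y\<close>, the boundary perturbation
  drops out of its linearised equation: \<open>v\<close> satisfies a Dirichlet problem although
  \<open>U\<close> is a Neumann function. The overdetermination is met because
  \<open>v 1 = 0\<close> yields \<open>u 1 = 0\<close>, while \<open>P 1 = 0\<close> fixes the
  boundary coefficient. No other resonance occurs: \<open>K\<close> increases with \<open>k\<close>,
  so it exceeds \<open>- \<lambda>\<^sub>1\<close> for \<open>k \<ge> 2\<close>; at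
  \<open>k = 0\<close> it equals \<open>- \<Lambda>\<close>, a Neumann value, where the radial
  solution cannot vanish at the boundary as well. That \<open>M\<^sub>0\<close> is positive is the
  inequality between the first Dirichlet and the radial Neumann eigenvalues. The coefficient of
  \<open>M\<close> that repairs order \<open>n\<close> multiplies the first order term, hence
  belongs to order \<open>n - 1\<close>. The majorant must therefore win back one power of
  \<open>s\<close> in every step, which the quadratic structure of the sources permits.\<close>

text \<open>\<open>bes N\<close> is the entire solution of \<open>4 z F'' + 2 N F' = F\<close> with \<open>F(0) = 1\<close>.\<close>

definition besc :: "nat \<Rightarrow> nat \<Rightarrow> real" where
  "besc N n = (\<Prod>j\<in>{1..n}. inverse (2 * real j * (2 * real j - 2 + real N)))"

definition bes :: "nat \<Rightarrow> real \<Rightarrow> real" where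
  "bes N z = (\<Sum>n. besc N n * z ^ n)"

definition bes1 :: "nat \<Rightarrow> real \<Rightarrow> real" where
  "bes1 N z = (\<Sum>n. diffs (besc N) n * z ^ n)"

definition bes2 :: "nat \<Rightarrow> real \<Rightarrow> real" where
  "bes2 N z = (\<Sum>n. diffs (diffs (besc N)) n * z ^ n)"

lemma besc_0 [simp]: "besc N 0 = 1"
  by (simp add: besc_def)

lemma besc_Suc: "besc N (Suc n) = besc N n / ((2 * real n + 2) * (2 * real n + real N))"
proof -
  have "{1..Suc n} = insert (Suc n) {1..n}" by auto
  then show ?thesis by (simp add: besc_def divide_inverse algebra_simps)
qed

lemma besc_pos: "N \<ge> 1 \<Longrightarrow> besc N n > 0"
  by (induction n) (auto simp: besc_Suc intro!: divide_pos_pos mult_pos_pos add_nonneg_pos)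

lemma besc_le_fact:
  assumes "N \<ge> 1" shows "besc N n \<le> 1 / fact n"
proof (induction n)
  case (Suc n)
  have "real n + 1 \<le> (2 * real n + 2) * (2 * real n + real N)"
  proof -
    have "(real n + 1) * 1 \<le> (2 * real n + 2) * (2 * real n + real N)"
      using assms by (intro mult_mono) auto
    then show ?thesis by simp
  qed
  moreover have "0 < real n + 1" by simp
  ultimately have "besc N n / ((2 * real n + 2) * (2 * real n + real N)) \<le> (1 / fact n) / (real n + 1)"
    using Suc besc_pos[OF assms, of n] by (intro frac_le) (auto simp: less_imp_le)
  then show ?case by (simp add: besc_Suc field_simps)
qed simp

lemma besc_summable:
  assumes "N \<ge> 1" shows "summable (\<lambda>n. besc N n * x ^ n)"
proof (rule summable_comparison_test'[where N = 0])
  show "summable (\<lambda>n. \<bar>x\<bar> ^ n / fact n)"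
    using summable_exp_generic[of "\<bar>x\<bar>"] by (simp add: divide_inverse mult.commute)
  show "norm (besc N n * x ^ n) \<le> \<bar>x\<bar> ^ n / fact n" for n
    using mult_right_mono[OF besc_le_fact[OF assms, of n], of "\<bar>x\<bar> ^ n"] besc_pos[OF assms, of n]
    by (simp add: abs_mult power_abs)
qed

lemma besc_diffs_summable:
  assumes "N \<ge> 1"
  shows "summable (\<lambda>n. diffs (besc N) n * x ^ n)" "summable (\<lambda>n. diffs (diffs (besc N)) n * x ^ n)"
proof -
  show *: "summable (\<lambda>n. diffs (besc N) n * x ^ n)" for x
    by (rule termdiff_converges_all) (rule besc_summable[OF assms])
  show "summable (\<lambda>n. diffs (diffs (besc N)) n * x ^ n)"
    by (rule termdiff_converges_all) (rule *)
qed

lemma DERIV_bes [derivative_intros]: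
  assumes "N \<ge> 1" "(f has_real_derivative f') (at x within S)"
  shows "((\<lambda>x. bes N (f x)) has_real_derivative bes1 N (f x) * f') (at x within S)"
proof -
  have "(bes N has_real_derivative bes1 N z) (at z)" for z
    unfolding bes_def bes1_def
    by (rule termdiffs_strong_converges_everywhere) (rule besc_summable[OF assms(1)])
  from DERIV_chain2[OF this assms(2)] show ?thesis .
qed

lemma DERIV_bes1 [derivative_intros]:
  assumes "N \<ge> 1" "(f has_real_derivative f') (at x within S)"
  shows "((\<lambda>x. bes1 N (f x)) has_real_derivative bes2 N (f x) * f') (at x within S)"
proof -
  have "(bes1 N has_real_derivative bes2 N z) (at z)" for z
    unfolding bes2_def bes1_def
    by (rule termdiffs_strong_converges_everywhere) (rule besc_diffs_summable[OF assms(1)])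
  from DERIV_chain2[OF this assms(2)] show ?thesis .
qed

lemma isCont_bes2: "N \<ge> 1 \<Longrightarrow> isCont (bes2 N) z"
  unfolding bes2_def
  by (rule isCont_powser_converges_everywhere) (rule besc_diffs_summable)

text \<open>Comparison of coefficients:
  \<open>4 n (n + 1) + 2 N (n + 1) = (2 n + 2) (2 n + N)\<close> is the denominator in
  \<open>besc_Suc\<close>. The index shift in the first sum is free because the factor
  \<open>n\<close> kills the term \<open>n = 0\<close>.\<close>

lemma bes_ode:
  assumes N: "N \<ge> 1" shows "4 * z * bes2 N z + 2 * real N * bes1 N z = bes N z"
proof -
  have s: "(\<lambda>n. 4 * z * (diffs (diffs (besc N)) n * z ^ n)) sums (4 * z * bes2 N z)"
    unfolding bes2_def by (intro sums_mult summable_sums besc_diffs_summable N)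
  have "(\<lambda>n. 4 * real (Suc n) * diffs (besc N) (Suc n) * z ^ Suc n) sums (4 * z * bes2 N z)"
    using s by (simp add: diffs_def algebra_simps)
  then have "(\<lambda>n. 4 * real n * diffs (besc N) n * z ^ n) sums (4 * z * bes2 N z)"
    using sums_Suc_iff[of "\<lambda>n. 4 * real n * diffs (besc N) n * z ^ n" "4 * z * bes2 N z"] by simp
  moreover have "(\<lambda>n. 2 * real N * (diffs (besc N) n * z ^ n)) sums (2 * real N * bes1 N z)"
    unfolding bes1_def by (intro sums_mult summable_sums besc_diffs_summable N)
  ultimately have "(\<lambda>n. 4 * real n * diffs (besc N) n * z ^ n + 2 * real N * (diffs (besc N) n * z ^ n))
     sums (4 * z * bes2 N z + 2 * real N * bes1 N z)"
    by (rule sums_add)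
  moreover have "4 * real n * diffs (besc N) n * z ^ n + 2 * real N * (diffs (besc N) n * z ^ n) = besc N n * z ^ n" for n
  proof -
    have "besc N n = (2 * real n + 2) * (2 * real n + real N) * besc N (Suc n)"
      using N by (simp add: besc_Suc add_nonneg_eq_0_iff)
    then show ?thesis by (simp add: diffs_def algebra_simps)
  qed
  ultimately show ?thesis
    unfolding bes_def by (simp add: sums_iff)
qed

lemma bes_0 [simp]: "bes N 0 = 1"
  unfolding bes_def by (simp add: powser_zero)

lemma bes1_0 [simp]: "bes1 N 0 = 1 / (2 * real N)"
  unfolding bes1_def by (subst powser_zero) (simp add: diffs_def besc_Suc)

lemma bes_ge_1:
  assumes "N \<ge> 1" "z \<ge> 0" shows "bes N z \<ge> 1" "bes1 N z \<ge> 0"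
proof -
  have "(\<Sum>n<1. besc N n * z ^ n) \<le> bes N z"
    unfolding bes_def using assms
    by (intro sum_le_suminf besc_summable) (auto intro!: mult_nonneg_nonneg simp: less_imp_le[OF besc_pos])
  then show "bes N z \<ge> 1" by simp
  show "bes1 N z \<ge> 0"
    unfolding bes1_def using assms
    by (intro suminf_nonneg besc_diffs_summable)
      (auto intro!: mult_nonneg_nonneg simp: diffs_def less_imp_le[OF besc_pos])
qed

text \<open>The regular radial solution of \<open>\<Delta>u = K u\<close> in dimension \<open>N\<close> and its derivative.\<close>

definition rad :: "nat \<Rightarrow> real \<Rightarrow> real \<Rightarrow> real" where
  "rad N K y = bes N (K * y\<^sup>2)"

definition rad' :: "nat \<Rightarrow> real \<Rightarrow> real \<Rightarrow> real" where
  "rad' N K y = 2 * K * y * bes1 N (K * y\<^sup>2)"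

definition rad'' :: "nat \<Rightarrow> real \<Rightarrow> real \<Rightarrow> real" where
  "rad'' N K y = 2 * K * bes1 N (K * y\<^sup>2) + 4 * K\<^sup>2 * y\<^sup>2 * bes2 N (K * y\<^sup>2)"

lemma rad_0 [simp]: "rad N K 0 = 1" "rad' N K 0 = 0"
  by (simp_all add: rad_def rad'_def)

lemma DERIV_rad: "N \<ge> 1 \<Longrightarrow> (rad N K has_real_derivative rad' N K y) (at y within S)"
  unfolding rad_def rad'_def by (auto intro!: derivative_eq_intros)

lemma DERIV_rad': "N \<ge> 1 \<Longrightarrow> (rad' N K has_real_derivative rad'' N K y) (at y within S)"
  unfolding rad'_def rad''_def by (auto intro!: derivative_eq_intros simp: power2_eq_square algebra_simps)

lemma rad_ode: "N \<ge> 1 \<Longrightarrow> y * rad'' N K y + (real N - 1) * rad' N K y = K * y * rad N K y"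
  unfolding rad''_def rad'_def rad_def bes_ode[of N "K * y\<^sup>2", symmetric]
  by (simp add: algebra_simps power2_eq_square)

lemma isCont_rad: "N \<ge> 1 \<Longrightarrow> isCont (rad N K) y" "N \<ge> 1 \<Longrightarrow> isCont (rad' N K) y"
    "N \<ge> 1 \<Longrightarrow> isCont (rad'' N K) y"
proof -
  show "N \<ge> 1 \<Longrightarrow> isCont (rad N K) y" using DERIV_rad DERIV_isCont by blast
  show "N \<ge> 1 \<Longrightarrow> isCont (rad' N K) y" using DERIV_rad' DERIV_isCont by blast
  have "N \<ge> 1 \<Longrightarrow> isCont (bes1 N) z" for z
    using DERIV_bes1[where f="\<lambda>x. x"] DERIV_isCont DERIV_ident by blast
  then have a: "N \<ge> 1 \<Longrightarrow> isCont (\<lambda>y. bes1 N (K * y\<^sup>2)) y"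
    by (intro isCont_o2[where g="bes1 N" and f="\<lambda>y. K * y\<^sup>2"] continuous_intros)
  have b: "N \<ge> 1 \<Longrightarrow> isCont (\<lambda>y. bes2 N (K * y\<^sup>2)) y"
    by (intro isCont_o2[where g="bes2 N" and f="\<lambda>y. K * y\<^sup>2"] isCont_bes2 continuous_intros)
  show "N \<ge> 1 \<Longrightarrow> isCont (rad'' N K) y"
    unfolding rad''_def using a b by (intro continuous_intros) auto
qed

lemma continuous_on_rad [continuous_intros]:
  assumes "N \<ge> 1"
  shows "continuous_on S (rad N K)" "continuous_on S (rad' N K)" "continuous_on S (rad'' N K)"
  using isCont_rad[OF assms] by (simp_all add: continuous_at_imp_continuous_on)

lemma DERIV_bes_minus:
  assumes "N \<ge> 1"
  shows "((\<lambda>x. bes N (- x)) has_real_derivative - bes1 N (- x)) (at x)"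
    "((\<lambda>x. bes1 N (- x)) has_real_derivative - bes2 N (- x)) (at x)"
  using DERIV_bes[OF assms DERIV_minus[OF DERIV_ident], of x UNIV]
    DERIV_bes1[OF assms DERIV_minus[OF DERIV_ident], of x UNIV] by simp_all

text \<open>The divergence form of the radial operator: the weight turns
  \<open>b' + (N - 1) b / y\<close> into an exact derivative. Every integration of a radial equation
  below rests on it.\<close>

lemma DERIV_radial_weight:
  fixes y :: real
  assumes "N \<ge> 1" "y \<noteq> 0" "(b has_real_derivative b') (at y within S)"
  shows "((\<lambda>y. y ^ (N - 1) * b y) has_real_derivative y ^ (N - 1) * (b' + (real N - 1) * b y / y)) (at y within S)"
proof -
  have "((\<lambda>y. y ^ (N - 1)) has_real_derivative (real N - 1) * y ^ (N - 1) / y) (at y within S)"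
  \<comment> \<open>For \<open>N = 1\<close> the weight is constant; otherwise the exponent is
    written as a successor, so that the power rule does not meet truncated subtraction.\<close>
  proof (cases "N = 1")
    case False
    then obtain n where n: "N = Suc (Suc n)" using assms(1) by (metis One_nat_def le_Suc_eq not0_implies_Suc not_one_le_zero)
    have "((\<lambda>y::real. y ^ Suc n) has_real_derivative real (Suc n) * y ^ n) (at y within S)"
      using DERIV_power_Suc[OF DERIV_ident, where s=S and n=n] by simp
    then show ?thesis using assms(2) n by (simp add: algebra_simps add_divide_distrib)
  qed auto
  from DERIV_mult[OF this assms(3)] show ?thesis by (rule DERIV_cong) (simp add: field_simps)
qed

text \<open>Uniqueness at a point \<open>r > 0\<close> by an energy: \<open>rad'^2 - K rad^2\<close>
  decays through the damping term \<open>(N - 1) / x\<close>, and the weight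
  \<open>x ^ (2 * N)\<close> overcompensates this decay, so \<open>G\<close> is nondecreasing. If
  \<open>G\<close> vanishes at \<open>r\<close>, then \<open>rad\<close> vanishes on all of
  \<open>(0, r]\<close>, which contradicts its limit \<open>1\<close> at \<open>0\<close>.\<close>

lemma rad_nontrivial:
  assumes N: "N \<ge> 1" and K: "K < 0" and r: "r > 0"
  shows "rad N K r \<noteq> 0 \<or> rad' N K r \<noteq> 0"
proof (rule ccontr)
  assume "\<not> ?thesis"
  then have z: "rad N K r = 0" "rad' N K r = 0" by auto
  define G where "G x = ((rad' N K x)\<^sup>2 - K * (rad N K x)\<^sup>2) * x ^ (2 * N)" for x
  have le: "G x \<le> G r" if "0 < x" "x \<le> r" for x
  proof (rule DERIV_nonneg_imp_nondecreasing[OF that(2)])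
    fix t assume t: "x \<le> t" "t \<le> r"
    then have t0: "t > 0" using that by simp
    have ode: "rad'' N K t = K * rad N K t - (real N - 1) * rad' N K t / t"
      using rad_ode[OF N, of t K] t0 by (simp add: field_simps)
    let ?D = "t ^ (2*N - 1) * (2 * (rad' N K t)\<^sup>2 - 2 * real N * K * (rad N K t)\<^sup>2)"
    have "t ^ (2*N) = t * t ^ (2*N - 1)" using N by (simp flip: power_Suc)
    then have "(G has_real_derivative ?D) (at t)"
      unfolding G_def
      by (auto intro!: derivative_eq_intros DERIV_rad DERIV_rad' N)
        (use t0 in \<open>simp add: ode field_simps power2_eq_square\<close>)
    moreover have "real N * (K * (rad N K t)\<^sup>2) \<le> 0" using K by (simp add: mult_nonneg_nonpos mult_nonpos_nonneg)
    then have "?D \<ge> 0" using t0 by (intro mult_nonneg_nonneg) (auto intro: order_trans)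
    ultimately show "\<exists>y. (G has_real_derivative y) (at t) \<and> 0 \<le> y" by blast
  qed
  have van: "rad N K x = 0" if "0 < x" "x \<le> r" for x
  proof -
    have "G x \<le> 0" using le[OF that] z by (simp add: G_def)
    then have "(rad' N K x)\<^sup>2 - K * (rad N K x)\<^sup>2 \<le> 0"
      using that unfolding G_def by (metis mult_le_0_iff not_le zero_less_power)
    then have "0 \<le> K * (rad N K x)\<^sup>2" by (smt (verit) zero_le_power2)
    then have "(rad N K x)\<^sup>2 \<le> 0" using K by (simp add: zero_le_mult_iff)
    then show ?thesis by simp
  qed
  have "((\<lambda>x. rad N K x) \<longlongrightarrow> 1) (at_right 0)"
    using isCont_rad(1)[OF N, where K=K and y=0] by (auto simp: isCont_def filterlim_at_split)
  moreover have "\<forall>\<^sub>F x in at_right 0. rad N K x = 0"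
    by (intro eventually_at_rightI[of 0 r]) (auto intro: van r less_imp_le)
  ultimately have "((\<lambda>x::real. 0::real) \<longlongrightarrow> 1) (at_right 0)"
    by (rule Lim_transform_eventually)
  then show False using tendsto_unique[of "at_right (0::real)", OF _ tendsto_const] by fastforce
qed

text \<open>The Pruefer angle \<open>arctan q\<close> grows at speed at least \<open>1 / 2\<close>
  once the damping coefficient \<open>(N - 1) / t\<close> is at most \<open>1\<close>. Without a
  zero it would gain \<open>9 / 2\<close> on an interval of length \<open>9\<close>, more than the
  length \<open>pi < 4\<close> of the range of \<open>arctan\<close>.\<close>

lemma rad_oscillates:
  assumes N: "N \<ge> 1" and a: "a \<ge> real N"
  shows "\<exists>r\<in>{a..a+9}. rad N (-1) r = 0"
proof (rule ccontr)
  assume "\<not> ?thesis"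
  then have nz: "rad N (-1) r \<noteq> 0" if "a \<le> r" "r \<le> a + 9" for r using that by auto
  define q where "q r = - (rad' N (-1) r / rad N (-1) r)" for r
  define G where "G x = arctan (q x) - x / 2" for x
  have "G a \<le> G (a + 9)"
  proof (rule DERIV_nonneg_imp_nondecreasing[where f=G])
    fix t assume t: "a \<le> t" "t \<le> a + 9"
    have t0: "t > 0" using a N t by linarith
    have ode: "rad'' N (-1) t = - rad N (-1) t - (real N - 1) * rad' N (-1) t / t"
      using rad_ode[OF N, of t "-1"] t0 by (simp add: field_simps)
    define c where "c = (real N - 1) / t"
    have c: "0 \<le> c" "c \<le> 1" using a N t t0 by (auto simp: c_def field_simps)
    have "(q has_real_derivative (1 - c * q t + (q t)\<^sup>2)) (at t)"
      unfolding q_def using nz[OF t] t0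
      by (auto intro!: derivative_eq_intros DERIV_rad DERIV_rad' N
           simp: ode c_def divide_simps power2_eq_square algebra_simps)
    then have "(G has_real_derivative (inverse (1 + (q t)\<^sup>2) * (1 - c * q t + (q t)\<^sup>2) - 1 / 2)) (at t)"
      unfolding G_def by (auto intro!: derivative_eq_intros)
    moreover have "0 \<le> inverse (1 + (q t)\<^sup>2) * (1 - c * q t + (q t)\<^sup>2) - 1 / 2"
    proof -
      have "2 * (c * q t) \<le> 1 + (q t)\<^sup>2"
      proof -
        have "2 * (c * q t) \<le> c\<^sup>2 + (q t)\<^sup>2" using sum_squares_bound[of c "q t"] by simp
        also have "c\<^sup>2 \<le> 1" using c by (simp add: power_le_one)
        finally show ?thesis by simp
      qed
      then have "(1 + (q t)\<^sup>2) / 2 \<le> 1 - c * q t + (q t)\<^sup>2" by simp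
      moreover have "0 < 1 + (q t)\<^sup>2" by (smt (verit) zero_le_power2)
      ultimately show ?thesis by (simp add: field_simps)
    qed
    ultimately show "\<exists>y. (G has_real_derivative y) (at t) \<and> 0 \<le> y" by blast
  qed simp
  then have "arctan (q a) + 9 / 2 \<le> arctan (q (a + 9))" by (simp add: G_def field_simps)
  then show False using arctan_bounded[of "q a"] arctan_bounded[of "q (a+9)"] pi_less_4 by linarith
qed

section \<open>Zeros of \<open>bes\<close> and \<open>bes1\<close>: the Dirichlet and Neumann
  spectra of radial functions\<close>

lemma bes_zero_exists:
  assumes N: "N \<ge> 1" shows "\<exists>l>b. bes N (- l) = 0"
proof -
  obtain r where r: "r \<in> {max (real N) (1 + \<bar>b\<bar>)..max (real N) (1 + \<bar>b\<bar>) + 9}" "rad N (-1) r = 0"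
    using rad_oscillates[OF N, of "max (real N) (1 + \<bar>b\<bar>)"] by auto
  then have "r \<ge> 1" "r > b" by auto
  then have "r\<^sup>2 > b" by (smt (verit) self_le_power zero_less_numeral)
  then show ?thesis using r(2) by (auto simp: rad_def)
qed

lemma first_bes_zero:
  assumes N: "N \<ge> 1"
  obtains l where "l > 0" "bes N (- l) = 0" "\<And>x. 0 \<le> x \<Longrightarrow> x < l \<Longrightarrow> bes N (- x) > 0"
proof -
  have cont: "continuous_on S (\<lambda>x. bes N (- x))" for S
    using DERIV_bes_minus(1)[OF N] by (meson DERIV_isCont continuous_at_imp_continuous_on)
  define Z where "Z = {0..} \<inter> (\<lambda>x. bes N (- x)) -` {0}"
  have "closed Z" unfolding Z_def
    using cont[of UNIV] by (intro continuous_closed_vimage closed_Int) (auto simp: continuous_on_eq_continuous_at)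
  moreover obtain l0 where "l0 > 0" "bes N (- l0) = 0" using bes_zero_exists[OF N, of 0] by blast
  then have "l0 \<in> Z" by (simp add: Z_def)
  then have "Z \<noteq> {}" by blast
  moreover have bb: "bdd_below Z" by (auto simp: Z_def bdd_below_def)
  ultimately have I: "Inf Z \<in> Z" using closed_contains_Inf by blast
  show thesis
  proof
    show "Inf Z > 0" using I by (cases "Inf Z = 0") (auto simp: Z_def)
    show "bes N (- Inf Z) = 0" using I by (auto simp: Z_def)
    fix x assume x: "0 \<le> x" "x < Inf Z"
    show "bes N (- x) > 0"
    proof (rule ccontr)
      assume "\<not> ?thesis"
      then obtain y where "0 \<le> y" "y \<le> x" "bes N (- y) = 0"
        using IVT2'[of "\<lambda>x. bes N (- x)" x 0 0] x(1) cont by auto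
      then have "y \<in> Z" by (simp add: Z_def)
      then show False using cInf_lower[OF _ bb] x \<open>y \<le> x\<close> by fastforce
    qed
  qed
qed

text \<open>At an accumulation point both \<open>bes1\<close> and its derivative \<open>bes2\<close>
  vanish, so the differential equation forces \<open>bes\<close> to vanish too. This contradicts
  \<open>rad_nontrivial\<close>; the point \<open>0\<close> is excluded by
  \<open>bes N 0 = 1\<close>.\<close>

lemma finite_bes1_zeros:
  assumes N: "N \<ge> 1" shows "finite ({l. 0 < l \<and> bes1 N (- l) = 0} \<inter> {..b})"
proof (rule ccontr)
  assume inf: "infinite ({l. 0 < l \<and> bes1 N (- l) = 0} \<inter> {..b})" (is "infinite ?S")
  have "?S \<subseteq> {0..b}" by auto
  then obtain x where x: "x \<in> {0..b}" "x islimpt ?S"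
    using compact_eq_Bolzano_Weierstrass[of "{0..b}"] inf by auto
  then obtain f where f: "\<And>n. f n \<in> ?S - {x}" "f \<longlonglongrightarrow> x"
    by (auto simp: islimpt_sequential)
  have d: "((\<lambda>l. bes1 N (- l)) has_real_derivative - bes2 N (- x)) (at x)"
    by (rule DERIV_bes_minus[OF N])
  then have "(\<lambda>l. bes1 N (- l)) \<midarrow>x\<rightarrow> bes1 N (- x)" using DERIV_isCont isCont_def by blast
  moreover have fx: "filterlim f (at x) sequentially" using f by (auto simp: filterlim_at)
  ultimately have "(\<lambda>n. bes1 N (- f n)) \<longlonglongrightarrow> bes1 N (- x)" by (rule filterlim_compose)
  then have b1: "bes1 N (- x) = 0" using f by (simp add: LIMSEQ_const_iff)
  have "(\<lambda>l. (bes1 N (- l) - bes1 N (- x)) / (l - x)) \<midarrow>x\<rightarrow> - bes2 N (- x)"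
    using d by (simp add: has_field_derivative_iff)
  from filterlim_compose[OF this fx] have b2: "bes2 N (- x) = 0"
    using f b1 by (simp add: LIMSEQ_const_iff)
  have "bes N (- x) = 0" using bes_ode[OF N, of "- x"] b1 b2 by simp
  then have "x > 0" using x by (cases "x = 0") auto
  then show False using rad_nontrivial[OF N, of "-1" "sqrt x"] b1 \<open>bes N (- x) = 0\<close>
    by (simp add: rad_def rad'_def)
qed

text \<open>Rolle's theorem between two consecutive choices of zeros of \<open>bes\<close>.\<close>

lemma bes1_zero_exists:
  assumes N: "N \<ge> 1" shows "\<exists>l>b. 0 < l \<and> bes1 N (- l) = 0"
proof -
  obtain l where l: "l > max b 0" "bes N (- l) = 0" using bes_zero_exists[OF N] by blast
  obtain l' where l': "l' > l" "bes N (- l') = 0" using bes_zero_exists[OF N] by blast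
  have d: "((\<lambda>l. bes N (- l)) has_real_derivative - bes1 N (- x)) (at x)" for x
    by (rule DERIV_bes_minus[OF N])
  obtain z where "l < z" "z < l'" "bes N (- l') - bes N (- l) = (l' - l) * - bes1 N (- z)"
    using MVT2[OF l'(1), of "\<lambda>l. bes N (- l)", OF d] by blast
  then show ?thesis using l l' by (intro exI[of _ z]) auto
qed

lemma discrete_set_nth:
  fixes S :: "real set"
  assumes fin: "\<And>b. finite (S \<inter> {..b})" and unb: "\<And>b. \<exists>x\<in>S. x > b" and "m \<ge> 1"
  shows "\<exists>x\<in>S. card (S \<inter> {..x}) = m"
  using \<open>m \<ge> 1\<close>
proof (induction m rule: nat_induct_at_least)
  case base
  obtain s where s: "s \<in> S" using unb[of 0] by auto
  define x where "x = Min (S \<inter> {..s})"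
  have x: "x \<in> S \<inter> {..s}" unfolding x_def using fin s by (intro Min_in) auto
  have "S \<inter> {..x} = {x}" using x by (auto simp: x_def fin intro: antisym Min_le[OF fin])
  then show ?case using x by (intro bexI[of _ x]) auto
next
  case (Suc m)
  then obtain x where x: "x \<in> S" "card (S \<inter> {..x}) = m" by auto
  obtain s where s: "s \<in> S" "s > x" using unb by auto
  have f: "finite (S \<inter> {x<..s})" by (rule finite_subset[OF _ fin[of s]]) auto
  define y where "y = Min (S \<inter> {x<..s})"
  have y: "y \<in> S \<inter> {x<..s}" unfolding y_def using f s by (intro Min_in) auto
  have "z = y" if "z \<in> S" "z > x" "z \<le> y" for z
    using that y Min_le[OF f, of z] by (auto simp: y_def[symmetric])
  then have *: "z = y \<or> z \<le> x" if "z \<in> S" "z \<le> y" for z using that by force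
  have "S \<inter> {..y} = insert y (S \<inter> {..x})" using y by (auto dest: *)
  then have "card (S \<inter> {..y}) = Suc m" using x y fin by (subst \<open>S \<inter> {..y} = _\<close>) (simp add: card_insert_if)
  then show ?case using y by auto
qed

lemma bes1_zero_nth:
  assumes "N \<ge> 1" "m \<ge> 1"
  obtains L where "L > 0" "bes1 N (- L) = 0"
    "finite ({l. 0 < l \<and> bes1 N (- l) = 0} \<inter> {..L})" "card ({l. 0 < l \<and> bes1 N (- l) = 0} \<inter> {..L}) = m"
proof -
  let ?S = "{l. 0 < l \<and> bes1 N (- l) = 0}"
  have "\<exists>x\<in>?S. x > b" for b using bes1_zero_exists[OF assms(1), of b] by auto
  from discrete_set_nth[OF finite_bes1_zeros[OF assms(1)] this assms(2)]
  obtain L where "L \<in> ?S" "card (?S \<inter> {..L}) = m" by blast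
  then show thesis using that[of L] finite_bes1_zeros[OF assms(1)] by blast
qed

text \<open>This makes \<open>M0\<close> positive. If \<open>L \<le> l\<close>, then
  \<open>y ^ (N - 1) * rad' N (-1) y\<close> has the derivative
  \<open>- y ^ (N - 1) * rad N (-1) y\<close>, negative on \<open>(0, sqrt L)\<close>, although the
  function vanishes at both ends.\<close>

lemma first_bes_zero_less:
  assumes N: "N \<ge> 1" and l: "l > 0" "\<And>x. 0 \<le> x \<Longrightarrow> x < l \<Longrightarrow> bes N (- x) > 0"
    and L: "L > 0" "bes1 N (- L) = 0"
  shows "l < L"
proof (rule ccontr)
  assume "\<not> l < L"
  then have Ll: "L \<le> l" by simp
  define G where "G y = y ^ (N - 1) * rad' N (-1) y" for y
  have "G (sqrt L) < G 0"
  proof (rule DERIV_neg_imp_decreasing_open[where f=G])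
    show "0 < sqrt L" using L by simp
    show "continuous_on {0..sqrt L} G" unfolding G_def by (intro continuous_intros N)
    fix y assume y: "0 < y" "y < sqrt L"
    have "y\<^sup>2 < L" using y by (smt (verit) real_less_rsqrt real_le_lsqrt)
    then have p: "rad N (-1) y > 0" using l(2)[of "y\<^sup>2"] Ll by (simp add: rad_def)
    have ode: "rad'' N (-1) y + (real N - 1) * rad' N (-1) y / y = - rad N (-1) y"
      using rad_ode[OF N, of y "-1"] y by (simp add: field_simps)
    have "(G has_real_derivative y ^ (N - 1) * (- rad N (-1) y)) (at y)"
      unfolding G_def using DERIV_radial_weight[OF N _ DERIV_rad'[OF N], of y "-1"] ode y by simp
    moreover have "y ^ (N - 1) * (- rad N (-1) y) < 0" using p y by (simp add: mult_pos_pos)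
    ultimately show "\<exists>z. (G has_real_derivative z) (at y) \<and> z < 0" by blast
  qed
  then show False using L by (simp add: G_def rad'_def)
qed

section \<open>Eigenfunctions on the ball\<close>

text \<open>Derivatives within a set are unique at points from which an open cone of directions enters it.\<close>

definition cone_at :: "'a::euclidean_space set \<Rightarrow> 'a \<Rightarrow> bool" where
  "cone_at S z \<longleftrightarrow> (\<exists>v. \<exists>e>0. \<forall>v'\<in>ball v e. \<exists>d>0. \<forall>\<tau>\<in>{0<..<d}. z + \<tau> *\<^sub>R v' \<in> S)"

lemma cone_at_open:
  assumes "open S" "z \<in> S" shows "cone_at S z"
proof -
  obtain r where r: "r > 0" "ball z r \<subseteq> S" using assms open_contains_ball by blast
  have "\<exists>d>0. \<forall>\<tau>\<in>{0<..<d}. z + \<tau> *\<^sub>R v' \<in> S" for v'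
  proof (intro exI[of _ "r / (norm v' + 1)"] conjI ballI)
    show "0 < r / (norm v' + 1)" using r by (simp add: add_nonneg_pos)
    fix \<tau> assume "\<tau> \<in> {0<..<r / (norm v' + 1)}"
    moreover have "0 < norm v' + 1" by (simp add: add_nonneg_pos)
    ultimately have t: "\<tau> > 0" "\<tau> * (norm v' + 1) < r" by (auto simp: pos_less_divide_eq)
    then have "norm (\<tau> *\<^sub>R v') < r" by (simp add: algebra_simps)
    then show "z + \<tau> *\<^sub>R v' \<in> S" using r by (auto simp: dist_norm)
  qed
  then show ?thesis unfolding cone_at_def by (intro exI[of _ 0] exI[of _ 1]) auto
qed

lemma cone_at_mono:
  assumes "cone_at S z" "S \<subseteq> T" shows "cone_at T z"
proof -
  obtain v e where ve: "e > 0" "\<forall>v'\<in>ball v e. \<exists>d>0. \<forall>\<tau>\<in>{0<..<d}. z + \<tau> *\<^sub>R v' \<in> S"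
    using assms(1) unfolding cone_at_def by (elim exE conjE)
  have "\<forall>v'\<in>ball v e. \<exists>d>0. \<forall>\<tau>\<in>{0<..<d}. z + \<tau> *\<^sub>R v' \<in> T"
  proof
    fix v' assume "v' \<in> ball v e"
    then obtain d where "d > 0" "\<forall>\<tau>\<in>{0<..<d}. z + \<tau> *\<^sub>R v' \<in> S" using ve(2) by metis
    then show "\<exists>d>0. \<forall>\<tau>\<in>{0<..<d}. z + \<tau> *\<^sub>R v' \<in> T" using assms(2) by (intro exI[of _ d]) auto
  qed
  then show ?thesis unfolding cone_at_def using ve(1) by (intro exI[of _ v] exI[of _ e] conjI)
qed

text \<open>From a boundary point \<open>z\<close> every direction within distance \<open>1\<close>
  of \<open>- z\<close> enters the ball, since \<open>z + \<tau> v'\<close> is a convex combination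
  of \<open>z\<close> and \<open>v' + z\<close>.\<close>

lemma cone_at_cball:
  assumes "z \<in> cball 0 1" shows "cone_at (cball 0 1) z"
proof (cases "norm z < 1")
  case True
  then show ?thesis using cone_at_mono[OF cone_at_open[of "ball 0 1" z], of "cball 0 1"] by auto
next
  case False
  then have z: "norm z = 1" using assms by auto
  have "\<exists>d>0. \<forall>\<tau>\<in>{0<..<d}. z + \<tau> *\<^sub>R v' \<in> cball 0 1" if v': "v' \<in> ball (- z) 1" for v'
  proof (intro exI[of _ 1] conjI ballI)
    fix \<tau> :: real assume t: "\<tau> \<in> {0<..<1}"
    have "z + \<tau> *\<^sub>R v' = (1 - \<tau>) *\<^sub>R z + \<tau> *\<^sub>R (v' + z)" by (simp add: algebra_simps)
    then have "norm (z + \<tau> *\<^sub>R v') \<le> (1 - \<tau>) * norm z + \<tau> * norm (v' + z)"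
      using t norm_triangle_ineq[of "(1 - \<tau>) *\<^sub>R z" "\<tau> *\<^sub>R (v' + z)"] by simp
    also have "norm (v' + z) = dist (- z) v'" by (simp add: dist_norm norm_minus_commute add.commute)
    also have "(1 - \<tau>) * norm z + \<tau> * dist (- z) v' \<le> (1 - \<tau>) * 1 + \<tau> * 1"
      using t v' z by (intro add_mono mult_left_mono) auto
    finally show "z + \<tau> *\<^sub>R v' \<in> cball 0 1" by simp
  qed simp
  then show ?thesis unfolding cone_at_def by (intro exI[of _ "- z"] exI[of _ 1]) auto
qed

text \<open>The difference of two derivatives vanishes in every direction along which a segment
  stays in the set. These directions fill a ball, so linearity makes the difference zero
  everywhere.\<close>

lemma has_derivative_unique_cone:
  fixes f :: "'a::euclidean_space \<Rightarrow> real"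
  assumes c: "cone_at S z" and D: "(f has_derivative D1) (at z within S)" "(f has_derivative D2) (at z within S)"
  shows "D1 = D2"
proof -
  define D where "D = (\<lambda>x. D1 x - D2 x)"
  have D0: "((\<lambda>y. 0) has_derivative D) (at z within S)"
    using has_derivative_diff[OF D] unfolding D_def by simp
  interpret bounded_linear D using D0 by (rule has_derivative_bounded_linear)
  obtain v e where e: "e > 0" and ve: "\<forall>v'\<in>ball v e. \<exists>d>0. \<forall>\<tau>\<in>{0<..<d}. z + \<tau> *\<^sub>R v' \<in> S"
    using c unfolding cone_at_def by (elim exE conjE)
  have van: "D v' = 0" if v': "v' \<in> ball v e" for v'
  proof -
    obtain d where d: "d > 0" "\<And>\<tau>. \<tau> \<in> {0<..<d} \<Longrightarrow> z + \<tau> *\<^sub>R v' \<in> S" using bspec[OF ve v'] by blast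
    have p: "((\<lambda>\<tau>. z + \<tau> *\<^sub>R v') has_derivative (\<lambda>\<tau>. \<tau> *\<^sub>R v')) (at 0 within {0<..<d})"
      by (auto intro!: derivative_eq_intros)
    have "((\<lambda>y. 0) has_derivative D) (at (z + 0 *\<^sub>R v') within (\<lambda>\<tau>. z + \<tau> *\<^sub>R v') ` {0<..<d})"
      using has_derivative_subset[OF D0, of "(\<lambda>\<tau>. z + \<tau> *\<^sub>R v') ` {0<..<d}"] d(2) by (auto simp: image_subset_iff)
    from has_derivative_in_compose[OF p this]
    have 1: "((\<lambda>\<tau>::real. 0::real) has_derivative (\<lambda>\<tau>. D (\<tau> *\<^sub>R v'))) (at 0 within {0<..<d})" by simp
    have 2: "((\<lambda>\<tau>::real. 0::real) has_derivative (\<lambda>\<tau>. 0)) (at 0 within {0<..<d})" by simp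
    have "(\<lambda>\<tau>. D (\<tau> *\<^sub>R v')) = (\<lambda>\<tau>. 0)"
    proof (rule frechet_derivative_unique_within[OF 1 2])
      fix i e :: real assume "i \<in> Basis" "0 < e"
      then show "\<exists>d'. 0 < \<bar>d'\<bar> \<and> \<bar>d'\<bar> < e \<and> 0 + d' *\<^sub>R i \<in> {0<..<d}"
        using d(1) by (intro exI[of _ "min e d / 2"]) auto
    qed
    from fun_cong[OF this, of 1] show ?thesis by simp
  qed
  have "D w = 0" for w
  proof -
    define t where "t = e / (2 * (norm w + 1))"
    have t: "t > 0" using e by (simp add: t_def add_nonneg_pos)
    have "t * norm w < e"
    proof -
      have "norm w < 2 * (norm w + 1)" "0 < 2 * (norm w + 1)" by (smt (verit) norm_ge_zero)+
      then have "norm w / (2 * (norm w + 1)) < 1" by (simp only: pos_divide_less_eq)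
      then have "e * (norm w / (2 * (norm w + 1))) < e * 1" using e by (rule mult_strict_left_mono)
      then show ?thesis by (simp add: t_def)
    qed
    then have "v + t *\<^sub>R w \<in> ball v e" using t by (simp add: dist_norm)
    then have "D (v + t *\<^sub>R w) = 0" "D v = 0" using van e by auto
    then show ?thesis using t by (simp add: add scaleR)
  qed
  then show ?thesis by (auto simp: D_def)
qed

section \<open>Gradients and Laplacians from explicit candidates\<close>

lemma differentiable_grad:
  assumes "u differentiable (at z within S)"
  shows "(u has_derivative (\<lambda>d. grad S u z \<bullet> d)) (at z within S)"
proof -
  have D: "(u has_derivative frechet_derivative u (at z within S)) (at z within S)"
    using assms by (simp add: frechet_derivative_works)
  interpret bounded_linear "frechet_derivative u (at z within S)"
    using D by (rule has_derivative_bounded_linear)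
  have "frechet_derivative u (at z within S) d = grad S u z \<bullet> d" for d
  proof -
    have "frechet_derivative u (at z within S) d = frechet_derivative u (at z within S) (\<Sum>b\<in>Basis. (d \<bullet> b) *\<^sub>R b)"
      by (simp add: euclidean_representation)
    also have "\<dots> = grad S u z \<bullet> d"
      unfolding grad_def sum scaleR inner_sum_left by (simp add: inner_commute mult.commute)
    finally show ?thesis .
  qed
  then have "frechet_derivative u (at z within S) = (\<lambda>d. grad S u z \<bullet> d)" by auto
  then show ?thesis using D by simp
qed

lemma grad_eqI:
  assumes "cone_at S z" "(u has_derivative (\<lambda>d. G \<bullet> d)) (at z within S)"
  shows "grad S u z = G"
proof -
  have "u differentiable (at z within S)" using assms(2) differentiable_def by blast
  from has_derivative_unique_cone[OF assms(1) differentiable_grad[OF this] assms(2)]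
  have "grad S u z \<bullet> d = G \<bullet> d" for d by metis
  then show ?thesis by (metis vector_eq_rdot)
qed

text \<open>\<open>grad\<close> is built on a derivative picked by choice. The cone condition makes
  this choice unambiguous on closed sets as well, so that an explicit candidate can be recognised as
  the gradient.\<close>

lemma C1_onI:
  assumes "\<And>z. z \<in> S \<Longrightarrow> cone_at S z"
    and "\<And>z. z \<in> S \<Longrightarrow> (u has_derivative (\<lambda>d. G z \<bullet> d)) (at z within S)"
    and "continuous_on S G"
  shows "C1_on S u" "\<And>z. z \<in> S \<Longrightarrow> grad S u z = G z"
proof -
  show g: "grad S u z = G z" if "z \<in> S" for z
    using grad_eqI assms(1,2) that by blast
  show "C1_on S u"
    unfolding C1_on_def differentiable_on_def differentiable_def
    using assms(2) continuous_on_cong[OF refl g, of S] assms(3) by auto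
qed

lemma C2_onI:
  assumes c: "\<And>z. z \<in> S \<Longrightarrow> cone_at S z"
    and u: "\<And>z. z \<in> S \<Longrightarrow> (u has_derivative (\<lambda>d. G z \<bullet> d)) (at z within S)"
    and G: "\<And>z b. z \<in> S \<Longrightarrow> b \<in> Basis \<Longrightarrow> ((\<lambda>z. G z \<bullet> b) has_derivative (\<lambda>d. H b z \<bullet> d)) (at z within S)"
    and H: "\<And>b. b \<in> Basis \<Longrightarrow> continuous_on S (H b)"
  shows "C2_on S u" "\<And>z. z \<in> S \<Longrightarrow> laplacian S u z = (\<Sum>b\<in>Basis. H b z \<bullet> b)"
    "\<And>z. z \<in> S \<Longrightarrow> grad S u z = G z"
proof -
  have "continuous_on S (\<lambda>z. \<Sum>b\<in>Basis. (G z \<bullet> b) *\<^sub>R b)"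
    by (intro continuous_intros has_derivative_continuous_on[OF G]) auto
  then have cG: "continuous_on S G" by (simp add: euclidean_representation)
  note 1 = C1_onI[OF c u cG]
  then show "\<And>z. z \<in> S \<Longrightarrow> grad S u z = G z" by blast
  have G': "((\<lambda>z. grad S u z \<bullet> b) has_derivative (\<lambda>d. H b z \<bullet> d)) (at z within S)"
    if "z \<in> S" "b \<in> Basis" for z b
    by (rule has_derivative_transform[OF that(1) _ G[OF that]]) (simp add: 1)
  note 2 = C1_onI[OF c G' H]
  show "C2_on S u" unfolding C2_on_def using 1 2 by auto
  show "laplacian S u z = (\<Sum>b\<in>Basis. H b z \<bullet> b)" if "z \<in> S" for z
    unfolding laplacian_def using 2(2) that by simp
qed

text \<open>The function is written through \<open>t \<bullet> t\<close> instead of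
  \<open>norm t\<close>: it is an entire function of the squared norm and therefore smooth at the
  origin, where the norm itself is not.\<close>

lemma rad_ball:
  fixes S :: "'a::euclidean_space set" and c K :: real
  defines "N \<equiv> DIM('a)"
  defines "f \<equiv> (\<lambda>t::'a. c * rad N K (norm t))"
  assumes cone: "\<And>z. z \<in> S \<Longrightarrow> cone_at S z"
  shows "C2_on S f" "C1_on S f"
    "\<And>t. t \<in> S \<Longrightarrow> laplacian S f t = K * f t"
    "\<And>t. t \<in> S \<Longrightarrow> grad S f t = (2 * c * K * bes1 N (K * (norm t)\<^sup>2)) *\<^sub>R t"
proof -
  have N: "N \<ge> 1" by (simp add: N_def DIM_positive Suc_leI)
  define G where "G t = (2 * c * K * bes1 N (K * (t \<bullet> t))) *\<^sub>R t" for t :: 'a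
  define H where "H b t = (4 * c * K\<^sup>2 * bes2 N (K * (t \<bullet> t)) * (t \<bullet> b)) *\<^sub>R t + (2 * c * K * bes1 N (K * (t \<bullet> t))) *\<^sub>R b" for b t :: 'a
  have f: "f = (\<lambda>t. c * bes N (K * (t \<bullet> t)))" by (simp add: f_def rad_def power2_norm_eq_inner)
  have inn: "((\<lambda>t. K * (t \<bullet> t)) has_derivative (\<lambda>d. 2 * K * (t \<bullet> d))) (at t within S)" for t :: 'a
    by (auto intro!: derivative_eq_intros simp: inner_commute)
  have b1: "((\<lambda>t. bes1 N (K * (t \<bullet> t))) has_derivative (\<lambda>d. bes2 N (K * (t \<bullet> t)) * (2 * K * (t \<bullet> d)))) (at t within S)" for t :: 'a
    using has_derivative_compose[OF inn, of "bes1 N"] DERIV_bes1[OF N DERIV_ident, of "K * (t \<bullet> t)" UNIV]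
    by (simp add: has_field_derivative_def)
  have b0: "((\<lambda>t. bes N (K * (t \<bullet> t))) has_derivative (\<lambda>d. bes1 N (K * (t \<bullet> t)) * (2 * K * (t \<bullet> d)))) (at t within S)" for t :: 'a
    using has_derivative_compose[OF inn, of "bes N"] DERIV_bes[OF N DERIV_ident, of "K * (t \<bullet> t)" UNIV]
    by (simp add: has_field_derivative_def)
  have u: "(f has_derivative (\<lambda>d. G t \<bullet> d)) (at t within S)" for t
    unfolding f G_def by (rule has_derivative_eq_rhs[OF has_derivative_mult_right[OF b0]]) (auto simp: fun_eq_iff)
  have Gd: "((\<lambda>z. G z \<bullet> b) has_derivative (\<lambda>d. H b t \<bullet> d)) (at t within S)" for t b
    unfolding G_def H_def inner_scaleR_left
    by (rule has_derivative_eq_rhs[OF has_derivative_mult[OF has_derivative_mult_right[OF b1] has_derivative_inner_left[OF has_derivative_ident]]])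
       (auto simp: fun_eq_iff inner_add_left inner_commute power2_eq_square algebra_simps)
  have c1: "continuous_on S (\<lambda>t. bes1 N (K * (t \<bullet> t)))"
    by (rule has_derivative_continuous_on) (rule b1)
  have "continuous_on UNIV (bes2 N)" using isCont_bes2[OF N] by (simp add: continuous_at_imp_continuous_on)
  then have c2: "continuous_on S (\<lambda>t. bes2 N (K * (t \<bullet> t)))"
    by (rule continuous_on_compose2) (auto intro!: continuous_intros)
  have Hc: "continuous_on S (H b)" for b
    unfolding H_def by (intro continuous_intros c1 c2)
  have cG: "continuous_on S G" unfolding G_def by (intro continuous_intros c1)
  note C = C2_onI[OF cone u Gd Hc]
  show "C2_on S f" by (rule C(1))
  show "C1_on S f" using C1_onI[OF cone u cG] by blast
  show "grad S f t = (2 * c * K * bes1 N (K * (norm t)\<^sup>2)) *\<^sub>R t" if "t \<in> S" for t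
    using C(3)[OF _ that] by (simp add: G_def power2_norm_eq_inner)
  show "laplacian S f t = K * f t" if "t \<in> S" for t
  proof -
    have "laplacian S f t = (\<Sum>b\<in>Basis. H b t \<bullet> b)" using C(2)[OF _ that] by simp
    also have "\<dots> = (\<Sum>b\<in>Basis. 4 * c * K\<^sup>2 * bes2 N (K * (t \<bullet> t)) * (t \<bullet> b)\<^sup>2 + 2 * c * K * bes1 N (K * (t \<bullet> t)))"
      by (intro sum.cong refl) (simp add: H_def inner_add_left power2_eq_square algebra_simps)
    also have "\<dots> = 4 * c * K\<^sup>2 * bes2 N (K * (t \<bullet> t)) * (\<Sum>b\<in>Basis. (t \<bullet> b)\<^sup>2) + real N * (2 * c * K * bes1 N (K * (t \<bullet> t)))"
      by (simp add: sum.distrib sum_distrib_left N_def)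
    also have "(\<Sum>b\<in>Basis. (t \<bullet> b)\<^sup>2) = t \<bullet> t"
      using euclidean_inner[of t t] by (simp add: power2_eq_square)
    also have "4 * c * K\<^sup>2 * bes2 N (K * (t \<bullet> t)) * (t \<bullet> t) + real N * (2 * c * K * bes1 N (K * (t \<bullet> t)))
       = K * (c * (4 * (K * (t \<bullet> t)) * bes2 N (K * (t \<bullet> t)) + 2 * real N * bes1 N (K * (t \<bullet> t))))"
      by (simp add: power2_eq_square algebra_simps)
    also have "\<dots> = K * f t" unfolding bes_ode[OF N] f by simp
    finally show ?thesis .
  qed
qed

section \<open>Radial Neumann eigenfunctions\<close>

lemma C1_on_has_derivative:
  assumes "C1_on S u" "open S" "z \<in> S"
  shows "(u has_derivative (\<lambda>d. grad S u z \<bullet> d)) (at z)"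
proof -
  have "u differentiable (at z within S)"
    using assms(1,3) unfolding C1_on_def differentiable_on_def by blast
  from differentiable_grad[OF this] show ?thesis using at_within_open[OF assms(3,2)] by simp
qed

text \<open>Only the eigenfunction property of \<open>U (norm t)\<close> is given, so the radial
  equation has to be extracted along a ray \<open>r *\<^sub>R e\<close>. Uniqueness for this
  equation, singular at \<open>0\<close>, identifies the radial derivative with a multiple of
  \<open>rad'\<close>, and the boundary condition then reads \<open>bes1 = 0\<close>.\<close>

lemma neumann_eigenvalue_bes1:
  fixes U :: "real \<Rightarrow> real"
  assumes nm: "neumann_eigenfunction ev (\<lambda>t::'a::euclidean_space. U (norm t))" and ev: "ev > 0"
  shows "bes1 DIM('a) (- ev) = 0"
proof -
  define N where "N = DIM('a)"
  have N: "N \<ge> 1" by (simp add: N_def DIM_positive Suc_leI)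
  define w where "w = (\<lambda>t::'a. U (norm t))"
  define B where "B = ball (0::'a) 1"
  define g where "g = grad B w"
  have oB: "open B" by (simp add: B_def)
  have C2: "C2_on B w" and C1: "C1_on (cball 0 1) w" and nz: "\<exists>t\<in>B. w t \<noteq> 0"
    and pde: "\<And>t. t \<in> B \<Longrightarrow> laplacian B w t + ev * w t = 0"
    and bc: "\<And>t. t \<in> sphere 0 1 \<Longrightarrow> grad (cball 0 1) w t \<bullet> t = 0"
    using nm unfolding neumann_eigenfunction_def w_def B_def by auto
  have wd: "(w has_derivative (\<lambda>d. g t \<bullet> d)) (at t)" if "t \<in> B" for t
    using C1_on_has_derivative[OF _ oB that] C2 unfolding C2_on_def g_def by blast
  have gd: "((\<lambda>t. g t \<bullet> b) has_derivative (\<lambda>d. grad B (\<lambda>y. g y \<bullet> b) t \<bullet> d)) (at t)" if "t \<in> B" "b \<in> Basis" for t b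
    using C1_on_has_derivative[OF _ oB that(1)] C2 that(2) unfolding C2_on_def g_def by blast
  have uniq: "D = D'" if "(f has_derivative D) (at t)" "(f has_derivative D') (at t)"
    for f :: "'a \<Rightarrow> real" and D D' and t :: 'a
    using has_derivative_unique that by blast
  obtain e :: 'a where e: "e \<in> Basis" using nonempty_Basis by blast
  have ee: "e \<bullet> e = 1" "norm e = 1" using e by (auto simp: inner_Basis)
  define V where "V r = g (r *\<^sub>R e) \<bullet> e" for r
  define V' where "V' r = grad B (\<lambda>y. g y \<bullet> e) (r *\<^sub>R e) \<bullet> e" for r
  have reB: "r *\<^sub>R e \<in> B" if "0 \<le> r" "r < 1" for r using that ee by (simp add: B_def)
  have line: "((\<lambda>r. r *\<^sub>R e) has_derivative (\<lambda>d. d *\<^sub>R e)) (at r)" for r :: real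
    by (auto intro!: derivative_eq_intros)
  have wline: "((\<lambda>r. w (r *\<^sub>R e)) has_real_derivative V r) (at r)" if "0 \<le> r" "r < 1" for r
    using has_derivative_compose[OF line, of w "\<lambda>d. g (r *\<^sub>R e) \<bullet> d"] wd[OF reB[OF that]]
    by (simp add: V_def has_field_derivative_def mult.commute[of _ "g (r *\<^sub>R e) \<bullet> e"])
  have Vd: "(V has_real_derivative V' r) (at r)" if "0 \<le> r" "r < 1" for r
    using has_derivative_compose[OF line, of "\<lambda>t. g t \<bullet> e" "\<lambda>d. grad B (\<lambda>y. g y \<bullet> e) (r *\<^sub>R e) \<bullet> d"] gd[OF reB[OF that] e]
    by (simp add: V_def[abs_def] V'_def has_field_derivative_def mult.commute[of _ "grad B (\<lambda>y. g y \<bullet> e) (r *\<^sub>R e) \<bullet> e"])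
  have Ud: "(U has_real_derivative V r) (at r)" if "0 < r" "r < 1" for r
  proof (rule has_field_derivative_transform_within_open[OF wline])
    show "open {0<..<1::real}" "r \<in> {0<..<1}" using that by auto
    show "w (x *\<^sub>R e) = U x" if "x \<in> {0<..<1}" for x using that ee by (simp add: w_def)
  qed (use that in auto)
  have gV: "g t = (V (norm t) / norm t) *\<^sub>R t" if "t \<in> B" "t \<noteq> 0" for t
  proof -
    have "norm t < 1" "norm t > 0" using that by (auto simp: B_def)
    then have "(w has_derivative (\<lambda>d. V (norm t) * (d \<bullet> sgn t))) (at t)"
      unfolding w_def using has_derivative_compose[OF has_derivative_norm[OF that(2)], of U "\<lambda>d. V (norm t) * d"] Ud[of "norm t"]
      by (simp add: has_field_derivative_def)
    from uniq[OF wd[OF that(1)] this] have "g t \<bullet> d = V (norm t) * (d \<bullet> sgn t)" for d by metis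
    then have "g t \<bullet> d = ((V (norm t) / norm t) *\<^sub>R t) \<bullet> d" for d
      by (simp add: sgn_div_norm inner_commute divide_inverse)
    then show ?thesis by (metis vector_eq_rdot)
  qed
  have ode: "V' r + (real N - 1) * V r / r + ev * U r = 0" if "0 < r" "r < 1" for r
  proof -
    let ?t = "r *\<^sub>R e"
    have tB: "?t \<in> B" and t0: "?t \<noteq> 0" using that reB ee by auto
    have nt: "norm ?t = r" using that ee by simp
    have sgnt: "sgn ?t = e" using that ee by (simp add: sgn_div_norm)
    define Q where "Q y = V y / y" for y
    define Q' where "Q' = (V' r * r - V r) / (r * r)"
    have Qd: "(Q has_real_derivative Q') (at r)"
      unfolding Q_def[abs_def] Q'_def using Vd[of r] that by (auto intro!: derivative_eq_intros)
    have Qn: "((\<lambda>y. Q (norm y)) has_derivative (\<lambda>d. Q' * (d \<bullet> e))) (at ?t)"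
      using has_derivative_compose[OF has_derivative_norm[OF t0], of Q "\<lambda>d. Q' * d"] Qd
      unfolding nt sgnt by (simp add: has_field_derivative_def)
    have comp: "grad B (\<lambda>y. g y \<bullet> b) ?t \<bullet> b = Q' * r * (e \<bullet> b)\<^sup>2 + Q r" if b: "b \<in> Basis" for b
    proof -
      have d1: "((\<lambda>y. Q (norm y) * (y \<bullet> b)) has_derivative (\<lambda>d. Q' * (d \<bullet> e) * (?t \<bullet> b) + Q r * (d \<bullet> b))) (at ?t)"
        by (rule has_derivative_eq_rhs[OF has_derivative_mult[OF Qn has_derivative_inner_left[OF has_derivative_ident]]])
           (use ee \<open>0 < r\<close> in \<open>auto simp: fun_eq_iff\<close>)
      have "((\<lambda>y. g y \<bullet> b) has_derivative (\<lambda>d. Q' * (d \<bullet> e) * (?t \<bullet> b) + Q r * (d \<bullet> b))) (at ?t)"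
      proof (rule has_derivative_transform_within_open[OF d1])
        show "open (B - {0})" using oB by (simp add: open_delete)
        show "?t \<in> B - {0}" using tB t0 by simp
        show "Q (norm y) * (y \<bullet> b) = g y \<bullet> b" if "y \<in> B - {0}" for y using that by (simp add: gV Q_def)
      qed
      from fun_cong[OF uniq[OF gd[OF tB b] this], of b] show ?thesis
        using b by (simp add: inner_Basis inner_commute power2_eq_square)
    qed
    have "laplacian B w ?t = (\<Sum>b\<in>Basis. Q' * r * (e \<bullet> b)\<^sup>2 + Q r)"
      unfolding laplacian_def g_def[symmetric] by (intro sum.cong refl comp)
    also have "\<dots> = Q' * r * (\<Sum>b\<in>Basis. (e \<bullet> b)\<^sup>2) + real N * Q r"
      by (simp add: sum.distrib sum_distrib_left N_def)
    also have "(\<Sum>b\<in>Basis. (e \<bullet> b)\<^sup>2) = 1"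
      using euclidean_inner[of e e] ee by (simp add: power2_eq_square)
    also have "Q' * r * 1 + real N * Q r = V' r + (real N - 1) * V r / r"
      using \<open>0 < r\<close> by (simp add: Q_def Q'_def field_simps)
    finally have "laplacian B w ?t = V' r + (real N - 1) * V r / r" .
    moreover have "w ?t = U r" using nt by (simp add: w_def)
    ultimately show ?thesis using pde[OF tB] by simp
  qed
  \<comment> \<open>The function is even in \<open>t\<close>, so its gradient vanishes at the
    origin. This is the second initial value at the singular point.\<close>
  have g0: "g 0 = 0"
  proof -
    have 0: "0 \<in> B" by (simp add: B_def)
    have m: "((\<lambda>y::'a. - y) has_derivative (\<lambda>d. - d)) (at 0)" by (auto intro!: derivative_eq_intros)
    have "((\<lambda>y. w (- y)) has_derivative (\<lambda>d. g 0 \<bullet> (- d))) (at 0)"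
      using has_derivative_compose[OF m, of w "\<lambda>d. g 0 \<bullet> d"] wd[OF 0] by simp
    moreover have "(\<lambda>y. w (- y)) = w" by (simp add: w_def)
    ultimately have "g 0 \<bullet> g 0 = g 0 \<bullet> (- g 0)" using uniq[OF wd[OF 0]] by metis
    then show ?thesis by simp
  qed
  define D where "D r = w (r *\<^sub>R e) - w 0 * rad N (- ev) r" for r
  define E where "E r = V r - w 0 * rad' N (- ev) r" for r
  \<comment> \<open>The energy of the difference to the regular solution. Its derivative is
    \<open>- 2 (N - 1) E^2 / r\<close>, so it cannot increase from the value \<open>0\<close> at the
    origin.\<close>
  define Q where "Q r = (E r)\<^sup>2 + ev * (D r)\<^sup>2" for r
  have Dd: "(D has_real_derivative E r) (at r)" if "0 \<le> r" "r < 1" for r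
    unfolding D_def[abs_def] E_def by (auto intro!: derivative_eq_intros DERIV_rad N wline that)
  have Ed: "(E has_real_derivative V' r - w 0 * rad'' N (- ev) r) (at r)" if "0 \<le> r" "r < 1" for r
    unfolding E_def[abs_def] by (auto intro!: derivative_eq_intros DERIV_rad' N Vd that)
  have Qd: "(Q has_real_derivative 2 * E r * (V' r - w 0 * rad'' N (- ev) r) + 2 * ev * D r * E r) (at r)"
    if "0 \<le> r" "r < 1" for r
    unfolding Q_def[abs_def] by (auto intro!: derivative_eq_intros Dd Ed that)
  have Q0: "Q 0 = 0" by (simp add: Q_def E_def D_def V_def g0)
  have zero: "D r = 0 \<and> E r = 0" if r: "0 < r" "r < 1" for r
  proof -
    have "Q r \<le> Q 0"
    proof (rule DERIV_nonpos_imp_nonincreasing[where f=Q])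
      fix x assume x: "0 \<le> x" "x \<le> r"
      have "2 * E x * (V' x - w 0 * rad'' N (- ev) x) + 2 * ev * D x * E x \<le> 0"
      proof (cases "x = 0")
        case True
        then show ?thesis by (simp add: E_def V_def g0)
      next
        case False
        then have x': "0 < x" "x < 1" using x r by auto
        have "w (x *\<^sub>R e) = U x" using x' ee by (simp add: w_def)
        then have e1: "V' x = - (real N - 1) * V x / x - ev * (D x + w 0 * rad N (- ev) x)"
          using ode[OF x'] by (simp add: D_def algebra_simps diff_divide_distrib add_divide_distrib)
        have e2: "rad'' N (- ev) x = - (real N - 1) * rad' N (- ev) x / x - ev * rad N (- ev) x"
          using rad_ode[OF N, of x "- ev"] x' by (simp add: field_simps)
        have "V' x - w 0 * rad'' N (- ev) x = - (real N - 1) * E x / x - ev * D x"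
          unfolding e1 e2 E_def by (simp add: algebra_simps diff_divide_distrib add_divide_distrib)
        then have "2 * E x * (V' x - w 0 * rad'' N (- ev) x) + 2 * ev * D x * E x
           = - (2 * (real N - 1) * (E x)\<^sup>2 / x)"
          by (simp only:) (simp add: power2_eq_square algebra_simps diff_divide_distrib add_divide_distrib)
        also have "\<dots> \<le> 0" using N x' by simp
        finally show ?thesis .
      qed
      then show "\<exists>y. (Q has_real_derivative y) (at x) \<and> y \<le> 0" using Qd[of x] x r by force
    qed (use r in simp)
    then have *: "(E r)\<^sup>2 + ev * (D r)\<^sup>2 \<le> 0" by (simp add: Q0) (simp add: Q_def)
    moreover have "ev * (D r)\<^sup>2 \<ge> 0" using ev by simp
    ultimately have "(E r)\<^sup>2 \<le> 0" "ev * (D r)\<^sup>2 \<le> 0" using zero_le_power2[of "E r"] by linarith+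
    then show ?thesis using ev by (simp add: mult_le_0_iff)
  qed
  have w0: "w 0 \<noteq> 0"
  proof
    assume w0: "w 0 = 0"
    obtain t where t: "t \<in> B" "w t \<noteq> 0" using nz by blast
    then have "t \<noteq> 0" using w0 by auto
    then have "0 < norm t" "norm t < 1" using t by (auto simp: B_def)
    moreover from this have "w (norm t *\<^sub>R e) = w t" using ee by (simp add: w_def)
    ultimately show False using zero[of "norm t"] t w0 by (simp add: D_def)
  qed
  \<comment> \<open>The gradient within the closed ball agrees with the ordinary one for
    \<open>r < 1\<close>; continuity up to the sphere carries the identity to \<open>r = 1\<close>,
    where the Neumann condition is imposed.\<close>
  let ?gc = "\<lambda>r::real. grad (cball 0 1) w (r *\<^sub>R e) \<bullet> e"
  have gc: "?gc r = w 0 * rad' N (- ev) r" if "0 < r" "r < 1" for r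
  proof -
    have "r *\<^sub>R e \<in> interior (cball 0 1)" using that ee by simp
    then have "at (r *\<^sub>R e) within cball 0 1 = at (r *\<^sub>R e)" by (rule at_within_interior)
    moreover have "at (r *\<^sub>R e) within B = at (r *\<^sub>R e)" using at_within_open[OF reB oB] that by simp
    ultimately have "grad (cball 0 1) w (r *\<^sub>R e) = g (r *\<^sub>R e)" by (simp add: grad_def g_def)
    then show ?thesis using zero[OF that] by (simp add: E_def V_def)
  qed
  have "continuous_on (cball 0 1) (grad (cball 0 1) w)" using C1 by (simp add: C1_on_def)
  then have "continuous_on {0..1} (\<lambda>r. grad (cball 0 1) w (r *\<^sub>R e))"
    by (rule continuous_on_compose2) (use ee in \<open>auto intro!: continuous_on_scaleR\<close>)
  then have c1: "continuous_on {0..1} ?gc" by (intro continuous_on_inner continuous_on_const)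
  have c2: "continuous_on {0..1} (\<lambda>r. w 0 * rad' N (- ev) r)"
    by (intro continuous_on_mult continuous_on_const continuous_on_rad N)
  define \<delta> where "\<delta> r = ?gc r - w 0 * rad' N (- ev) r" for r
  have "continuous_on (closure {0<..<1}) \<delta>"
    using continuous_on_diff[OF c1 c2] by (simp add: \<delta>_def[abs_def])
  moreover have "\<delta> r = 0" if "r \<in> {0<..<1}" for r using gc that by (simp add: \<delta>_def)
  moreover have "(1::real) \<in> closure {0<..<1}" by simp
  ultimately have "\<delta> 1 = 0" using continuous_constant_on_closure by blast
  then have "?gc 1 = w 0 * rad' N (- ev) 1" by (simp add: \<delta>_def)
  moreover have "?gc 1 = 0" using bc[of e] ee by simp
  ultimately have "rad' N (- ev) 1 = 0" using w0 by simp
  then show ?thesis using ev by (simp add: rad'_def N_def)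
qed

lemma radial_neumann_eigenvalues_eq:
  "{l \<in> radial_neumann_eigenvalues TYPE('a::euclidean_space). 0 < l} = {l. 0 < l \<and> bes1 DIM('a) (- l) = 0}"
  "bes1 DIM('a) (- l) = 0 \<Longrightarrow> c \<noteq> 0 \<Longrightarrow> neumann_eigenfunction l (\<lambda>t::'a. c * rad DIM('a) (- l) (norm t))"
proof -
  show 1: "neumann_eigenfunction l (\<lambda>t::'a. c * rad DIM('a) (- l) (norm t))"
    if "bes1 DIM('a) (- l) = 0" "c \<noteq> 0" for l c
    unfolding neumann_eigenfunction_def
  proof (intro conjI ballI)
    have o: "cone_at (ball 0 1) z" if "z \<in> ball (0::'a) 1" for z using that by (intro cone_at_open) auto
    show "C2_on (ball 0 1) (\<lambda>t::'a. c * rad DIM('a) (- l) (norm t))" by (rule rad_ball) (rule o)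
    show "C1_on (cball 0 1) (\<lambda>t::'a. c * rad DIM('a) (- l) (norm t))" by (rule rad_ball) (rule cone_at_cball)
    show "\<exists>t\<in>ball (0::'a) 1. c * rad DIM('a) (- l) (norm t) \<noteq> 0" using that by (intro bexI[of _ 0]) auto
    show "laplacian (ball 0 1) (\<lambda>t::'a. c * rad DIM('a) (- l) (norm t)) t + l * (c * rad DIM('a) (- l) (norm t)) = 0"
      if "t \<in> ball 0 1" for t :: 'a
      using rad_ball(3)[OF o that, of c "- l"] by simp
    show "grad (cball 0 1) (\<lambda>t::'a. c * rad DIM('a) (- l) (norm t)) t \<bullet> t = 0" if t: "t \<in> sphere 0 1" for t :: 'a
    proof -
      have "t \<in> cball 0 1" using t by auto
      from rad_ball(4)[OF cone_at_cball this, of c "- l"] show ?thesis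
        using t \<open>bes1 DIM('a) (- l) = 0\<close> by simp
    qed
  qed
  show "{l \<in> radial_neumann_eigenvalues TYPE('a). 0 < l} = {l. 0 < l \<and> bes1 DIM('a) (- l) = 0}"
  proof (intro set_eqI iffI)
    fix l assume "l \<in> {l \<in> radial_neumann_eigenvalues TYPE('a). 0 < l}"
    then show "l \<in> {l. 0 < l \<and> bes1 DIM('a) (- l) = 0}"
      using neumann_eigenvalue_bes1 by (auto simp: radial_neumann_eigenvalues_def)
  next
    fix l assume "l \<in> {l. 0 < l \<and> bes1 DIM('a) (- l) = 0}"
    then have l: "0 < l" "neumann_eigenfunction l (\<lambda>t::'a. 1 * rad DIM('a) (- l) (norm t))"
      using 1[of l 1] by auto
    have "\<exists>U. neumann_eigenfunction l (\<lambda>t::'a. U (norm t))"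
      using l(2) by (rule exI[of _ "\<lambda>r. 1 * rad DIM('a) (- l) r"])
    then show "l \<in> {l \<in> radial_neumann_eigenvalues TYPE('a). 0 < l}"
      unfolding radial_neumann_eigenvalues_def using l(1) by simp
  qed
qed

section \<open>The first Dirichlet eigenvalue\<close>

lemma second_derivative_max:
  fixes p p' :: "real \<Rightarrow> real"
  assumes d: "d > 0" and p: "\<And>x. \<bar>x\<bar> < d \<Longrightarrow> (p has_real_derivative p' x) (at x)"
    and p': "(p' has_real_derivative H) (at 0)" and max: "\<And>x. \<bar>x\<bar> < d \<Longrightarrow> p x \<le> p 0"
  shows "H \<le> 0"
proof (rule ccontr)
  assume "\<not> H \<le> 0"
  then have H: "H > 0" by simp
  have p0: "p' 0 = 0"
    by (rule DERIV_local_max[OF p[of 0] d]) (use d max in auto)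
  obtain e where e: "e > 0" "\<And>h. 0 < h \<Longrightarrow> h < e \<Longrightarrow> p' 0 < p' (0 + h)"
    using DERIV_pos_inc_right[OF p' H] by auto
  define h where "h = min d e / 2"
  have h: "0 < h" "h < d" "h < e" using d e by (auto simp: h_def)
  obtain z where z: "0 < z" "z < h" "p h - p 0 = (h - 0) * p' z"
    using MVT2[OF h(1), of p p'] p h by force
  then have "p h - p 0 > 0" using e(2)[of z] h p0 by simp
  then show False using max[of h] h by simp
qed

text \<open>A comparison argument that replaces the variational characterisation. For
  \<open>l < L < l1\<close> the radial solution \<open>f\<close> with eigenvalue \<open>L\<close> is
  positive on the closed ball. At an interior maximum of \<open>c v / f\<close> with value
  \<open>M > 0\<close>, the function \<open>c v - M f\<close> touches \<open>0\<close> from below,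
  so its Laplacian is at most \<open>0\<close> there; the equations give the value
  \<open>(L - l) M f > 0\<close>.\<close>

lemma dirichlet_eigenvalue_ge:
  fixes v :: "'a::euclidean_space \<Rightarrow> real"
  assumes dir: "dirichlet_eigenfunction l v"
    and pos: "\<And>x. 0 \<le> x \<Longrightarrow> x < l1 \<Longrightarrow> bes DIM('a) (- x) > 0" and l1: "l1 > 0"
  shows "l1 \<le> l"
proof (rule ccontr)
  assume "\<not> l1 \<le> l"
  \<comment> \<open>The maximum with \<open>0\<close> keeps \<open>L\<close> positive also for
    negative \<open>l\<close>.\<close>
  define L where "L = (max l 0 + l1) / 2"
  have L: "l < L" "L < l1" "0 < L" using \<open>\<not> l1 \<le> l\<close> l1 by (auto simp: L_def)
  define N where "N = DIM('a)"
  have N: "N \<ge> 1" by (simp add: N_def DIM_positive Suc_leI)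
  define B where "B = ball (0::'a) 1"
  have oB: "open B" by (simp add: B_def)
  define f where "f = (\<lambda>t::'a. 1 * rad N (- L) (norm t))"
  have fpos: "f t > 0" if "t \<in> cball 0 1" for t
  proof -
    have "L * (norm t)\<^sup>2 \<le> L * 1" using that L by (intro mult_left_mono) (auto simp: power_le_one)
    then have "L * (norm t)\<^sup>2 < l1" "0 \<le> L * (norm t)\<^sup>2" using L(2,3) by (linarith, simp)
    then show ?thesis using pos[of "L * (norm t)\<^sup>2"] by (simp add: f_def rad_def N_def)
  qed
  have o: "cone_at B z" if "z \<in> B" for z using that oB by (intro cone_at_open) auto
  have f2: "C2_on B f" "\<And>t. t \<in> B \<Longrightarrow> laplacian B f t = - L * f t"
    unfolding f_def N_def using rad_ball(1,3)[where S=B and c=1 and K="- L", OF o] by auto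
  have fc: "continuous_on (cball 0 1) f"
    using rad_ball(2)[where S="cball (0::'a) 1" and c=1 and K="- L", OF cone_at_cball] unfolding f_def N_def C1_on_def
    by (auto dest: differentiable_imp_continuous_on)
  have v2: "C2_on B v" and vc: "continuous_on (cball 0 1) v" and nz: "\<exists>t\<in>B. v t \<noteq> 0"
    and pde: "\<And>t. t \<in> B \<Longrightarrow> laplacian B v t + l * v t = 0"
    and bc: "\<And>t. t \<in> sphere 0 1 \<Longrightarrow> v t = 0"
    using dir unfolding dirichlet_eigenfunction_def B_def by auto
  obtain t1 where t1: "t1 \<in> B" "v t1 \<noteq> 0" using nz by blast
  \<comment> \<open>The sign that makes the maximum of \<open>c * v / f\<close> positive, hence
    attained away from the sphere.\<close>
  define c where "c = sgn (v t1)"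
  have c: "c * v t1 > 0" using t1 by (simp add: c_def sgn_if)
  have "compact (cball (0::'a) 1)" "cball (0::'a) 1 \<noteq> {}" by auto
  moreover have "continuous_on (cball 0 1) (\<lambda>t. c * v t / f t)"
    using fpos by (intro continuous_intros vc fc) (auto simp: less_imp_neq[symmetric])
  ultimately have "\<exists>x\<in>cball 0 1. \<forall>y\<in>cball 0 1. c * v y / f y \<le> c * v x / f x"
    by (rule continuous_attains_sup)
  then obtain t0 where t0: "t0 \<in> cball 0 1" and mx: "\<And>t. t \<in> cball 0 1 \<Longrightarrow> c * v t / f t \<le> c * v t0 / f t0"
    by blast
  define M where "M = c * v t0 / f t0"
  have "0 < c * v t1 / f t1" using c fpos[of t1] t1 by (auto simp: B_def)
  also have "\<dots> \<le> M" unfolding M_def using mx[of t1] t1 by (auto simp: B_def)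
  finally have M: "M > 0" .
  then have "v t0 \<noteq> 0" by (auto simp: M_def)
  then have "t0 \<notin> sphere 0 1" using bc by auto
  then have t0B: "t0 \<in> B" using t0 by (auto simp: B_def)
  define q where "q t = c * v t - M * f t" for t
  have q0: "q t0 = 0" using fpos[OF t0] by (simp add: q_def M_def)
  have qle: "q t \<le> 0" if "t \<in> B" for t
  proof -
    have "t \<in> cball 0 1" using that by (auto simp: B_def)
    then have "c * v t / f t \<le> M" "f t > 0" using mx fpos by (auto simp: M_def)
    then show ?thesis by (simp add: q_def pos_divide_le_eq)
  qed
  have comp: "c * (grad B (\<lambda>y. grad B v y \<bullet> b) t0 \<bullet> b) - M * (grad B (\<lambda>y. grad B f y \<bullet> b) t0 \<bullet> b) \<le> 0"
    if b: "b \<in> Basis" for b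
  proof -
    obtain d where d: "d > 0" "ball t0 d \<subseteq> B" using t0B oB open_contains_ball by blast
    have inB: "t0 + x *\<^sub>R b \<in> B" if "\<bar>x\<bar> < d" for x using that d(2) b by (auto simp: dist_norm subset_eq)
    have line: "((\<lambda>x. t0 + x *\<^sub>R b) has_derivative (\<lambda>d. d *\<^sub>R b)) (at x)" for x :: real
      by (auto intro!: derivative_eq_intros)
    have D1: "((\<lambda>x. u (t0 + x *\<^sub>R b)) has_real_derivative grad B u (t0 + x *\<^sub>R b) \<bullet> b) (at x)"
      if "C1_on B u" "\<bar>x\<bar> < d" for u x
    proof -
      have "(u has_derivative (\<lambda>d. grad B u (t0 + x *\<^sub>R b) \<bullet> d)) (at (t0 + x *\<^sub>R b))"
        using C1_on_has_derivative[OF that(1) oB inB[OF that(2)]] .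
      from has_derivative_compose[OF line this] show ?thesis
        by (simp add: has_field_derivative_def mult.commute[of _ "grad B u (t0 + x *\<^sub>R b) \<bullet> b"])
    qed
    have 1: "C1_on B v" "C1_on B f" "C1_on B (\<lambda>y. grad B v y \<bullet> b)" "C1_on B (\<lambda>y. grad B f y \<bullet> b)"
      using v2 f2(1) b unfolding C2_on_def by auto
    show ?thesis
    proof (rule second_derivative_max[OF d(1)])
      show "((\<lambda>x. q (t0 + x *\<^sub>R b)) has_real_derivative
         c * (grad B v (t0 + x *\<^sub>R b) \<bullet> b) - M * (grad B f (t0 + x *\<^sub>R b) \<bullet> b)) (at x)" if "\<bar>x\<bar> < d" for x
        unfolding q_def by (intro DERIV_diff DERIV_cmult D1 1 that)
      have "((\<lambda>x. c * (grad B v (t0 + x *\<^sub>R b) \<bullet> b) - M * (grad B f (t0 + x *\<^sub>R b) \<bullet> b)) has_real_derivative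
         c * (grad B (\<lambda>y. grad B v y \<bullet> b) (t0 + 0 *\<^sub>R b) \<bullet> b) - M * (grad B (\<lambda>y. grad B f y \<bullet> b) (t0 + 0 *\<^sub>R b) \<bullet> b)) (at 0)"
        by (intro DERIV_diff DERIV_cmult D1 1) (use d in auto)
      then show "((\<lambda>x. c * (grad B v (t0 + x *\<^sub>R b) \<bullet> b) - M * (grad B f (t0 + x *\<^sub>R b) \<bullet> b)) has_real_derivative
         c * (grad B (\<lambda>y. grad B v y \<bullet> b) t0 \<bullet> b) - M * (grad B (\<lambda>y. grad B f y \<bullet> b) t0 \<bullet> b)) (at 0)" by simp
      show "q (t0 + x *\<^sub>R b) \<le> q (t0 + 0 *\<^sub>R b)" if "\<bar>x\<bar> < d" for x using qle[OF inB[OF that]] q0 by simp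
    qed
  qed
  have "c * laplacian B v t0 - M * laplacian B f t0
    = (\<Sum>b\<in>Basis. c * (grad B (\<lambda>y. grad B v y \<bullet> b) t0 \<bullet> b) - M * (grad B (\<lambda>y. grad B f y \<bullet> b) t0 \<bullet> b))"
    by (simp add: laplacian_def sum_distrib_left sum_subtractf)
  also have "\<dots> \<le> 0" by (intro sum_nonpos comp)
  finally have "c * laplacian B v t0 - M * laplacian B f t0 \<le> 0" .
  moreover have lv: "laplacian B v t0 = - l * v t0" using pde[OF t0B] by simp
  have "c * laplacian B v t0 = - l * (c * v t0)" unfolding lv by simp
  moreover have "c * v t0 = M * f t0" using q0 by (simp add: q_def)
  ultimately have "- l * (M * f t0) + M * (L * f t0) \<le> 0"
    using f2(2)[OF t0B] by simp
  then have "(M * f t0) * (L - l) \<le> 0" by (simp add: algebra_simps)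
  moreover have "M * f t0 > 0" using M fpos[OF t0] by simp
  then have "(M * f t0) * (L - l) > 0" using L by (intro mult_pos_pos[of "M * f t0"]) auto
  ultimately show False by linarith
qed

lemma positive_first_dirichlet_rad:
  assumes l: "l > 0" "bes DIM('a) (- l) = 0" "\<And>x. 0 \<le> x \<Longrightarrow> x < l \<Longrightarrow> bes DIM('a) (- x) > 0"
  shows "positive_first_dirichlet_eigenfunction (\<lambda>t::'a::euclidean_space. rad DIM('a) (- l) (norm t))"
  unfolding positive_first_dirichlet_eigenfunction_def
proof (intro conjI exI[of _ l] allI impI ballI)
  have o: "cone_at (ball 0 1) z" if "z \<in> ball (0::'a) 1" for z using that by (intro cone_at_open) auto
  note r = rad_ball[where S="ball (0::'a) 1" and c=1 and K="- l", OF o]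
  show "dirichlet_eigenfunction l (\<lambda>t::'a. rad DIM('a) (- l) (norm t))"
    unfolding dirichlet_eigenfunction_def
  proof (intro conjI ballI)
    show "C2_on (ball 0 1) (\<lambda>t::'a. rad DIM('a) (- l) (norm t))" using r(1) by auto
    show "continuous_on (cball 0 1) (\<lambda>t::'a. rad DIM('a) (- l) (norm t))"
      using rad_ball(2)[where S="cball (0::'a) 1" and c=1 and K="- l", OF cone_at_cball] unfolding C1_on_def
      by (auto dest: differentiable_imp_continuous_on)
    show "\<exists>t\<in>ball (0::'a) 1. rad DIM('a) (- l) (norm t) \<noteq> 0" by (intro bexI[of _ 0]) auto
    show "laplacian (ball 0 1) (\<lambda>t::'a. rad DIM('a) (- l) (norm t)) t + l * rad DIM('a) (- l) (norm t) = 0"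
      if "t \<in> ball 0 1" for t :: 'a
      using r(3)[OF _ that] by auto
    show "rad DIM('a) (- l) (norm t) = 0" if "t \<in> sphere 0 1" for t :: 'a
      using that l(2) by (simp add: rad_def)
  qed
  show "l \<le> l'" if "dirichlet_eigenfunction l' v" for l' and v :: "'a \<Rightarrow> real"
    by (rule dirichlet_eigenvalue_ge[OF that l(3,1)])
  show "0 < rad DIM('a) (- l) (norm t)" if "t \<in> ball 0 1" for t :: 'a
  proof -
    have "(norm t)\<^sup>2 < 1" using that by (simp add: power_less_one_iff abs_square_less_1)
    then have "l * (norm t)\<^sup>2 < l * 1" using l(1) by (intro mult_strict_left_mono) auto
    then show ?thesis using l by (simp add: rad_def)
  qed
qed

section \<open>The inhomogeneous radial equation\<close>

text \<open>\<open>y * ravg N f y\<close> is the solution \<open>b\<close> of \<open>b' + (N - 1) b / y = f\<close> that is regular at \<open>0\<close>.\<close>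

definition ravg :: "nat \<Rightarrow> (real \<Rightarrow> real) \<Rightarrow> real \<Rightarrow> real" where
  "ravg N f y = integral {0..1} (\<lambda>\<theta>. \<theta> ^ (N - 1) * f (\<theta> * y))"

lemma ravg_integrand:
  fixes f :: "real \<Rightarrow> real"
  assumes "continuous_on {0..1} f" "y \<in> {0..1}"
  shows "continuous_on {0..1} (\<lambda>\<theta>. \<theta> ^ (N - 1) * f (\<theta> * y))"
proof -
  have "continuous_on {0..1} (\<lambda>\<theta>. f (\<theta> * y))"
    by (rule continuous_on_compose2[OF assms(1)]) (use assms(2) in \<open>auto intro!: continuous_intros simp: mult_le_one\<close>)
  then show ?thesis by - (intro continuous_intros)
qed

lemma ravg_bound:
  assumes "continuous_on {0..1} f" "y \<in> {0..1}" "\<And>s. s \<in> {0..y} \<Longrightarrow> \<bar>f s\<bar> \<le> B"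
  shows "\<bar>ravg N f y\<bar> \<le> B"
proof -
  have "norm (integral {0..1} (\<lambda>\<theta>. \<theta> ^ (N - 1) * f (\<theta> * y))) \<le> B * (1 - 0)"
  proof (rule integral_bound)
    fix t :: real assume t: "t \<in> {0..1}"
    have "t * y \<in> {0..y}" using t assms(2) by (auto simp: mult_left_le_one_le)
    then have "\<bar>f (t * y)\<bar> \<le> B" by (rule assms(3))
    then have "\<bar>t ^ (N - 1)\<bar> * \<bar>f (t * y)\<bar> \<le> 1 * B"
      using t by (intro mult_mono) (auto simp: power_le_one)
    then show "norm (t ^ (N - 1) * f (t * y)) \<le> B" by (simp add: abs_mult)
  qed (simp, rule ravg_integrand[OF assms(1,2)])
  then show ?thesis by (simp add: ravg_def)
qed

lemma ravg_continuous:
  assumes "continuous_on {0..1} f" shows "continuous_on {0..1} (ravg N f)"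
proof -
  have "continuous_on {0..1} (\<lambda>y. integral (cbox 0 1) (\<lambda>\<theta>. \<theta> ^ (N - 1) * f (\<theta> * y)))"
  proof (rule integral_continuous_on_param)
    have "continuous_on ({0..1} \<times> cbox 0 1) (\<lambda>z::real \<times> real. f (snd z * fst z))"
      by (rule continuous_on_compose2[OF assms]) (auto intro!: continuous_intros simp: mult_le_one)
    then show "continuous_on ({0..1} \<times> cbox 0 1) (\<lambda>(y, \<theta>). \<theta> ^ (N - 1) * f (\<theta> * y))"
      unfolding case_prod_beta by (intro continuous_intros)
  qed
  then show ?thesis by (simp add: ravg_def[abs_def])
qed

lemma ravg_add:
  assumes "continuous_on {0..1} f" "continuous_on {0..1} g" "y \<in> {0..1}"
  shows "ravg N (\<lambda>s. f s + g s) y = ravg N f y + ravg N g y"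
  unfolding ravg_def distrib_left
  by (intro integral_add integrable_continuous_real ravg_integrand assms)

lemma ravg_cmult: "ravg N (\<lambda>s. c * f s) y = c * ravg N f y"
  unfolding ravg_def by (subst integral_mult_right[symmetric]) (simp add: mult_ac)

lemma ravg_0:
  assumes "N \<ge> 1" shows "ravg N f 0 = f 0 / N"
proof -
  have "((\<lambda>\<theta>::real. \<theta> ^ (N - 1)) has_integral (1 ^ N / N - 0 ^ N / N)) {0..1}"
    by (rule fundamental_theorem_of_calculus)
      (use assms in \<open>auto intro!: derivative_eq_intros simp flip: has_real_derivative_iff_has_vector_derivative\<close>)
  then have "integral {0..1} (\<lambda>\<theta>::real. \<theta> ^ (N - 1)) = 1 / N" using assms by (auto simp: zero_power)
  then show ?thesis by (simp add: ravg_def)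
qed

text \<open>The substitution \<open>s = y \<theta>\<close>. It links the average, which makes sense
  at \<open>y = 0\<close>, with the integral to which the fundamental theorem applies.\<close>

lemma ravg_integral:
  assumes f: "continuous_on {0..1} f" and N: "N \<ge> 1" and y: "0 < y" "y \<le> 1"
  shows "integral {0..y} (\<lambda>s. s ^ (N - 1) * f s) = y ^ N * ravg N f y"
proof -
  let ?g = "\<lambda>s. s ^ (N - 1) * f s"
  have "continuous_on {0..y} ?g"
    using y by (intro continuous_intros continuous_on_subset[OF f]) auto
  then have "(?g has_integral integral {0..y} ?g) {0..y}"
    by (simp add: integrable_continuous_real integrable_integral)
  from has_integral_stretch_real[OF this, of y]
  have "((\<lambda>x. (y * x) ^ (N - 1) * f (y * x)) has_integral (1 / y) * integral {0..y} ?g) ((\<lambda>x. x / y) ` {0..y})"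
    using y by simp
  moreover have "(\<lambda>x. x / y) ` {0..y} = {0..1}"
  proof (intro set_eqI iffI)
    fix x :: real assume "x \<in> {0..1}"
    then show "x \<in> (\<lambda>x. x / y) ` {0..y}" using y by (intro image_eqI[of _ _ "x * y"]) (auto simp: mult_left_le_one_le)
  qed (use y in \<open>auto simp: divide_le_eq\<close>)
  ultimately have "integral {0..1} (\<lambda>x. y ^ (N - 1) * (x ^ (N - 1) * f (x * y))) = (1 / y) * integral {0..y} ?g"
    by (intro integral_unique) (simp add: power_mult_distrib mult_ac)
  then have "y ^ (N - 1) * ravg N f y = (1 / y) * integral {0..y} ?g"
    by (simp only: integral_mult_right ravg_def)
  then have "integral {0..y} ?g = y * y ^ (N - 1) * ravg N f y" using y by (simp add: field_simps)
  also have "y * y ^ (N - 1) = y ^ N" using N by (simp flip: power_Suc)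
  finally show ?thesis .
qed

lemma DERIV_ravg:
  assumes f: "continuous_on {0..1} f" and N: "N \<ge> 1" and y: "y \<in> {0..1}"
  shows "((\<lambda>y. y * ravg N f y) has_real_derivative f y - (real N - 1) * ravg N f y) (at y within {0..1})"
proof (cases "y = 0")
  case True
  \<comment> \<open>At \<open>0\<close> the difference quotient of \<open>y * ravg N f y\<close> is
    \<open>ravg N f\<close> itself; the value \<open>f 0 / N\<close> makes its limit agree with the
    general formula.\<close>
  have "((\<lambda>x. ravg N f x) \<longlongrightarrow> ravg N f 0) (at 0 within {0..1})"
    using ravg_continuous[OF f, of N] by (simp add: continuous_on_def)
  then have "((\<lambda>x. (x * ravg N f x - 0 * ravg N f 0) / (x - 0)) \<longlongrightarrow> ravg N f 0) (at 0 within {0..1})"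
    by (rule Lim_transform_eventually) (auto simp: eventually_at_filter)
  moreover have "f 0 - (real N - 1) * ravg N f 0 = ravg N f 0" using N by (simp add: ravg_0 field_simps)
  ultimately show ?thesis using True by (simp add: has_field_derivative_iff)
next
  case False
  then have y0: "0 < y" "y \<le> 1" using y by auto
  let ?G = "\<lambda>y. integral {0..y} (\<lambda>s. s ^ (N - 1) * f s)"
  have "(?G has_real_derivative y ^ (N - 1) * f y) (at y within {0..1})"
    by (rule integral_has_real_derivative) (use y in \<open>auto intro!: continuous_intros f\<close>)
  moreover have "((\<lambda>y. y ^ (N - 1) * 1) has_real_derivative y ^ (N - 1) * (0 + (real N - 1) * 1 / y)) (at y within {0..1})"
    by (rule DERIV_radial_weight) (use N False in auto)
  ultimately have "((\<lambda>y. ?G y / (y ^ (N - 1) * 1)) has_real_derivative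
     (y ^ (N - 1) * f y * (y ^ (N - 1) * 1) - ?G y * (y ^ (N - 1) * (0 + (real N - 1) * 1 / y))) / ((y ^ (N - 1) * 1) * (y ^ (N - 1) * 1))) (at y within {0..1})"
    by (rule DERIV_divide) (use y0 in auto)
  moreover have "(y ^ (N - 1) * f y * (y ^ (N - 1) * 1) - ?G y * (y ^ (N - 1) * (0 + (real N - 1) * 1 / y))) / ((y ^ (N - 1) * 1) * (y ^ (N - 1) * 1))
     = f y - (real N - 1) * ravg N f y"
  proof -
    have "?G y = y * y ^ (N - 1) * ravg N f y"
      using ravg_integral[OF f N y0] N by (simp flip: power_Suc)
    then show ?thesis using y0 by (simp add: field_simps)
  qed
  ultimately have D: "((\<lambda>y. ?G y / (y ^ (N - 1) * 1)) has_real_derivative f y - (real N - 1) * ravg N f y) (at y within {0..1})"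
    by simp
  show ?thesis
  proof (rule has_field_derivative_transform_within[OF D y0(1) y])
    fix x assume x: "x \<in> {0..1}" "dist x y < y"
    then have x0: "0 < x" "x \<le> 1" by (auto simp: dist_real_def)
    have "?G x = x * x ^ (N - 1) * ravg N f x"
      using ravg_integral[OF f N x0] N by (simp flip: power_Suc)
    then show "?G x / (x ^ (N - 1) * 1) = x * ravg N f x" using x0 by simp
  qed
qed

text \<open>The difference of two solutions, multiplied by \<open>y ^ (N - 1)\<close>, is constant.
  Continuity and \<open>b 0 = 0\<close> make the constant \<open>0\<close>, which excludes the
  singular solution \<open>y ^ (1 - N)\<close> of the homogeneous equation.\<close>

lemma ravg_unique:
  assumes N: "N \<ge> 1" and f: "continuous_on {0..1} f" and b: "continuous_on {0..1} b" "b 0 = 0"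
    and b': "\<And>y. 0 < y \<Longrightarrow> y < 1 \<Longrightarrow> (b has_real_derivative f y - (real N - 1) * b y / y) (at y)"
    and y: "y \<in> {0..1}"
  shows "b y = y * ravg N f y"
proof (cases "y = 0")
  case False
  then have y0: "0 < y" "y \<le> 1" using y by auto
  define d where "d y = y ^ (N - 1) * (b y - y * ravg N f y)" for y
  have "d y = d 0"
  proof (rule DERIV_isconst_end[OF y0(1)])
    show "continuous_on {0..y} d" unfolding d_def using y0
      by (intro continuous_intros continuous_on_subset[OF b(1)] continuous_on_subset[OF ravg_continuous[OF f]]) auto
    fix x assume x: "0 < x" "x < y"
    then have x1: "x \<in> {0<..<1}" using y0 by auto
    then have "at x within {0..1} = at x" by (intro at_within_interior) auto
    then have "((\<lambda>y. y * ravg N f y) has_real_derivative f x - (real N - 1) * ravg N f x) (at x)"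
      using DERIV_ravg[OF f N, of x] x1 by auto
    from DERIV_radial_weight[OF N _ DERIV_diff[OF b'[of x] this]] x1
    show "(d has_real_derivative 0) (at x)"
      unfolding d_def by (auto simp: field_simps elim!: DERIV_cong[rotated])
  qed
  also have "d 0 = 0" using b(2) by (simp add: d_def)
  finally show ?thesis using y0 by (simp add: d_def)
qed (use b in auto)

section \<open>Volterra construction of solutions that are regular on the axis\<close>

definition volt :: "nat \<Rightarrow> (real \<Rightarrow> real) \<Rightarrow> real \<Rightarrow> real" where
  "volt N f y = integral {0..y} (\<lambda>t. t * ravg N f t)"

lemma volt_integrand: "continuous_on {0..1} f \<Longrightarrow> S \<subseteq> {0..1} \<Longrightarrow> continuous_on S (\<lambda>t. t * ravg N f t)"
  by (intro continuous_intros continuous_on_subset[OF ravg_continuous]) auto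

lemma DERIV_volt:
  "continuous_on {0..1} f \<Longrightarrow> y \<in> {0..1} \<Longrightarrow> (volt N f has_real_derivative y * ravg N f y) (at y within {0..1})"
  unfolding volt_def by (rule integral_has_real_derivative) (auto intro: volt_integrand)

lemma volt_continuous: "continuous_on {0..1} f \<Longrightarrow> continuous_on {0..1} (volt N f)"
  using DERIV_continuous_on[OF DERIV_volt] .

lemma volt_add:
  assumes "continuous_on {0..1} f" "continuous_on {0..1} g" "y \<in> {0..1}"
  shows "volt N (\<lambda>s. f s + g s) y = volt N f y + volt N g y"
proof -
  have "volt N (\<lambda>s. f s + g s) y = integral {0..y} (\<lambda>t. t * ravg N f t + t * ravg N g t)"
    unfolding volt_def using assms by (intro integral_cong) (auto simp: ravg_add algebra_simps)
  also have "\<dots> = volt N f y + volt N g y"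
    unfolding volt_def using assms by (intro integral_add integrable_continuous_real volt_integrand) auto
  finally show ?thesis .
qed

lemma volt_cmult: "volt N (\<lambda>s. c * f s) y = c * volt N f y"
  unfolding volt_def ravg_cmult by (subst integral_mult_right[symmetric]) (simp add: mult_ac)

text \<open>\<open>volt\<close> inverts the radial Laplacian with zero value and zero slope at the
  axis. Each application gains the factor \<open>y / (n + 1)\<close>, which produces the factorials
  that make the Neumann series converge for every \<open>K\<close>.\<close>

lemma volt_bound:
  assumes f: "continuous_on {0..1} f" and y: "y \<in> {0..1}" and B: "B \<ge> 0"
    and le: "\<And>s. s \<in> {0..y} \<Longrightarrow> \<bar>f s\<bar> \<le> B * s ^ n"
  shows "\<bar>volt N f y\<bar> \<le> B * y ^ Suc n / Suc n"
proof -
  have le': "norm (integral {0..y} (\<lambda>t. t * ravg N f t)) \<le> integral {0..y} (\<lambda>t. B * t ^ n)"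
  proof (rule integral_norm_bound_integral)
    show "(\<lambda>t. t * ravg N f t) integrable_on {0..y}" using y f
      by (intro integrable_continuous_real volt_integrand) auto
    show "(\<lambda>t. B * t ^ n) integrable_on {0..y}" by (intro integrable_continuous_real continuous_intros)
    fix t assume t: "t \<in> {0..y}"
    have "\<bar>ravg N f t\<bar> \<le> B * t ^ n"
    proof (rule ravg_bound[OF f])
      fix s assume s: "s \<in> {0..t}"
      then have "\<bar>f s\<bar> \<le> B * s ^ n" using le t by auto
      also have "\<dots> \<le> B * t ^ n" using s B by (intro mult_left_mono power_mono) auto
      finally show "\<bar>f s\<bar> \<le> B * t ^ n" .
    qed (use t y in auto)
    then have "\<bar>t\<bar> * \<bar>ravg N f t\<bar> \<le> 1 * (B * t ^ n)" using t y by (intro mult_mono) auto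
    then show "norm (t * ravg N f t) \<le> B * t ^ n" by (simp add: abs_mult)
  qed
  have P: "((\<lambda>t. B * t ^ Suc n / Suc n) has_real_derivative B * x ^ n) (at x within {0..y})" for x
  proof -
    have "((\<lambda>t. B / Suc n * t ^ Suc n) has_real_derivative B / Suc n * ((1 + real n) * x ^ n)) (at x within {0..y})"
      by (rule DERIV_cmult) (use DERIV_power_Suc[OF DERIV_ident, where x=x and s="{0..y}" and n=n] in simp)
    then show ?thesis by (simp add: add.commute)
  qed
  have "((\<lambda>t. B * t ^ n) has_integral (B * y ^ Suc n / Suc n - B * 0 ^ Suc n / Suc n)) {0..y}"
    by (rule fundamental_theorem_of_calculus)
      (use y P in \<open>auto simp flip: has_real_derivative_iff_has_vector_derivative\<close>)
  then have "integral {0..y} (\<lambda>t. B * t ^ n) = B * y ^ Suc n / Suc n"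
    by (subst integral_unique) auto
  with le' show ?thesis by (simp add: volt_def)
qed

text \<open>The Neumann series of \<open>v = F + K volt v\<close>: its terms are at most
  \<open>M |K|^n / n!\<close>, so it converges uniformly and its sum is bounded by an
  exponential.\<close>

lemma volterra_exists:
  assumes F: "continuous_on {0..1} F" and M: "\<And>y. y \<in> {0..1} \<Longrightarrow> \<bar>F y\<bar> \<le> M"
  obtains v where "continuous_on {0..1} v" "\<And>y. y \<in> {0..1} \<Longrightarrow> v y = F y + K * volt N v y"
    "\<And>y. y \<in> {0..1} \<Longrightarrow> \<bar>v y\<bar> \<le> M * exp \<bar>K\<bar>"
proof -
  have M0: "M \<ge> 0" using M[of 0] by force
  define V where "V = rec_nat F (\<lambda>_ v y. K * volt N v y)"
  have V0: "V 0 = F" and VS: "V (Suc n) = (\<lambda>y. K * volt N (V n) y)" for n by (simp_all add: V_def)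
  have Vc: "continuous_on {0..1} (V n)" for n
    by (induction n) (auto simp: V0 VS F intro!: continuous_intros volt_continuous)
  have Vb: "\<bar>V n y\<bar> \<le> M * \<bar>K\<bar> ^ n / fact n * y ^ n" if "y \<in> {0..1}" for n y
    using that
  proof (induction n arbitrary: y)
    case 0
    then show ?case by (simp add: V0 M)
  next
    case (Suc n)
    have "\<bar>volt N (V n) y\<bar> \<le> (M * \<bar>K\<bar> ^ n / fact n) * y ^ Suc n / Suc n"
      by (rule volt_bound[OF Vc Suc.prems]) (use Suc M0 in \<open>auto intro!: Suc.IH\<close>)
    then have "\<bar>K\<bar> * \<bar>volt N (V n) y\<bar> \<le> \<bar>K\<bar> * ((M * \<bar>K\<bar> ^ n / fact n) * y ^ Suc n / Suc n)"
      by (intro mult_left_mono) auto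
    then show ?case by (simp add: VS abs_mult field_simps)
  qed
  define c where "c n = M * \<bar>K\<bar> ^ n / fact n" for n
  have Vc': "\<bar>V n y\<bar> \<le> c n" if "y \<in> {0..1}" for n y
  proof -
    have "M * \<bar>K\<bar> ^ n / fact n * y ^ n \<le> M * \<bar>K\<bar> ^ n / fact n * 1"
      using that M0 by (intro mult_left_mono) (auto simp: power_le_one)
    then show ?thesis using Vb[OF that, of n] by (simp add: c_def)
  qed
  have cs: "c sums (M * exp \<bar>K\<bar>)"
    using sums_mult[OF exp_converges[of "\<bar>K\<bar>"], of M] by (simp add: c_def[abs_def] divide_inverse mult_ac)
  define v where "v y = (\<Sum>n. V n y)" for y
  have ul: "uniform_limit {0..1} (\<lambda>m y. \<Sum>n<m. V n y) v sequentially"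
    unfolding v_def[abs_def] by (rule Weierstrass_m_test[OF _ sums_summable[OF cs]]) (use Vc' in auto)
  have vc: "continuous_on {0..1} v"
    by (rule uniform_limit_theorem[OF _ ul]) (auto intro!: always_eventually continuous_intros Vc)
  have psum: "continuous_on {0..1} (\<lambda>y. \<Sum>n<m. V n y)" for m by (intro continuous_intros Vc)
  have Vsum: "K * volt N (\<lambda>y. \<Sum>n<m. V n y) y = (\<Sum>n<m. V (Suc n) y)" if "y \<in> {0..1}" for m y
  proof (induction m)
    case 0
    have "volt N (\<lambda>y. 0 * 0) y = 0 * volt N (\<lambda>y. 0) y" by (rule volt_cmult)
    then show ?case by simp
  next
    case (Suc m)
    have "volt N (\<lambda>y. \<Sum>n<Suc m. V n y) y = volt N (\<lambda>y. \<Sum>n<m. V n y) y + volt N (V m) y"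
      using volt_add[OF psum Vc that] by simp
    then show ?case using Suc by (simp add: VS algebra_simps)
  qed
  have vfix: "v y = F y + K * volt N v y" if y: "y \<in> {0..1}" for y
  proof -
    have "(\<lambda>m. volt N (\<lambda>y. \<Sum>n<m. V n y) y) \<longlonglongrightarrow> volt N v y"
    proof (rule LIMSEQ_I)
      fix e :: real assume e: "e > 0"
      then have "\<forall>\<^sub>F m in sequentially. \<forall>x\<in>{0..1}. dist (\<Sum>n<m. V n x) (v x) < e / 2"
        using ul unfolding uniform_limit_iff by (meson half_gt_zero)
      then obtain m0 where m0: "\<And>m x. m \<ge> m0 \<Longrightarrow> x \<in> {0..1} \<Longrightarrow> dist (\<Sum>n<m. V n x) (v x) < e / 2"
        unfolding eventually_sequentially by blast
      show "\<exists>no. \<forall>m\<ge>no. norm (volt N (\<lambda>y. \<Sum>n<m. V n y) y - volt N v y) < e"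
      proof (intro exI[of _ m0] allI impI)
        fix m assume m: "m \<ge> m0"
        have "volt N (\<lambda>s. (\<Sum>n<m. V n s) + (-1) * v s) y = volt N (\<lambda>y. \<Sum>n<m. V n y) y + volt N (\<lambda>s. (-1) * v s) y"
          by (rule volt_add[OF psum _ y]) (intro continuous_intros vc)
        also have "\<dots> = volt N (\<lambda>y. \<Sum>n<m. V n y) y - volt N v y" unfolding volt_cmult by simp
        finally have "volt N (\<lambda>y. \<Sum>n<m. V n y) y - volt N v y = volt N (\<lambda>s. (\<Sum>n<m. V n s) + (-1) * v s) y" ..
        moreover have "\<bar>volt N (\<lambda>s. (\<Sum>n<m. V n s) + (-1) * v s) y\<bar> \<le> (e / 2) * y ^ Suc 0 / Suc 0"
          by (rule volt_bound) (use m0[OF m] y e in \<open>auto intro!: continuous_intros Vc vc simp: dist_real_def less_imp_le\<close>)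
        moreover have "(e / 2) * y ^ Suc 0 / Suc 0 < e"
        proof -
          have "(e / 2) * y \<le> (e / 2) * 1" using y e by (intro mult_left_mono) auto
          then show ?thesis using e by simp
        qed
        ultimately show "norm (volt N (\<lambda>y. \<Sum>n<m. V n y) y - volt N v y) < e" by simp
      qed
    qed
    then have "(\<lambda>m. K * volt N (\<lambda>y. \<Sum>n<m. V n y) y) \<longlonglongrightarrow> K * volt N v y" by (intro tendsto_mult tendsto_const)
    then have "(\<lambda>m. \<Sum>n<m. V (Suc n) y) \<longlonglongrightarrow> K * volt N v y" by (simp add: Vsum[OF y])
    then have "(\<lambda>n. V (Suc n) y) sums (K * volt N v y)" by (simp add: sums_def)
    then have "(\<lambda>n. V n y) sums (K * volt N v y + V 0 y)" by (subst sums_Suc_iff[symmetric]) simp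
    then show ?thesis by (simp add: v_def V0 sums_iff)
  qed
  have bd: "\<bar>v y\<bar> \<le> M * exp \<bar>K\<bar>" if "y \<in> {0..1}" for y
  proof -
    have "norm (\<Sum>n. V n y) \<le> (\<Sum>n. c n)"
      by (rule norm_suminf_le) (use Vc' that cs sums_summable in auto)
    then show ?thesis using cs by (simp add: v_def sums_iff)
  qed
  from that vc vfix bd show thesis by blast
qed

text \<open>Solutions \<open>v\<close> of \<open>(v' - a)' + (N - 1) (v' - a) / y = K v + f\<close> that are regular at \<open>0\<close>.\<close>

definition radial_sol :: "nat \<Rightarrow> real \<Rightarrow> (real \<Rightarrow> real) \<Rightarrow> (real \<Rightarrow> real) \<Rightarrow> (real \<Rightarrow> real) \<Rightarrow> bool" where
  "radial_sol N K a f v \<longleftrightarrow> continuous_on {0..1} v \<and>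
     (\<forall>y\<in>{0..1}. (v has_real_derivative a y + y * ravg N (\<lambda>s. K * v s + f s) y) (at y within {0..1}))"

text \<open>Integrating the equation twice turns it into a Volterra equation with the free term
  \<open>F\<close>. The factor \<open>exp \<bar>K\<bar>\<close> is far too large for high
  frequencies; it serves for finitely many of them.\<close>

lemma radial_sol_exists:
  assumes a: "continuous_on {0..1} a" "\<And>y. y \<in> {0..1} \<Longrightarrow> \<bar>a y\<bar> \<le> \<alpha>"
    and f: "continuous_on {0..1} f" "\<And>y. y \<in> {0..1} \<Longrightarrow> \<bar>f y\<bar> \<le> \<beta>"
  obtains v where "radial_sol N K a f v" "\<And>y. y \<in> {0..1} \<Longrightarrow> \<bar>v y\<bar> \<le> (\<alpha> + \<beta>) * exp \<bar>K\<bar>"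
proof -
  have ab: "\<alpha> \<ge> 0" "\<beta> \<ge> 0"
    using order_trans[OF abs_ge_zero a(2)[of 0]] order_trans[OF abs_ge_zero f(2)[of 0]] by simp_all
  define F where "F y = integral {0..y} a + volt N f y" for y
  have Ad: "((\<lambda>y. integral {0..y} a) has_real_derivative a y) (at y within {0..1})" if "y \<in> {0..1}" for y
    by (rule integral_has_real_derivative[OF a(1) that])
  have "continuous_on {0..1} (\<lambda>y. integral {0..y} a)" using Ad by (rule DERIV_continuous_on)
  then have Fc: "continuous_on {0..1} F" unfolding F_def by (intro continuous_intros volt_continuous f)
  have Fb: "\<bar>F y\<bar> \<le> \<alpha> + \<beta>" if y: "y \<in> {0..1}" for y
  proof -
    have "norm (integral {0..y} a) \<le> \<alpha> * (y - 0)"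
      by (rule integral_bound) (use y a in \<open>auto intro: continuous_on_subset\<close>)
    also have "\<dots> \<le> \<alpha> * 1" using y ab by (intro mult_left_mono) auto
    finally have 1: "\<bar>integral {0..y} a\<bar> \<le> \<alpha>" by simp
    have "\<bar>volt N f y\<bar> \<le> \<beta> * y ^ Suc 0 / Suc 0"
      by (rule volt_bound[OF f(1) y ab(2)]) (use f(2) y in auto)
    also have "\<dots> \<le> \<beta> * 1" using y ab mult_left_mono[of y 1 \<beta>] by simp
    finally show ?thesis using 1 unfolding F_def by linarith
  qed
  obtain v where v: "continuous_on {0..1} v" "\<And>y. y \<in> {0..1} \<Longrightarrow> v y = F y + K * volt N v y"
    "\<And>y. y \<in> {0..1} \<Longrightarrow> \<bar>v y\<bar> \<le> (\<alpha> + \<beta>) * exp \<bar>K\<bar>"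
    using volterra_exists[OF Fc Fb] by blast
  have "radial_sol N K a f v"
    unfolding radial_sol_def
  proof (intro conjI ballI v(1))
    fix y :: real assume y: "y \<in> {0..1}"
    have D: "((\<lambda>y. F y + K * volt N v y) has_real_derivative a y + y * ravg N f y + K * (y * ravg N v y)) (at y within {0..1})"
      unfolding F_def by (intro DERIV_add DERIV_cmult Ad DERIV_volt f v(1) y)
    have "ravg N (\<lambda>s. K * v s + f s) y = K * ravg N v y + ravg N f y"
      using y v(1) f by (subst ravg_add) (auto simp: ravg_cmult intro!: continuous_intros)
    then have eq: "a y + y * ravg N f y + K * (y * ravg N v y) = a y + y * ravg N (\<lambda>s. K * v s + f s) y"
      by (simp add: algebra_simps)
    then show "(v has_real_derivative a y + y * ravg N (\<lambda>s. K * v s + f s) y) (at y within {0..1})"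
      using v(2) by (intro has_field_derivative_transform_within[OF D[unfolded eq] zero_less_one y]) simp
  qed
  then show thesis using that v(3) by blast
qed

lemma rad'_ravg:
  assumes N: "N \<ge> 1" and y: "y \<in> {0..1}"
  shows "rad' N K y = y * ravg N (\<lambda>s. K * rad N K s) y"
proof (rule ravg_unique[OF N _ _ _ _ y])
  show "(rad' N K has_real_derivative K * rad N K y - (real N - 1) * rad' N K y / y) (at y)" if "0 < y" for y
  proof -
    have "rad'' N K y = K * rad N K y - (real N - 1) * rad' N K y / y"
      using rad_ode[OF N, of y K] that by (simp add: field_simps)
    then show ?thesis using DERIV_rad'[OF N, of K y UNIV] by simp
  qed
qed (auto intro!: continuous_intros N)

lemma radial_sol_add_rad:
  assumes N: "N \<ge> 1" and v: "radial_sol N K a f v" and f: "continuous_on {0..1} f"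
  shows "radial_sol N K a f (\<lambda>y. v y + c * rad N K y)"
  unfolding radial_sol_def
proof (intro conjI ballI)
  have vc: "continuous_on {0..1} v" using v by (simp add: radial_sol_def)
  then show "continuous_on {0..1} (\<lambda>y. v y + c * rad N K y)" by (intro continuous_intros N)
  fix y :: real assume y: "y \<in> {0..1}"
  have "(\<lambda>s. K * (v s + c * rad N K s) + f s) = (\<lambda>s. (K * v s + f s) + c * (K * rad N K s))"
    by (simp add: algebra_simps)
  moreover have "ravg N (\<lambda>s. (K * v s + f s) + c * (K * rad N K s)) y = ravg N (\<lambda>s. K * v s + f s) y + ravg N (\<lambda>s. c * (K * rad N K s)) y"
    by (rule ravg_add[OF _ _ y]) (auto intro!: continuous_intros vc f N)
  ultimately have eq: "a y + y * ravg N (\<lambda>s. K * (v s + c * rad N K s) + f s) y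
     = (a y + y * ravg N (\<lambda>s. K * v s + f s) y) + c * rad' N K y"
    using rad'_ravg[OF N y, of K] by (simp add: ravg_cmult algebra_simps)
  have "(v has_real_derivative a y + y * ravg N (\<lambda>s. K * v s + f s) y) (at y within {0..1})"
    using v y unfolding radial_sol_def by blast
  then show "((\<lambda>y. v y + c * rad N K y) has_real_derivative a y + y * ravg N (\<lambda>s. K * (v s + c * rad N K s) + f s) y) (at y within {0..1})"
    unfolding eq by (intro DERIV_add DERIV_cmult DERIV_rad N)
qed

section \<open>Bounds that are uniform for large positive \<open>K\<close>\<close>

lemma rad_scale: "rad N (\<kappa>\<^sup>2) y = rad N 1 (\<kappa> * y)" "rad' N (\<kappa>\<^sup>2) y = \<kappa> * rad' N 1 (\<kappa> * y)"
  by (simp_all add: rad_def rad'_def power_mult_distrib power2_eq_square mult_ac)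

text \<open>Two-sided control of the logarithmic derivative of the modified Bessel type solution.
  The upper bound holds because \<open>rad^2 - rad'^2\<close> is nondecreasing; the lower one
  because \<open>x ^ (N - 1) * b x\<close> is.\<close>

lemma rad_1_bounds:
  assumes N: "N \<ge> 1" and t: "t \<ge> 0"
  shows "1 \<le> rad N 1 t" "0 \<le> rad' N 1 t" "rad' N 1 t \<le> rad N 1 t" "t * rad N 1 t \<le> (real N + t) * rad' N 1 t"
proof -
  have g1: "1 \<le> rad N 1 t" if "t \<ge> 0" for t using bes_ge_1(1)[OF N, of "1 * t\<^sup>2"] by (simp add: rad_def)
  have g0: "0 \<le> rad' N 1 t" if "t \<ge> 0" for t
    using bes_ge_1(2)[OF N, of "1 * t\<^sup>2"] that by (simp add: rad'_def)
  have ode: "rad'' N 1 x = rad N 1 x - (real N - 1) * rad' N 1 x / x" if "x > 0" for x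
    using rad_ode[OF N, of x 1] that by (simp add: field_simps)
  have le: "rad' N 1 t \<le> rad N 1 t" if t: "t \<ge> 0" for t
  proof -
    define H where "H x = (rad N 1 x)\<^sup>2 - (rad' N 1 x)\<^sup>2" for x
    have "H 0 \<le> H t"
    proof (rule DERIV_nonneg_imp_increasing_open[where f=H, OF t])
      show "continuous_on {0..t} H" unfolding H_def by (intro continuous_intros N)
      fix x assume x: "0 < x" "x < t"
      have "(H has_real_derivative 2 * rad' N 1 x * ((real N - 1) * rad' N 1 x / x)) (at x)"
        unfolding H_def using x
        by (auto intro!: derivative_eq_intros DERIV_rad DERIV_rad' N simp: ode algebra_simps)
      moreover have "0 \<le> 2 * rad' N 1 x * ((real N - 1) * rad' N 1 x / x)"
        using g0[of x] N x by (intro mult_nonneg_nonneg divide_nonneg_pos) auto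
      ultimately show "\<exists>y. (H has_real_derivative y) (at x) \<and> y \<ge> 0" by blast
    qed
    then have "(rad' N 1 t)\<^sup>2 \<le> (rad N 1 t)\<^sup>2" by (simp add: H_def)
    then show ?thesis by (rule power2_le_imp_le) (use g1[OF t] in simp)
  qed
  \<comment> \<open>The comparison quotient \<open>x / (N + x)\<close> has the behaviour of
    \<open>rad' / rad\<close> at both ends: \<open>x / N\<close> near \<open>0\<close> and the limit
    \<open>1\<close> at infinity.\<close>
  define b where "b x = rad' N 1 x - x * rad N 1 x / (real N + x)" for x
  define P where "P x = x ^ (N - 1) * b x" for x
  have "P 0 \<le> P t"
  proof (rule DERIV_nonneg_imp_increasing_open[where f=P, OF t])
    show "continuous_on {0..t} P" unfolding P_def b_def using N by (intro continuous_intros) auto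
    fix x assume x: "0 < x" "x < t"
    let ?b' = "rad'' N 1 x - ((rad N 1 x + x * rad' N 1 x) * (real N + x) - x * rad N 1 x) / ((real N + x) * (real N + x))"
    have Nx: "real N + x > 0" using x by simp
    have "(b has_real_derivative ?b') (at x)"
      unfolding b_def using Nx
      by (auto intro!: derivative_eq_intros DERIV_rad DERIV_rad' N)
    from DERIV_radial_weight[OF N _ this] x
    have "(P has_real_derivative x ^ (N - 1) * (?b' + (real N - 1) * b x / x)) (at x)" unfolding P_def by auto
    moreover have "?b' + (real N - 1) * b x / x = x * (rad N 1 x - rad' N 1 x) / (real N + x) + x * rad N 1 x / ((real N + x) * (real N + x))"
    proof -
      define M where "M = real N + x"
      have M: "M > 0" "real N = M - x" using Nx by (auto simp: M_def)
      show ?thesis unfolding ode[OF x(1)] b_def using x(1) M(1)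
        unfolding M_def[symmetric] M(2) by (simp add: divide_simps) (simp add: algebra_simps)
    qed
    moreover have "0 \<le> x * (rad N 1 x - rad' N 1 x) / (real N + x) + x * rad N 1 x / ((real N + x) * (real N + x))"
      using le[of x] g1[of x] x Nx by (intro add_nonneg_nonneg divide_nonneg_pos mult_nonneg_nonneg) auto
    ultimately show "\<exists>y. (P has_real_derivative y) (at x) \<and> y \<ge> 0"
      using x by (intro exI[of _ "x ^ (N - 1) * (?b' + (real N - 1) * b x / x)"]) (auto intro!: mult_nonneg_nonneg)
  qed
  then have "0 \<le> t ^ (N - 1) * b t" by (simp add: P_def b_def)
  then have "t > 0 \<Longrightarrow> 0 \<le> b t" using zero_less_power[of t "N - 1"] by (metis mult_le_cancel_left_pos mult_zero_right)
  then show "t * rad N 1 t \<le> (real N + t) * rad' N 1 t"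
    using t N by (cases "t = 0") (auto simp: b_def field_simps)
  show "1 \<le> rad N 1 t" "0 \<le> rad' N 1 t" "rad' N 1 t \<le> rad N 1 t" using g1 g0 le t by auto
qed

lemma abs_diff_le_by_derivative:
  fixes g G :: "real \<Rightarrow> real"
  assumes ab: "a \<le> b" and c: "continuous_on {a..b} g" "continuous_on {a..b} G"
    and d: "\<And>x. a < x \<Longrightarrow> x < b \<Longrightarrow> (g has_real_derivative g' x) (at x)"
      "\<And>x. a < x \<Longrightarrow> x < b \<Longrightarrow> (G has_real_derivative G' x) (at x)"
    and le: "\<And>x. a < x \<Longrightarrow> x < b \<Longrightarrow> \<bar>g' x\<bar> \<le> G' x"
  shows "\<bar>g b - g a\<bar> \<le> G b - G a"
proof -
  have "(\<lambda>x. G x - g x) a \<le> (\<lambda>x. G x - g x) b"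
    by (rule DERIV_nonneg_imp_increasing_open[OF ab])
      (use d le in \<open>force intro!: DERIV_diff continuous_on_diff c exI conjI simp: abs_le_iff\<close>)+
  moreover have "(\<lambda>x. G x + g x) a \<le> (\<lambda>x. G x + g x) b"
  proof (rule DERIV_nonneg_imp_increasing_open[OF ab])
    fix x assume x: "a < x" "x < b"
    show "\<exists>y. ((\<lambda>x. G x + g x) has_real_derivative y) (at x) \<and> 0 \<le> y"
      using DERIV_add[OF d(2,1)[OF x]] le[OF x] by (intro exI[of _ "G' x + g' x"]) auto
  qed (intro continuous_intros c)
  ultimately show ?thesis by (simp add: abs_le_iff)
qed

text \<open>Lagrange's identity: the terms with \<open>K\<close> cancel, and the weight absorbs the
  first order terms, so that only the sources \<open>a\<close> and \<open>f\<close> remain.\<close>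

lemma radial_sol_wronskian:
  assumes N: "N \<ge> 1" and v: "radial_sol N K a f v" and a: "continuous_on {0..1} a" and f: "continuous_on {0..1} f"
    and y: "0 < y" "y < 1"
  defines "b \<equiv> \<lambda>y. y * ravg N (\<lambda>s. K * v s + f s) y"
  shows "((\<lambda>y. y ^ (N - 1) * (rad N K y * b y - rad' N K y * v y)) has_real_derivative
      y ^ (N - 1) * (rad N K y * f y - rad' N K y * a y)) (at y)"
    "(b has_real_derivative K * v y + f y - (real N - 1) * b y / y) (at y)"
    "(v has_real_derivative a y + b y) (at y)"
proof -
  have at: "at y within {0..1} = at y" using y by (intro at_within_interior) auto
  have vc: "continuous_on {0..1} v" using v by (simp add: radial_sol_def)
  have c: "continuous_on {0..1} (\<lambda>s. K * v s + f s)" by (intro continuous_intros vc f)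
  show vd: "(v has_real_derivative a y + b y) (at y)"
    using v y at unfolding radial_sol_def b_def by (metis atLeastAtMost_iff less_imp_le)
  show bd: "(b has_real_derivative K * v y + f y - (real N - 1) * b y / y) (at y)"
    using DERIV_ravg[OF c N, of y] y at unfolding b_def by simp
  have ode: "rad'' N K y = K * rad N K y - (real N - 1) * rad' N K y / y"
    using rad_ode[OF N, of y K] y by (simp add: field_simps)
  have "((\<lambda>y. rad N K y * b y - rad' N K y * v y) has_real_derivative
      (rad' N K y * b y + (K * v y + f y - (real N - 1) * b y / y) * rad N K y) - (rad'' N K y * v y + (a y + b y) * rad' N K y)) (at y)"
    by (intro DERIV_diff DERIV_mult DERIV_rad DERIV_rad' N bd vd)
  from DERIV_radial_weight[OF N _ this] y
  show "((\<lambda>y. y ^ (N - 1) * (rad N K y * b y - rad' N K y * v y)) has_real_derivative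
      y ^ (N - 1) * (rad N K y * f y - rad' N K y * a y)) (at y)"
    unfolding ode by (auto simp: algebra_simps diff_divide_distrib add_divide_distrib elim!: DERIV_cong)
qed

text \<open>
  With \<open>\<phi> = rad N K\<close> and \<open>b = v' - a\<close> the weighted Wronskian \<open>y ^ (N - 1) * (\<phi> b - \<phi>' v)\<close> has the derivative
  \<open>y ^ (N - 1) * (\<phi> f - \<phi>' a)\<close>. Its bound controls \<open>(v / \<phi>)'\<close>, which is integrated from the boundary.
\<close>

lemma radial_sol_bound:
  fixes \<kappa> :: real
  assumes N: "N \<ge> 1" and \<kappa>: "\<kappa> \<ge> 1" and v: "radial_sol N (\<kappa>\<^sup>2) a f v" "v 1 = 0"
    and a: "continuous_on {0..1} a" "\<And>y. y \<in> {0..1} \<Longrightarrow> \<bar>a y\<bar> \<le> \<alpha>"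
    and f: "continuous_on {0..1} f" "\<And>y. y \<in> {0..1} \<Longrightarrow> \<bar>f y\<bar> \<le> \<beta>"
    and y: "y \<in> {0..1}"
  shows "\<bar>v y\<bar> \<le> (2 * real N + 4) * (\<alpha> / \<kappa> + \<beta> / \<kappa>\<^sup>2)"
    "\<bar>y * ravg N (\<lambda>s. \<kappa>\<^sup>2 * v s + f s) y\<bar> \<le> (2 * real N + 5) * (\<alpha> + \<beta> / \<kappa>)"
proof -
  define K where "K = \<kappa>\<^sup>2"
  define \<phi> where "\<phi> = rad N K"
  define \<phi>' where "\<phi>' = rad' N K"
  define b where "b y = y * ravg N (\<lambda>s. K * v s + f s) y" for y
  have K0: "K > 0" "\<kappa> > 0" using \<kappa> by (auto simp: K_def)
  have \<alpha>: "\<alpha> \<ge> 0" and \<beta>: "\<beta> \<ge> 0"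
    using order_trans[OF abs_ge_zero a(2)[of 0]] order_trans[OF abs_ge_zero f(2)[of 0]] by simp_all
  have vc: "continuous_on {0..1} v" using v by (simp add: radial_sol_def)
  have c: "continuous_on {0..1} (\<lambda>s. K * v s + f s)" by (intro continuous_intros vc f)
  have bc: "continuous_on {0..1} b" unfolding b_def by (intro continuous_intros ravg_continuous c)
  have \<phi>d: "(\<phi> has_real_derivative \<phi>' x) (at x)" for x unfolding \<phi>_def \<phi>'_def by (rule DERIV_rad[OF N])
  have \<phi>c: "continuous_on S \<phi>" "continuous_on S \<phi>'" for S
    unfolding \<phi>_def \<phi>'_def by (intro continuous_intros N)+
  have \<phi>1: "1 \<le> \<phi> x" "0 \<le> \<phi>' x" "\<phi>' x \<le> \<kappa> * \<phi> x" if "x \<ge> 0" for x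
  proof -
    have "\<kappa> * x \<ge> 0" using that K0 by simp
    note r = rad_1_bounds[OF N this]
    show "1 \<le> \<phi> x" "0 \<le> \<phi>' x" "\<phi>' x \<le> \<kappa> * \<phi> x"
      using r K0 by (simp_all add: \<phi>_def \<phi>'_def K_def rad_scale)
  qed
  \<comment> \<open>The lower bound for \<open>\<phi>' / \<phi>\<close> is of size
    \<open>\<kappa>\<close> only outside the layer \<open>x < 1 / \<kappa>\<close> around the axis.
    This is why the two regions are treated separately below.\<close>
  have \<phi>2: "\<kappa> * \<phi> x \<le> (real N + 1) * \<phi>' x" if "x \<ge> 1 / \<kappa>" for x
  proof -
    have kx: "\<kappa> * x \<ge> 1" using that K0 by (simp add: field_simps)
    then have kx0: "\<kappa> * x \<ge> 0" by linarith
    note r = rad_1_bounds[OF N kx0]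
    have "(\<kappa> * x) * rad N 1 (\<kappa> * x) \<le> (real N + \<kappa> * x) * rad' N 1 (\<kappa> * x)" by (rule r(4))
    also have "\<dots> \<le> ((\<kappa> * x) * (real N + 1)) * rad' N 1 (\<kappa> * x)"
    proof (rule mult_right_mono[OF _ r(2)])
      have "real N * 1 \<le> real N * (\<kappa> * x)" by (rule mult_left_mono[OF kx]) simp
      then show "real N + \<kappa> * x \<le> \<kappa> * x * (real N + 1)" by (simp add: algebra_simps)
    qed
    finally have "(\<kappa> * x) * rad N 1 (\<kappa> * x) \<le> (\<kappa> * x) * ((real N + 1) * rad' N 1 (\<kappa> * x))" by (simp add: mult_ac)
    then have "rad N 1 (\<kappa> * x) \<le> (real N + 1) * rad' N 1 (\<kappa> * x)"
      using kx by (subst (asm) mult_le_cancel_left_pos) linarith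
    then show ?thesis using K0 by (simp add: \<phi>_def \<phi>'_def K_def rad_scale mult.left_commute)
  qed
  have mono: "\<phi> x \<le> \<phi> z" if "0 \<le> x" "x \<le> z" for x z
    by (rule DERIV_nonneg_imp_nondecreasing[OF that(2)]) (use \<phi>d \<phi>1(2) that in \<open>meson order_trans\<close>)
  have at: "(v has_real_derivative a x + b x) (at x)" if "0 < x" "x < 1" for x
    using radial_sol_wronskian(3)[OF N v(1) a(1) f(1) that] by (simp add: b_def K_def)
  have W: "\<bar>\<phi> x * b x - \<phi>' x * v x\<bar> \<le> \<beta> * \<phi>' x / K + \<alpha> * \<phi> x" if x: "x \<in> {0..1}" for x
  proof (cases "x = 0")
    case True
    then show ?thesis using \<alpha> by (simp add: b_def \<phi>_def \<phi>'_def)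
  next
    case False
    then have x0: "0 < x" "x \<le> 1" using x by auto
    define g where "g y = y ^ (N - 1) * (\<phi> y * b y - \<phi>' y * v y)" for y
    \<comment> \<open>The part with \<open>\<phi>'\<close> is an exact primitive of the weighted
      \<open>\<beta> * \<phi>\<close>, because \<open>\<phi>\<close> solves the homogeneous
      equation. The part with \<open>\<phi>\<close> overshoots the weighted
      \<open>\<alpha> * \<phi>'\<close>, which does no harm to a bound.\<close>
    define G where "G y = y ^ (N - 1) * (\<beta> * \<phi>' y / K + \<alpha> * \<phi> y)" for y
    have "\<bar>g x - g 0\<bar> \<le> G x - G 0"
    proof (rule abs_diff_le_by_derivative)
      show "0 \<le> x" using x0 by simp
      show "continuous_on {0..x} g" unfolding g_def using x0
        by (intro continuous_intros \<phi>c continuous_on_subset[OF bc] continuous_on_subset[OF vc]) auto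
      show "continuous_on {0..x} G" unfolding G_def using K0 by (intro continuous_intros \<phi>c) auto
      fix z assume z: "0 < z" "z < x"
      then have z1: "z < 1" using x0 by simp
      show "(g has_real_derivative z ^ (N - 1) * (\<phi> z * f z - \<phi>' z * a z)) (at z)"
        using radial_sol_wronskian(1)[OF N v(1) a(1) f(1) z(1) z1]
        by (simp add: g_def[abs_def] b_def K_def \<phi>_def \<phi>'_def)
      have ode: "rad'' N K z = K * \<phi> z - (real N - 1) * \<phi>' z / z"
        using rad_ode[OF N, of z K] z by (simp add: field_simps \<phi>_def \<phi>'_def)
      have "((\<lambda>y. \<beta> / K * \<phi>' y + \<alpha> * \<phi> y) has_real_derivative \<beta> / K * rad'' N K z + \<alpha> * \<phi>' z) (at z)"
        by (intro DERIV_add DERIV_cmult \<phi>d) (simp add: \<phi>'_def DERIV_rad'[OF N])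
      from DERIV_radial_weight[OF N _ this] z
      have D: "((\<lambda>y. y ^ (N - 1) * (\<beta> / K * \<phi>' y + \<alpha> * \<phi> y)) has_real_derivative
        z ^ (N - 1) * (\<beta> / K * rad'' N K z + \<alpha> * \<phi>' z + (real N - 1) * (\<beta> / K * \<phi>' z + \<alpha> * \<phi> z) / z)) (at z)" by auto
      have eq: "\<beta> / K * rad'' N K z + \<alpha> * \<phi>' z + (real N - 1) * (\<beta> / K * \<phi>' z + \<alpha> * \<phi> z) / z
        = \<beta> * \<phi> z + \<alpha> * \<phi>' z + (real N - 1) * \<alpha> * \<phi> z / z"
        unfolding ode using K0 z by (simp add: field_simps)
      show "(G has_real_derivative z ^ (N - 1) * (\<beta> * \<phi> z + \<alpha> * \<phi>' z + (real N - 1) * \<alpha> * \<phi> z / z)) (at z)"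
        using D unfolding eq by (simp add: G_def[abs_def])
      have "\<bar>\<phi> z * f z - \<phi>' z * a z\<bar> \<le> \<phi> z * \<beta> + \<phi>' z * \<alpha>"
      proof -
        have "\<bar>\<phi> z * f z - \<phi>' z * a z\<bar> \<le> \<bar>\<phi> z * f z\<bar> + \<bar>\<phi>' z * a z\<bar>" by linarith
        also have "\<dots> \<le> \<phi> z * \<beta> + \<phi>' z * \<alpha>"
          using \<phi>1[of z] f(2)[of z] a(2)[of z] z z1 by (intro add_mono) (auto simp: abs_mult intro!: mult_mono)
        finally show ?thesis .
      qed
      also have "\<dots> \<le> \<beta> * \<phi> z + \<alpha> * \<phi>' z + (real N - 1) * \<alpha> * \<phi> z / z"
        using N \<alpha> \<phi>1[of z] z by (simp add: mult.commute)
      finally show "\<bar>z ^ (N - 1) * (\<phi> z * f z - \<phi>' z * a z)\<bar> \<le> z ^ (N - 1) * (\<beta> * \<phi> z + \<alpha> * \<phi>' z + (real N - 1) * \<alpha> * \<phi> z / z)"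
        using z by (simp add: abs_mult mult_left_mono)
    qed
    moreover have "g 0 = 0" by (simp add: g_def b_def \<phi>'_def)
    moreover have "G 0 \<ge> 0" using \<alpha> \<phi>1[of 0] by (simp add: G_def \<phi>'_def)
    ultimately have "\<bar>g x\<bar> \<le> G x" by simp
    then have "x ^ (N - 1) * \<bar>\<phi> x * b x - \<phi>' x * v x\<bar> \<le> x ^ (N - 1) * (\<beta> * \<phi>' x / K + \<alpha> * \<phi> x)"
      using x0 by (simp add: g_def G_def abs_mult)
    then show ?thesis using x0 by (subst (asm) mult_le_cancel_left_pos) auto
  qed
  define q where "q y = v y / \<phi> y" for y
  define q' where "q' y = (a y * \<phi> y + (\<phi> y * b y - \<phi>' y * v y)) / (\<phi> y * \<phi> y)" for y
  have qc: "continuous_on {0..1} q" unfolding q_def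
    by (intro continuous_intros vc \<phi>c) (use \<phi>1(1) in force)
  have qd: "(q has_real_derivative q' x) (at x)" if "0 < x" "x < 1" for x
  proof -
    have "\<phi> x \<noteq> 0" using \<phi>1(1)[of x] that by auto
    from DERIV_divide[OF at[OF that] \<phi>d this] show ?thesis
      unfolding q_def q'_def by (simp add: algebra_simps)
  qed
  have q': "\<bar>q' x\<bar> \<le> 2 * \<alpha> / \<phi> x + \<beta> / K * (\<phi>' x / (\<phi> x * \<phi> x))" if x: "x \<in> {0..1}" for x
  proof -
    have p: "\<phi> x \<ge> 1" using \<phi>1(1)[of x] x by auto
    have "\<bar>a x * \<phi> x\<bar> \<le> \<alpha> * \<phi> x" using a(2)[OF x] p by (simp add: abs_mult mult_right_mono)
    then have "\<bar>a x * \<phi> x + (\<phi> x * b x - \<phi>' x * v x)\<bar> \<le> 2 * \<alpha> * \<phi> x + \<beta> * \<phi>' x / K"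
      using W[OF x] by linarith
    then have "\<bar>q' x\<bar> \<le> (2 * \<alpha> * \<phi> x + \<beta> * \<phi>' x / K) / (\<phi> x * \<phi> x)"
    proof -
      have "\<bar>q' x\<bar> = \<bar>a x * \<phi> x + (\<phi> x * b x - \<phi>' x * v x)\<bar> / (\<phi> x * \<phi> x)"
        using p by (simp add: q'_def)
      moreover assume "\<bar>a x * \<phi> x + (\<phi> x * b x - \<phi>' x * v x)\<bar> \<le> 2 * \<alpha> * \<phi> x + \<beta> * \<phi>' x / K"
      then have "\<bar>a x * \<phi> x + (\<phi> x * b x - \<phi>' x * v x)\<bar> / (\<phi> x * \<phi> x) \<le> (2 * \<alpha> * \<phi> x + \<beta> * \<phi>' x / K) / (\<phi> x * \<phi> x)"
        using p by (intro divide_right_mono) auto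
      ultimately show ?thesis by simp
    qed
    also have "\<dots> = 2 * \<alpha> / \<phi> x + \<beta> / K * (\<phi>' x / (\<phi> x * \<phi> x))" using p by (simp add: field_simps)
    finally show ?thesis .
  qed
  have invd: "((\<lambda>y. - (1 / \<phi> y)) has_real_derivative \<phi>' x / (\<phi> x * \<phi> x)) (at x)" if "x \<ge> 0" for x
    using \<phi>1(1)[OF that] by (auto intro!: derivative_eq_intros \<phi>d simp: power2_eq_square)
  have invc: "continuous_on {x..z} (\<lambda>y. - (1 / \<phi> y))" if "x \<ge> 0" for x z
  proof -
    have "\<phi> w \<noteq> 0" if "w \<in> {x..z}" for w using \<phi>1(1)[of w] that \<open>x \<ge> 0\<close> by auto
    then show ?thesis by (intro continuous_intros \<phi>c) auto
  qed
  \<comment> \<open>Outside the layer \<open>1 / \<phi>\<close> is at most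
    \<open>(N + 1) / \<kappa>\<close> times \<open>\<phi>' / \<phi>^2\<close>, so \<open>q'\<close>
    is dominated by a multiple of the derivative of \<open>- 1 / \<phi>\<close>, and the integral
    from \<open>x\<close> to the boundary is at most a multiple of
    \<open>1 / \<phi> x\<close>.\<close>
  have v1: "\<bar>v x\<bar> \<le> 2 * (real N + 1) * \<alpha> / \<kappa> + \<beta> / K" if x: "1 / \<kappa> \<le> x" "x \<le> 1" for x
  proof -
    have x0: "0 < x" using x K0 by (meson divide_pos_pos less_le_trans zero_less_one)
    let ?c = "2 * \<alpha> * (real N + 1) / \<kappa> + \<beta> / K"
    have "\<bar>q 1 - q x\<bar> \<le> (\<lambda>y. ?c * - (1 / \<phi> y)) 1 - (\<lambda>y. ?c * - (1 / \<phi> y)) x"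
    proof (rule abs_diff_le_by_derivative[OF x(2)])
      show "continuous_on {x..1} q" by (rule continuous_on_subset[OF qc]) (use x0 in auto)
      show "continuous_on {x..1} (\<lambda>y. ?c * - (1 / \<phi> y))" by (intro continuous_on_mult continuous_on_const invc) (use x0 in auto)
      fix z assume z: "x < z" "z < 1"
      show "(q has_real_derivative q' z) (at z)" by (rule qd) (use z x0 in auto)
      show "((\<lambda>y. ?c * - (1 / \<phi> y)) has_real_derivative ?c * (\<phi>' z / (\<phi> z * \<phi> z))) (at z)"
        by (intro DERIV_cmult invd) (use z x0 in auto)
      have p: "\<phi> z \<ge> 1" using \<phi>1(1)[of z] z x0 by auto
      have "1 / \<phi> z \<le> (real N + 1) / \<kappa> * (\<phi>' z / (\<phi> z * \<phi> z))"
      proof -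
        have "1 / \<kappa> \<le> z" using x z by linarith
        from \<phi>2[OF this] show ?thesis using K0 p by (simp add: field_simps)
      qed
      then have i1: "2 * \<alpha> * (1 / \<phi> z) \<le> 2 * \<alpha> * ((real N + 1) / \<kappa> * (\<phi>' z / (\<phi> z * \<phi> z)))"
        using \<alpha> by (intro mult_left_mono) auto
      have e: "?c * r = 2 * \<alpha> * ((real N + 1) / \<kappa> * r) + \<beta> / K * r" for r by (simp add: algebra_simps)
      have "2 * \<alpha> / \<phi> z + \<beta> / K * (\<phi>' z / (\<phi> z * \<phi> z)) \<le> ?c * (\<phi>' z / (\<phi> z * \<phi> z))"
        unfolding e by (rule add_right_mono) (use i1 in simp)
      then show "\<bar>q' z\<bar> \<le> ?c * (\<phi>' z / (\<phi> z * \<phi> z))" using q'[of z] z x0 by auto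
    qed
    also have "\<dots> \<le> ?c / \<phi> x"
      using \<alpha> \<beta> K0 \<phi>1(1)[of 1] by simp
    finally have "\<bar>v x\<bar> / \<phi> x \<le> ?c / \<phi> x"
      using v(2) \<phi>1(1)[of x] x0 by (simp add: q_def)
    then have "\<bar>v x\<bar> \<le> ?c" using \<phi>1(1)[of x] x0 by (simp add: divide_le_cancel)
    then show ?thesis by (simp add: mult_ac)
  qed
  have v2: "\<bar>v x\<bar> \<le> (2 * real N + 4) * (\<alpha> / \<kappa> + \<beta> / K)" if x: "x \<in> {0..1}" for x
  proof (cases "1 / \<kappa> \<le> x")
    case True
    have "2 * (real N + 1) * \<alpha> / \<kappa> + \<beta> / K \<le> (2 * real N + 4) * (\<alpha> / \<kappa>) + (2 * real N + 4) * (\<beta> / K)"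
    proof (intro add_mono)
      show "2 * (real N + 1) * \<alpha> / \<kappa> \<le> (2 * real N + 4) * (\<alpha> / \<kappa>)"
        using \<alpha> K0 mult_right_mono[of "2 * (real N + 1)" "2 * real N + 4" "\<alpha> / \<kappa>"] by simp
      show "\<beta> / K \<le> (2 * real N + 4) * (\<beta> / K)"
        using \<beta> K0 mult_right_mono[of 1 "2 * real N + 4" "\<beta> / K"] by simp
    qed
    then show ?thesis using v1[OF True] x by (simp add: distrib_left)
  next
    case False
    \<comment> \<open>Inside the layer the crude bound \<open>2 \<alpha> / \<phi> x\<close>
      suffices, because the interval has length at most \<open>1 / \<kappa>\<close>; the integration
      starts from the value at the edge, bounded by \<open>v1\<close>.\<close>
    define z where "z = 1 / \<kappa>"
    have z: "0 \<le> x" "x < z" "z \<le> 1" using False x K0 \<kappa> by (auto simp: z_def)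
    let ?G = "\<lambda>y. 2 * \<alpha> / \<phi> x * y + \<beta> / K * - (1 / \<phi> y)"
    have px: "\<phi> x \<ge> 1" "\<phi> z \<ge> \<phi> x" using \<phi>1(1)[of x] mono[of x z] z by auto
    have "\<bar>q z - q x\<bar> \<le> ?G z - ?G x"
    proof (rule abs_diff_le_by_derivative)
      show "x \<le> z" using z by simp
      show "continuous_on {x..z} q" by (rule continuous_on_subset[OF qc]) (use z in auto)
      show "continuous_on {x..z} ?G" by (intro continuous_on_add continuous_on_mult continuous_on_const continuous_on_id invc z)
      fix y assume y: "x < y" "y < z"
      show "(q has_real_derivative q' y) (at y)" by (rule qd) (use y z in auto)
      show "(?G has_real_derivative 2 * \<alpha> / \<phi> x * 1 + \<beta> / K * (\<phi>' y / (\<phi> y * \<phi> y))) (at y)"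
        by (intro DERIV_add DERIV_cmult invd DERIV_ident) (use y z in auto)
      have "2 * \<alpha> / \<phi> y \<le> 2 * \<alpha> / \<phi> x" using mono[of x y] y z px \<alpha> by (intro divide_left_mono) auto
      then show "\<bar>q' y\<bar> \<le> 2 * \<alpha> / \<phi> x * 1 + \<beta> / K * (\<phi>' y / (\<phi> y * \<phi> y))" using q'[of y] y z by auto
    qed
    also have "?G z - ?G x \<le> 2 * \<alpha> / \<phi> x * z + \<beta> / K * (1 / \<phi> x)"
    proof -
      have "2 * \<alpha> / \<phi> x * x \<ge> 0" "\<beta> / K * (1 / \<phi> z) \<ge> 0" using \<alpha> \<beta> K0 px z by auto
      then show ?thesis by (simp add: algebra_simps)
    qed
    finally have "\<bar>q x\<bar> \<le> \<bar>q z\<bar> + 2 * \<alpha> / \<phi> x * z + \<beta> / K * (1 / \<phi> x)" by linarith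
    then have "\<phi> x * \<bar>q x\<bar> \<le> \<phi> x * (\<bar>q z\<bar> + 2 * \<alpha> / \<phi> x * z + \<beta> / K * (1 / \<phi> x))"
      using px by (intro mult_left_mono) auto
    also have "\<dots> = \<phi> x * \<bar>q z\<bar> + 2 * \<alpha> * z + \<beta> / K" using px by (simp add: distrib_left)
    also have "\<phi> x * \<bar>q z\<bar> \<le> \<phi> z * \<bar>q z\<bar>" using px by (intro mult_right_mono) auto
    also have "\<phi> z * \<bar>q z\<bar> = \<bar>v z\<bar>" using px by (simp add: q_def)
    also have "\<bar>v z\<bar> \<le> 2 * (real N + 1) * \<alpha> / \<kappa> + \<beta> / K" using v1[of z] z by (simp add: z_def)
    also have "\<phi> x * \<bar>q x\<bar> = \<bar>v x\<bar>" using px by (simp add: q_def)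
    finally have "\<bar>v x\<bar> \<le> (2 * real N + 4) * (\<alpha> / \<kappa>) + 2 * (\<beta> / K)"
      by (simp add: z_def algebra_simps add_divide_distrib)
    also have "2 * (\<beta> / K) \<le> (2 * real N + 4) * (\<beta> / K)" using \<beta> K0 by (intro mult_right_mono) auto
    finally show ?thesis by (simp add: distrib_left)
  qed
  show "\<bar>v y\<bar> \<le> (2 * real N + 4) * (\<alpha> / \<kappa> + \<beta> / \<kappa>\<^sup>2)" using v2[OF y] by (simp add: K_def)
  have p: "\<phi> y \<ge> 1" "0 \<le> \<phi>' y" "\<phi>' y \<le> \<kappa> * \<phi> y" using \<phi>1[of y] y by auto
  \<comment> \<open>The derivative part \<open>b\<close> is recovered from the Wronskian bound and
    the bound for \<open>v\<close>, using \<open>\<phi>' \<le> \<kappa> \<phi>\<close>.\<close>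
  have "\<phi> y * \<bar>b y\<bar> = \<bar>(\<phi> y * b y - \<phi>' y * v y) + \<phi>' y * v y\<bar>" using p by (simp add: abs_mult)
  also have "\<dots> \<le> \<bar>\<phi> y * b y - \<phi>' y * v y\<bar> + \<bar>\<phi>' y * v y\<bar>" by (rule abs_triangle_ineq)
  also have "\<bar>\<phi>' y * v y\<bar> = \<phi>' y * \<bar>v y\<bar>" using p by (simp add: abs_mult)
  also have "\<bar>\<phi> y * b y - \<phi>' y * v y\<bar> + \<phi>' y * \<bar>v y\<bar> \<le> (\<beta> * \<phi>' y / K + \<alpha> * \<phi> y) + \<phi>' y * \<bar>v y\<bar>"
    using W[OF y] by simp
  also have "\<dots> \<le> (\<beta> * (\<kappa> * \<phi> y) / K + \<alpha> * \<phi> y) + (\<kappa> * \<phi> y) * ((2 * real N + 4) * (\<alpha> / \<kappa> + \<beta> / K))"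
    using p \<alpha> \<beta> K0 v2[OF y] by (intro add_mono mult_mono divide_right_mono) auto
  also have "\<dots> = \<phi> y * ((2 * real N + 5) * (\<alpha> + \<beta> / \<kappa>))"
    using K0 by (simp add: K_def power2_eq_square field_simps)
  finally have "\<phi> y * \<bar>b y\<bar> \<le> \<phi> y * ((2 * real N + 5) * (\<alpha> + \<beta> / \<kappa>))" .
  then have "\<bar>b y\<bar> \<le> (2 * real N + 5) * (\<alpha> + \<beta> / \<kappa>)" using p by (subst (asm) mult_le_cancel_left_pos) auto
  then show "\<bar>y * ravg N (\<lambda>s. \<kappa>\<^sup>2 * v s + f s) y\<bar> \<le> (2 * real N + 5) * (\<alpha> + \<beta> / \<kappa>)"
    by (simp add: b_def K_def)
qed

lemma continuous_unit_interval_bound: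
  fixes f :: "real \<Rightarrow> real"
  assumes "continuous_on {0..1} f" obtains B where "B \<ge> 0" "\<forall>y\<in>{0..1}. \<bar>f y\<bar> \<le> B"
proof -
  obtain B where "B > 0" "\<forall>x\<in>f ` {0..1}. norm x \<le> B"
    using compact_imp_bounded[OF compact_continuous_image[OF assms compact_Icc]] unfolding bounded_pos by blast
  then show thesis by (intro that[of B]) auto
qed

text \<open>The flag \<open>z\<close> marks resonance. Without it, a multiple of \<open>rad\<close>
  corrects the boundary value of the Volterra solution. In the resonant case \<open>rad\<close>
  vanishes at \<open>1\<close> and cannot correct anything, but the orthogonality condition already
  makes the Volterra solution vanish there.\<close>

lemma radial_sol_exists_bounded:
  assumes N: "N \<ge> 1" and nz: "z \<or> rad N K 1 \<noteq> 0" and nz': "z \<Longrightarrow> rad N K 1 = 0 \<and> rad' N K 1 \<noteq> 0"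
  shows "\<exists>C\<ge>0. \<forall>a f \<alpha> \<beta>. continuous_on {0..1} a \<longrightarrow> continuous_on {0..1} f \<longrightarrow>
     (\<forall>y\<in>{0..1}. \<bar>a y\<bar> \<le> \<alpha>) \<longrightarrow> (\<forall>y\<in>{0..1}. \<bar>f y\<bar> \<le> \<beta>) \<longrightarrow>
     (z \<longrightarrow> integral {0..1} (\<lambda>s. s ^ (N - 1) * (rad N K s * f s - rad' N K s * a s)) = 0) \<longrightarrow>
     (\<exists>v. radial_sol N K a f v \<and> v 1 = 0 \<and> (\<forall>y\<in>{0..1}. \<bar>v y\<bar> \<le> C * (\<alpha> + \<beta>) \<and>
        \<bar>y * ravg N (\<lambda>s. K * v s + f s) y\<bar> \<le> C * (\<alpha> + \<beta>)))"
proof -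
  obtain B where B0: "B \<ge> 0" and "\<forall>y\<in>{0..1}. \<bar>rad N K y\<bar> \<le> B"
    using continuous_unit_interval_bound[OF continuous_on_rad(1)[OF N]] by blast
  then have B: "\<And>y. y \<in> {0..1} \<Longrightarrow> \<bar>rad N K y\<bar> \<le> B" by blast
  define E where "E = exp \<bar>K\<bar>"
  have E: "E \<ge> 1" by (simp add: E_def)
  define C1 where "C1 = E * (1 + B / \<bar>rad N K 1\<bar>)"
  have C1: "C1 \<ge> E" using E B0 by (simp add: C1_def mult_le_cancel_left1)
  define C where "C = \<bar>K\<bar> * C1 + C1 + 1"
  have C: "C \<ge> C1" "C \<ge> \<bar>K\<bar> * C1 + 1" "C \<ge> 0" using C1 E by (auto simp: C_def)
  show ?thesis
  proof (intro exI[of _ C] conjI allI impI C(3))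
    fix a f :: "real \<Rightarrow> real" and \<alpha> \<beta> :: real
    assume a: "continuous_on {0..1} a" and f: "continuous_on {0..1} f"
      and ab: "\<forall>y\<in>{0..1}. \<bar>a y\<bar> \<le> \<alpha>" and fb: "\<forall>y\<in>{0..1}. \<bar>f y\<bar> \<le> \<beta>"
      and orth: "z \<longrightarrow> integral {0..1} (\<lambda>s. s ^ (N - 1) * (rad N K s * f s - rad' N K s * a s)) = 0"
    have \<alpha>: "\<alpha> \<ge> 0" and \<beta>: "\<beta> \<ge> 0"
      using order_trans[OF abs_ge_zero bspec[OF ab, of 0]] order_trans[OF abs_ge_zero bspec[OF fb, of 0]] by simp_all
    obtain w where w: "radial_sol N K a f w" "\<And>y. y \<in> {0..1} \<Longrightarrow> \<bar>w y\<bar> \<le> (\<alpha> + \<beta>) * E"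
      using radial_sol_exists[OF a _ f, of \<alpha> \<beta>] ab fb unfolding E_def by blast
    have "\<exists>v. radial_sol N K a f v \<and> v 1 = 0 \<and> (\<forall>y\<in>{0..1}. \<bar>v y\<bar> \<le> C1 * (\<alpha> + \<beta>))"
    proof (cases z)
      case False
      then have nz: "rad N K 1 \<noteq> 0" using nz by simp
      define c where "c = - w 1 / rad N K 1"
      have "\<bar>w y + c * rad N K y\<bar> \<le> C1 * (\<alpha> + \<beta>)" if y: "y \<in> {0..1}" for y
      proof -
        have "\<bar>c\<bar> \<le> (\<alpha> + \<beta>) * E / \<bar>rad N K 1\<bar>"
          using w(2)[of 1] by (simp add: c_def abs_divide divide_right_mono)
        then have "\<bar>c * rad N K y\<bar> \<le> (\<alpha> + \<beta>) * E / \<bar>rad N K 1\<bar> * B"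
          unfolding abs_mult using B[OF y] \<alpha> \<beta> E by (intro mult_mono) auto
        then have "\<bar>w y + c * rad N K y\<bar> \<le> (\<alpha> + \<beta>) * E + (\<alpha> + \<beta>) * E / \<bar>rad N K 1\<bar> * B"
          using w(2)[OF y] by linarith
        also have "\<dots> = C1 * (\<alpha> + \<beta>)" by (simp add: C1_def algebra_simps)
        finally show ?thesis .
      qed
      then show ?thesis using radial_sol_add_rad[OF N w(1) f, of c] nz
        by (intro exI[of _ "\<lambda>y. w y + c * rad N K y"]) (simp add: c_def)
    next
      case True
      note r1 = nz'[OF True]
      define b where "b y = y * ravg N (\<lambda>s. K * w s + f s) y" for y
      define g where "g s = s ^ (N - 1) * (rad N K s * f s - rad' N K s * a s)" for s
      \<comment> \<open>The weighted Wronskian: its increment over \<open>[0, 1]\<close> is the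
        orthogonality integral, it vanishes at \<open>0\<close>, and at \<open>1\<close> it reduces
        to \<open>- rad' N K 1 * w 1\<close>.\<close>
      define X where "X y = y ^ (N - 1) * (rad N K y * b y - rad' N K y * w y)" for y
      have wc: "continuous_on {0..1} w" using w(1) by (simp add: radial_sol_def)
      have bc: "continuous_on {0..1} b" unfolding b_def by (intro continuous_intros ravg_continuous wc f)
      have "(g has_integral X 1 - X 0) {0..1}"
      proof (rule fundamental_theorem_of_calculus_interior)
        show "continuous_on {0..1} X" unfolding X_def by (intro continuous_intros bc wc N)
        show "(X has_vector_derivative g x) (at x)" if "x \<in> {0<..<1}" for x
          using radial_sol_wronskian(1)[OF N w(1) a f, of x] that
          by (simp add: X_def[abs_def] g_def b_def flip: has_real_derivative_iff_has_vector_derivative)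
      qed simp
      then have "integral {0..1} g = X 1 - X 0" by (rule integral_unique)
      moreover have "integral {0..1} g = 0" using orth True by (simp add: g_def[abs_def])
      ultimately have "X 1 - X 0 = 0" by simp
      moreover have "X 0 = 0" by (simp add: X_def b_def)
      ultimately have "X 1 = 0" by simp
      moreover have "X 1 = - rad' N K 1 * w 1" using r1 by (simp add: X_def)
      ultimately have "w 1 = 0" using r1 by simp
      moreover have "(\<alpha> + \<beta>) * E \<le> C1 * (\<alpha> + \<beta>)"
        using C1 \<alpha> \<beta> by (simp add: mult.commute mult_right_mono)
      then have "\<forall>y\<in>{0..1}. \<bar>w y\<bar> \<le> C1 * (\<alpha> + \<beta>)" using w(2) by (meson order_trans)
      ultimately show ?thesis using w(1) by blast
    qed
    then obtain v where v: "radial_sol N K a f v" "v 1 = 0" "\<And>y. y \<in> {0..1} \<Longrightarrow> \<bar>v y\<bar> \<le> C1 * (\<alpha> + \<beta>)" by blast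
    have vc: "continuous_on {0..1} v" using v(1) by (simp add: radial_sol_def)
    have "\<bar>v y\<bar> \<le> C * (\<alpha> + \<beta>) \<and> \<bar>y * ravg N (\<lambda>s. K * v s + f s) y\<bar> \<le> C * (\<alpha> + \<beta>)" if y: "y \<in> {0..1}" for y
    proof
      have "C1 * (\<alpha> + \<beta>) \<le> C * (\<alpha> + \<beta>)" using C \<alpha> \<beta> by (intro mult_right_mono) auto
      then show "\<bar>v y\<bar> \<le> C * (\<alpha> + \<beta>)" using v(3)[OF y] by linarith
      have "\<bar>ravg N (\<lambda>s. K * v s + f s) y\<bar> \<le> (\<bar>K\<bar> * C1 + 1) * (\<alpha> + \<beta>)"
      proof (rule ravg_bound[OF _ y])
        show "continuous_on {0..1} (\<lambda>s. K * v s + f s)" by (intro continuous_intros vc f)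
        fix s assume "s \<in> {0..y}"
        then have s: "s \<in> {0..1}" using y by auto
        have "\<bar>K * v s\<bar> \<le> \<bar>K\<bar> * (C1 * (\<alpha> + \<beta>))" unfolding abs_mult using v(3)[OF s] by (intro mult_left_mono) auto
        moreover have "\<bar>f s\<bar> \<le> \<alpha> + \<beta>" using fb s \<alpha> by force
        ultimately have "\<bar>K * v s + f s\<bar> \<le> \<bar>K\<bar> * (C1 * (\<alpha> + \<beta>)) + (\<alpha> + \<beta>)" by linarith
        also have "\<dots> = (\<bar>K\<bar> * C1 + 1) * (\<alpha> + \<beta>)" by (simp add: algebra_simps)
        finally show "\<bar>K * v s + f s\<bar> \<le> (\<bar>K\<bar> * C1 + 1) * (\<alpha> + \<beta>)" .
      qed
      also have "\<dots> \<le> C * (\<alpha> + \<beta>)" using C \<alpha> \<beta> by (intro mult_right_mono) auto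
      finally have "\<bar>y\<bar> * \<bar>ravg N (\<lambda>s. K * v s + f s) y\<bar> \<le> 1 * (C * (\<alpha> + \<beta>))"
        using y by (intro mult_mono) auto
      then show "\<bar>y * ravg N (\<lambda>s. K * v s + f s) y\<bar> \<le> C * (\<alpha> + \<beta>)" by (simp add: abs_mult)
    qed
    then show "\<exists>v. radial_sol N K a f v \<and> v 1 = 0 \<and> (\<forall>y\<in>{0..1}. \<bar>v y\<bar> \<le> C * (\<alpha> + \<beta>) \<and>
        \<bar>y * ravg N (\<lambda>s. K * v s + f s) y\<bar> \<le> C * (\<alpha> + \<beta>))" using v by blast
  qed
qed

text \<open>\<open>l1\<close> is the first Dirichlet eigenvalue and \<open>Lam\<close> a nonconstant radial Neumann eigenvalue of the unit ball.\<close>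

locale schiffer =
  fixes N :: nat and l1 Lam :: real
  assumes N: "N \<ge> 1" and l1: "l1 > 0" "bes N (- l1) = 0" "\<And>x. 0 \<le> x \<Longrightarrow> x < l1 \<Longrightarrow> bes N (- x) > 0"
    and Lam: "Lam > 0" "bes1 N (- Lam) = 0"
begin

definition "M0 = Lam - l1"
definition "Kk k = M0 * (real k)\<^sup>2 - Lam"
definition "U y = rad N (- Lam) y / bes N (- Lam)"
definition "U' y = rad' N (- Lam) y / bes N (- Lam)"
definition "U'' y = rad'' N (- Lam) y / bes N (- Lam)"

lemma M0: "M0 > 0"
  unfolding M0_def using first_bes_zero_less[OF N l1(1,3) Lam] by simp

lemma bes_Lam: "bes N (- Lam) \<noteq> 0"
  using rad_nontrivial[OF N, of "- Lam" 1] Lam by (simp add: rad_def rad'_def)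

lemma bes1_l1: "bes1 N (- l1) \<noteq> 0"
  using rad_nontrivial[OF N, of "- l1" 1] l1 by (simp add: rad_def rad'_def)

lemma U_1 [simp]: "U 1 = 1" "U' 1 = 0" "U' 0 = 0"
  using bes_Lam Lam by (simp_all add: U_def U'_def rad_def rad'_def)

lemma U_ode: "y * U'' y = - (real N - 1) * U' y - Lam * y * U y"
proof -
  have e: "y * rad'' N (- Lam) y = - (real N - 1) * rad' N (- Lam) y - Lam * y * rad N (- Lam) y"
    using rad_ode[OF N, of y "- Lam"] by (simp add: algebra_simps)
  have "y * U'' y = (y * rad'' N (- Lam) y) / bes N (- Lam)" by (simp add: U''_def)
  then show ?thesis unfolding e by (simp add: U_def U'_def diff_divide_distrib)
qed

lemma U''_1 [simp]: "U'' 1 = - Lam"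
  using U_ode[of 1] by simp

text \<open>The third part differentiates \<open>y * U'' y\<close> after rewriting it by the
  differential equation; this avoids a third derivative of \<open>U\<close> and a division by
  \<open>y\<close>.\<close>

lemma DERIV_U: "(U has_real_derivative U' y) (at y within S)" "(U' has_real_derivative U'' y) (at y within S)"
    "((\<lambda>y. y * U'' y) has_real_derivative - (real N - 1) * U'' y - Lam * (U y + y * U' y)) (at y within S)"
proof -
  show 1: "(U has_real_derivative U' y) (at y within S)" for y
    unfolding U_def[abs_def] U'_def by (intro DERIV_cdivide DERIV_rad N)
  show 2: "(U' has_real_derivative U'' y) (at y within S)" for y
    unfolding U'_def[abs_def] U''_def by (intro DERIV_cdivide DERIV_rad' N)
  show "((\<lambda>y. y * U'' y) has_real_derivative - (real N - 1) * U'' y - Lam * (U y + y * U' y)) (at y within S)"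
    unfolding U_ode by (auto intro!: derivative_eq_intros 1 2 simp: algebra_simps)
qed

lemma continuous_U: "continuous_on S U" "continuous_on S U'" "continuous_on S U''"
  unfolding U_def[abs_def] U'_def[abs_def] U''_def[abs_def]
  using bes_Lam by (auto intro!: continuous_intros N)

text \<open>One constant for all frequencies. Relative to \<open>f\<close> the solution gains two
  powers of the frequency and \<open>b = v' - a\<close> gains one; relative to \<open>a\<close> it
  is one power less in each case. These are the weights needed to close the estimates with first
  derivatives in \<open>x\<close>.\<close>

definition linear_bound :: "real \<Rightarrow> bool" where
  "linear_bound C \<longleftrightarrow> (\<forall>k a f \<alpha> \<beta>. continuous_on {0..1} a \<longrightarrow> continuous_on {0..1} f \<longrightarrow>
     (\<forall>y\<in>{0..1}. \<bar>a y\<bar> \<le> \<alpha>) \<longrightarrow> (\<forall>y\<in>{0..1}. \<bar>f y\<bar> \<le> \<beta>) \<longrightarrow>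
     (k = 1 \<longrightarrow> integral {0..1} (\<lambda>s. s ^ (N - 1) * (rad N (- l1) s * f s - rad' N (- l1) s * a s)) = 0) \<longrightarrow>
     (\<exists>v. radial_sol N (Kk k) a f v \<and> v 1 = 0 \<and> (\<forall>y\<in>{0..1}. (1 + real k)\<^sup>2 * \<bar>v y\<bar> \<le> C * ((1 + real k) * \<alpha> + \<beta>) \<and>
        (1 + real k) * \<bar>y * ravg N (\<lambda>s. Kk k * v s + f s) y\<bar> \<le> C * ((1 + real k) * \<alpha> + \<beta>))))"

text \<open>From some \<open>k0\<close> on \<open>Kk k\<close> is comparable to the square of
  \<open>k\<close>, and \<open>radial_sol_bound\<close> with \<open>\<kappa> = sqrt (Kk k)\<close>
  yields the weights. The finitely many smaller frequencies have individual constants from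
  \<open>radial_sol_exists_bounded\<close>.\<close>

lemma linear_estimate: "\<exists>C\<ge>1. linear_bound C"
proof -
  have K0: "Kk 0 = - Lam" and K1: "Kk 1 = - l1" by (simp_all add: Kk_def M0_def)
  \<comment> \<open>For \<open>k \<ge> 2\<close> the value \<open>Kk k\<close> lies above
    \<open>- l1\<close>, minus the first zero. For \<open>k = 0\<close> it is \<open>- Lam\<close>,
    where the derivative vanishes and hence the function does not.\<close>
  have nz: "k = 1 \<or> rad N (Kk k) 1 \<noteq> 0" for k
  proof (cases "k = 0 \<or> k = 1")
    case True
    then show ?thesis using bes_Lam K0 by (auto simp: rad_def)
  next
    case False
    then have "(real k)\<^sup>2 > 1" by (simp add: one_less_power)
    then have "M0 * (real k)\<^sup>2 > M0 * 1" using M0 by (intro mult_strict_left_mono)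
    then have K: "Kk k > - l1" by (simp add: Kk_def M0_def)
    have "bes N (Kk k) > 0"
    proof (cases "Kk k \<ge> 0")
      case True
      then show ?thesis using bes_ge_1(1)[OF N True] by simp
    next
      case False
      then show ?thesis using l1(3)[of "- Kk k"] K by simp
    qed
    then show ?thesis by (simp add: rad_def)
  qed
  have nz': "rad N (Kk k) 1 = 0 \<and> rad' N (Kk k) 1 \<noteq> 0" if "k = 1" for k
    unfolding that K1 using l1 bes1_l1 by (simp add: rad_def rad'_def)
  define P where "P k C \<longleftrightarrow> (\<forall>a f \<alpha> \<beta>. continuous_on {0..1} a \<longrightarrow> continuous_on {0..1} f \<longrightarrow>
     (\<forall>y\<in>{0..1}. \<bar>a y\<bar> \<le> \<alpha>) \<longrightarrow> (\<forall>y\<in>{0..1}. \<bar>f y\<bar> \<le> \<beta>) \<longrightarrow>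
     (k = 1 \<longrightarrow> integral {0..1} (\<lambda>s. s ^ (N - 1) * (rad N (Kk k) s * f s - rad' N (Kk k) s * a s)) = 0) \<longrightarrow>
     (\<exists>v. radial_sol N (Kk k) a f v \<and> v 1 = 0 \<and> (\<forall>y\<in>{0..1}. \<bar>v y\<bar> \<le> C * (\<alpha> + \<beta>) \<and>
        \<bar>y * ravg N (\<lambda>s. Kk k * v s + f s) y\<bar> \<le> C * (\<alpha> + \<beta>))))" for k C
  have "\<exists>C\<ge>0. P k C" for k
    unfolding P_def using radial_sol_exists_bounded[OF N, of "k = 1" "Kk k", OF nz nz'] .
  then obtain c where c: "\<And>k. c k \<ge> 0" "\<And>k. P k (c k)" by metis
  \<comment> \<open>For large \<open>k\<close> half of \<open>M0 k^2\<close> absorbs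
    \<open>Lam\<close>, and \<open>(1 + k)^2 \<le> 4 k^2\<close>; together \<open>Kk k\<close> is at
    least \<open>M0 / 8\<close> times \<open>(1 + k)^2\<close>.\<close>
  define d where "d = sqrt (M0 / 8)"
  have d: "d > 0" "d\<^sup>2 = M0 / 8" using M0 by (auto simp: d_def)
  obtain k0 :: nat where k0: "real k0 > max 1 (2 * (Lam + 1) / M0)" using reals_Archimedean2 by blast
  have big: "Kk k \<ge> 1 \<and> Kk k \<ge> d\<^sup>2 * (1 + real k)\<^sup>2" if "k \<ge> k0" for k
  proof
    have k: "real k \<ge> 1" "real k > 2 * (Lam + 1) / M0" using k0 that by auto
    have "2 * (Lam + 1) < M0 * real k" using k(2) M0 by (simp add: field_simps)
    also have "\<dots> \<le> M0 * (real k)\<^sup>2" using k(1) M0 by (intro mult_left_mono) (auto simp: power2_eq_square mult_le_cancel_left1)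
    finally have *: "Lam + 1 < M0 * (real k)\<^sup>2 / 2" by simp
    moreover have "M0 * (real k)\<^sup>2 \<ge> 0" using M0 by simp
    ultimately show "Kk k \<ge> 1" unfolding Kk_def by linarith
    have "(1 + real k)\<^sup>2 \<le> (2 * real k)\<^sup>2" using k(1) by (intro power_mono) auto
    then have "M0 / 8 * (1 + real k)\<^sup>2 \<le> M0 / 8 * (2 * real k)\<^sup>2" using M0 by (intro mult_left_mono) auto
    also have "\<dots> = M0 * (real k)\<^sup>2 / 2" by (simp add: power2_eq_square)
    finally show "Kk k \<ge> d\<^sup>2 * (1 + real k)\<^sup>2" using * by (simp add: Kk_def d)
  qed
  define C1 where "C1 = (2 * real N + 5) * (1 / d + 1 / d\<^sup>2 + 1)"
  define C where "C = 1 + C1 + (\<Sum>k<k0. c k * (1 + real k)\<^sup>2)"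
  have C1: "C1 \<ge> 0" using d by (simp add: C1_def)
  have s0: "(\<Sum>k<k0. c k * (1 + real k)\<^sup>2) \<ge> 0" using c(1) by (intro sum_nonneg) auto
  show ?thesis
  unfolding linear_bound_def
  proof (intro exI[of _ C] conjI allI impI)
    show "C \<ge> 1" using C1 s0 by (simp add: C_def)
    fix k :: nat and a f :: "real \<Rightarrow> real" and \<alpha> \<beta> :: real
    assume a: "continuous_on {0..1} a" and f: "continuous_on {0..1} f"
      and ab: "\<forall>y\<in>{0..1}. \<bar>a y\<bar> \<le> \<alpha>" and fb: "\<forall>y\<in>{0..1}. \<bar>f y\<bar> \<le> \<beta>"
      and orth: "k = 1 \<longrightarrow> integral {0..1} (\<lambda>s. s ^ (N - 1) * (rad N (- l1) s * f s - rad' N (- l1) s * a s)) = 0"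
    have \<alpha>: "\<alpha> \<ge> 0" and \<beta>: "\<beta> \<ge> 0"
      using order_trans[OF abs_ge_zero bspec[OF ab, of 0]] order_trans[OF abs_ge_zero bspec[OF fb, of 0]] by simp_all
    have orth': "k = 1 \<longrightarrow> integral {0..1} (\<lambda>s. s ^ (N - 1) * (rad N (Kk k) s * f s - rad' N (Kk k) s * a s)) = 0"
      using orth K1 by auto
    obtain v where v: "radial_sol N (Kk k) a f v" "v 1 = 0"
      "\<And>y. y \<in> {0..1} \<Longrightarrow> \<bar>v y\<bar> \<le> c k * (\<alpha> + \<beta>)"
      "\<And>y. y \<in> {0..1} \<Longrightarrow> \<bar>y * ravg N (\<lambda>s. Kk k * v s + f s) y\<bar> \<le> c k * (\<alpha> + \<beta>)"
      using c(2)[of k, unfolded P_def, THEN spec[of _ a], THEN spec[of _ f], THEN spec[of _ \<alpha>], THEN spec[of _ \<beta>],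
        THEN mp, OF a, THEN mp, OF f, THEN mp, OF ab, THEN mp, OF fb, THEN mp, OF orth'] by blast
    show "\<exists>v. radial_sol N (Kk k) a f v \<and> v 1 = 0 \<and> (\<forall>y\<in>{0..1}. (1 + real k)\<^sup>2 * \<bar>v y\<bar> \<le> C * ((1 + real k) * \<alpha> + \<beta>) \<and>
        (1 + real k) * \<bar>y * ravg N (\<lambda>s. Kk k * v s + f s) y\<bar> \<le> C * ((1 + real k) * \<alpha> + \<beta>))"
    proof (intro exI[of _ v] conjI ballI v(1,2))
      fix y :: real assume y: "y \<in> {0..1}"
      let ?b = "y * ravg N (\<lambda>s. Kk k * v s + f s) y"
      have k1: "1 + real k \<ge> 1" by simp
      have ab1: "\<alpha> + \<beta> \<le> (1 + real k) * \<alpha> + \<beta>" using \<alpha> by (simp add: distrib_right)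
      have "(1 + real k)\<^sup>2 * \<bar>v y\<bar> \<le> C * ((1 + real k) * \<alpha> + \<beta>) \<and> (1 + real k) * \<bar>?b\<bar> \<le> C * ((1 + real k) * \<alpha> + \<beta>)"
      proof (cases "k < k0")
        case True
        then have "c k * (1 + real k)\<^sup>2 \<le> (\<Sum>k<k0. c k * (1 + real k)\<^sup>2)"
          using c(1) by (intro member_le_sum) auto
        then have cC: "c k * (1 + real k)\<^sup>2 \<le> C" using C1 by (simp add: C_def)
        have *: "(1 + real k)\<^sup>2 * (c k * (\<alpha> + \<beta>)) \<le> C * ((1 + real k) * \<alpha> + \<beta>)"
          using mult_mono[OF cC ab1] \<alpha> \<beta> c(1)[of k] C1 s0 by (simp add: C_def mult_ac)
        have "(1 + real k)\<^sup>2 * \<bar>v y\<bar> \<le> (1 + real k)\<^sup>2 * (c k * (\<alpha> + \<beta>))" using v(3)[OF y] by (intro mult_left_mono) auto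
        moreover have "(1 + real k) * \<bar>?b\<bar> \<le> (1 + real k)\<^sup>2 * (c k * (\<alpha> + \<beta>))"
          using v(4)[OF y] k1 by (intro mult_mono) (auto simp: power2_eq_square mult_le_cancel_left1)
        ultimately show ?thesis using * by linarith
      next
        case False
        define \<kappa> where "\<kappa> = sqrt (Kk k)"
        have big': "Kk k \<ge> 1" "Kk k \<ge> (d * (1 + real k))\<^sup>2" using big[of k] False by (auto simp: power_mult_distrib)
        have \<kappa>: "\<kappa> \<ge> 1" "\<kappa>\<^sup>2 = Kk k" using big' by (auto simp: \<kappa>_def)
        have "sqrt ((d * (1 + real k))\<^sup>2) \<le> \<kappa>" unfolding \<kappa>_def using big'(2) by (rule real_sqrt_le_mono)
        then have \<kappa>d: "d * (1 + real k) \<le> \<kappa>" using d by simp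
        have dk: "d * (1 + real k) > 0" using d by simp
        note bd = radial_sol_bound[OF N \<kappa>(1), where v=v and a=a and f=f and \<alpha>=\<alpha> and \<beta>=\<beta> and y=y, unfolded \<kappa>(2)]
        have bv: "\<bar>v y\<bar> \<le> (2 * real N + 4) * (\<alpha> / \<kappa> + \<beta> / Kk k)"
          and bb: "\<bar>?b\<bar> \<le> (2 * real N + 5) * (\<alpha> + \<beta> / \<kappa>)" using bd v(1,2) a f ab fb y by blast+
        have i1: "(1 + real k) * (\<alpha> / \<kappa>) \<le> \<alpha> / d"
        proof -
          have "\<alpha> / \<kappa> \<le> \<alpha> / (d * (1 + real k))" using \<kappa>d dk \<alpha> by (intro divide_left_mono) auto
          then have "(1 + real k) * (\<alpha> / \<kappa>) \<le> (1 + real k) * (\<alpha> / (d * (1 + real k)))" by (intro mult_left_mono) auto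
          then show ?thesis by simp
        qed
        have i2: "(1 + real k) * (\<beta> / \<kappa>) \<le> \<beta> / d"
        proof -
          have "\<beta> / \<kappa> \<le> \<beta> / (d * (1 + real k))" using \<kappa>d dk \<beta> by (intro divide_left_mono) auto
          then have "(1 + real k) * (\<beta> / \<kappa>) \<le> (1 + real k) * (\<beta> / (d * (1 + real k)))" by (intro mult_left_mono) auto
          then show ?thesis by simp
        qed
        have i3: "(1 + real k)\<^sup>2 * (\<beta> / Kk k) \<le> \<beta> / d\<^sup>2"
        proof -
          have "\<beta> / Kk k \<le> \<beta> / (d * (1 + real k))\<^sup>2" using big' dk \<beta> d by (intro divide_left_mono) auto
          then have "(1 + real k)\<^sup>2 * (\<beta> / Kk k) \<le> (1 + real k)\<^sup>2 * (\<beta> / (d * (1 + real k))\<^sup>2)" by (intro mult_left_mono) auto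
          then show ?thesis using d(1) by (simp add: power_mult_distrib)
        qed
        define Q where "Q = (1 + real k) * \<alpha> + \<beta>"
        have Q: "(1 + real k) * \<alpha> \<le> Q" "\<beta> \<le> Q" "Q \<ge> 0" using \<alpha> \<beta> by (auto simp: Q_def)
        have C1Q: "(2 * real N + 5) * (Q / d + Q / d\<^sup>2 + Q) \<le> C * Q"
        proof -
          have "(2 * real N + 5) * (Q / d + Q / d\<^sup>2 + Q) = C1 * Q" by (simp add: C1_def algebra_simps)
          also have "\<dots> \<le> C * Q" using s0 Q by (intro mult_right_mono) (auto simp: C_def)
          finally show ?thesis .
        qed
        have "(1 + real k)\<^sup>2 * \<bar>v y\<bar> \<le> (1 + real k)\<^sup>2 * ((2 * real N + 4) * (\<alpha> / \<kappa> + \<beta> / Kk k))"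
          using bv by (intro mult_left_mono) auto
        also have "\<dots> = (2 * real N + 4) * ((1 + real k) * ((1 + real k) * (\<alpha> / \<kappa>)) + (1 + real k)\<^sup>2 * (\<beta> / Kk k))"
        proof -
          have "(1 + real k)\<^sup>2 * ((2 * real N + 4) * (x + z)) = (2 * real N + 4) * ((1 + real k) * ((1 + real k) * x) + (1 + real k)\<^sup>2 * z)" for x z
            by (simp add: power2_eq_square algebra_simps)
          then show ?thesis .
        qed
        also have "\<dots> \<le> (2 * real N + 5) * (Q / d + Q / d\<^sup>2 + Q)"
        proof (rule mult_mono)
          have "(1 + real k) * ((1 + real k) * (\<alpha> / \<kappa>)) \<le> (1 + real k) * (\<alpha> / d)" using i1 by (intro mult_left_mono) auto
          also have "\<dots> = ((1 + real k) * \<alpha>) / d" by simp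
          also have "\<dots> \<le> Q / d" using Q d by (intro divide_right_mono) auto
          finally have "(1 + real k) * ((1 + real k) * (\<alpha> / \<kappa>)) \<le> Q / d" .
          moreover have "\<beta> / d\<^sup>2 \<le> Q / d\<^sup>2" using Q by (intro divide_right_mono) auto
          ultimately show "(1 + real k) * ((1 + real k) * (\<alpha> / \<kappa>)) + (1 + real k)\<^sup>2 * (\<beta> / Kk k) \<le> Q / d + Q / d\<^sup>2 + Q"
            using i3 Q(3) by linarith
          show "0 \<le> (1 + real k) * ((1 + real k) * (\<alpha> / \<kappa>)) + (1 + real k)\<^sup>2 * (\<beta> / Kk k)"
            using \<alpha> \<beta> \<kappa> big' by (intro add_nonneg_nonneg mult_nonneg_nonneg divide_nonneg_nonneg) auto
        qed auto
        finally have 1: "(1 + real k)\<^sup>2 * \<bar>v y\<bar> \<le> C * Q" using C1Q by linarith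
        have "(1 + real k) * \<bar>?b\<bar> \<le> (1 + real k) * ((2 * real N + 5) * (\<alpha> + \<beta> / \<kappa>))"
          using bb by (intro mult_left_mono) auto
        also have "\<dots> = (2 * real N + 5) * ((1 + real k) * \<alpha> + (1 + real k) * (\<beta> / \<kappa>))"
        proof -
          have "(1 + real k) * ((2 * real N + 5) * (x + z)) = (2 * real N + 5) * ((1 + real k) * x + (1 + real k) * z)" for x z
            by (simp add: algebra_simps)
          then show ?thesis .
        qed
        also have "\<dots> \<le> (2 * real N + 5) * (Q / d + Q / d\<^sup>2 + Q)"
        proof (rule mult_left_mono)
          have "\<beta> / d \<le> Q / d" using Q d by (intro divide_right_mono) auto
          moreover have "Q / d\<^sup>2 \<ge> 0" using Q by simp
          ultimately show "(1 + real k) * \<alpha> + (1 + real k) * (\<beta> / \<kappa>) \<le> Q / d + Q / d\<^sup>2 + Q"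
            using i2 Q(1) by linarith
        qed auto
        finally have 2: "(1 + real k) * \<bar>?b\<bar> \<le> C * Q" using C1Q by linarith
        show ?thesis using 1 2 by (simp add: Q_def)
      qed
      then show "(1 + real k)\<^sup>2 * \<bar>v y\<bar> \<le> C * ((1 + real k) * \<alpha> + \<beta>)" "(1 + real k) * \<bar>?b\<bar> \<le> C * ((1 + real k) * \<alpha> + \<beta>)"
        by blast+
    qed
  qed
qed

end

context schiffer
begin

section \<open>The formal expansion\<close>

text \<open>
  The frequency \<open>k\<close> part of the flattened system at one order; \<open>A\<close>, \<open>C\<close>, \<open>D\<close>, \<open>S\<close> collect the products of
  lower orders, and \<open>B\<close> is a bound that carries the weights \<open>k\<close> of the derivatives in \<open>x\<close>.
\<close>

definition mode_eqs :: "nat \<Rightarrow> (real \<Rightarrow> real) \<Rightarrow> (real \<Rightarrow> real) \<Rightarrow> (real \<Rightarrow> real) \<Rightarrow> (real \<Rightarrow> real) \<Rightarrow>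
    real \<Rightarrow> (real \<Rightarrow> real) \<Rightarrow> (real \<Rightarrow> real) \<Rightarrow> (real \<Rightarrow> real) \<Rightarrow> (real \<Rightarrow> real) \<Rightarrow> (real \<Rightarrow> real) \<Rightarrow> (real \<Rightarrow> real) \<Rightarrow> real \<Rightarrow> bool" where
  "mode_eqs k A C D S \<gamma> p p' v v' u u' B \<longleftrightarrow>
     continuous_on {0..1} p' \<and> continuous_on {0..1} v' \<and> continuous_on {0..1} u' \<and>
     p 0 = 0 \<and> v' 0 = 0 \<and> p 1 = 0 \<and> v 1 = 0 \<and> u 1 = 0 \<and>
     (\<forall>y\<in>{0..1}.
        (p has_real_derivative p' y) (at y within {0..1}) \<and>
        (v has_real_derivative v' y) (at y within {0..1}) \<and>
        (u has_real_derivative u' y) (at y within {0..1}) \<and>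
        u' y = p y + \<gamma> * U' y + C y \<and>
        k * u y = k * v y + y * k * \<gamma> * U' y + D y \<and>
        k * v' y = k * p y - y * k * \<gamma> * U'' y + A y \<and>
        y * p' y + (real N - 1) * p y + y * Lam * (u y + \<gamma> * U y) - y * M0 * (real k)\<^sup>2 * v y + y * S y = 0 \<and>
        (1 + real k) * \<bar>p y\<bar> \<le> B \<and> \<bar>p' y\<bar> \<le> B \<and> (1 + real k)\<^sup>2 * \<bar>v y\<bar> \<le> B \<and>
        (1 + real k) * \<bar>v' y\<bar> \<le> B \<and> (1 + real k) * \<bar>u y\<bar> \<le> B \<and> \<bar>u' y\<bar> \<le> B) \<and>
     (1 + real k) * \<bar>\<gamma>\<bar> \<le> B"

lemma U_bound: obtains B where "B \<ge> 1" "\<And>y. y \<in> {0..1} \<Longrightarrow> \<bar>U y\<bar> \<le> B" "\<And>y. y \<in> {0..1} \<Longrightarrow> \<bar>U' y\<bar> \<le> B"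
  "\<And>y. y \<in> {0..1} \<Longrightarrow> \<bar>U'' y\<bar> \<le> B"
proof -
  obtain a b c where "\<forall>y\<in>{0..1}. \<bar>U y\<bar> \<le> a" "\<forall>y\<in>{0..1}. \<bar>U' y\<bar> \<le> b" "\<forall>y\<in>{0..1}. \<bar>U'' y\<bar> \<le> c"
    using continuous_unit_interval_bound continuous_U by metis
  then show thesis by (intro that[of "max 1 (max a (max b c))"]) (auto simp: le_max_iff_disj)
qed

text \<open>The condition \<open>D' = k C - A\<close> is the compatibility of the sources:
  differentiating the algebraic relation between \<open>u\<close> and \<open>v\<close> then
  reproduces the differential equations for \<open>u\<close> and \<open>v\<close>. For
  \<open>k = 0\<close> the relations containing \<open>A\<close> and \<open>D\<close> reduce to
  \<open>D = 0\<close> and \<open>A = 0\<close>.\<close>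

definition mode_bound :: "real \<Rightarrow> bool" where
  "mode_bound C0 \<longleftrightarrow> (\<forall>k A C D S q. continuous_on {0..1} A \<longrightarrow> continuous_on {0..1} C \<longrightarrow> continuous_on {0..1} S \<longrightarrow>
     (\<forall>y\<in>{0..1}. (D has_real_derivative real k * C y - A y) (at y within {0..1})) \<longrightarrow> D 1 = 0 \<longrightarrow> A 0 = 0 \<longrightarrow> C 0 = 0 \<longrightarrow>
     (k = 0 \<longrightarrow> (\<forall>y\<in>{0..1}. A y = 0 \<and> D y = 0)) \<longrightarrow>
     (\<forall>y\<in>{0..1}. \<bar>A y\<bar> \<le> q \<and> \<bar>C y\<bar> \<le> q \<and> \<bar>D y\<bar> \<le> q \<and> \<bar>S y\<bar> \<le> q) \<longrightarrow>
     (k = 1 \<longrightarrow> integral {0..1} (\<lambda>s. s ^ (N - 1) * (rad N (- l1) s * (S s + Lam * D s) + rad' N (- l1) s * A s)) = 0) \<longrightarrow>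
     (\<exists>\<gamma> p p' v v' u u'. mode_eqs k A C D S \<gamma> p p' v v' u u' (C0 * q) \<and> (k = 0 \<longrightarrow> v = (\<lambda>_. 0) \<and> v' = (\<lambda>_. 0))))"

text \<open>
  In the unknown \<open>b = p - y \<gamma> U''\<close> the boundary coefficient \<open>\<gamma>\<close> drops out and \<open>v\<close> solves a radial equation; then
  \<open>\<gamma>\<close> is read off from \<open>p 1 = 0\<close>, because \<open>U'' 1 = - Lam\<close>.
\<close>

lemma mode_solve: "\<exists>C0\<ge>1. mode_bound C0"
proof -
  obtain C1 where C1: "C1 \<ge> 1" and lin: "linear_bound C1"
    using linear_estimate by blast
  obtain BU where BU: "BU \<ge> 1" "\<And>y. y \<in> {0..1} \<Longrightarrow> \<bar>U y\<bar> \<le> BU" "\<And>y. y \<in> {0..1} \<Longrightarrow> \<bar>U' y\<bar> \<le> BU"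
    "\<And>y. y \<in> {0..1} \<Longrightarrow> \<bar>U'' y\<bar> \<le> BU" using U_bound by blast
  define C2 where "C2 = C1 * (3 + Lam)"
  define C3 where "C3 = C2 / Lam"
  define C4 where "C4 = C2 + C3 * BU"
  define C5 where "C5 = (M0 + Lam) * C2 + 1 + Lam"
  define C6 where "C6 = real N * C5 + C3 * (real N * BU + Lam * (2 * BU))"
  define C0 where "C0 = C2 + C3 + C4 + C5 + C6 + (C2 + 2 + C3 * BU) + (C4 + C3 * BU + 1) + 2"
  have pos: "Lam > 0" "M0 > 0" using Lam M0 by auto
  have C2: "C2 \<ge> 1" using C1 pos mult_mono[of 1 C1 1 "3 + Lam"] by (simp add: C2_def)
  have C3: "C3 \<ge> 0" using C2 pos by (simp add: C3_def)
  have C4: "C4 \<ge> 1" using C2 C3 BU by (simp add: C4_def add_increasing2)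
  have C5: "C5 \<ge> 1" using C2 pos by (simp add: C5_def)
  have C6: "C6 \<ge> 0" using C5 C3 BU pos by (auto simp: C6_def intro!: add_nonneg_nonneg mult_nonneg_nonneg)
  have CU: "C3 * BU \<ge> 0" using C3 BU by simp
  show ?thesis
    unfolding mode_bound_def
  proof (rule exI[of _ C0], intro conjI allI impI)
    show "C0 \<ge> 1" unfolding C0_def using C2 C3 C4 C5 C6 CU by linarith
    fix k :: nat and A C D S :: "real \<Rightarrow> real" and q :: real
    assume A: "continuous_on {0..1} A" and C: "continuous_on {0..1} C" and S: "continuous_on {0..1} S"
      and D': "\<forall>y\<in>{0..1}. (D has_real_derivative real k * C y - A y) (at y within {0..1})"
      and D1: "D 1 = 0" and A0: "A 0 = 0" and C0': "C 0 = 0"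
      and k0: "k = 0 \<longrightarrow> (\<forall>y\<in>{0..1}. A y = 0 \<and> D y = 0)"
      and q: "\<forall>y\<in>{0..1}. \<bar>A y\<bar> \<le> q \<and> \<bar>C y\<bar> \<le> q \<and> \<bar>D y\<bar> \<le> q \<and> \<bar>S y\<bar> \<le> q"
      and orth: "k = 1 \<longrightarrow> integral {0..1} (\<lambda>s. s ^ (N - 1) * (rad N (- l1) s * (S s + Lam * D s) + rad' N (- l1) s * A s)) = 0"
    have q0: "q \<ge> 0" using bspec[OF q, of 0] by auto
    \<comment> \<open>For \<open>k \<noteq> 0\<close> the relations are divided by \<open>k\<close>.
      For \<open>k = 0\<close> those for \<open>v\<close> are void; there an auxiliary
      \<open>v\<close> is introduced by \<open>u = v + \<gamma> y U'\<close>, and \<open>C\<close>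
      takes over the role of \<open>a\<close>.\<close>
    define a where "a y = (if k = 0 then C y else A y / real k)" for y
    define E where "E y = (if k = 0 then 0 else D y / real k)" for y
    define f where "f y = - S y - Lam * E y" for y
    have kE: "real k * E y = D y" if "y \<in> {0..1}" for y using k0 that by (simp add: E_def)
    have E': "(E has_real_derivative C y - a y) (at y within {0..1})" if y: "y \<in> {0..1}" for y
    proof (cases "k = 0")
      case True
      then show ?thesis by (simp add: E_def[abs_def] a_def)
    next
      case False
      then show ?thesis
        using DERIV_cdivide[OF bspec[OF D' y], of "real k"] by (simp add: E_def[abs_def] a_def diff_divide_distrib)
    qed
    have ac: "continuous_on {0..1} a"
      unfolding a_def by (cases "k = 0") (auto intro!: continuous_intros A C)
    have Ec: "continuous_on {0..1} E" using E' by (rule DERIV_continuous_on)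
    have fc: "continuous_on {0..1} f" unfolding f_def by (intro continuous_intros S Ec)
    have ab: "\<bar>a y\<bar> \<le> 2 * q / (1 + real k)" if y: "y \<in> {0..1}" for y
    proof (cases "k = 0")
      case True
      have "\<bar>C y\<bar> \<le> q" using q y by blast
      then show ?thesis using True q0 by (simp add: a_def)
    next
      case False
      have "\<bar>A y / real k\<bar> \<le> q / real k" using bspec[OF q y] False by (simp add: abs_divide divide_right_mono)
      also have "q / real k \<le> 2 * q / (1 + real k)"
      proof -
        have "q * 1 \<le> q * real k" using q0 False by (intro mult_left_mono) auto
        then show ?thesis using False by (simp add: field_simps)
      qed
      finally show ?thesis using False by (simp add: a_def)
    qed
    have Eb: "\<bar>E y\<bar> \<le> q / real k" "(1 + real k) * \<bar>E y\<bar> \<le> 2 * q" "\<bar>E y\<bar> \<le> q" if y: "y \<in> {0..1}" for y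
    proof -
      have Dq: "\<bar>D y\<bar> \<le> q" using q y by blast
      show "\<bar>E y\<bar> \<le> q / real k" using Dq by (auto simp: E_def abs_divide divide_right_mono)
      show le: "\<bar>E y\<bar> \<le> q"
      proof (cases "k = 0")
        case False
        then have "q / real k \<le> q" using q0 by (simp add: divide_le_eq mult_le_cancel_left1)
        then show ?thesis using \<open>\<bar>E y\<bar> \<le> q / real k\<close> by linarith
      qed (use q0 in \<open>simp add: E_def\<close>)
      have "real k * \<bar>E y\<bar> = \<bar>D y\<bar>" using kE[OF y] by (metis abs_mult abs_of_nat)
      then show "(1 + real k) * \<bar>E y\<bar> \<le> 2 * q" using le Dq by (simp add: distrib_right)
    qed
    have fb: "\<bar>f y\<bar> \<le> (1 + Lam) * q" if y: "y \<in> {0..1}" for y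
    proof -
      have "\<bar>Lam * E y\<bar> \<le> Lam * q" using Eb(3)[OF y] pos by (simp add: abs_mult)
      moreover have "\<bar>S y\<bar> \<le> q" using q y by blast
      ultimately show ?thesis unfolding f_def by (simp add: distrib_right)
    qed
    have orth': "k = 1 \<longrightarrow> integral {0..1} (\<lambda>s. s ^ (N - 1) * (rad N (- l1) s * f s - rad' N (- l1) s * a s)) = 0"
    proof
      assume k: "k = 1"
      have "(\<lambda>s. s ^ (N - 1) * (rad N (- l1) s * f s - rad' N (- l1) s * a s)) =
        (\<lambda>s. - (s ^ (N - 1) * (rad N (- l1) s * (S s + Lam * D s) + rad' N (- l1) s * A s)))"
        by (rule ext) (simp add: f_def a_def E_def k algebra_simps)
      then show "integral {0..1} (\<lambda>s. s ^ (N - 1) * (rad N (- l1) s * f s - rad' N (- l1) s * a s)) = 0"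
        using orth k by simp
    qed
    obtain v where v: "radial_sol N (Kk k) a f v" "v 1 = 0"
      and vb0: "\<And>y. y \<in> {0..1} \<Longrightarrow> (1 + real k)\<^sup>2 * \<bar>v y\<bar> \<le> C1 * ((1 + real k) * (2 * q / (1 + real k)) + (1 + Lam) * q)"
      and bb0: "\<And>y. y \<in> {0..1} \<Longrightarrow> (1 + real k) * \<bar>y * ravg N (\<lambda>s. Kk k * v s + f s) y\<bar> \<le> C1 * ((1 + real k) * (2 * q / (1 + real k)) + (1 + Lam) * q)"
      using lin[unfolded linear_bound_def, rule_format, OF ac fc, of "2 * q / (1 + real k)" "(1 + Lam) * q" k] ab fb orth' by blast
    have kq: "(1 + real k) * (2 * q / (1 + real k)) = 2 * q" by simp
    have C2q: "C1 * ((1 + real k) * (2 * q / (1 + real k)) + (1 + Lam) * q) = C2 * q"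
      unfolding kq by (simp add: C2_def algebra_simps)
    note vb = vb0[unfolded C2q]
    define r where "r = ravg N (\<lambda>s. Kk k * v s + f s)"
    define b where "b y = y * r y" for y
    have bb: "(1 + real k) * \<bar>b y\<bar> \<le> C2 * q" if "y \<in> {0..1}" for y
      using bb0[OF that] unfolding C2q b_def r_def .
    have vc: "continuous_on {0..1} v" using v by (simp add: radial_sol_def)
    have Kc: "continuous_on {0..1} (\<lambda>s. Kk k * v s + f s)" by (intro continuous_intros vc fc)
    have rc: "continuous_on {0..1} r" unfolding r_def by (rule ravg_continuous[OF Kc])
    have vd: "(v has_real_derivative a y + b y) (at y within {0..1})" if "y \<in> {0..1}" for y
      using v(1) that unfolding radial_sol_def b_def r_def by blast
    have bd: "(b has_real_derivative Kk k * v y + f y - (real N - 1) * r y) (at y within {0..1})" if "y \<in> {0..1}" for y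
      using DERIV_ravg[OF Kc N that] unfolding b_def[abs_def] r_def .
    define \<gamma> where "\<gamma> = b 1 / Lam"
    define Y where "Y y = - (real N - 1) * U'' y - Lam * (U y + y * U' y)" for y
    define p where "p y = b y + \<gamma> * (y * U'' y)" for y
    define p' where "p' y = (Kk k * v y + f y - (real N - 1) * r y) + \<gamma> * Y y" for y
    define u where "u y = v y + E y + \<gamma> * (y * U' y)" for y
    define u' where "u' y = p y + \<gamma> * U' y + C y" for y
    have pd: "(p has_real_derivative p' y) (at y within {0..1})" if "y \<in> {0..1}" for y
      unfolding p_def[abs_def] p'_def Y_def by (intro DERIV_add bd that DERIV_cmult DERIV_U)
    have ud: "(u has_real_derivative u' y) (at y within {0..1})" if y: "y \<in> {0..1}" for y
    proof -
      have "((\<lambda>y. y * U' y) has_real_derivative 1 * U' y + U'' y * y) (at y within {0..1})"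
        by (intro DERIV_mult DERIV_ident DERIV_U)
      from DERIV_add[OF DERIV_add[OF vd[OF y] E'[OF y]] DERIV_cmult[OF this, of \<gamma>]]
      show ?thesis unfolding u_def[abs_def] u'_def p_def by (simp add: algebra_simps)
    qed
    have \<gamma>b: "(1 + real k) * \<bar>\<gamma>\<bar> \<le> C3 * q"
    proof -
      have "(1 + real k) * \<bar>\<gamma>\<bar> = ((1 + real k) * \<bar>b 1\<bar>) / Lam" using pos by (simp add: \<gamma>_def abs_divide)
      also have "\<dots> \<le> (C2 * q) / Lam" using bb[of 1] pos by (intro divide_right_mono) auto
      finally show ?thesis by (simp add: C3_def)
    qed
    have k1: "x \<le> (1 + real k) * x" if "x \<ge> 0" for x using that by (simp add: distrib_right)
    have \<gamma>b1: "\<bar>\<gamma>\<bar> \<le> C3 * q" using \<gamma>b k1[of "\<bar>\<gamma>\<bar>"] by simp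
    have gU: "(1 + real k) * \<bar>\<gamma> * (y * x)\<bar> \<le> C3 * BU * q" if "y \<in> {0..1}" "\<bar>x\<bar> \<le> BU" for x y
    proof -
      have yx: "\<bar>y\<bar> * \<bar>x\<bar> \<le> 1 * BU" using that BU by (intro mult_mono) auto
      have "((1 + real k) * \<bar>\<gamma>\<bar>) * (\<bar>y\<bar> * \<bar>x\<bar>) \<le> (C3 * q) * (1 * BU)"
        by (rule mult_mono[OF \<gamma>b yx]) (use C3 q0 in auto)
      then show ?thesis by (simp add: abs_mult mult_ac)
    qed
    have pb: "(1 + real k) * \<bar>p y\<bar> \<le> C4 * q" if y: "y \<in> {0..1}" for y
    proof -
      have "\<bar>p y\<bar> \<le> \<bar>b y\<bar> + \<bar>\<gamma> * (y * U'' y)\<bar>" unfolding p_def by (rule abs_triangle_ineq)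
      then have "(1 + real k) * \<bar>p y\<bar> \<le> (1 + real k) * (\<bar>b y\<bar> + \<bar>\<gamma> * (y * U'' y)\<bar>)" by (intro mult_left_mono) auto
      also have "\<dots> \<le> C2 * q + C3 * BU * q" using bb[OF y] gU[OF y BU(4)[OF y]] by (simp add: distrib_left)
      finally show ?thesis by (simp add: C4_def algebra_simps)
    qed
    have Kb: "\<bar>Kk k * v y + f y\<bar> \<le> C5 * q" if y: "y \<in> {0..1}" for y
    proof -
      have k2: "(real k)\<^sup>2 \<le> (1 + real k)\<^sup>2" "1 \<le> (1 + real k)\<^sup>2" by (auto intro: power_mono)
      have "\<bar>Kk k\<bar> \<le> M0 * (real k)\<^sup>2 + Lam" using pos by (simp add: Kk_def abs_le_iff)
      also have "\<dots> \<le> M0 * (1 + real k)\<^sup>2 + Lam * (1 + real k)\<^sup>2"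
        using k2 pos by (intro add_mono mult_left_mono) (auto simp: mult_le_cancel_left1)
      finally have "\<bar>Kk k\<bar> * \<bar>v y\<bar> \<le> ((M0 + Lam) * (1 + real k)\<^sup>2) * \<bar>v y\<bar>"
        by (intro mult_right_mono) (auto simp: distrib_right)
      also have "\<dots> = (M0 + Lam) * ((1 + real k)\<^sup>2 * \<bar>v y\<bar>)" by simp
      also have "\<dots> \<le> (M0 + Lam) * (C2 * q)" using vb[OF y] pos by (intro mult_left_mono) auto
      finally have "\<bar>Kk k * v y\<bar> \<le> (M0 + Lam) * C2 * q" by (simp add: abs_mult)
      then show ?thesis using fb[OF y] abs_triangle_ineq[of "Kk k * v y" "f y"] by (simp add: C5_def algebra_simps)
    qed
    have p'b: "\<bar>p' y\<bar> \<le> (C5 + C6) * q" if y: "y \<in> {0..1}" for y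
    proof -
      have "\<bar>r y\<bar> \<le> C5 * q" unfolding r_def by (rule ravg_bound[OF Kc y]) (use Kb y in auto)
      then have "\<bar>(real N - 1) * r y\<bar> \<le> real N * (C5 * q)"
        unfolding abs_mult using N by (intro mult_mono) auto
      moreover have "\<bar>Y y\<bar> \<le> real N * BU + Lam * (2 * BU)"
      proof -
        have "\<bar>(real N - 1) * U'' y\<bar> \<le> real N * BU" unfolding abs_mult using N BU(4)[OF y] by (intro mult_mono) auto
        moreover have "\<bar>y * U' y\<bar> \<le> 1 * BU" unfolding abs_mult using y BU by (intro mult_mono) auto
        then have "\<bar>U y + y * U' y\<bar> \<le> 2 * BU" using BU(2)[OF y] by linarith
        then have "\<bar>Lam * (U y + y * U' y)\<bar> \<le> Lam * (2 * BU)" unfolding abs_mult using pos by (intro mult_mono) auto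
        moreover have "Y y = - ((real N - 1) * U'' y) - Lam * (U y + y * U' y)" by (simp add: Y_def algebra_simps)
        ultimately show ?thesis by linarith
      qed
      then have "\<bar>\<gamma> * Y y\<bar> \<le> (C3 * q) * (real N * BU + Lam * (2 * BU))"
        unfolding abs_mult using \<gamma>b1 C3 q0 by (intro mult_mono) auto
      ultimately have "\<bar>p' y\<bar> \<le> C5 * q + real N * (C5 * q) + (C3 * q) * (real N * BU + Lam * (2 * BU))"
        using Kb[OF y] unfolding p'_def by linarith
      then show ?thesis by (simp add: C6_def algebra_simps)
    qed
    have v'b: "(1 + real k) * \<bar>a y + b y\<bar> \<le> (C2 + 2) * q" if y: "y \<in> {0..1}" for y
    proof -
      have "(1 + real k) * \<bar>a y\<bar> \<le> (1 + real k) * (2 * q / (1 + real k))" using ab[OF y] by (intro mult_left_mono) auto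
      moreover have "(1 + real k) * \<bar>a y + b y\<bar> \<le> (1 + real k) * (\<bar>a y\<bar> + \<bar>b y\<bar>)" by (intro mult_left_mono) auto
      ultimately show ?thesis using bb[OF y] unfolding kq by (simp add: distrib_left distrib_right)
    qed
    have ub: "(1 + real k) * \<bar>u y\<bar> \<le> (C2 + 2 + C3 * BU) * q" if y: "y \<in> {0..1}" for y
    proof -
      have "\<bar>v y\<bar> * (1 + real k) \<le> \<bar>v y\<bar> * (1 + real k)\<^sup>2"
        by (intro mult_left_mono) (auto simp: power2_eq_square)
      then have 1: "(1 + real k) * \<bar>v y\<bar> \<le> C2 * q" using vb[OF y] by (simp add: mult.commute)
      have "\<bar>u y\<bar> \<le> \<bar>v y\<bar> + \<bar>E y\<bar> + \<bar>\<gamma> * (y * U' y)\<bar>" unfolding u_def by linarith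
      then have "(1 + real k) * \<bar>u y\<bar> \<le> (1 + real k) * (\<bar>v y\<bar> + \<bar>E y\<bar> + \<bar>\<gamma> * (y * U' y)\<bar>)" by (intro mult_left_mono) auto
      then show ?thesis using 1 Eb(2)[OF y] gU[OF y BU(3)[OF y]] by (simp add: distrib_left distrib_right)
    qed
    have u'b: "\<bar>u' y\<bar> \<le> (C4 + C3 * BU + 1) * q" if y: "y \<in> {0..1}" for y
    proof -
      have "\<bar>p y\<bar> \<le> C4 * q" using pb[OF y] k1[of "\<bar>p y\<bar>"] by simp
      moreover have "\<bar>\<gamma> * U' y\<bar> \<le> (C3 * q) * BU" unfolding abs_mult using \<gamma>b1 BU(3)[OF y] C3 q0 by (intro mult_mono) auto
      moreover have "\<bar>C y\<bar> \<le> q" using q y by blast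
      ultimately show ?thesis unfolding u'_def by (simp add: algebra_simps)
    qed
    have le: "x * q \<le> C0 * q" if "x \<le> C0" for x using that q0 by (intro mult_right_mono)
    have Cle: "C2 \<le> C0" "C3 \<le> C0" "C4 \<le> C0" "C5 + C6 \<le> C0" "C2 + 2 \<le> C0" "C2 + 2 + C3 * BU \<le> C0" "C4 + C3 * BU + 1 \<le> C0"
      unfolding C0_def using C2 C3 C4 C5 C6 CU by linarith+
    \<comment> \<open>At \<open>k = 0\<close> the auxiliary function has done its work for
      \<open>u\<close>. The coefficient itself enters the mode equations only with a factor
      \<open>k\<close> and is set to \<open>0\<close>.\<close>
    define vv where "vv y = (if k = 0 then 0 else v y)" for y
    define vv' where "vv' y = (if k = 0 then 0 else a y + b y)" for y
    have "mode_eqs k A C D S \<gamma> p p' vv vv' u u' (C0 * q)"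
      unfolding mode_eqs_def
    proof (intro conjI ballI)
      show "continuous_on {0..1} p'" unfolding p'_def Y_def by (intro continuous_intros vc fc rc continuous_U)
      show "continuous_on {0..1} vv'" unfolding vv'_def b_def by (cases "k = 0") (auto intro!: continuous_intros ac rc)
      have "continuous_on {0..1} p" unfolding p_def b_def by (intro continuous_intros rc continuous_U)
      then show "continuous_on {0..1} u'" unfolding u'_def by (intro continuous_intros C continuous_U)
      show "p 0 = 0" by (simp add: p_def b_def)
      show "vv' 0 = 0" using A0 C0' by (simp add: vv'_def b_def a_def)
      show "p 1 = 0" using pos by (simp add: p_def \<gamma>_def)
      show "vv 1 = 0" using v by (simp add: vv_def)
      show "u 1 = 0" using v D1 by (simp add: u_def E_def)
      show "(1 + real k) * \<bar>\<gamma>\<bar> \<le> C0 * q" using \<gamma>b le[OF Cle(2)] by linarith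
      fix y :: real assume y: "y \<in> {0..1}"
      show "(p has_real_derivative p' y) (at y within {0..1})" by (rule pd[OF y])
      show "(vv has_real_derivative vv' y) (at y within {0..1})"
        using vd[OF y] by (cases "k = 0") (auto simp: vv_def[abs_def] vv'_def)
      show "(u has_real_derivative u' y) (at y within {0..1})" by (rule ud[OF y])
      show "u' y = p y + \<gamma> * U' y + C y" by (simp add: u'_def)
      show "k * u y = k * vv y + y * k * \<gamma> * U' y + D y"
        using kE[OF y] by (simp add: u_def vv_def algebra_simps)
      show "k * vv' y = k * p y - y * k * \<gamma> * U'' y + A y"
        using k0 y by (auto simp: vv'_def p_def a_def algebra_simps)
      show "y * p' y + (real N - 1) * p y + y * Lam * (u y + \<gamma> * U y) - y * M0 * (real k)\<^sup>2 * vv y + y * S y = 0"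
        by (cases "k = 0") (auto simp: p'_def p_def u_def Y_def b_def vv_def f_def Kk_def algebra_simps)
      show "(1 + real k) * \<bar>p y\<bar> \<le> C0 * q" using pb[OF y] le[OF Cle(3)] by linarith
      show "\<bar>p' y\<bar> \<le> C0 * q" using p'b[OF y] le[OF Cle(4)] by linarith
      show "(1 + real k)\<^sup>2 * \<bar>vv y\<bar> \<le> C0 * q"
      proof (cases "k = 0")
        case True
        then show ?thesis using le[of 0] C2 Cle(1) by (simp add: vv_def)
      next
        case False
        then show ?thesis using vb[OF y] le[OF Cle(1)] by (simp add: vv_def)
      qed
      show "(1 + real k) * \<bar>vv' y\<bar> \<le> C0 * q"
      proof (cases "k = 0")
        case True
        then show ?thesis using le[of 0] C2 Cle(1) by (simp add: vv'_def)
      next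
        case False
        then show ?thesis using v'b[OF y] le[OF Cle(5)] by (simp add: vv'_def)
      qed
      show "(1 + real k) * \<bar>u y\<bar> \<le> C0 * q" using ub[OF y] le[OF Cle(6)] by linarith
      show "\<bar>u' y\<bar> \<le> C0 * q" using u'b[OF y] le[OF Cle(7)] by linarith
    qed
    moreover have "k = 0 \<longrightarrow> vv = (\<lambda>_. 0) \<and> vv' = (\<lambda>_. 0)" by (auto simp: vv_def vv'_def)
    ultimately show "\<exists>\<gamma> p p' v v' u u'. mode_eqs k A C D S \<gamma> p p' v v' u u' (C0 * q) \<and> (k = 0 \<longrightarrow> v = (\<lambda>_. 0) \<and> v' = (\<lambda>_. 0))"
      by blast
  qed
qed

end

section \<open>Convolution of Fourier coefficients\<close>

abbreviation freqs :: "nat \<Rightarrow> int set" where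
  "freqs n \<equiv> {- int n..int n}"

text \<open>Order \<open>n\<close>, frequency \<open>k\<close> of a product of two series without
  terms of order \<open>0\<close>, hence \<open>m\<close> runs from \<open>1\<close> to
  \<open>n - 1\<close> only. Frequencies of both signs are kept with even or odd coefficients; then
  products of cosines and sines become plain convolutions.\<close>

definition cnv :: "(nat \<Rightarrow> int \<Rightarrow> real) \<Rightarrow> (nat \<Rightarrow> int \<Rightarrow> real) \<Rightarrow> nat \<Rightarrow> int \<Rightarrow> real" where
  "cnv f g n k = (\<Sum>m\<in>{1..<n}. \<Sum>j\<in>freqs m. f m j * g (n - m) (k - j))"

lemma cnv_cong:
  assumes "\<And>m j. m < n \<Longrightarrow> f m j = f' m j" "\<And>m j. m < n \<Longrightarrow> g m j = g' m j"
  shows "cnv f g n k = cnv f' g' n k"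
  unfolding cnv_def using assms by (intro sum.cong refl) auto

lemma cnv_uminus:
  assumes f: "\<And>m j. 1 \<le> m \<Longrightarrow> m < n \<Longrightarrow> f m (- j) = a * f m j" and g: "\<And>m j. 1 \<le> m \<Longrightarrow> m < n \<Longrightarrow> g m (- j) = b * g m j"
  shows "cnv f g n (- k) = a * b * cnv f g n k"
proof -
  have *: "(\<Sum>j\<in>freqs m. f m j * g (n - m) (- k - j)) = (\<Sum>j\<in>freqs m. a * b * (f m j * g (n - m) (k - j)))"
    if m: "m \<in> {1..<n}" for m
  proof (rule sum.reindex_bij_witness[of _ uminus uminus])
    fix j
    have "g (n - m) (- (k - - j)) = b * g (n - m) (k - - j)" using m by (intro g) auto
    moreover have "f m (- (- j)) = a * f m (- j)" using m by (intro f) auto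
    moreover have "- (k - - j) = - k - j" by simp
    ultimately show "a * b * (f m (- j) * g (n - m) (k - - j)) = f m j * g (n - m) (- k - j)"
      by (simp add: mult_ac)
  qed auto
  show ?thesis unfolding cnv_def sum_distrib_left by (rule sum.cong[OF refl]) (rule *)
qed

lemma cnv_bound:
  assumes f: "\<And>m j. 1 \<le> m \<Longrightarrow> m < n \<Longrightarrow> \<bar>f m j\<bar> \<le> f' m j" and g: "\<And>m j. 1 \<le> m \<Longrightarrow> m < n \<Longrightarrow> \<bar>g m j\<bar> \<le> g' m j"
  shows "\<bar>cnv f g n k\<bar> \<le> cnv f' g' n k"
  unfolding cnv_def
proof (intro order_trans[OF sum_abs] sum_mono)
  fix m j assume m: "m \<in> {1..<n}"
  have "\<bar>f m j\<bar> \<le> f' m j" "\<bar>g (n - m) (k - j)\<bar> \<le> g' (n - m) (k - j)" using m by (auto intro!: f g)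
  then show "\<bar>f m j * g (n - m) (k - j)\<bar> \<le> f' m j * g' (n - m) (k - j)"
    unfolding abs_mult by (intro mult_mono) (auto intro: order_trans[OF abs_ge_zero])
qed

lemma cnv_support:
  assumes g: "\<And>m j. 1 \<le> m \<Longrightarrow> m < n \<Longrightarrow> \<bar>j\<bar> > int m \<Longrightarrow> g m j = 0" and k: "\<bar>k\<bar> > int n"
  shows "cnv f g n k = 0"
  unfolding cnv_def
proof (intro sum.neutral ballI)
  fix m j assume m: "m \<in> {1..<n}" and j: "j \<in> freqs m"
  have "g (n - m) (k - j) = 0" using m j k by (intro g) auto
  then show "f m j * g (n - m) (k - j) = 0" by simp
qed

lemma shifted_sum_le:
  fixes b :: "int \<Rightarrow> real"
  assumes b: "\<And>k. b k \<ge> 0" and s: "\<And>k. \<bar>k\<bar> > int m \<Longrightarrow> b k = 0"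
  shows "(\<Sum>k\<in>freqs n. b (k - j)) \<le> (\<Sum>k\<in>freqs m. b k)"
proof -
  have "(\<Sum>k\<in>freqs n. b (k - j)) = (\<Sum>l\<in>{- int n - j..int n - j}. b l)"
    by (rule sum.reindex_bij_witness[of _ "\<lambda>l. l + j" "\<lambda>k. k - j"]) auto
  also have "\<dots> = (\<Sum>l\<in>{- int n - j..int n - j} \<inter> freqs m. b l)"
    by (rule sum.mono_neutral_right) (auto intro!: s)
  also have "\<dots> \<le> (\<Sum>k\<in>freqs m. b k)" using b by (intro sum_mono2) auto
  finally show ?thesis .
qed

text \<open>The sum over frequencies is submultiplicative under convolution, as in Young's
  inequality; this reduces the estimates to scalar sequences.\<close>

lemma cnv_sum_le:
  assumes b: "\<And>m j. b m j \<ge> 0" and s: "\<And>m j. 1 \<le> m \<Longrightarrow> m < n \<Longrightarrow> \<bar>j\<bar> > int m \<Longrightarrow> b m j = 0"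
  shows "(\<Sum>k\<in>freqs n. cnv b b n k) \<le> (\<Sum>m\<in>{1..<n}. (\<Sum>j\<in>freqs m. b m j) * (\<Sum>j\<in>freqs (n - m). b (n - m) j))"
proof -
  have "(\<Sum>k\<in>freqs n. cnv b b n k) = (\<Sum>m\<in>{1..<n}. \<Sum>j\<in>freqs m. b m j * (\<Sum>k\<in>freqs n. b (n - m) (k - j)))"
  proof -
    have "(\<Sum>k\<in>freqs n. cnv b b n k) = (\<Sum>m\<in>{1..<n}. \<Sum>k\<in>freqs n. \<Sum>j\<in>freqs m. b m j * b (n - m) (k - j))"
      unfolding cnv_def by (rule sum.swap)
    also have "\<dots> = (\<Sum>m\<in>{1..<n}. \<Sum>j\<in>freqs m. \<Sum>k\<in>freqs n. b m j * b (n - m) (k - j))"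
      by (rule sum.cong[OF refl], rule sum.swap)
    finally show ?thesis by (simp add: sum_distrib_left)
  qed
  also have "\<dots> \<le> (\<Sum>m\<in>{1..<n}. \<Sum>j\<in>freqs m. b m j * (\<Sum>j\<in>freqs (n - m). b (n - m) j))"
    by (intro sum_mono mult_left_mono b shifted_sum_le s) auto
  finally show ?thesis by (simp add: sum_distrib_right)
qed

text \<open>The Fourier coefficients at one order of the expansion parameter: \<open>cg\<close> of the boundary,
  \<open>cp\<close>, \<open>cv\<close>, \<open>cu\<close> and their derivatives \<open>cp'\<close>, \<open>cv'\<close>, \<open>cu'\<close> of the unknown functions,
  \<open>cm\<close> of the spectral parameter (shifted by one order), and the majorant \<open>cb\<close>.\<close>

datatype coefs = Coefs (cg: "int \<Rightarrow> real") (cp: "int \<Rightarrow> real \<Rightarrow> real") (cp': "int \<Rightarrow> real \<Rightarrow> real")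
  (cv: "int \<Rightarrow> real \<Rightarrow> real") (cv': "int \<Rightarrow> real \<Rightarrow> real") (cu: "int \<Rightarrow> real \<Rightarrow> real") (cu': "int \<Rightarrow> real \<Rightarrow> real")
  (cm: real) (cb: "int \<Rightarrow> real")

context schiffer
begin

text \<open>
  \<open>sS\<close> contains the coefficient \<open>cm (X n)\<close> that is still to be chosen at order \<open>n\<close>, \<open>sS0\<close> does not.
\<close>

definition "sC X n k y = cnv (\<lambda>m j. cg (X m) j) (\<lambda>m l. cp (X m) l y) n k"
text \<open>The quadratic parts of the flattened system: \<open>sC\<close> from \<open>g P\<close>
  in the equation for \<open>u_y\<close>, \<open>sA\<close> from \<open>g P_x - y g' P_y\<close> in
  that for \<open>v_y\<close>, \<open>sD\<close> from \<open>y g' P\<close> in that for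
  \<open>u_x\<close>, \<open>sG\<close> from \<open>g v_x - y g' v_y\<close>, \<open>sH\<close> from
  \<open>g u\<close>. The signs in \<open>sG\<close> arise because two derivatives in
  \<open>x\<close>, or a product of two sine series, shift the phase by \<open>pi\<close>.\<close>

definition "sA X n k y = cnv (\<lambda>m j. cg (X m) j) (\<lambda>m l. of_int l * cp (X m) l y) n k
   - y * cnv (\<lambda>m j. of_int j * cg (X m) j) (\<lambda>m l. cp' (X m) l y) n k"
definition "sD X n k y = y * cnv (\<lambda>m j. of_int j * cg (X m) j) (\<lambda>m l. cp (X m) l y) n k"
definition "sG X n k y = y * cnv (\<lambda>m j. of_int j * cg (X m) j) (\<lambda>m l. of_int l * cv' (X m) l y) n k
   - cnv (\<lambda>m j. cg (X m) j) (\<lambda>m l. (of_int l)\<^sup>2 * cv (X m) l y) n k"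
definition "sH X n k y = cnv (\<lambda>m j. cg (X m) j) (\<lambda>m l. cu (X m) l y) n k"
definition "sS0 X n k y = Lam * sH X n k y + M0 * sG X n k y +
   (\<Sum>i\<in>{1..<n-1}. cm (X (Suc i)) * (sG X (n - i) k y - (of_int k)\<^sup>2 * cv (X (n - i)) k y))"
definition "sS X n k y = Lam * sH X n k y + M0 * sG X n k y +
   (\<Sum>i\<in>{1..<n}. cm (X (Suc i)) * (sG X (n - i) k y - (of_int k)\<^sup>2 * cv (X (n - i)) k y))"

definition tot :: "(nat \<Rightarrow> coefs) \<Rightarrow> nat \<Rightarrow> real" where "tot X n = (\<Sum>k\<in>freqs n. cb (X n) k)"
definition totQ :: "(nat \<Rightarrow> coefs) \<Rightarrow> nat \<Rightarrow> real" where "totQ X n = (\<Sum>m\<in>{1..<n}. tot X m * tot X (n - m))"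
definition totR :: "(nat \<Rightarrow> coefs) \<Rightarrow> nat \<Rightarrow> real" where
  "totR X n = totQ X n + (\<Sum>i\<in>{1..<n-1}. \<bar>cm (X (Suc i))\<bar> * (tot X (n - i) + totQ X (n - i)))"

text \<open>The mode equations are demanded for \<open>0 \<le> k \<le> n\<close> only; the negative
  frequencies inherit them from the evenness of the coefficients, because the sources have the
  matching parity.\<close>

definition good :: "(nat \<Rightarrow> coefs) \<Rightarrow> nat \<Rightarrow> bool" where
  "good X n \<longleftrightarrow>
    (\<forall>k. \<bar>k\<bar> > int n \<longrightarrow> cg (X n) k = 0 \<and> cp (X n) k = (\<lambda>_. 0) \<and> cp' (X n) k = (\<lambda>_. 0) \<and> cv (X n) k = (\<lambda>_. 0) \<and>
       cv' (X n) k = (\<lambda>_. 0) \<and> cu (X n) k = (\<lambda>_. 0) \<and> cu' (X n) k = (\<lambda>_. 0) \<and> cb (X n) k = 0) \<and>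
    (\<forall>k. cg (X n) (- k) = cg (X n) k \<and> cp (X n) (- k) = cp (X n) k \<and> cp' (X n) (- k) = cp' (X n) k \<and>
       cv (X n) (- k) = cv (X n) k \<and> cv' (X n) (- k) = cv' (X n) k \<and> cu (X n) (- k) = cu (X n) k \<and>
       cu' (X n) (- k) = cu' (X n) k \<and> cb (X n) (- k) = cb (X n) k \<and> cb (X n) k \<ge> 0) \<and>
    cv (X n) 0 = (\<lambda>_. 0) \<and> cv' (X n) 0 = (\<lambda>_. 0) \<and>
    (\<forall>k\<le>n. mode_eqs k (sA X n (int k)) (sC X n (int k)) (sD X n (int k)) (sS X n (int k))
       (cg (X n) (int k)) (cp (X n) (int k)) (cp' (X n) (int k)) (cv (X n) (int k)) (cv' (X n) (int k))
       (cu (X n) (int k)) (cu' (X n) (int k)) (cb (X n) (int k)))"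

text \<open>All these sources at order \<open>n\<close> involve strictly lower orders, which makes
  the recursion well founded. \<open>sS\<close> is absent because it contains
  \<open>cm (X n)\<close>.\<close>

lemma src_cong:
  assumes "\<And>m. m < n \<Longrightarrow> X m = Y m"
  shows "sC X n = sC Y n" "sA X n = sA Y n" "sD X n = sD Y n" "sG X n = sG Y n" "sH X n = sH Y n" "sS0 X n = sS0 Y n"
    "totQ X n = totQ Y n" "totR X n = totR Y n"
proof -
  show 1: "sC X n = sC Y n" "sA X n = sA Y n" "sD X n = sD Y n" "sH X n = sH Y n"
    unfolding sC_def sA_def sD_def sH_def fun_eq_iff using assms
    by (auto intro!: cnv_cong arg_cong2[where f="(-)"] arg_cong2[where f="(*)"])
  have G: "sG X m = sG Y m" if "m \<le> n" for m
    unfolding sG_def fun_eq_iff using assms that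
    by (auto intro!: cnv_cong arg_cong2[where f="(-)"] arg_cong2[where f="(*)"])
  then show "sG X n = sG Y n" by simp
  show "sS0 X n = sS0 Y n"
    unfolding sS0_def 1 G[OF order_refl] fun_eq_iff using assms G
    by (intro allI arg_cong2[where f="(+)"] refl sum.cong) auto
  have t: "tot X m = tot Y m" if "m < n" for m using assms that by (simp add: tot_def)
  then have Q: "totQ X m = totQ Y m" if "m \<le> n" for m using that by (auto simp: totQ_def intro!: sum.cong)
  then show "totQ X n = totQ Y n" by simp
  show "totR X n = totR Y n" unfolding totR_def Q[OF order_refl] using assms t Q
    by (intro arg_cong2[where f="(+)"] refl sum.cong) auto
qed

text \<open>The summand \<open>i = n - 1\<close> pairs \<open>cm (X n)\<close> with order one, where
  the convolution \<open>sG\<close> is empty. It is the only place where the coefficient still to be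
  chosen enters.\<close>

lemma sS_split:
  assumes "n \<ge> 2"
  shows "sS X n k y = sS0 X n k y - cm (X n) * (of_int k)\<^sup>2 * cv (X 1) k y"
proof -
  have "{1..<n} = insert (n - 1) {1..<n - 1}" using assms by auto
  moreover have "sG X (n - (n - 1)) k y = 0" using assms by (simp add: sG_def cnv_def)
  ultimately show ?thesis using assms by (simp add: sS_def sS0_def)
qed

lemma sS_cong:
  assumes "\<And>m. m \<le> n \<Longrightarrow> X m = Y m"
  shows "sS X n = sS Y n"
proof -
  have G: "sG X m = sG Y m" if "m \<le> n" for m using that assms by (intro src_cong) auto
  have H: "sH X n = sH Y n" using assms by (intro src_cong) auto
  show ?thesis unfolding sS_def H G[OF order_refl] fun_eq_iff using assms G
    by (intro allI arg_cong2[where f="(+)"] refl sum.cong) auto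
qed

lemma good_cong:
  assumes "\<And>m. m \<le> n \<Longrightarrow> X m = Y m"
  shows "good X n = good Y n"
proof -
  have "sC X n = sC Y n" "sA X n = sA Y n" "sD X n = sD Y n" using assms by (auto intro!: src_cong)
  moreover have "sS X n = sS Y n" by (rule sS_cong) (rule assms)
  ultimately show ?thesis unfolding good_def using assms[OF order_refl] by simp
qed

end

section \<open>Properties of solved orders and estimates of the sources\<close>

context schiffer
begin

lemma good_mode:
  assumes g: "good X n"
  shows "cb (X n) k \<ge> 0"
    "cg (X n) (- k) = cg (X n) k" "cp (X n) (- k) = cp (X n) k" "cp' (X n) (- k) = cp' (X n) k"
    "cv (X n) (- k) = cv (X n) k" "cv' (X n) (- k) = cv' (X n) k" "cu (X n) (- k) = cu (X n) k"
    "cu' (X n) (- k) = cu' (X n) k" "cb (X n) (- k) = cb (X n) k"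
    "cv (X n) 0 = (\<lambda>_. 0)" "cv' (X n) 0 = (\<lambda>_. 0)"
    "\<bar>k\<bar> > int n \<Longrightarrow> cg (X n) k = 0 \<and> cp (X n) k = (\<lambda>_. 0) \<and> cp' (X n) k = (\<lambda>_. 0) \<and> cv (X n) k = (\<lambda>_. 0) \<and>
       cv' (X n) k = (\<lambda>_. 0) \<and> cu (X n) k = (\<lambda>_. 0) \<and> cu' (X n) k = (\<lambda>_. 0) \<and> cb (X n) k = 0"
  using g unfolding good_def by blast+

lemma good_abs:
  assumes g: "good X n"
  shows "cg (X n) \<bar>k\<bar> = cg (X n) k" "cp (X n) \<bar>k\<bar> = cp (X n) k" "cp' (X n) \<bar>k\<bar> = cp' (X n) k"
    "cv (X n) \<bar>k\<bar> = cv (X n) k" "cv' (X n) \<bar>k\<bar> = cv' (X n) k" "cu (X n) \<bar>k\<bar> = cu (X n) k"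
    "cu' (X n) \<bar>k\<bar> = cu' (X n) k" "cb (X n) \<bar>k\<bar> = cb (X n) k"
  using good_mode(2-9)[OF g, of k] by (simp_all add: abs_if)

lemma good_mode_eqs:
  assumes g: "good X n" and k: "\<bar>k\<bar> \<le> int n"
  shows "mode_eqs (nat \<bar>k\<bar>) (sA X n \<bar>k\<bar>) (sC X n \<bar>k\<bar>) (sD X n \<bar>k\<bar>) (sS X n \<bar>k\<bar>)
     (cg (X n) k) (cp (X n) k) (cp' (X n) k) (cv (X n) k) (cv' (X n) k) (cu (X n) k) (cu' (X n) k) (cb (X n) k)"
proof -
  have "nat \<bar>k\<bar> \<le> n" using k by simp
  then have "mode_eqs (nat \<bar>k\<bar>) (sA X n (int (nat \<bar>k\<bar>))) (sC X n (int (nat \<bar>k\<bar>))) (sD X n (int (nat \<bar>k\<bar>))) (sS X n (int (nat \<bar>k\<bar>)))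
       (cg (X n) (int (nat \<bar>k\<bar>))) (cp (X n) (int (nat \<bar>k\<bar>))) (cp' (X n) (int (nat \<bar>k\<bar>))) (cv (X n) (int (nat \<bar>k\<bar>))) (cv' (X n) (int (nat \<bar>k\<bar>)))
       (cu (X n) (int (nat \<bar>k\<bar>))) (cu' (X n) (int (nat \<bar>k\<bar>))) (cb (X n) (int (nat \<bar>k\<bar>)))"
    using g unfolding good_def by blast
  then show ?thesis by (simp add: good_abs[OF g])
qed

lemma good_regular:
  assumes g: "good X n"
  shows "y \<in> {0..1} \<Longrightarrow> (cp (X n) k has_real_derivative cp' (X n) k y) (at y within {0..1})"
    "y \<in> {0..1} \<Longrightarrow> (cv (X n) k has_real_derivative cv' (X n) k y) (at y within {0..1})"
    "y \<in> {0..1} \<Longrightarrow> (cu (X n) k has_real_derivative cu' (X n) k y) (at y within {0..1})"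
    "continuous_on {0..1} (cp' (X n) k)" "continuous_on {0..1} (cv' (X n) k)" "continuous_on {0..1} (cu' (X n) k)"
    "cp (X n) k 0 = 0" "cv' (X n) k 0 = 0" "cp (X n) k 1 = 0" "cv (X n) k 1 = 0" "cu (X n) k 1 = 0"
  using good_mode_eqs[OF g, of k, unfolded mode_eqs_def] good_mode(12)[OF g, of k]
  by (cases "\<bar>k\<bar> \<le> int n"; force)+

lemma good_continuous:
  assumes g: "good X n"
  shows "continuous_on {0..1} (cp (X n) k)" "continuous_on {0..1} (cv (X n) k)" "continuous_on {0..1} (cu (X n) k)"
  by (rule DERIV_continuous_on, erule good_regular(1)[OF g], rule DERIV_continuous_on, erule good_regular(2)[OF g],
      rule DERIV_continuous_on, erule good_regular(3)[OF g])

lemma good_bounds: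
  fixes k :: int
  assumes g: "good X n" and y: "y \<in> {0..1}"
  defines "K \<equiv> 1 + \<bar>real_of_int k\<bar>"
  shows "K * \<bar>cg (X n) k\<bar> \<le> cb (X n) k" "K * \<bar>cp (X n) k y\<bar> \<le> cb (X n) k" "\<bar>cp' (X n) k y\<bar> \<le> cb (X n) k"
    "K\<^sup>2 * \<bar>cv (X n) k y\<bar> \<le> cb (X n) k" "K * \<bar>cv' (X n) k y\<bar> \<le> cb (X n) k"
    "K * \<bar>cu (X n) k y\<bar> \<le> cb (X n) k" "\<bar>cu' (X n) k y\<bar> \<le> cb (X n) k"
  using good_mode_eqs[OF g, of k, unfolded mode_eqs_def] good_mode(12)[OF g, of k] y
  by (cases "\<bar>k\<bar> \<le> int n"; force simp: K_def)+

lemma abs_le_weighted: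
  fixes x B :: real
  assumes "(1 + \<bar>k\<bar>) * \<bar>x\<bar> \<le> B" shows "\<bar>x\<bar> \<le> B" "\<bar>k * x\<bar> \<le> B"
proof -
  have "(1 + \<bar>k\<bar>) * \<bar>x\<bar> = \<bar>x\<bar> + \<bar>k * x\<bar>" by (simp add: distrib_right abs_mult)
  then show "\<bar>x\<bar> \<le> B" "\<bar>k * x\<bar> \<le> B" using assms by linarith+
qed

lemma good_bounds':
  assumes g: "good X n" and y: "y \<in> {0..1}"
  shows "\<bar>cg (X n) k\<bar> \<le> cb (X n) k" "\<bar>of_int k * cg (X n) k\<bar> \<le> cb (X n) k" "\<bar>cp (X n) k y\<bar> \<le> cb (X n) k"
    "\<bar>of_int k * cp (X n) k y\<bar> \<le> cb (X n) k" "\<bar>cp' (X n) k y\<bar> \<le> cb (X n) k"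
    "\<bar>cv (X n) k y\<bar> \<le> cb (X n) k" "\<bar>of_int k * cv (X n) k y\<bar> \<le> cb (X n) k" "\<bar>(of_int k)\<^sup>2 * cv (X n) k y\<bar> \<le> cb (X n) k"
    "\<bar>cv' (X n) k y\<bar> \<le> cb (X n) k" "\<bar>of_int k * cv' (X n) k y\<bar> \<le> cb (X n) k"
    "\<bar>cu (X n) k y\<bar> \<le> cb (X n) k" "\<bar>of_int k * cu (X n) k y\<bar> \<le> cb (X n) k" "\<bar>cu' (X n) k y\<bar> \<le> cb (X n) k"
proof -
  note b = good_bounds[OF g y, of k]
  show "\<bar>cg (X n) k\<bar> \<le> cb (X n) k" "\<bar>of_int k * cg (X n) k\<bar> \<le> cb (X n) k" "\<bar>cp (X n) k y\<bar> \<le> cb (X n) k"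
    "\<bar>of_int k * cp (X n) k y\<bar> \<le> cb (X n) k" "\<bar>cp' (X n) k y\<bar> \<le> cb (X n) k"
    "\<bar>cv' (X n) k y\<bar> \<le> cb (X n) k" "\<bar>of_int k * cv' (X n) k y\<bar> \<le> cb (X n) k"
    "\<bar>cu (X n) k y\<bar> \<le> cb (X n) k" "\<bar>of_int k * cu (X n) k y\<bar> \<le> cb (X n) k" "\<bar>cu' (X n) k y\<bar> \<le> cb (X n) k"
    using b abs_le_weighted by blast+
  have "(1 + \<bar>real_of_int k\<bar>) * \<bar>(1 + \<bar>real_of_int k\<bar>) * cv (X n) k y\<bar> \<le> cb (X n) k"
    using b(4) by (simp add: abs_mult power2_eq_square mult.assoc)
  note c = abs_le_weighted[OF this]
  have "(1 + \<bar>real_of_int k\<bar>) * \<bar>cv (X n) k y\<bar> \<le> cb (X n) k" using c(1) by (simp add: abs_mult)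
  then show "\<bar>cv (X n) k y\<bar> \<le> cb (X n) k" "\<bar>of_int k * cv (X n) k y\<bar> \<le> cb (X n) k" using abs_le_weighted by blast+
  have "(1 + \<bar>real_of_int k\<bar>) * \<bar>of_int k * cv (X n) k y\<bar> \<le> cb (X n) k"
    using c(2) by (simp add: abs_mult mult.left_commute)
  from abs_le_weighted(2)[OF this] show "\<bar>(of_int k)\<^sup>2 * cv (X n) k y\<bar> \<le> cb (X n) k"
    by (simp add: power2_eq_square mult.assoc)
qed

lemma src_facts:
  assumes gd: "\<forall>m. 1 \<le> m \<and> m < n \<longrightarrow> good X m"
  shows "continuous_on {0..1} (sA X n k)" "continuous_on {0..1} (sC X n k)" "continuous_on {0..1} (sD X n k)"
    "continuous_on {0..1} (sG X n k)" "continuous_on {0..1} (sH X n k)"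
    "sA X n k 0 = 0" "sC X n k 0 = 0" "sD X n k 1 = 0"
    "y \<in> {0..1} \<Longrightarrow> (sD X n k has_real_derivative of_int k * sC X n k y - sA X n k y) (at y within {0..1})"
    "sA X n (- k) = (\<lambda>y. - sA X n k y)" "sC X n (- k) = sC X n k" "sD X n (- k) = (\<lambda>y. - sD X n k y)"
    "sG X n (- k) = sG X n k" "sH X n (- k) = sH X n k"
proof -
  have g: "good X m" if "1 \<le> m" "m < n" for m using gd that by blast
  note c = good_continuous[OF g] good_regular(4-6)[OF g]
  have r: "n - m \<ge> 1 \<and> n - m < n" if "m \<in> {1..<n}" for m using that by auto
  show "continuous_on {0..1} (sA X n k)" "continuous_on {0..1} (sC X n k)" "continuous_on {0..1} (sD X n k)"
    "continuous_on {0..1} (sG X n k)" "continuous_on {0..1} (sH X n k)"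
    unfolding sA_def sC_def sD_def sG_def sH_def cnv_def
    by (auto intro!: continuous_on_add continuous_on_diff continuous_on_mult continuous_on_sum continuous_on_const continuous_on_id c dest: r)
  show "sA X n k 0 = 0" "sC X n k 0 = 0" "sD X n k 1 = 0"
    unfolding sA_def sC_def sD_def cnv_def
    by (auto intro!: sum.neutral simp: good_regular(7,9)[OF g])
  show "(sD X n k has_real_derivative of_int k * sC X n k y - sA X n k y) (at y within {0..1})" if y: "y \<in> {0..1}"
  proof -
    have d: "((\<lambda>y. cnv (\<lambda>m j. of_int j * cg (X m) j) (\<lambda>m l. cp (X m) l y) n k) has_real_derivative
       cnv (\<lambda>m j. of_int j * cg (X m) j) (\<lambda>m l. cp' (X m) l y) n k) (at y within {0..1})"
      unfolding cnv_def
      by (intro DERIV_sum DERIV_cmult good_regular(1)[OF g] y) auto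
    \<comment> \<open>Splitting \<open>k = j + (k - j)\<close>: the part with \<open>k - j\<close>
      is the first convolution in \<open>sA\<close>, and the part with \<open>j\<close> remains.
      This is the compatibility condition required in \<open>mode_bound\<close>.\<close>
    have "of_int k * sC X n k y - cnv (\<lambda>m j. cg (X m) j) (\<lambda>m l. of_int l * cp (X m) l y) n k
      = cnv (\<lambda>m j. of_int j * cg (X m) j) (\<lambda>m l. cp (X m) l y) n k"
      unfolding sC_def cnv_def sum_distrib_left sum_subtractf[symmetric]
      by (intro sum.cong refl) (simp add: algebra_simps)
    then show ?thesis
      unfolding sD_def[abs_def] sA_def
      by (intro DERIV_cong[OF DERIV_mult[OF DERIV_ident d]]) (simp add: algebra_simps)
  qed
  show "sA X n (- k) = (\<lambda>y. - sA X n k y)"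
    unfolding sA_def fun_eq_iff
    by (subst cnv_uminus[where a=1 and b="-1"], simp_all add: good_mode[OF g])
       (subst cnv_uminus[where a="-1" and b=1], simp_all add: good_mode[OF g])
  show "sC X n (- k) = sC X n k" "sH X n (- k) = sH X n k"
    unfolding sC_def sH_def fun_eq_iff
    by (subst cnv_uminus[where a=1 and b=1], simp_all add: good_mode[OF g])+
  show "sD X n (- k) = (\<lambda>y. - sD X n k y)"
    unfolding sD_def fun_eq_iff
    by (subst cnv_uminus[where a="-1" and b=1], simp_all add: good_mode[OF g])
  show "sG X n (- k) = sG X n k"
    unfolding sG_def fun_eq_iff
    by (subst cnv_uminus[where a="-1" and b="-1"], simp_all add: good_mode[OF g])
       (subst cnv_uminus[where a=1 and b=1], simp_all add: good_mode[OF g])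
qed

lemma src_bounds:
  fixes k :: int
  assumes gd: "\<forall>m. 1 \<le> m \<and> m < n \<longrightarrow> good X m" and y: "y \<in> {0..1}"
  defines "Q \<equiv> cnv (\<lambda>m. cb (X m)) (\<lambda>m. cb (X m)) n k"
  shows "\<bar>sA X n k y\<bar> \<le> 2 * Q" "\<bar>sC X n k y\<bar> \<le> Q" "\<bar>sD X n k y\<bar> \<le> Q" "\<bar>sG X n k y\<bar> \<le> 2 * Q" "\<bar>sH X n k y\<bar> \<le> Q" "Q \<ge> 0"
proof -
  have g: "good X m" if "1 \<le> m" "m < n" for m using gd that by blast
  note b = good_bounds'[OF g y]
  have yb: "\<bar>y * x\<bar> \<le> Q" if "\<bar>x\<bar> \<le> Q" for x
  proof -
    have "\<bar>y\<bar> * \<bar>x\<bar> \<le> 1 * Q" using that y by (intro mult_mono) auto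
    then show ?thesis by (simp add: abs_mult)
  qed
  have "\<bar>cnv (\<lambda>m j. cg (X m) j) (\<lambda>m l. of_int l * cp (X m) l y) n k\<bar> \<le> Q"
    "\<bar>y * cnv (\<lambda>m j. of_int j * cg (X m) j) (\<lambda>m l. cp' (X m) l y) n k\<bar> \<le> Q"
    unfolding Q_def by (intro cnv_bound yb[unfolded Q_def] b; assumption)+
  then show "\<bar>sA X n k y\<bar> \<le> 2 * Q" unfolding sA_def by linarith
  show C: "\<bar>sC X n k y\<bar> \<le> Q" unfolding sC_def Q_def by (intro cnv_bound b; assumption)
  show "\<bar>sD X n k y\<bar> \<le> Q" unfolding sD_def by (rule yb, unfold Q_def) (intro cnv_bound b; assumption)
  show "\<bar>sH X n k y\<bar> \<le> Q" unfolding sH_def Q_def by (intro cnv_bound b; assumption)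
  have "\<bar>cnv (\<lambda>m j. cg (X m) j) (\<lambda>m l. (of_int l)\<^sup>2 * cv (X m) l y) n k\<bar> \<le> Q"
    "\<bar>y * cnv (\<lambda>m j. of_int j * cg (X m) j) (\<lambda>m l. of_int l * cv' (X m) l y) n k\<bar> \<le> Q"
    unfolding Q_def by (intro cnv_bound yb[unfolded Q_def] b; assumption)+
  then show "\<bar>sG X n k y\<bar> \<le> 2 * Q" unfolding sG_def by linarith
  show "Q \<ge> 0" using C by linarith
qed

end

section \<open>Solution of a single order\<close>

context schiffer
begin

text \<open>The frequencies \<open>1\<close> and \<open>-1\<close> share the amplitude of
  \<open>cos x\<close>, hence the factor one half.\<close>

definition first :: "coefs \<Rightarrow> bool" where
  "first r \<longleftrightarrow> (\<forall>k y. cv r k y = (if \<bar>k\<bar> = 1 then rad N (- l1) y / 2 else 0))"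

text \<open>The transversality condition: up to a factor this integral is the coefficient with which
  \<open>cm\<close> enters the solvability condition at the resonant frequency.\<close>

lemma rad_square_integral_pos: "integral {0..1} (\<lambda>s. s ^ (N - 1) * (rad N (- l1) s)\<^sup>2) > 0"
proof -
  let ?g = "\<lambda>s. s ^ (N - 1) * (rad N (- l1) s)\<^sup>2"
  have c: "continuous_on {0..1} ?g" by (intro continuous_intros N)
  have nn: "?g s \<ge> 0" if "s \<in> {0..1}" for s using that by simp
  have "integral {0..1} ?g \<noteq> 0"
  proof
    assume "integral {0..1} ?g = 0"
    then have "(?g has_integral 0) {0..1}" using c integrable_continuous_real by (metis integrable_integral)
    then have "(?g has_integral 0) (cbox 0 1)" by simp
    from has_integral_0_cbox_imp_0[OF _ _ this, of "1 / 2"] c nn have "(1 / 2) ^ (N - 1) * (rad N (- l1) (1 / 2))\<^sup>2 = 0" by simp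
    then have "rad N (- l1) (1 / 2) = 0" by simp
    moreover have "rad N (- l1) (1 / 2) > 0" using l1(3)[of "l1 * (1 / 2)\<^sup>2"] l1(1) by (simp add: rad_def power2_eq_square)
    ultimately show False by simp
  qed
  moreover have "integral {0..1} ?g \<ge> 0" by (rule integral_nonneg) (use c nn in \<open>auto intro: integrable_continuous_real\<close>)
  ultimately show ?thesis by simp
qed

text \<open>The coefficient \<open>cm r\<close> is chosen so that the resonant frequency \<open>k = 1\<close> becomes solvable.\<close>

lemma order_step:
  "\<exists>CC\<ge>0. \<forall>X n. n \<ge> 2 \<longrightarrow> (\<forall>m. 1 \<le> m \<and> m < n \<longrightarrow> good X m) \<longrightarrow> first (X 1) \<longrightarrow>
     (\<exists>r. good (X(n := r)) n \<and> \<bar>cm r\<bar> \<le> CC * totR X n \<and> tot (X(n := r)) n \<le> CC * (totR X n + \<bar>cm r\<bar> * tot X 1))"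
proof -
  obtain C0 where C0: "C0 \<ge> 1" and solve: "mode_bound C0"
    using mode_solve by blast
  define \<phi> where "\<phi> = rad N (- l1)"
  define \<phi>' where "\<phi>' = rad' N (- l1)"
  have \<phi>c: "continuous_on {0..1} \<phi>" "continuous_on {0..1} \<phi>'" unfolding \<phi>_def \<phi>'_def by (intro continuous_intros N)+
  obtain b1 b2 where b12: "\<forall>y\<in>{0..1}. \<bar>\<phi> y\<bar> \<le> b1" "\<forall>y\<in>{0..1}. \<bar>\<phi>' y\<bar> \<le> b2"
    using continuous_unit_interval_bound \<phi>c by metis
  define B where "B = max b1 b2"
  have B: "\<bar>\<phi> y\<bar> \<le> B" "\<bar>\<phi>' y\<bar> \<le> B" if "y \<in> {0..1}" for y using b12 that by (auto simp: B_def le_max_iff_disj)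
  have B0: "B \<ge> 0" using B(1)[of 0] by simp
  define I2 where "I2 = integral {0..1} (\<lambda>s. s ^ (N - 1) * (\<phi> s)\<^sup>2)"
  have I2: "I2 > 0" unfolding I2_def \<phi>_def by (rule rad_square_integral_pos)
  have pos: "Lam > 0" "M0 > 0" using Lam M0 by auto
  define c1 where "c1 = Lam + 2 * M0 + 2"
  have c1: "c1 \<ge> 2" using pos by (simp add: c1_def)
  define c2 where "c2 = 2 * (B * (2 + Lam) * c1) / I2"
  have c2: "c2 \<ge> 0" using B0 pos c1 I2 by (simp add: c2_def)
  define CC where "CC = c2 + C0 * c1"
  have CC: "CC \<ge> c2" "CC \<ge> C0 * c1" "CC \<ge> C0" "CC \<ge> 0"
  proof -
    have "C0 * 1 \<le> C0 * c1" using C0 c1 by (intro mult_left_mono) auto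
    then have a: "C0 \<le> C0 * c1" by (simp only: mult_1_right)
    show "CC \<ge> c2" "CC \<ge> C0 * c1" "CC \<ge> C0" "CC \<ge> 0" unfolding CC_def using a c2 C0 by linarith+
  qed
  show ?thesis
  proof (rule exI[of _ CC], intro conjI allI impI CC(4))
    fix X :: "nat \<Rightarrow> coefs" and n :: nat
    assume n: "n \<ge> 2" and gd: "\<forall>m. 1 \<le> m \<and> m < n \<longrightarrow> good X m" and fst: "first (X 1)"
    have g: "good X m" if "1 \<le> m" "m < n" for m using gd that by blast
    have gdm: "\<forall>i. 1 \<le> i \<and> i < m \<longrightarrow> good X i" if "m \<le> n" for m using gd that by auto
    define b where "b m = cb (X m)" for m
    define Q2 where "Q2 m k = cnv b b m k" for m k
    have b0: "b m k \<ge> 0" if "1 \<le> m" "m < n" for m k using good_mode(1)[of X m, OF g[OF that]] by (simp add: b_def)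
    have Q0: "Q2 m k \<ge> 0" if "m \<le> n" for m k
      unfolding Q2_def cnv_def using that by (intro sum_nonneg mult_nonneg_nonneg b0) auto
    \<comment> \<open>The majorant \<open>totR\<close> before summation over frequencies; it
      controls all parts of the sources that involve neither the new coefficient nor its
      multiplier.\<close>
    define Rk where "Rk k = Q2 n k + (\<Sum>i\<in>{1..<n-1}. \<bar>cm (X (Suc i))\<bar> * (b (n - i) k + Q2 (n - i) k))" for k
    have Rk0: "Rk k \<ge> 0" for k
      unfolding Rk_def using n by (intro add_nonneg_nonneg sum_nonneg mult_nonneg_nonneg Q0 b0) auto
    have Q2R: "Q2 n k \<le> Rk k" for k
    proof -
      have "(\<Sum>i\<in>{1..<n-1}. \<bar>cm (X (Suc i))\<bar> * (b (n - i) k + Q2 (n - i) k)) \<ge> 0"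
        using n by (intro add_nonneg_nonneg sum_nonneg mult_nonneg_nonneg Q0 b0) auto
      then show ?thesis by (simp add: Rk_def)
    qed
    have srcb: "\<bar>sA X m k y\<bar> \<le> 2 * Q2 m k \<and> \<bar>sC X m k y\<bar> \<le> Q2 m k \<and> \<bar>sD X m k y\<bar> \<le> Q2 m k \<and> \<bar>sG X m k y\<bar> \<le> 2 * Q2 m k \<and> \<bar>sH X m k y\<bar> \<le> Q2 m k"
      if "m \<le> n" "y \<in> {0..1}" for m k y
      using src_bounds[OF gdm[OF that(1)] that(2), of k] by (auto simp: Q2_def b_def[abs_def])
    have S0b: "\<bar>sS0 X n k y\<bar> \<le> c1 * Rk k" if y: "y \<in> {0..1}" for k y
    proof -
      have 1: "\<bar>Lam * sH X n k y\<bar> \<le> Lam * Q2 n k" using srcb[OF order_refl y, of k] pos by (simp add: abs_mult)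
      have 2: "\<bar>M0 * sG X n k y\<bar> \<le> M0 * (2 * Q2 n k)" using srcb[OF order_refl y, of k] pos by (simp add: abs_mult)
      have 3: "\<bar>\<Sum>i\<in>{1..<n-1}. cm (X (Suc i)) * (sG X (n - i) k y - (of_int k)\<^sup>2 * cv (X (n - i)) k y)\<bar>
        \<le> (\<Sum>i\<in>{1..<n-1}. 2 * (\<bar>cm (X (Suc i))\<bar> * (b (n - i) k + Q2 (n - i) k)))"
      proof (intro order_trans[OF sum_abs] sum_mono)
        fix i assume i: "i \<in> {1..<n-1}"
        then have ni: "1 \<le> n - i" "n - i < n" "n - i \<le> n" by auto
        have "\<bar>(of_int k)\<^sup>2 * cv (X (n - i)) k y\<bar> \<le> b (n - i) k"
          using good_bounds'(8)[OF g[OF ni(1,2)] y] by (simp add: b_def)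
        then have "\<bar>sG X (n - i) k y - (of_int k)\<^sup>2 * cv (X (n - i)) k y\<bar> \<le> 2 * Q2 (n - i) k + b (n - i) k"
          using conjunct1[OF conjunct2[OF conjunct2[OF conjunct2[OF srcb[OF ni(3) y, of k]]]]]
          by (intro order_trans[OF abs_triangle_ineq4] add_mono)
        also have "\<dots> \<le> 2 * (b (n - i) k + Q2 (n - i) k)" using b0[OF ni(1,2), of k] by simp
        finally have "\<bar>cm (X (Suc i))\<bar> * \<bar>sG X (n - i) k y - (of_int k)\<^sup>2 * cv (X (n - i)) k y\<bar>
           \<le> \<bar>cm (X (Suc i))\<bar> * (2 * (b (n - i) k + Q2 (n - i) k))" by (intro mult_left_mono) auto
        then show "\<bar>cm (X (Suc i)) * (sG X (n - i) k y - (of_int k)\<^sup>2 * cv (X (n - i)) k y)\<bar>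
           \<le> 2 * (\<bar>cm (X (Suc i))\<bar> * (b (n - i) k + Q2 (n - i) k))"
          unfolding abs_mult[of "cm (X (Suc i))"] by (simp only: mult.left_commute)
      qed
      have 4: "(\<Sum>i\<in>{1..<n-1}. 2 * (\<bar>cm (X (Suc i))\<bar> * (b (n - i) k + Q2 (n - i) k))) = 2 * (Rk k - Q2 n k)"
        by (simp add: Rk_def sum_distrib_left)
      have "\<bar>sS0 X n k y\<bar> \<le> Lam * Q2 n k + M0 * (2 * Q2 n k) + 2 * (Rk k - Q2 n k)"
        unfolding sS0_def
        by (rule order_trans[OF abs_triangle_ineq add_mono[OF order_trans[OF abs_triangle_ineq add_mono[OF 1 2]] 3[unfolded 4]]])
      also have "\<dots> \<le> Lam * Rk k + M0 * (2 * Rk k) + 2 * Rk k"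
        using Q2R[of k] Q0[of n k] pos by (intro add_mono mult_left_mono) auto
      finally show ?thesis by (simp add: c1_def algebra_simps)
    qed
    have Qc: "2 * Q2 n k \<le> c1 * Rk k" for k using Q2R[of k] Q0[of n k] c1 mult_mono[of 2 c1 "Q2 n k" "Rk k"] by simp
    have S0c: "continuous_on {0..1} (sS0 X n k)" for k
      unfolding sS0_def using n
      by (intro continuous_on_add continuous_on_mult continuous_on_const continuous_on_sum continuous_on_diff src_facts(4,5) good_continuous g gdm)
        auto
    note sf = src_facts[of n X, OF gd]
    define I0 where "I0 = integral {0..1} (\<lambda>s. s ^ (N - 1) * (\<phi> s * (sS0 X n 1 s + Lam * sD X n 1 s) + \<phi>' s * sA X n 1 s))"
    \<comment> \<open>At \<open>k = 1\<close> the new term contributes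
      \<open>- \<mu> \<phi> / 2\<close> to the source, because the first order coefficient is
      \<open>\<phi> / 2\<close>. Orthogonality to \<open>\<phi>\<close> thus reads
      \<open>I0 = (\<mu> / 2) I2\<close>.\<close>
    define \<mu> where "\<mu> = 2 * I0 / I2"
    have I0c: "continuous_on {0..1} (\<lambda>s. s ^ (N - 1) * (\<phi> s * (sS0 X n 1 s + Lam * sD X n 1 s) + \<phi>' s * sA X n 1 s))"
      by (intro continuous_intros \<phi>c S0c sf)
    have I0b: "\<bar>I0\<bar> \<le> B * (2 + Lam) * c1 * Rk 1"
    proof -
      have "norm I0 \<le> (B * (2 + Lam) * c1 * Rk 1) * (1 - 0)"
        unfolding I0_def
      proof (rule integral_bound[OF _ I0c])
        fix s :: real assume s: "s \<in> {0..1}"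
        have "\<bar>Lam * sD X n 1 s\<bar> \<le> Lam * Q2 n 1" using srcb[OF order_refl s, of 1] pos by (simp add: abs_mult)
        also have "Lam * Q2 n 1 \<le> Lam * (c1 * Rk 1)" using Qc[of 1] Q0[of n 1] pos by (intro mult_left_mono) auto
        finally have "\<bar>sS0 X n 1 s + Lam * sD X n 1 s\<bar> \<le> (1 + Lam) * (c1 * Rk 1)"
          using S0b[OF s, of 1] by (simp add: distrib_right)
        then have "\<bar>\<phi> s * (sS0 X n 1 s + Lam * sD X n 1 s)\<bar> \<le> B * ((1 + Lam) * (c1 * Rk 1))"
          unfolding abs_mult using B(1)[OF s] B0 by (intro mult_mono) auto
        moreover have "\<bar>sA X n 1 s\<bar> \<le> c1 * Rk 1" using srcb[OF order_refl s, of 1] Qc[of 1] by linarith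
        then have "\<bar>\<phi>' s * sA X n 1 s\<bar> \<le> B * (c1 * Rk 1)"
          unfolding abs_mult using B(2)[OF s] B0 by (intro mult_mono) auto
        ultimately have "\<bar>\<phi> s * (sS0 X n 1 s + Lam * sD X n 1 s) + \<phi>' s * sA X n 1 s\<bar> \<le> B * (2 + Lam) * c1 * Rk 1"
          by (simp add: algebra_simps)
        moreover have "\<bar>s ^ (N - 1)\<bar> \<le> 1" using s by (simp add: power_le_one)
        ultimately have "\<bar>s ^ (N - 1)\<bar> * \<bar>\<phi> s * (sS0 X n 1 s + Lam * sD X n 1 s) + \<phi>' s * sA X n 1 s\<bar> \<le> 1 * (B * (2 + Lam) * c1 * Rk 1)"
          by (intro mult_mono) auto
        then show "norm (s ^ (N - 1) * (\<phi> s * (sS0 X n 1 s + Lam * sD X n 1 s) + \<phi>' s * sA X n 1 s)) \<le> B * (2 + Lam) * c1 * Rk 1"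
          by (simp add: abs_mult)
      qed simp
      then show ?thesis by simp
    qed
    have \<mu>b: "\<bar>\<mu>\<bar> \<le> c2 * Rk 1"
    proof -
      have "\<bar>\<mu>\<bar> = 2 * \<bar>I0\<bar> / I2" using I2 by (simp add: \<mu>_def abs_mult)
      also have "\<dots> \<le> 2 * (B * (2 + Lam) * c1 * Rk 1) / I2" using I0b I2 by (intro divide_right_mono) auto
      finally show ?thesis by (simp add: c2_def mult_ac)
    qed
    define S where "S k y = sS0 X n k y - \<mu> * (of_int k)\<^sup>2 * cv (X 1) k y" for k y
    define q where "q k = c1 * Rk k + \<bar>\<mu>\<bar> * b 1 k" for k
    have "\<exists>\<gamma> p p' v v' u u'. mode_eqs k (sA X n (int k)) (sC X n (int k)) (sD X n (int k)) (S (int k)) \<gamma> p p' v v' u u' (C0 * q (int k)) \<and>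
       (k = 0 \<longrightarrow> v = (\<lambda>_. 0) \<and> v' = (\<lambda>_. 0))" for k
    proof (rule solve[unfolded mode_bound_def, THEN spec, THEN spec, THEN spec, THEN spec, THEN spec, THEN spec,
        THEN mp, THEN mp, THEN mp, THEN mp, THEN mp, THEN mp, THEN mp, THEN mp, THEN mp, THEN mp])
      show "continuous_on {0..1} (sA X n (int k))" "continuous_on {0..1} (sC X n (int k))" by (rule sf)+
      show "continuous_on {0..1} (S (int k))"
        unfolding S_def using n by (intro continuous_intros S0c good_continuous g) auto
      show "\<forall>y\<in>{0..1}. (sD X n (int k) has_real_derivative real k * sC X n (int k) y - sA X n (int k) y) (at y within {0..1})"
        using sf(9)[of _ "int k"] by simp
      show "sD X n (int k) 1 = 0" "sA X n (int k) 0 = 0" "sC X n (int k) 0 = 0" by (rule sf)+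
      show "k = 0 \<longrightarrow> (\<forall>y\<in>{0..1}. sA X n (int k) y = 0 \<and> sD X n (int k) y = 0)"
        using fun_cong[OF sf(10)[of 0]] fun_cong[OF sf(12)[of 0]] by simp
      show "\<forall>y\<in>{0..1}. \<bar>sA X n (int k) y\<bar> \<le> q (int k) \<and> \<bar>sC X n (int k) y\<bar> \<le> q (int k) \<and> \<bar>sD X n (int k) y\<bar> \<le> q (int k) \<and> \<bar>S (int k) y\<bar> \<le> q (int k)"
      proof
        fix y :: real assume y: "y \<in> {0..1}"
        have m0: "\<bar>\<mu>\<bar> * b 1 (int k) \<ge> 0" using n by (intro mult_nonneg_nonneg b0) auto
        have "\<bar>(of_int (int k))\<^sup>2 * cv (X 1) (int k) y\<bar> \<le> b 1 (int k)"
          using good_bounds'(8)[OF g y, of 1 "int k"] n by (simp add: b_def)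
        then have "\<bar>\<mu>\<bar> * \<bar>(of_int (int k))\<^sup>2 * cv (X 1) (int k) y\<bar> \<le> \<bar>\<mu>\<bar> * b 1 (int k)" by (intro mult_left_mono) auto
        then have "\<bar>\<mu> * (of_int (int k))\<^sup>2 * cv (X 1) (int k) y\<bar> \<le> \<bar>\<mu>\<bar> * b 1 (int k)" by (simp add: abs_mult)
        then have "\<bar>S (int k) y\<bar> \<le> q (int k)" unfolding S_def q_def using S0b[OF y, of "int k"] by linarith
        then show "\<bar>sA X n (int k) y\<bar> \<le> q (int k) \<and> \<bar>sC X n (int k) y\<bar> \<le> q (int k) \<and> \<bar>sD X n (int k) y\<bar> \<le> q (int k) \<and> \<bar>S (int k) y\<bar> \<le> q (int k)"
          using srcb[OF order_refl y, of "int k"] Qc[of "int k"] m0 Q0[of n "int k"] unfolding q_def by auto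
      qed
      show "k = 1 \<longrightarrow> integral {0..1} (\<lambda>s. s ^ (N - 1) * (rad N (- l1) s * (S (int k) s + Lam * sD X n (int k) s) + rad' N (- l1) s * sA X n (int k) s)) = 0"
      proof
        assume k: "k = 1"
        have f: "(\<lambda>s. s ^ (N - 1) * (rad N (- l1) s * (S (int k) s + Lam * sD X n (int k) s) + rad' N (- l1) s * sA X n (int k) s))
          = (\<lambda>s. s ^ (N - 1) * (\<phi> s * (sS0 X n 1 s + Lam * sD X n 1 s) + \<phi>' s * sA X n 1 s) - (\<mu> / 2) * (s ^ (N - 1) * (\<phi> s)\<^sup>2))"
          using fst by (auto simp: fun_eq_iff k S_def first_def \<phi>_def \<phi>'_def power2_eq_square algebra_simps)
        have i1: "integral {0..1} (\<lambda>s. s ^ (N - 1) * (\<phi> s * (sS0 X n 1 s + Lam * sD X n 1 s) + \<phi>' s * sA X n 1 s) - (\<mu> / 2) * (s ^ (N - 1) * (\<phi> s)\<^sup>2))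
          = I0 - integral {0..1} (\<lambda>s. (\<mu> / 2) * (s ^ (N - 1) * (\<phi> s)\<^sup>2))"
          unfolding I0_def by (intro integral_diff integrable_continuous_real I0c continuous_intros \<phi>c)
        have i2: "integral {0..1} (\<lambda>s. (\<mu> / 2) * (s ^ (N - 1) * (\<phi> s)\<^sup>2)) = (\<mu> / 2) * I2"
          unfolding I2_def by (rule integral_mult_right)
        show "integral {0..1} (\<lambda>s. s ^ (N - 1) * (rad N (- l1) s * (S (int k) s + Lam * sD X n (int k) s) + rad' N (- l1) s * sA X n (int k) s)) = 0"
          unfolding f i1 i2 using I2 by (simp add: \<mu>_def)
      qed
    qed
    then obtain G P P' V V' W W' where sol: "\<And>k. mode_eqs k (sA X n (int k)) (sC X n (int k)) (sD X n (int k)) (S (int k))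
        (G k) (P k) (P' k) (V k) (V' k) (W k) (W' k) (C0 * q (int k)) \<and> (k = 0 \<longrightarrow> V k = (\<lambda>_. 0) \<and> V' k = (\<lambda>_. 0))"
      by metis
    define ex :: "(nat \<Rightarrow> real \<Rightarrow> real) \<Rightarrow> int \<Rightarrow> real \<Rightarrow> real" where "ex F k = (if \<bar>k\<bar> \<le> int n then F (nat \<bar>k\<bar>) else (\<lambda>_. 0))" for F k
    define r where "r = Coefs (\<lambda>k. if \<bar>k\<bar> \<le> int n then G (nat \<bar>k\<bar>) else 0) (ex P) (ex P') (ex V) (ex V') (ex W) (ex W') \<mu>
        (\<lambda>k. if \<bar>k\<bar> \<le> int n then C0 * q \<bar>k\<bar> else 0)"
    define Y where "Y = X(n := r)"
    have YX: "Y m = X m" if "m < n" for m using that by (simp add: Y_def)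
    have Yn: "Y n = r" by (simp add: Y_def)
    have src: "sA Y n = sA X n" "sC Y n = sC X n" "sD Y n = sD X n" "sS0 Y n = sS0 X n" by (rule src_cong, rule YX, assumption)+
    have SY: "sS Y n k = S k" for k
      unfolding fun_eq_iff sS_split[OF n] S_def src Yn using YX[of 1] n by (simp add: r_def)
    have q0: "q k \<ge> 0" for k unfolding q_def using c1 Rk0[of k] n by (intro add_nonneg_nonneg mult_nonneg_nonneg b0) auto
    have gY: "good Y n"
      unfolding good_def Yn src SY
    proof (intro conjI allI impI)
      show "cv r 0 = (\<lambda>_. 0)" "cv' r 0 = (\<lambda>_. 0)" using sol[of 0] by (simp_all add: r_def ex_def)
      fix k :: nat assume "k \<le> n"
      then show "mode_eqs k (sA X n (int k)) (sC X n (int k)) (sD X n (int k)) (S (int k)) (cg r (int k)) (cp r (int k)) (cp' r (int k))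
        (cv r (int k)) (cv' r (int k)) (cu r (int k)) (cu' r (int k)) (cb r (int k))"
        using sol[of k] by (simp add: r_def ex_def)
    qed (use C0 q0 in \<open>auto simp: r_def ex_def\<close>)
    have bs: "b m j = 0" if "1 \<le> m" "m < n" "\<bar>j\<bar> > int m" for m j
      using good_mode(12)[OF g[OF that(1,2)] that(3)] by (simp add: b_def)
    have tb: "(\<Sum>j\<in>freqs m. b m j) = tot X m" for m by (simp add: tot_def b_def)
    have sQ: "(\<Sum>k\<in>freqs m. Q2 m k) \<le> totQ X m" if "m \<le> n" for m
    proof -
      \<comment> \<open>Nonnegativity is known only for the orders from \<open>1\<close> to
        \<open>n - 1\<close>, whereas \<open>cnv_sum_le\<close> asks for it at all orders; the
        cutoff changes no summand.\<close>
      define b' where "b' i j = (if 1 \<le> i \<and> i < n then b i j else 0)" for i j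
      have "(\<Sum>k\<in>freqs m. Q2 m k) = (\<Sum>k\<in>freqs m. cnv b' b' m k)"
        unfolding Q2_def cnv_def using that by (intro sum.cong refl) (auto simp: b'_def)
      also have "\<dots> \<le> (\<Sum>i\<in>{1..<m}. (\<Sum>j\<in>freqs i. b' i j) * (\<Sum>j\<in>freqs (m - i). b' (m - i) j))"
        by (rule cnv_sum_le) (auto simp: b'_def b0 bs)
      also have "\<dots> = totQ X m"
        unfolding totQ_def tb[symmetric] using that
        by (intro sum.cong refl arg_cong2[where f="(*)"]) (auto simp: b'_def)
      finally show ?thesis .
    qed
    have wide: "(\<Sum>k\<in>freqs n. f k) = (\<Sum>k\<in>freqs m. f k)"
      if "m \<le> n" "\<And>k. \<bar>k\<bar> > int m \<Longrightarrow> f k = 0" for f :: "int \<Rightarrow> real" and m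
      using that by (intro sum.mono_neutral_right) auto
    have sR: "(\<Sum>k\<in>freqs n. Rk k) \<le> totR X n"
    proof -
      have "(\<Sum>k\<in>freqs n. Rk k) = (\<Sum>k\<in>freqs n. Q2 n k) +
        (\<Sum>i\<in>{1..<n-1}. \<bar>cm (X (Suc i))\<bar> * ((\<Sum>k\<in>freqs n. b (n - i) k) + (\<Sum>k\<in>freqs n. Q2 (n - i) k)))"
        unfolding Rk_def sum.distrib
        by (subst sum.swap) (simp add: sum_distrib_left sum.distrib distrib_left)
      also have "\<dots> \<le> totR X n"
        unfolding totR_def
      proof (intro add_mono sum_mono mult_left_mono sQ order_refl)
        fix i assume i: "i \<in> {1..<n-1}"
        then have ni: "1 \<le> n - i" "n - i < n" by auto
        show "(\<Sum>k\<in>freqs n. b (n - i) k) \<le> tot X (n - i)"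
          unfolding tb[symmetric] using wide[of "n - i" "b (n - i)"] bs[OF ni] by simp
        have "Q2 (n - i) k = 0" if "\<bar>k\<bar> > int (n - i)" for k
          unfolding Q2_def using that by (intro cnv_support bs) (use ni in auto)
        then show "(\<Sum>k\<in>freqs n. Q2 (n - i) k) \<le> totQ X (n - i)"
          using wide[of "n - i" "Q2 (n - i)"] sQ[of "n - i"] ni by simp
      qed auto
      finally show ?thesis .
    qed
    have R0: "totR X n \<ge> 0" using sR Rk0 by (meson order_trans sum_nonneg)
    have "Rk 1 \<le> (\<Sum>k\<in>freqs n. Rk k)" using n Rk0 by (intro member_le_sum) auto
    then have R1: "Rk 1 \<le> totR X n" using sR by linarith
    have "c2 * Rk 1 \<le> CC * totR X n" using R1 c2 CC R0 Rk0[of 1] by (intro mult_mono) auto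
    then have mu: "\<bar>cm r\<bar> \<le> CC * totR X n" using \<mu>b by (simp add: r_def)
    have "tot Y n = (\<Sum>k\<in>freqs n. C0 * q \<bar>k\<bar>)" unfolding tot_def Yn by (intro sum.cong refl) (auto simp: r_def)
    also have "\<dots> = (\<Sum>k\<in>freqs n. C0 * q k)"
    proof (intro sum.cong refl)
      fix k :: int
      have ev: "b m (- j) = b m j" if "1 \<le> m" "m < n" for m j using good_mode(9)[OF g[OF that]] by (simp add: b_def)
      have Qe: "Q2 m (- k) = Q2 m k" if "m \<le> n" for m
        unfolding Q2_def using cnv_uminus[of m b 1 b 1 k] ev that by simp
      have "Rk (- k) = Rk k" unfolding Rk_def using n by (simp add: Qe) (intro sum.cong refl, auto simp: Qe ev)
      then have "q (- k) = q k" unfolding q_def using ev[of 1 k] n by simp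
      then show "C0 * q \<bar>k\<bar> = C0 * q k" by (simp add: abs_if)
    qed
    also have "\<dots> = C0 * (c1 * (\<Sum>k\<in>freqs n. Rk k) + \<bar>\<mu>\<bar> * (\<Sum>k\<in>freqs n. b 1 k))"
      by (simp add: q_def sum_distrib_left sum.distrib distrib_left)
    also have "(\<Sum>k\<in>freqs n. b 1 k) = tot X 1"
      unfolding tb[symmetric] using n by (intro wide bs) auto
    also have "C0 * (c1 * (\<Sum>k\<in>freqs n. Rk k) + \<bar>\<mu>\<bar> * tot X 1) \<le> C0 * (c1 * totR X n + \<bar>\<mu>\<bar> * tot X 1)"
      using C0 c1 sR by (intro mult_left_mono add_mono) auto
    also have "\<dots> = (C0 * c1) * totR X n + C0 * (\<bar>\<mu>\<bar> * tot X 1)" by (simp add: algebra_simps)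
    also have "\<dots> \<le> CC * totR X n + CC * (\<bar>\<mu>\<bar> * tot X 1)"
    proof (intro add_mono mult_right_mono CC R0)
      have "tot X 1 \<ge> 0" unfolding tb[symmetric] using n by (intro sum_nonneg b0) auto
      then show "0 \<le> \<bar>\<mu>\<bar> * tot X 1" by simp
    qed
    finally have "tot Y n \<le> CC * (totR X n + \<bar>cm r\<bar> * tot X 1)" by (simp add: r_def distrib_left)
    then show "\<exists>r. good (X(n := r)) n \<and> \<bar>cm r\<bar> \<le> CC * totR X n \<and> tot (X(n := r)) n \<le> CC * (totR X n + \<bar>cm r\<bar> * tot X 1)"
      using gY mu by (intro exI[of _ r]) (simp add: Y_def)
  qed
qed

end

section \<open>The scalar majorant\<close>

lemma finite_cauchy_le:
  fixes x y :: "nat \<Rightarrow> real"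
  assumes x: "\<And>i. x i \<ge> 0" and y: "\<And>i. y i \<ge> 0" and e: "e \<ge> 0"
  shows "(\<Sum>n\<in>{a..b}. e ^ n * (\<Sum>i\<in>{1..<n}. x i * y (n - i))) \<le> (\<Sum>i\<in>{1..<b}. e ^ i * x i) * (\<Sum>i\<in>{1..<b}. e ^ i * y i)"
proof -
  have "(\<Sum>n\<in>{a..b}. e ^ n * (\<Sum>i\<in>{1..<n}. x i * y (n - i))) = (\<Sum>n\<in>{a..b}. \<Sum>i\<in>{1..<n}. (e ^ i * x i) * (e ^ (n - i) * y (n - i)))"
  proof (intro sum.cong refl)
    fix n
    have "e ^ n = e ^ i * e ^ (n - i)" if "i \<in> {1..<n}" for i using that by (simp flip: power_add)
    then show "e ^ n * (\<Sum>i\<in>{1..<n}. x i * y (n - i)) = (\<Sum>i\<in>{1..<n}. (e ^ i * x i) * (e ^ (n - i) * y (n - i)))"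
      unfolding sum_distrib_left by (intro sum.cong refl) (metis (no_types, lifting) mult.assoc mult.left_commute)
  qed
  also have "\<dots> = (\<Sum>(n, i)\<in>Sigma {a..b} (\<lambda>n. {1..<n}). (e ^ i * x i) * (e ^ (n - i) * y (n - i)))"
    by (rule sum.Sigma) auto
  also have "\<dots> = (\<Sum>(i, j)\<in>(\<lambda>(n, i). (i, n - i)) ` Sigma {a..b} (\<lambda>n. {1..<n}). (e ^ i * x i) * (e ^ j * y j))"
    by (subst sum.reindex) (auto simp: inj_on_def case_prod_beta)
  also have "\<dots> \<le> (\<Sum>(i, j)\<in>{1..<b} \<times> {1..<b}. (e ^ i * x i) * (e ^ j * y j))"
    by (rule sum_mono2) (use x y e in \<open>auto intro!: mult_nonneg_nonneg\<close>)
  also have "\<dots> = (\<Sum>i\<in>{1..<b}. e ^ i * x i) * (\<Sum>i\<in>{1..<b}. e ^ i * y i)"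
    by (simp add: sum_product sum.cartesian_product)
  finally show ?thesis .
qed

text \<open>The bound for \<open>\<mu> (n - 1)\<close> by \<open>R n\<close> loses one power of
  \<open>\<epsilon>\<close>. It is recovered because \<open>R\<close> is quadratic: squares of
  \<open>T\<close> are of order \<open>\<epsilon>^2\<close>, and the product of \<open>M\<close>
  with the orders from two on carries the factor \<open>\<delta> \<epsilon>\<close>. The induction
  keeps the orders from two on below \<open>\<delta> \<epsilon>\<close> and the sums of
  \<open>\<mu>\<close> below \<open>\<delta>'\<close>.\<close>

lemma majorant_bound:
  fixes t \<mu> :: "nat \<Rightarrow> real"
  assumes t: "\<And>n. t n \<ge> 0" and \<mu>: "\<And>n. \<mu> n \<ge> 0" and C: "C \<ge> 0"
  defines "Q \<equiv> \<lambda>n. \<Sum>m\<in>{1..<n}. t m * t (n - m)"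
  defines "R \<equiv> \<lambda>n. Q n + (\<Sum>i\<in>{1..<n-1}. \<mu> i * (t (n - i) + Q (n - i)))"
  assumes t_le: "\<And>n. n \<ge> 2 \<Longrightarrow> t n \<le> C * (R n + \<mu> (n - 1) * t 1)"
    and \<mu>_le: "\<And>n. n \<ge> 2 \<Longrightarrow> \<mu> (n - 1) \<le> C * R n"
  shows "\<exists>\<epsilon>>0. \<exists>B. \<forall>n. (\<Sum>i\<in>{1..n}. \<epsilon> ^ i * t i) \<le> B \<and> (\<Sum>i\<in>{1..n}. \<epsilon> ^ i * \<mu> i) \<le> B"
proof -
  define c where "c = t 1"
  have c: "c \<ge> 0" using t by (simp add: c_def)
  define D where "D = max C 1"
  have D: "D \<ge> 1" "D \<ge> C" by (auto simp: D_def)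
  have Q0: "Q n \<ge> 0" for n unfolding Q_def using t by (intro sum_nonneg mult_nonneg_nonneg)
  have R0: "R n \<ge> 0" for n unfolding R_def using t \<mu> Q0 by (intro add_nonneg_nonneg sum_nonneg mult_nonneg_nonneg)
  \<comment> \<open>The three scales are nested: \<open>D \<delta> = 1 / 8\<close> makes the mixed
    product of \<open>M\<close> and \<open>Y\<close> a small fraction of \<open>\<delta>'\<close>;
    \<open>\<delta>'\<close> is small against \<open>\<delta>\<close> to pay for the term
    \<open>D c \<epsilon> M\<close> in the bound of \<open>Y\<close>; finally
    \<open>\<epsilon>\<close> makes the squares of the order one part small against
    \<open>\<delta>'\<close>.\<close>
  define \<delta> where "\<delta> = 1 / (8 * D)"
  define \<delta>' where "\<delta>' = \<delta> / (8 * D * (c + 1))"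
  have \<delta>: "\<delta> > 0" "\<delta> \<le> 1" using D by (auto simp: \<delta>_def)
  have \<delta>': "\<delta>' > 0" using \<delta> D c by (auto simp: \<delta>'_def intro!: divide_pos_pos mult_pos_pos)
  have \<delta>'1: "\<delta>' \<le> 1"
  proof -
    have "1 * 1 \<le> (8 * D) * (c + 1)" using D c by (intro mult_mono) auto
    then have "\<delta>' \<le> \<delta> / 1" unfolding \<delta>'_def using \<delta> by (intro divide_left_mono) auto
    then show ?thesis using \<delta> by simp
  qed
  define \<epsilon> where "\<epsilon> = min 1 (\<delta>' / (8 * D * (c + 1)\<^sup>2))"
  have c1: "(c + 1)\<^sup>2 \<ge> 1" using c by (simp add: one_le_power)
  have \<epsilon>: "\<epsilon> > 0" "\<epsilon> \<le> 1" using \<delta>' D c1 by (auto simp: \<epsilon>_def intro!: divide_pos_pos mult_pos_pos)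
  have \<epsilon>2: "\<epsilon> * (c + 1)\<^sup>2 * (8 * D) \<le> \<delta>'"
  proof -
    have "\<epsilon> \<le> \<delta>' / (8 * D * (c + 1)\<^sup>2)" by (simp add: \<epsilon>_def)
    moreover have "8 * D * (c + 1)\<^sup>2 > 0" using D c1 by (intro mult_pos_pos) auto
    ultimately show ?thesis by (simp add: pos_le_divide_eq mult_ac)
  qed
  define T where "T n = (\<Sum>i\<in>{1..<n}. \<epsilon> ^ i * t i)" for n
  define Y where "Y n = (\<Sum>i\<in>{2..<n}. \<epsilon> ^ i * t i)" for n
  define M where "M n = (\<Sum>i\<in>{1..<n}. \<epsilon> ^ i * \<mu> i)" for n
  have nn: "\<epsilon> ^ i * t i \<ge> 0" "\<epsilon> ^ i * \<mu> i \<ge> 0" "\<epsilon> ^ i * R i \<ge> 0" for i using \<epsilon> t \<mu> R0 by auto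
  have Y0: "Y n \<ge> 0" and M0: "M n \<ge> 0" and T0: "T n \<ge> 0" for n
    unfolding Y_def M_def T_def using nn by (auto intro!: sum_nonneg)
  have TY: "T n \<le> \<epsilon> * c + Y n" for n
  proof (cases "n \<ge> 2")
    case True
    then have "{1..<n} = insert 1 {2..<n}" by auto
    then show ?thesis by (simp add: T_def Y_def c_def)
  next
    case False
    then have "{1..<n} = {}" by auto
    then show ?thesis using Y0[of n] \<epsilon> c by (simp add: T_def)
  qed
  have sumQ: "(\<Sum>m\<in>{a..n}. \<epsilon> ^ m * Q m) \<le> (T n)\<^sup>2" for a n
    using finite_cauchy_le[OF t t less_imp_le[OF \<epsilon>(1)], where a=a and b=n] by (simp add: Q_def T_def power2_eq_square)
  have sumR: "(\<Sum>m\<in>{2..n}. \<epsilon> ^ m * R m) \<le> (T n)\<^sup>2 + M (n - 1) * (Y n + (T n)\<^sup>2)" for n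
  proof -
    \<comment> \<open>Truncation turns the inner sums, which stop before \<open>m - 1\<close>, into
      a full Cauchy product. Since \<open>z\<close> omits order one, the factor is the small sum
      \<open>Y\<close> and not \<open>T\<close>.\<close>
    define x where "x i = (if i < n - 1 then \<mu> i else 0)" for i
    define z where "z i = (if 2 \<le> i then t i + Q i else 0)" for i
    have x0: "x i \<ge> 0" and z0: "z i \<ge> 0" for i using \<mu> t Q0 by (auto simp: x_def z_def)
    have "(\<Sum>m\<in>{2..n}. \<epsilon> ^ m * (\<Sum>i\<in>{1..<m-1}. \<mu> i * (t (m - i) + Q (m - i)))) = (\<Sum>m\<in>{2..n}. \<epsilon> ^ m * (\<Sum>i\<in>{1..<m}. x i * z (m - i)))"
    proof (rule sum.cong[OF refl])
      fix m assume m: "m \<in> {2..n}"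
      have "(\<Sum>i\<in>{1..<m-1}. \<mu> i * (t (m - i) + Q (m - i))) = (\<Sum>i\<in>{1..<m-1}. x i * z (m - i))"
        using m by (intro sum.cong refl) (auto simp: x_def z_def)
      also have "\<dots> = (\<Sum>i\<in>{1..<m}. x i * z (m - i))"
        by (rule sum.mono_neutral_left) (auto simp: z_def)
      finally show "\<epsilon> ^ m * (\<Sum>i\<in>{1..<m-1}. \<mu> i * (t (m - i) + Q (m - i))) = \<epsilon> ^ m * (\<Sum>i\<in>{1..<m}. x i * z (m - i))"
        by simp
    qed
    also have "\<dots> \<le> (\<Sum>i\<in>{1..<n}. \<epsilon> ^ i * x i) * (\<Sum>i\<in>{1..<n}. \<epsilon> ^ i * z i)"
      by (rule finite_cauchy_le[OF x0 z0 less_imp_le[OF \<epsilon>(1)]])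
    also have "(\<Sum>i\<in>{1..<n}. \<epsilon> ^ i * x i) = M (n - 1)"
      unfolding M_def by (rule sum.mono_neutral_cong_right) (auto simp: x_def)
    also have "(\<Sum>i\<in>{1..<n}. \<epsilon> ^ i * z i) = (\<Sum>i\<in>{2..<n}. \<epsilon> ^ i * t i + \<epsilon> ^ i * Q i)"
      by (rule sum.mono_neutral_cong_right) (auto simp: z_def distrib_left)
    also have "\<dots> \<le> Y n + (\<Sum>i\<in>{2..n}. \<epsilon> ^ i * Q i)"
      unfolding Y_def sum.distrib using \<epsilon> Q0 by (intro add_mono sum_mono2) auto
    finally have *: "(\<Sum>m\<in>{2..n}. \<epsilon> ^ m * (\<Sum>i\<in>{1..<m-1}. \<mu> i * (t (m - i) + Q (m - i)))) \<le> M (n - 1) * (Y n + (T n)\<^sup>2)"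
      using sumQ[of 2 n] M0[of "n - 1"] by (meson add_left_mono mult_left_mono order_trans)
    have "(\<Sum>m\<in>{2..n}. \<epsilon> ^ m * R m) = (\<Sum>m\<in>{2..n}. \<epsilon> ^ m * Q m) + (\<Sum>m\<in>{2..n}. \<epsilon> ^ m * (\<Sum>i\<in>{1..<m-1}. \<mu> i * (t (m - i) + Q (m - i))))"
      by (simp add: R_def distrib_left sum.distrib)
    then show ?thesis using * sumQ[of 2 n] by linarith
  qed
  have main: "Y (Suc n) \<le> \<delta> * \<epsilon> \<and> M n \<le> \<delta>'" for n
  proof (induction n)
    case 0
    then show ?case using \<delta> \<delta>' \<epsilon> by (simp add: Y_def M_def)
  next
    case (Suc n)
    define n' where "n' = Suc n"
    have Yn: "Y n' \<le> \<delta> * \<epsilon>" and Mn: "M n \<le> \<delta>'" using Suc by (auto simp: n'_def)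
    have "T n' \<le> \<epsilon> * c + \<epsilon> * 1"
    proof -
      have "\<delta> * \<epsilon> \<le> 1 * \<epsilon>" using \<delta> \<epsilon> by (intro mult_right_mono) auto
      then show ?thesis using TY[of n'] Yn by linarith
    qed
    then have "(T n')\<^sup>2 \<le> (\<epsilon> * (c + 1))\<^sup>2" using T0 by (intro power_mono) (auto simp: distrib_left)
    also have "\<dots> = \<epsilon> * (\<epsilon> * (c + 1)\<^sup>2)" by (simp add: power2_eq_square)
    also have "\<dots> \<le> \<epsilon> * (\<delta>' / (8 * D))"
      using \<epsilon>2 D \<epsilon> by (intro mult_left_mono) (auto simp: pos_le_divide_eq)
    finally have T2: "(T n')\<^sup>2 \<le> \<epsilon> * (\<delta>' / (8 * D))" .
    define r where "r = \<delta>' / (8 * D)"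
    have r: "r \<ge> 0" "D * r = \<delta>' / 8" "r \<le> \<delta>'" using \<delta>' D by (auto simp: r_def divide_le_eq mult_le_cancel_left1)
    have SR: "(\<Sum>m\<in>{2..n'}. \<epsilon> ^ m * R m) \<le> \<epsilon> * (r + \<delta>' * (\<delta> + r))"
    proof -
      have "M (n' - 1) * (Y n' + (T n')\<^sup>2) \<le> \<delta>' * (\<delta> * \<epsilon> + \<epsilon> * r)"
        using Mn Yn T2 \<delta>' Y0[of n'] M0[of n] by (intro mult_mono add_mono) (auto simp: n'_def r_def)
      then have "(\<Sum>m\<in>{2..n'}. \<epsilon> ^ m * R m) \<le> \<epsilon> * r + \<delta>' * (\<delta> * \<epsilon> + \<epsilon> * r)"
        using sumR[of n'] T2 unfolding r_def by linarith
      then show ?thesis by (simp add: algebra_simps)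
    qed
    have Dr: "D * (r + \<delta>' * (\<delta> + r)) \<le> \<delta>' / 2"
    proof -
      have "D * (\<delta>' * (\<delta> + r)) = \<delta>' * (D * \<delta> + D * r)" by (simp add: algebra_simps)
      also have "\<dots> = \<delta>' * (1 / 8 + \<delta>' / 8)" using D r by (simp add: \<delta>_def)
      also have "\<dots> \<le> \<delta>' * (1 / 8 + 1 / 8)" using \<delta>' \<delta>'1 by (intro mult_left_mono) auto
      finally have "D * (\<delta>' * (\<delta> + r)) \<le> \<delta>' / 4" by simp
      then show ?thesis using r \<delta>' by (simp add: distrib_left)
    qed
    \<comment> \<open>The coefficient used at order \<open>m\<close> has index \<open>m - 1\<close>,
      so its weight is too large by one factor \<open>\<epsilon>\<close>; this is the power that has
      to be won back.\<close>
    have eM: "(\<Sum>m\<in>{2..n'}. \<epsilon> ^ m * \<mu> (m - 1)) = \<epsilon> * M n'"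
      unfolding M_def sum_distrib_left
      by (rule sum.reindex_bij_witness[of _ Suc "\<lambda>m. m - 1"]) (auto simp: mult.assoc power_Suc[symmetric] simp del: power_Suc)
    have SR': "D * (\<Sum>m\<in>{2..n'}. \<epsilon> ^ m * R m) \<le> \<epsilon> * (\<delta>' / 2)"
    proof -
      have "D * (\<Sum>m\<in>{2..n'}. \<epsilon> ^ m * R m) \<le> D * (\<epsilon> * (r + \<delta>' * (\<delta> + r)))" using SR D by (intro mult_left_mono) auto
      also have "\<dots> = \<epsilon> * (D * (r + \<delta>' * (\<delta> + r)))" by simp
      also have "\<dots> \<le> \<epsilon> * (\<delta>' / 2)" using Dr \<epsilon> by (intro mult_left_mono) auto
      finally show ?thesis .
    qed
    have "\<epsilon> * M n' \<le> (\<Sum>m\<in>{2..n'}. D * (\<epsilon> ^ m * R m))"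
      unfolding eM[symmetric]
    proof (rule sum_mono)
      fix m assume "m \<in> {2..n'}"
      then have "\<mu> (m - 1) \<le> C * R m" by (intro \<mu>_le) auto
      also have "\<dots> \<le> D * R m" using D R0 by (intro mult_right_mono)
      finally have "\<epsilon> ^ m * \<mu> (m - 1) \<le> \<epsilon> ^ m * (D * R m)" using \<epsilon> by (intro mult_left_mono) auto
      then show "\<epsilon> ^ m * \<mu> (m - 1) \<le> D * (\<epsilon> ^ m * R m)" by (simp add: mult_ac)
    qed
    also have "\<dots> = D * (\<Sum>m\<in>{2..n'}. \<epsilon> ^ m * R m)" by (simp add: sum_distrib_left)
    also note SR'
    finally have M2: "M n' \<le> \<delta>' / 2" using \<epsilon> by (simp only: mult_le_cancel_left_pos)
    have "Y (Suc n') = (\<Sum>m\<in>{2..n'}. \<epsilon> ^ m * t m)" by (simp add: Y_def atLeastLessThanSuc_atLeastAtMost)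
    also have "\<dots> \<le> (\<Sum>m\<in>{2..n'}. D * (\<epsilon> ^ m * R m) + D * c * (\<epsilon> ^ m * \<mu> (m - 1)))"
    proof (rule sum_mono)
      fix m assume "m \<in> {2..n'}"
      then have "t m \<le> C * (R m + \<mu> (m - 1) * t 1)" by (intro t_le) auto
      also have "\<dots> \<le> D * (R m + \<mu> (m - 1) * c)" unfolding c_def using D R0 \<mu> t by (intro mult_right_mono) auto
      finally have "\<epsilon> ^ m * t m \<le> \<epsilon> ^ m * (D * (R m + \<mu> (m - 1) * c))" using \<epsilon> by (intro mult_left_mono) auto
      then show "\<epsilon> ^ m * t m \<le> D * (\<epsilon> ^ m * R m) + D * c * (\<epsilon> ^ m * \<mu> (m - 1))" by (simp add: algebra_simps)
    qed
    also have "\<dots> = D * (\<Sum>m\<in>{2..n'}. \<epsilon> ^ m * R m) + D * c * (\<Sum>m\<in>{2..n'}. \<epsilon> ^ m * \<mu> (m - 1))"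
      by (simp add: sum.distrib sum_distrib_left)
    also note eM
    also have "D * (\<Sum>m\<in>{2..n'}. \<epsilon> ^ m * R m) + D * c * (\<epsilon> * M n') \<le> \<epsilon> * (\<delta>' / 2) + D * c * (\<epsilon> * (\<delta>' / 2))"
      using M2 SR' D c \<epsilon> by (intro add_mono mult_left_mono) auto
    also have "\<dots> = \<epsilon> * ((1 + D * c) * (\<delta>' / 2))" by (simp add: algebra_simps)
    also have "\<dots> \<le> \<epsilon> * \<delta>"
    proof (rule mult_left_mono)
      have "(1 + D * c) * (\<delta>' / 2) \<le> (8 * D * (c + 1)) * \<delta>'"
      proof -
        have "8 * D * (c + 1) = 8 * (D * c) + 8 * D" by (simp add: algebra_simps)
        moreover have "D * c \<ge> 0" using D c by simp
        ultimately have "1 + D * c \<le> 8 * D * (c + 1)" using D by linarith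
        then have "(1 + D * c) * (\<delta>' / 2) \<le> (8 * D * (c + 1)) * (\<delta>' / 2)" using \<delta>' by (intro mult_right_mono) auto
        also have "\<dots> \<le> (8 * D * (c + 1)) * \<delta>'" using \<delta>' D c by (intro mult_left_mono) auto
        finally show ?thesis .
      qed
      also have "(8 * D * (c + 1)) * \<delta>' = \<delta>" using D c by (simp add: \<delta>'_def)
      finally show "(1 + D * c) * (\<delta>' / 2) \<le> \<delta>" .
    qed (use \<epsilon> in simp)
    finally have "Y (Suc n') \<le> \<delta> * \<epsilon>" by (simp add: mult.commute)
    then show ?case using M2 \<delta>' by (simp add: n'_def)
  qed
  define B where "B = c + 1 + \<delta>'"
  show ?thesis
  proof (rule exI[of _ \<epsilon>], rule conjI[OF \<epsilon>(1)], rule exI[of _ B], intro allI conjI)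
    fix n
    have "\<epsilon> * c \<le> 1 * c" "\<delta> * \<epsilon> \<le> 1 * 1" using \<epsilon> c \<delta> mult_right_mono[of \<epsilon> 1 c] mult_mono[of \<delta> 1 \<epsilon> 1] by simp_all
    then have "T (Suc n) \<le> B" using TY[of "Suc n"] conjunct1[OF main[of n]] \<delta>' by (simp add: B_def)
    then show "(\<Sum>i\<in>{1..n}. \<epsilon> ^ i * t i) \<le> B" by (simp add: T_def atLeastLessThanSuc_atLeastAtMost)
    have "M (Suc n) \<le> B" using conjunct2[OF main[of "Suc n"]] c by (simp add: B_def)
    then show "(\<Sum>i\<in>{1..n}. \<epsilon> ^ i * \<mu> i) \<le> B" by (simp add: M_def atLeastLessThanSuc_atLeastAtMost)
  qed
qed

section \<open>The first order and the recursion over all orders\<close>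

context schiffer
begin

text \<open>The boundary amplitude at first order: the rule \<open>\<gamma> = b 1 / Lam\<close> from
  \<open>mode_solve\<close> with \<open>b\<close> the derivative of the Dirichlet eigenfunction. It
  becomes the constant \<open>\<gamma>\<close> of the theorem and, up to a factor,
  \<open>\<beta>\<close>.\<close>

definition "gh = rad' N (- l1) 1 / Lam"

lemma gh_nonzero: "gh \<noteq> 0"
  using bes1_l1 l1 Lam by (simp add: gh_def rad'_def)

definition zero_coefs :: coefs where
  "zero_coefs = Coefs (\<lambda>_. 0) (\<lambda>_ _. 0) (\<lambda>_ _. 0) (\<lambda>_ _. 0) (\<lambda>_ _. 0) (\<lambda>_ _. 0) (\<lambda>_ _. 0) 0 (\<lambda>_. 0)"

definition first_order :: "coefs \<Rightarrow> bool" where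
  "first_order r \<longleftrightarrow> first r \<and> (\<forall>k. cg r k = (if \<bar>k\<bar> = 1 then gh / 2 else 0)) \<and>
     (\<forall>k y. cu r k y = (if \<bar>k\<bar> = 1 then (rad N (- l1) y + gh * y * U' y) / 2 else 0))"

text \<open>At order one all convolutions are empty, so the resonant problem at \<open>k = 1\<close>
  is homogeneous and is solved by the Dirichlet eigenfunction itself. This choice selects the
  direction of the branch.\<close>

lemma first_order_exists: "\<exists>r. first_order r \<and> (\<forall>X. X 1 = r \<longrightarrow> good X 1)"
proof -
  define \<phi> where "\<phi> = rad N (- l1)"
  define \<phi>' where "\<phi>' = rad' N (- l1)"
  define \<phi>'' where "\<phi>'' = rad'' N (- l1)"
  have \<phi>d: "(\<phi> has_real_derivative \<phi>' y) (at y within S)" "(\<phi>' has_real_derivative \<phi>'' y) (at y within S)" for y S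
    unfolding \<phi>_def \<phi>'_def \<phi>''_def by (rule DERIV_rad[OF N] DERIV_rad'[OF N])+
  have \<phi>c: "continuous_on S \<phi>" "continuous_on S \<phi>'" "continuous_on S \<phi>''" for S
    unfolding \<phi>_def \<phi>'_def \<phi>''_def by (rule continuous_on_rad[OF N])+
  have \<phi>o: "y * \<phi>'' y + (real N - 1) * \<phi>' y = - l1 * y * \<phi> y" for y
    unfolding \<phi>_def \<phi>'_def \<phi>''_def by (rule rad_ode[OF N])
  define Y where "Y y = - (real N - 1) * U'' y - Lam * (U y + y * U' y)" for y
  define p where "p y = (\<phi>' y + gh * (y * U'' y)) / 2" for y
  define p' where "p' y = (\<phi>'' y + gh * Y y) / 2" for y
  define u where "u y = (\<phi> y + gh * y * U' y) / 2" for y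
  define u' where "u' y = (\<phi>' y + gh * (U' y + y * U'' y)) / 2" for y
  have pc: "continuous_on {0..1} p'" "continuous_on {0..1} u'" "continuous_on {0..1} p" "continuous_on {0..1} u"
    unfolding p'_def u'_def p_def u_def Y_def by (auto intro!: continuous_intros \<phi>c continuous_U)
  obtain b where b: "b \<ge> 0" and "\<forall>y\<in>{0..1}. \<bar>\<bar>p y\<bar> + \<bar>p' y\<bar> + \<bar>u y\<bar> + \<bar>u' y\<bar> + \<bar>\<phi> y\<bar> + \<bar>\<phi>' y\<bar>\<bar> \<le> b"
    by (rule continuous_unit_interval_bound[of "\<lambda>y. \<bar>p y\<bar> + \<bar>p' y\<bar> + \<bar>u y\<bar> + \<bar>u' y\<bar> + \<bar>\<phi> y\<bar> + \<bar>\<phi>' y\<bar>"])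
      (intro continuous_intros pc \<phi>c, rule that)
  then have bd: "\<bar>p y\<bar> + \<bar>p' y\<bar> + \<bar>u y\<bar> + \<bar>u' y\<bar> + \<bar>\<phi> y\<bar> + \<bar>\<phi>' y\<bar> \<le> b" if "y \<in> {0..1}" for y
    using that by (blast intro: order_trans[OF abs_ge_self])
  define B where "B = \<bar>gh\<bar> + 2 * b"
  define m where "m c k = (if \<bar>k\<bar> = (1::int) then c else 0)" for c :: real and k
  define mf where "mf f k = (if \<bar>k\<bar> = (1::int) then f else (\<lambda>_. 0))" for f :: "real \<Rightarrow> real" and k
  define r where "r = Coefs (m (gh / 2)) (mf p) (mf p') (mf (\<lambda>y. \<phi> y / 2)) (mf (\<lambda>y. \<phi>' y / 2)) (mf u) (mf u') 0 (m B)"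
  have B0: "B \<ge> 0" using b by (simp add: B_def)
  have fo: "first_order r"
    by (auto simp: first_order_def first_def r_def m_def mf_def u_def \<phi>_def)
  have "good X 1" if X: "X 1 = r" for X
  proof -
    have src: "sA X 1 k = (\<lambda>_. 0)" "sC X 1 k = (\<lambda>_. 0)" "sD X 1 k = (\<lambda>_. 0)" "sS X 1 k = (\<lambda>_. 0)" for k
      by (simp_all add: fun_eq_iff sA_def sC_def sD_def sS_def sH_def sG_def cnv_def)
    have m1: "mode_eqs 1 (\<lambda>_. 0) (\<lambda>_. 0) (\<lambda>_. 0) (\<lambda>_. 0) (gh / 2) p p' (\<lambda>y. \<phi> y / 2) (\<lambda>y. \<phi>' y / 2) u u' B"
      unfolding mode_eqs_def
    proof (intro conjI ballI)
      show "continuous_on {0..1} p'" "continuous_on {0..1} (\<lambda>y. \<phi>' y / 2)" "continuous_on {0..1} u'"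
        using pc by (auto intro!: continuous_intros \<phi>c)
      show "p 0 = 0" "\<phi>' 0 / 2 = 0" by (simp_all add: p_def \<phi>'_def)
      show "p 1 = 0" using Lam by (simp add: p_def gh_def \<phi>'_def)
      show "\<phi> 1 / 2 = 0" "u 1 = 0" using l1 by (simp_all add: \<phi>_def rad_def u_def)
      show "(1 + real 1) * \<bar>gh / 2\<bar> \<le> B" using b by (simp add: B_def)
      fix y :: real assume y: "y \<in> {0..1}"
      show "(p has_real_derivative p' y) (at y within {0..1})"
        unfolding p_def[abs_def] p'_def Y_def by (intro DERIV_cdivide DERIV_add DERIV_cmult \<phi>d DERIV_U)
      show "((\<lambda>y. \<phi> y / 2) has_real_derivative \<phi>' y / 2) (at y within {0..1})" by (intro DERIV_cdivide \<phi>d)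
      show "(u has_real_derivative u' y) (at y within {0..1})"
        unfolding u_def[abs_def] u'_def by (auto intro!: derivative_eq_intros \<phi>d DERIV_U simp: algebra_simps)
      show "u' y = p y + gh / 2 * U' y + 0" by (simp add: u'_def p_def field_simps)
      show "real 1 * u y = real 1 * (\<phi> y / 2) + y * real 1 * (gh / 2) * U' y + 0" by (simp add: u_def field_simps)
      show "real 1 * (\<phi>' y / 2) = real 1 * p y - y * real 1 * (gh / 2) * U'' y + 0" by (simp add: p_def field_simps)
      have "y * p' y + (real N - 1) * p y + y * Lam * (u y + gh / 2 * U y) - y * M0 * (real 1)\<^sup>2 * (\<phi> y / 2) + y * 0
        = ((y * \<phi>'' y + (real N - 1) * \<phi>' y) + y * Lam * \<phi> y - y * M0 * \<phi> y) / 2"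
        by (simp add: p'_def p_def u_def Y_def field_simps)
      then show "y * p' y + (real N - 1) * p y + y * Lam * (u y + gh / 2 * U y) - y * M0 * (real 1)\<^sup>2 * (\<phi> y / 2) + y * 0 = 0"
        unfolding \<phi>o by (simp add: M0_def algebra_simps)
      show "(1 + real 1) * \<bar>p y\<bar> \<le> B" "\<bar>p' y\<bar> \<le> B" "(1 + real 1)\<^sup>2 * \<bar>\<phi> y / 2\<bar> \<le> B" "(1 + real 1) * \<bar>\<phi>' y / 2\<bar> \<le> B"
        "(1 + real 1) * \<bar>u y\<bar> \<le> B" "\<bar>u' y\<bar> \<le> B"
        using bd[OF y] by (simp_all add: B_def)
    qed
    have m0: "mode_eqs 0 (\<lambda>_. 0) (\<lambda>_. 0) (\<lambda>_. 0) (\<lambda>_. 0) 0 (\<lambda>_. 0) (\<lambda>_. 0) (\<lambda>_. 0) (\<lambda>_. 0) (\<lambda>_. 0) (\<lambda>_. 0) 0"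
      by (simp add: mode_eqs_def)
    show ?thesis
      unfolding good_def X src
    proof (intro conjI allI impI)
      fix k :: nat assume "k \<le> 1"
      then consider "k = 0" | "k = 1" by linarith
      then show "mode_eqs k (\<lambda>_. 0) (\<lambda>_. 0) (\<lambda>_. 0) (\<lambda>_. 0) (cg r (int k)) (cp r (int k)) (cp' r (int k)) (cv r (int k))
        (cv' r (int k)) (cu r (int k)) (cu' r (int k)) (cb r (int k))"
        using m0 m1 by cases (simp_all add: r_def m_def mf_def)
    qed (use B0 in \<open>auto simp: r_def m_def mf_def\<close>)
  qed
  then show ?thesis using fo by blast
qed

lemma tot_cong: "X n = Y n \<Longrightarrow> tot X n = tot Y n"
  by (simp add: tot_def)

text \<open>The orders are chosen one after the other, each depending on all previous ones; the
  estimates of \<open>order_step\<close> are exactly the recursive inequalities of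
  \<open>majorant_bound\<close>, with \<open>\<mu> i\<close> standing for
  \<open>cm (X (Suc i))\<close>.\<close>

lemma expansion_exists:
  "\<exists>X \<epsilon>. \<epsilon> > 0 \<and> X 0 = zero_coefs \<and> first_order (X 1) \<and> (\<forall>n\<ge>1. good X n) \<and>
     summable (\<lambda>n. tot X n * \<epsilon> ^ n) \<and> summable (\<lambda>n. \<bar>cm (X (Suc n))\<bar> * \<epsilon> ^ n)"
proof -
  obtain CC where CC: "CC \<ge> 0" and step: "\<And>X n. n \<ge> 2 \<Longrightarrow> (\<forall>m. 1 \<le> m \<and> m < n \<longrightarrow> good X m) \<Longrightarrow> first (X 1) \<Longrightarrow>
     (\<exists>r. good (X(n := r)) n \<and> \<bar>cm r\<bar> \<le> CC * totR X n \<and> tot (X(n := r)) n \<le> CC * (totR X n + \<bar>cm r\<bar> * tot X 1))"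
    using order_step by (elim exE conjE) blast
  obtain r1 where r1: "first_order r1" "\<And>X. X 1 = r1 \<Longrightarrow> good X 1" using first_order_exists by blast
  \<comment> \<open>Recursion along a wellorder demands that the predicate at \<open>n\<close>
    depend on \<open>f\<close> only below \<open>n\<close>; \<open>Z\<close> keeps these values and
    puts the candidate \<open>r\<close> everywhere else.\<close>
  define Z where "Z f n r = (\<lambda>i. if i < n then f i else r)" for f :: "nat \<Rightarrow> coefs" and n :: nat and r
  define P where "P f n r \<longleftrightarrow> (n = 0 \<longrightarrow> r = zero_coefs) \<and> (n = 1 \<longrightarrow> r = r1) \<and> (n \<ge> 2 \<longrightarrow>
     good (Z f n r) n \<and> \<bar>cm r\<bar> \<le> CC * totR (Z f n r) n \<and> tot (Z f n r) n \<le> CC * (totR (Z f n r) n + \<bar>cm r\<bar> * tot (Z f n r) 1))" for f n r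
  have good_f: "good f m" if "P f m (f m)" "1 \<le> m" for f m
  proof (cases "m = 1")
    case True
    then show ?thesis using that r1(2)[of f] by (simp add: P_def)
  next
    case False
    then have "good (Z f m (f m)) m" using that by (simp add: P_def)
    then show ?thesis using good_cong[of m "Z f m (f m)" f] by (auto simp: Z_def)
  qed
  have "\<exists>f. \<forall>n. P f n (f n)"
  proof (rule dependent_wellorder_choice)
    show "P f n r = P g n r" if "\<And>m. m < n \<Longrightarrow> f m = g m" for r f g n
    proof -
      have "Z f n r = Z g n r" using that by (auto simp: Z_def)
      then show ?thesis by (simp add: P_def)
    qed
    show "\<exists>r. P f n r" if prev: "\<And>m. m < n \<Longrightarrow> P f m (f m)" for n f
    proof (cases "n \<ge> 2")
      case False
      then have "n = 0 \<or> n = 1" by linarith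
      then show ?thesis by (auto simp: P_def)
    next
      case True
      have "\<forall>m. 1 \<le> m \<and> m < n \<longrightarrow> good f m" using good_f prev by blast
      moreover have "first (f 1)" using prev[of 1] True r1(1) by (simp add: P_def first_order_def)
      ultimately obtain r where r: "good (f(n := r)) n" "\<bar>cm r\<bar> \<le> CC * totR f n" "tot (f(n := r)) n \<le> CC * (totR f n + \<bar>cm r\<bar> * tot f 1)"
        using step[OF True, of f] by blast
      have "good (Z f n r) n" using r(1) good_cong[of n "f(n := r)" "Z f n r"] by (auto simp: Z_def)
      moreover have "totR (Z f n r) n = totR f n" by (rule src_cong) (simp add: Z_def)
      moreover have "tot (Z f n r) n = tot (f(n := r)) n" "tot (Z f n r) 1 = tot f 1"
        using True by (auto intro!: tot_cong simp: Z_def)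
      ultimately show ?thesis using r True by (intro exI[of _ r]) (simp add: P_def)
    qed
  qed
  then obtain X where X: "\<And>n. P X n (X n)" by blast
  have gX: "good X n" if "n \<ge> 1" for n using good_f[OF X that] .
  have X0: "X 0 = zero_coefs" and X1: "X 1 = r1" using X[of 0] X[of 1] by (auto simp: P_def)
  have bnd: "\<bar>cm (X n)\<bar> \<le> CC * totR X n" "tot X n \<le> CC * (totR X n + \<bar>cm (X n)\<bar> * tot X 1)" if n: "n \<ge> 2" for n
  proof -
    have "totR (Z X n (X n)) n = totR X n" by (rule src_cong) (simp add: Z_def)
    moreover have "tot (Z X n (X n)) n = tot X n" "tot (Z X n (X n)) 1 = tot X 1"
      using n by (auto intro!: tot_cong simp: Z_def)
    ultimately show "\<bar>cm (X n)\<bar> \<le> CC * totR X n" "tot X n \<le> CC * (totR X n + \<bar>cm (X n)\<bar> * tot X 1)"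
      using X[of n] n by (simp_all add: P_def)
  qed
  define \<mu> where "\<mu> i = \<bar>cm (X (Suc i))\<bar>" for i
  have t0: "tot X n \<ge> 0" for n
  proof (cases "n = 0")
    case True
    then show ?thesis by (simp add: tot_def X0 zero_coefs_def)
  next
    case False
    then have "good X n" using gX by simp
    then show ?thesis unfolding tot_def by (intro sum_nonneg good_mode(1))
  qed
  have R: "totR X n = (\<Sum>m = 1..<n. tot X m * tot X (n - m)) + (\<Sum>i = 1..<n - 1. \<mu> i * (tot X (n - i) + (\<Sum>m = 1..<n - i. tot X m * tot X (n - i - m))))" for n
    by (simp add: totR_def totQ_def \<mu>_def)
  have \<mu>n: "\<mu> (n - 1) = \<bar>cm (X n)\<bar>" if "n \<ge> 2" for n using that by (simp add: \<mu>_def)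
  have "\<exists>\<epsilon>>0. \<exists>B. \<forall>n. (\<Sum>i\<in>{1..n}. \<epsilon> ^ i * tot X i) \<le> B \<and> (\<Sum>i\<in>{1..n}. \<epsilon> ^ i * \<mu> i) \<le> B"
    by (rule majorant_bound[OF t0 _ CC]) (use bnd R \<mu>n in \<open>auto simp: \<mu>_def\<close>)
  then obtain \<epsilon> B where e: "\<epsilon> > 0" "\<And>n. (\<Sum>i\<in>{1..n}. \<epsilon> ^ i * tot X i) \<le> B" "\<And>n. (\<Sum>i\<in>{1..n}. \<epsilon> ^ i * \<mu> i) \<le> B" by blast
  have sm: "summable (\<lambda>n. a n * \<epsilon> ^ n)" if a: "\<And>n. a n \<ge> 0" and b: "\<And>n. (\<Sum>i\<in>{1..n}. \<epsilon> ^ i * a i) \<le> B" for a :: "nat \<Rightarrow> real"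
  proof (rule bounded_imp_summable)
    show "0 \<le> a n * \<epsilon> ^ n" for n using a e by simp
    fix n :: nat
    have "{..n} = insert 0 {1..n}" by auto
    then have "(\<Sum>i\<le>n. a i * \<epsilon> ^ i) = a 0 + (\<Sum>i\<in>{1..n}. \<epsilon> ^ i * a i)" by (simp add: mult.commute)
    then show "(\<Sum>i\<le>n. a i * \<epsilon> ^ i) \<le> a 0 + B" using b[of n] by simp
  qed
  have "summable (\<lambda>n. tot X n * \<epsilon> ^ n)" "summable (\<lambda>n. \<bar>cm (X (Suc n))\<bar> * \<epsilon> ^ n)"
    using sm[OF t0 e(2)] sm[of \<mu>] e(3) by (auto simp: \<mu>_def)
  then show ?thesis using e(1) X0 X1 r1(1) gX by blast
qed

end

section \<open>Summation of the series\<close>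

text \<open>The phase \<open>\<delta>\<close> makes the class closed under \<open>\<partial>\<^sub>x\<close>, which multiplies by \<open>k\<close> and shifts \<open>\<delta>\<close> by \<open>pi / 2\<close>.\<close>

definition tst :: "real \<Rightarrow> (nat \<Rightarrow> int \<Rightarrow> real) \<Rightarrow> real \<Rightarrow> real \<Rightarrow> nat \<Rightarrow> real" where
  "tst \<delta> a s x n = s ^ n * (\<Sum>k\<in>freqs n. a n k * cos (of_int k * x + \<delta>))"

definition ts :: "real \<Rightarrow> (nat \<Rightarrow> int \<Rightarrow> real) \<Rightarrow> real \<Rightarrow> real \<Rightarrow> real" where
  "ts \<delta> a s x = (\<Sum>n. tst \<delta> a s x n)"

lemma tst_bound:
  assumes "(\<Sum>k\<in>freqs n. \<bar>a n k\<bar>) \<le> b" "\<bar>s\<bar> \<le> e"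
  shows "\<bar>tst \<delta> a s x n\<bar> \<le> b * e ^ n"
proof -
  have "\<bar>\<Sum>k\<in>freqs n. a n k * cos (of_int k * x + \<delta>)\<bar> \<le> (\<Sum>k\<in>freqs n. \<bar>a n k\<bar>)"
  proof (intro order_trans[OF sum_abs] sum_mono)
    fix k
    have "\<bar>a n k\<bar> * \<bar>cos (of_int k * x + \<delta>)\<bar> \<le> \<bar>a n k\<bar> * 1" by (intro mult_left_mono) auto
    then show "\<bar>a n k * cos (of_int k * x + \<delta>)\<bar> \<le> \<bar>a n k\<bar>" by (simp add: abs_mult)
  qed
  then have 1: "\<bar>\<Sum>k\<in>freqs n. a n k * cos (of_int k * x + \<delta>)\<bar> \<le> b" using assms(1) by linarith
  have "\<bar>s\<bar> ^ n \<le> e ^ n" using assms(2) by (intro power_mono) auto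
  then have "\<bar>s\<bar> ^ n * \<bar>\<Sum>k\<in>freqs n. a n k * cos (of_int k * x + \<delta>)\<bar> \<le> e ^ n * b"
    using 1 assms(2) by (intro mult_mono) auto
  then show ?thesis by (simp add: tst_def abs_mult power_abs mult.commute)
qed

lemma ts_summable:
  assumes B: "\<And>n. (\<Sum>k\<in>freqs n. \<bar>a n k\<bar>) \<le> B n" "summable (\<lambda>n. B n * e ^ n)" and s: "\<bar>s\<bar> \<le> e"
  shows "summable (\<lambda>n. \<bar>tst \<delta> a s x n\<bar>)" "summable (tst \<delta> a s x)"
    "\<bar>ts \<delta> a s x\<bar> \<le> (\<Sum>n. B n * e ^ n)"
proof -
  show 1: "summable (\<lambda>n. \<bar>tst \<delta> a s x n\<bar>)"
    by (rule summable_comparison_test'[OF B(2), of 0]) (auto intro!: tst_bound B(1) s)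
  then show "summable (tst \<delta> a s x)" by (rule summable_rabs_cancel)
  have "norm (\<Sum>n. tst \<delta> a s x n) \<le> (\<Sum>n. B n * e ^ n)"
    by (rule norm_suminf_le) (auto intro!: tst_bound B s)
  then show "\<bar>ts \<delta> a s x\<bar> \<le> (\<Sum>n. B n * e ^ n)" by (simp add: ts_def)
qed

lemma ts_uniform:
  assumes B: "\<And>n y. y \<in> S \<Longrightarrow> (\<Sum>k\<in>freqs n. \<bar>f n k y\<bar>) \<le> B n" "summable (\<lambda>n. B n * e ^ n)" and s: "\<bar>s\<bar> \<le> e"
  shows "uniform_limit (S \<times> UNIV) (\<lambda>m z. \<Sum>n<m. tst \<delta> (\<lambda>n k. f n k (fst z)) s (snd z) n)
    (\<lambda>z. ts \<delta> (\<lambda>n k. f n k (fst z)) s (snd z)) sequentially"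
  unfolding ts_def
  by (rule Weierstrass_m_test[OF _ B(2)]) (auto intro!: tst_bound B(1) s)

lemma ts_continuous:
  fixes S :: "real set"
  assumes B: "\<And>n y. y \<in> S \<Longrightarrow> (\<Sum>k\<in>freqs n. \<bar>f n k y\<bar>) \<le> B n" "summable (\<lambda>n. B n * e ^ n)" and s: "\<bar>s\<bar> \<le> e"
    and c: "\<And>n k. continuous_on S (f n k)"
  shows "continuous_on (S \<times> UNIV) (\<lambda>z. ts \<delta> (\<lambda>n k. f n k (fst z)) s (snd z))"
proof (rule uniform_limit_theorem[OF _ ts_uniform[OF B s]])
  have "continuous_on (S \<times> UNIV) (\<lambda>z. f n k (fst z))" for n k
    by (rule continuous_on_compose2[OF c]) (auto intro!: continuous_intros)
  then show "\<forall>\<^sub>F m in sequentially. continuous_on (S \<times> UNIV) (\<lambda>z. \<Sum>n<m. tst \<delta> (\<lambda>n k. f n k (fst z)) s (snd z) n)"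
    unfolding tst_def by (intro always_eventually allI) (auto intro!: continuous_intros)
qed auto

lemma ts_DERIV_y:
  assumes B: "\<And>n y. y \<in> S \<Longrightarrow> (\<Sum>k\<in>freqs n. \<bar>f n k y\<bar>) \<le> B n" "summable (\<lambda>n. B n * e ^ n)" and s: "\<bar>s\<bar> \<le> e"
    and B': "\<And>n y. y \<in> S \<Longrightarrow> (\<Sum>k\<in>freqs n. \<bar>f' n k y\<bar>) \<le> B n"
    and d: "\<And>n k y. y \<in> S \<Longrightarrow> (f n k has_real_derivative f' n k y) (at y within S)"
    and S: "convex S" "y \<in> S"
  shows "((\<lambda>y. ts \<delta> (\<lambda>n k. f n k y) s x) has_real_derivative ts \<delta> (\<lambda>n k. f' n k y) s x) (at y within S)"
proof -
  have "\<exists>g. \<forall>y\<in>S. (\<lambda>n. tst \<delta> (\<lambda>n k. f n k y) s x n) sums g y \<and>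
      (g has_field_derivative ts \<delta> (\<lambda>n k. f' n k y) s x) (at y within S)"
  proof (rule has_field_derivative_series[OF S(1) _ _ S(2)])
    show "((\<lambda>y. tst \<delta> (\<lambda>n k. f n k y) s x n) has_field_derivative tst \<delta> (\<lambda>n k. f' n k y) s x n) (at y within S)"
      if "y \<in> S" for n y
      unfolding tst_def by (intro DERIV_cmult DERIV_sum DERIV_cmult_right d that)
    show "uniform_limit S (\<lambda>n y. \<Sum>i<n. tst \<delta> (\<lambda>n k. f' n k y) s x i) (\<lambda>y. ts \<delta> (\<lambda>n k. f' n k y) s x) sequentially"
      unfolding ts_def by (rule Weierstrass_m_test[OF _ B(2)]) (auto intro!: tst_bound B' s)
    show "summable (\<lambda>n. tst \<delta> (\<lambda>n k. f n k y) s x n)" using ts_summable(2)[OF B(1)[OF S(2)] B(2) s] .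
  qed
  then obtain g where g: "\<And>y. y \<in> S \<Longrightarrow> (\<lambda>n. tst \<delta> (\<lambda>n k. f n k y) s x n) sums g y"
      "\<And>y. y \<in> S \<Longrightarrow> (g has_field_derivative ts \<delta> (\<lambda>n k. f' n k y) s x) (at y within S)" by blast
  have "g y = ts \<delta> (\<lambda>n k. f n k y) s x" if "y \<in> S" for y using g(1)[OF that] by (simp add: ts_def sums_iff)
  then show ?thesis using has_field_derivative_transform_within[OF g(2)[OF S(2)] zero_less_one S(2)] by simp
qed

lemma ts_DERIV_x:
  assumes B: "\<And>n. (\<Sum>k\<in>freqs n. \<bar>a n k\<bar>) \<le> B n" "summable (\<lambda>n. B n * e ^ n)" and s: "\<bar>s\<bar> \<le> e"
    and B': "\<And>n. (\<Sum>k\<in>freqs n. \<bar>of_int k * a n k\<bar>) \<le> B n"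
  shows "((\<lambda>x. ts \<delta> a s x) has_real_derivative ts (\<delta> + pi / 2) (\<lambda>n k. of_int k * a n k) s x) (at x)"
proof -
  have "\<exists>g. \<forall>x\<in>UNIV. (\<lambda>n. tst \<delta> a s x n) sums g x \<and>
      (g has_field_derivative ts (\<delta> + pi / 2) (\<lambda>n k. of_int k * a n k) s x) (at x within UNIV)"
  proof (rule has_field_derivative_series)
    show "((\<lambda>x. tst \<delta> a s x n) has_field_derivative tst (\<delta> + pi / 2) (\<lambda>n k. of_int k * a n k) s x n) (at x within UNIV)" for n x
    proof -
      have c: "cos (of_int k * x + (\<delta> + pi / 2)) = - sin (of_int k * x + \<delta>)" for k :: int
        using minus_sin_cos_eq[of "of_int k * x + \<delta>"] by (simp add: add.assoc)
      show ?thesis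
        unfolding tst_def c by (auto intro!: derivative_eq_intros simp: mult_ac)
    qed
    show "uniform_limit UNIV (\<lambda>n x. \<Sum>i<n. tst (\<delta> + pi / 2) (\<lambda>n k. of_int k * a n k) s x i)
       (\<lambda>x. ts (\<delta> + pi / 2) (\<lambda>n k. of_int k * a n k) s x) sequentially"
      unfolding ts_def by (rule Weierstrass_m_test[OF _ B(2)]) (auto intro!: tst_bound B' s)
    show "summable (\<lambda>n. tst \<delta> a s 0 n)" using ts_summable(2)[OF B s] .
  qed auto
  then obtain g where g: "\<And>x. (\<lambda>n. tst \<delta> a s x n) sums g x"
      "\<And>x. (g has_field_derivative ts (\<delta> + pi / 2) (\<lambda>n k. of_int k * a n k) s x) (at x)" by auto
  have "g = ts \<delta> a s" using g(1) by (auto simp: ts_def sums_iff)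
  then show ?thesis using g(2) by simp
qed

text \<open>The product formula produces cosines of sums and of differences with a factor one half.
  The parity of \<open>g\<close>, matched with its phase, turns the differences into the sums under
  \<open>l \<mapsto> - l\<close>, so that a plain convolution without any factor remains.\<close>

lemma cos_sum_mult:
  fixes g :: "int \<Rightarrow> real"
  assumes par: "\<And>l. g (- l) = \<sigma> * g l" and \<delta>': "\<sigma> = 1 \<and> \<delta>' = 0 \<or> \<sigma> = -1 \<and> \<delta>' = pi / 2"
    and supp: "\<And>l. \<bar>l\<bar> > int p \<Longrightarrow> g l = 0"
  shows "(\<Sum>j\<in>freqs m. a j * cos (of_int j * x + \<delta>)) * (\<Sum>l\<in>freqs p. g l * cos (of_int l * x + \<delta>'))
    = (\<Sum>k\<in>freqs (m + p). (\<Sum>j\<in>freqs m. a j * g (k - j)) * cos (of_int k * x + (\<delta> + \<delta>')))"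
proof -
  have shift: "\<sigma> * cos (\<theta> - \<delta>') = cos (\<theta> + \<delta>')" for \<theta>
    using \<delta>' by (elim disjE conjE; simp only:) (simp_all add: cos_add cos_diff)
  have 1: "cos A * (\<Sum>l\<in>freqs p. g l * cos (of_int l * x + \<delta>')) = (\<Sum>l\<in>freqs p. g l * cos (A + of_int l * x + \<delta>'))" for A
  proof -
    have "(\<Sum>l\<in>freqs p. g l * cos (A - (of_int l * x + \<delta>'))) = (\<Sum>l\<in>freqs p. g (- l) * cos (A - (of_int (- l) * x + \<delta>')))"
      by (rule sum.reindex_bij_witness[of _ uminus uminus]) auto
    also have "\<dots> = (\<Sum>l\<in>freqs p. g l * cos (A + of_int l * x + \<delta>'))"
    proof (intro sum.cong refl)
      fix l
      have "g (- l) * cos (A - (of_int (- l) * x + \<delta>')) = g l * (\<sigma> * cos ((A + of_int l * x) - \<delta>'))"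
        unfolding par by (simp add: algebra_simps)
      then show "g (- l) * cos (A - (of_int (- l) * x + \<delta>')) = g l * cos (A + of_int l * x + \<delta>')" by (simp only: shift)
    qed
    finally have 2: "(\<Sum>l\<in>freqs p. g l * cos (A - (of_int l * x + \<delta>'))) = (\<Sum>l\<in>freqs p. g l * cos (A + of_int l * x + \<delta>'))" .
    have "cos A * (\<Sum>l\<in>freqs p. g l * cos (of_int l * x + \<delta>'))
      = (\<Sum>l\<in>freqs p. (g l * cos (A - (of_int l * x + \<delta>')) + g l * cos (A + of_int l * x + \<delta>')) / 2)"
      unfolding sum_distrib_left by (intro sum.cong refl) (simp add: cos_add cos_diff algebra_simps)
    also have "\<dots> = ((\<Sum>l\<in>freqs p. g l * cos (A - (of_int l * x + \<delta>'))) + (\<Sum>l\<in>freqs p. g l * cos (A + of_int l * x + \<delta>'))) / 2"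
      by (simp add: sum.distrib sum_divide_distrib add_divide_distrib)
    finally show ?thesis unfolding 2 by simp
  qed
  have "(\<Sum>j\<in>freqs m. a j * cos (of_int j * x + \<delta>)) * (\<Sum>l\<in>freqs p. g l * cos (of_int l * x + \<delta>'))
    = (\<Sum>j\<in>freqs m. a j * (\<Sum>l\<in>freqs p. g l * cos ((of_int j * x + \<delta>) + of_int l * x + \<delta>')))"
    unfolding sum_distrib_right by (intro sum.cong refl) (simp add: 1 mult.assoc)
  also have "\<dots> = (\<Sum>j\<in>freqs m. a j * (\<Sum>k\<in>freqs (m + p). g (k - j) * cos (of_int k * x + (\<delta> + \<delta>'))))"
  proof (rule sum.cong[OF refl], rule arg_cong2[where f="(*)", OF refl])
    fix j assume j: "j \<in> freqs m"
    have "(\<Sum>l\<in>freqs p. g l * cos ((of_int j * x + \<delta>) + of_int l * x + \<delta>'))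
      = (\<Sum>k\<in>{- int p + j..int p + j}. g (k - j) * cos (of_int k * x + (\<delta> + \<delta>')))"
      by (rule sum.reindex_bij_witness[of _ "\<lambda>k. k - j" "\<lambda>l. l + j"]) (auto simp: algebra_simps)
    also have "\<dots> = (\<Sum>k\<in>freqs (m + p). g (k - j) * cos (of_int k * x + (\<delta> + \<delta>')))"
      using j by (intro sum.mono_neutral_left) (auto intro!: supp)
    finally show "(\<Sum>l\<in>freqs p. g l * cos ((of_int j * x + \<delta>) + of_int l * x + \<delta>'))
      = (\<Sum>k\<in>freqs (m + p). g (k - j) * cos (of_int k * x + (\<delta> + \<delta>')))" .
  qed
  also have "\<dots> = (\<Sum>k\<in>freqs (m + p). (\<Sum>j\<in>freqs m. a j * g (k - j)) * cos (of_int k * x + (\<delta> + \<delta>')))"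
    unfolding sum_distrib_left sum_distrib_right by (subst sum.swap) (simp add: mult.assoc)
  finally show ?thesis .
qed

lemma ts_mult_sums:
  assumes A: "\<And>n. (\<Sum>k\<in>freqs n. \<bar>a n k\<bar>) \<le> B n" and G: "\<And>n. (\<Sum>k\<in>freqs n. \<bar>g n k\<bar>) \<le> B' n"
    and B: "summable (\<lambda>n. B n * e ^ n)" "summable (\<lambda>n. B' n * e ^ n)" and s: "\<bar>s\<bar> \<le> e"
    and par: "\<And>n l. g n (- l) = \<sigma> * g n l" and \<delta>': "\<sigma> = 1 \<and> \<delta>' = 0 \<or> \<sigma> = -1 \<and> \<delta>' = pi / 2"
    and supp: "\<And>n l. \<bar>l\<bar> > int n \<Longrightarrow> g n l = 0"
  shows "(\<lambda>n. tst (\<delta> + \<delta>') (\<lambda>n k. \<Sum>m\<le>n. \<Sum>j\<in>freqs m. a m j * g (n - m) (k - j)) s x n) sums (ts \<delta> a s x * ts \<delta>' g s x)"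
proof -
  have "(\<lambda>n. \<Sum>m\<le>n. tst \<delta> a s x m * tst \<delta>' g s x (n - m)) sums ((\<Sum>n. tst \<delta> a s x n) * (\<Sum>n. tst \<delta>' g s x n))"
    by (rule Cauchy_product_sums) (use ts_summable(1)[OF A B(1) s] ts_summable(1)[OF G B(2) s] in auto)
  moreover have "(\<Sum>m\<le>n. tst \<delta> a s x m * tst \<delta>' g s x (n - m)) =
      tst (\<delta> + \<delta>') (\<lambda>n k. \<Sum>m\<le>n. \<Sum>j\<in>freqs m. a m j * g (n - m) (k - j)) s x n" for n
  proof -
    have "tst \<delta> a s x m * tst \<delta>' g s x (n - m) =
       s ^ n * (\<Sum>k\<in>freqs n. (\<Sum>j\<in>freqs m. a m j * g (n - m) (k - j)) * cos (of_int k * x + (\<delta> + \<delta>')))"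
      if m: "m \<le> n" for m
    proof -
      have "s ^ n = s ^ m * s ^ (n - m)" using m by (simp flip: power_add)
      then show ?thesis
        unfolding tst_def using cos_sum_mult[where g="g (n - m)" and p="n - m" and m=m and a="a m" and x=x and \<delta>=\<delta>, OF par \<delta>' supp] m
        by (simp add: mult_ac)
    qed
    then have "(\<Sum>m\<le>n. tst \<delta> a s x m * tst \<delta>' g s x (n - m)) =
      (\<Sum>m\<le>n. s ^ n * (\<Sum>k\<in>freqs n. (\<Sum>j\<in>freqs m. a m j * g (n - m) (k - j)) * cos (of_int k * x + (\<delta> + \<delta>'))))"
      by (intro sum.cong) auto
    also have "\<dots> = s ^ n * (\<Sum>m\<le>n. \<Sum>k\<in>freqs n. (\<Sum>j\<in>freqs m. a m j * g (n - m) (k - j)) * cos (of_int k * x + (\<delta> + \<delta>')))"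
      by (simp add: sum_distrib_left)
    also have "\<dots> = tst (\<delta> + \<delta>') (\<lambda>n k. \<Sum>m\<le>n. \<Sum>j\<in>freqs m. a m j * g (n - m) (k - j)) s x n"
      unfolding tst_def by (subst sum.swap) (simp add: sum_distrib_right)
    finally show ?thesis .
  qed
  ultimately show ?thesis by (simp add: ts_def)
qed

text \<open>Both factors start at order one, so the Cauchy product loses its first and last summand
  and becomes \<open>cnv\<close>.\<close>

lemma ts_mult:
  assumes A: "\<And>n. (\<Sum>k\<in>freqs n. \<bar>a n k\<bar>) \<le> B n" and G: "\<And>n. (\<Sum>k\<in>freqs n. \<bar>g n k\<bar>) \<le> B' n"
    and B: "summable (\<lambda>n. B n * e ^ n)" "summable (\<lambda>n. B' n * e ^ n)" and s: "\<bar>s\<bar> \<le> e"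
    and par: "\<And>n l. g n (- l) = \<sigma> * g n l" and \<delta>': "\<sigma> = 1 \<and> \<delta>' = 0 \<or> \<sigma> = -1 \<and> \<delta>' = pi / 2"
    and supp: "\<And>n l. \<bar>l\<bar> > int n \<Longrightarrow> g n l = 0" and z: "\<And>k. a 0 k = 0" "\<And>k. g 0 k = 0"
  shows "tst (\<delta> + \<delta>') (cnv a g) s x sums (ts \<delta> a s x * ts \<delta>' g s x)"
proof -
  have "(\<Sum>m\<le>n. \<Sum>j\<in>freqs m. a m j * g (n - m) (k - j)) = cnv a g n k" for n k
  proof -
    have "{..n} = insert 0 (insert n {1..<n})" by auto
    then show ?thesis unfolding cnv_def using z by (cases "n = 0") auto
  qed
  then show ?thesis
    using ts_mult_sums[where a=a and g=g and \<delta>=\<delta> and x=x, OF A G B s par \<delta>' supp] by (simp add: tst_def[abs_def])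
qed

lemma tst_add: "tst \<delta> (\<lambda>n k. a n k + b n k) s x n = tst \<delta> a s x n + tst \<delta> b s x n"
  by (simp add: tst_def sum.distrib algebra_simps)

lemma tst_cmult: "tst \<delta> (\<lambda>n k. c * a n k) s x n = c * tst \<delta> a s x n"
  by (simp add: tst_def sum_distrib_left mult_ac)

lemma tst_cong: "(\<And>k. \<bar>k\<bar> \<le> int n \<Longrightarrow> a n k = b n k) \<Longrightarrow> tst \<delta> a s x n = tst \<delta> b s x n"
  unfolding tst_def by (intro arg_cong2[where f="(*)"] refl sum.cong) (auto simp: abs_le_iff)

lemma tst_pi: "tst (\<delta> + pi) a s x n = - tst \<delta> a s x n"
  by (simp add: tst_def sum_negf flip: add.assoc)

text \<open>The frequencies \<open>1\<close> and \<open>-1\<close> contribute \<open>c / 2\<close>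
  each. For the higher orders \<open>\<bar>s\<bar> ^ (n + 2) \<le> s^2 e ^ n\<close> lets the
  majorant at radius \<open>e\<close> control the rest uniformly in \<open>x\<close>.\<close>

lemma ts_first_order:
  assumes B: "\<And>n. (\<Sum>k\<in>freqs n. \<bar>a n k\<bar>) \<le> B n" "summable (\<lambda>n. B n * e ^ n)" and e: "e > 0" and s: "\<bar>s\<bar> \<le> e"
    and a0: "a 0 0 = 0" and a1: "\<And>k. \<bar>k\<bar> \<le> 1 \<Longrightarrow> a 1 k = (if \<bar>k\<bar> = 1 then c / 2 else 0)"
  shows "\<bar>ts 0 a s x - s * c * cos x\<bar> \<le> s\<^sup>2 * ((\<Sum>n. B n * e ^ n) / e\<^sup>2)"
proof -
  define S where "S = (\<Sum>n. B n * e ^ n)"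
  have B0: "B n \<ge> 0" for n using order_trans[OF sum_nonneg B(1)] by simp
  have sm: "summable (tst 0 a s x)" by (rule ts_summable(2)[OF B s])
  have 0: "tst 0 a s x 0 = 0" using a0 by (simp add: tst_def)
  have "freqs 1 = {-1, 0, 1}" by auto
  then have 1: "tst 0 a s x 1 = s * c * cos x" using a1 by (simp add: tst_def)
  have b: "norm (tst 0 a s x (n + 2)) \<le> B (n + 2) * e ^ (n + 2) * (s\<^sup>2 / e\<^sup>2)" for n
  proof -
    have "\<bar>tst 0 a s x (n + 2)\<bar> \<le> B (n + 2) * \<bar>s\<bar> ^ (n + 2)" by (rule tst_bound[OF B(1)]) simp
    also have "\<dots> = B (n + 2) * (\<bar>s\<bar> ^ n * s\<^sup>2)" by (simp add: power_add power2_eq_square)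
    also have "\<dots> \<le> B (n + 2) * (e ^ n * s\<^sup>2)" using s B0 by (intro mult_left_mono mult_right_mono power_mono) auto
    also have "\<dots> = B (n + 2) * e ^ (n + 2) * (s\<^sup>2 / e\<^sup>2)" using e by (simp add: power_add power2_eq_square)
    finally show ?thesis by simp
  qed
  have B2: "summable (\<lambda>n. B (n + 2) * e ^ (n + 2))" using summable_ignore_initial_segment[OF B(2), of 2] .
  have "ts 0 a s x - s * c * cos x = (\<Sum>n. tst 0 a s x (n + 2))"
    using suminf_minus_initial_segment[OF sm, of 2] 0 1 by (simp add: ts_def eval_nat_numeral)
  also have "norm \<dots> \<le> (\<Sum>n. B (n + 2) * e ^ (n + 2) * (s\<^sup>2 / e\<^sup>2))"
    by (rule norm_suminf_le[OF b]) (intro summable_mult2 B2)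
  also have "\<dots> = (\<Sum>n. B (n + 2) * e ^ (n + 2)) * (s\<^sup>2 / e\<^sup>2)"
    by (rule suminf_mult2[OF B2, symmetric])
  also have "\<dots> \<le> S * (s\<^sup>2 / e\<^sup>2)"
  proof (rule mult_right_mono)
    have "(\<Sum>n. B (n + 2) * e ^ (n + 2)) = S - (\<Sum>i<2. B i * e ^ i)"
      unfolding S_def by (rule suminf_minus_initial_segment[OF B(2)])
    moreover have "(\<Sum>i<2. B i * e ^ i) \<ge> 0" using B0 e by (intro sum_nonneg) auto
    ultimately show "(\<Sum>n. B (n + 2) * e ^ (n + 2)) \<le> S" by linarith
  qed simp
  finally show ?thesis by (simp add: S_def mult.commute)
qed

text \<open>Order zero is zero because the series describe only the deviation from the cylinder
  solution \<open>g = 1\<close>, \<open>u = U\<close>, \<open>P = U'\<close>, \<open>v = 0\<close>,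
  \<open>M = M0\<close>.\<close>

locale expansion = schiffer +
  fixes X :: "nat \<Rightarrow> coefs" and e :: real
  assumes e: "e > 0" and X0: "X 0 = zero_coefs" and X1: "first_order (X 1)" and gX: "n \<ge> 1 \<Longrightarrow> good X n"
    and sum_tot: "summable (\<lambda>n. tot X n * e ^ n)" and sum_cm: "summable (\<lambda>n. \<bar>cm (X (Suc n))\<bar> * e ^ n)"
begin

lemma zero_order [simp]: "cg (X 0) = (\<lambda>_. 0)" "cp (X 0) = (\<lambda>_ _. 0)" "cp' (X 0) = (\<lambda>_ _. 0)" "cv (X 0) = (\<lambda>_ _. 0)"
  "cv' (X 0) = (\<lambda>_ _. 0)" "cu (X 0) = (\<lambda>_ _. 0)" "cu' (X 0) = (\<lambda>_ _. 0)"
  by (simp_all add: X0 zero_coefs_def)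

lemma sum_le_tot:
  assumes "n \<ge> 1 \<Longrightarrow> (\<And>k. \<bar>f k\<bar> \<le> cb (X n) k)" "n = 0 \<Longrightarrow> f 0 = 0"
  shows "(\<Sum>k\<in>freqs n. \<bar>f k\<bar>) \<le> tot X n"
proof (cases "n = 0")
  case True
  then show ?thesis using assms(2) by (simp add: tot_def X0 zero_coefs_def)
next
  case False
  then show ?thesis unfolding tot_def by (intro sum_mono assms(1)) auto
qed

lemma tot_bounds:
  assumes y: "y \<in> {0..1}"
  shows "(\<Sum>k\<in>freqs n. \<bar>cg (X n) k\<bar>) \<le> tot X n" "(\<Sum>k\<in>freqs n. \<bar>of_int k * cg (X n) k\<bar>) \<le> tot X n"
    "(\<Sum>k\<in>freqs n. \<bar>cp (X n) k y\<bar>) \<le> tot X n" "(\<Sum>k\<in>freqs n. \<bar>of_int k * cp (X n) k y\<bar>) \<le> tot X n"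
    "(\<Sum>k\<in>freqs n. \<bar>cp' (X n) k y\<bar>) \<le> tot X n" "(\<Sum>k\<in>freqs n. \<bar>of_int k * cv (X n) k y\<bar>) \<le> tot X n"
    "(\<Sum>k\<in>freqs n. \<bar>(of_int k)\<^sup>2 * cv (X n) k y\<bar>) \<le> tot X n" "(\<Sum>k\<in>freqs n. \<bar>of_int k * cv' (X n) k y\<bar>) \<le> tot X n"
    "(\<Sum>k\<in>freqs n. \<bar>cu (X n) k y\<bar>) \<le> tot X n" "(\<Sum>k\<in>freqs n. \<bar>of_int k * cu (X n) k y\<bar>) \<le> tot X n"
    "(\<Sum>k\<in>freqs n. \<bar>cu' (X n) k y\<bar>) \<le> tot X n"
  by (rule sum_le_tot; use good_bounds'[OF gX y] in simp)+

lemma parity: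
  "cg (X n) (- k) = cg (X n) k" "cp (X n) (- k) = cp (X n) k" "cp' (X n) (- k) = cp' (X n) k"
  "cv (X n) (- k) = cv (X n) k" "cv' (X n) (- k) = cv' (X n) k" "cu (X n) (- k) = cu (X n) k"
  by (cases "n = 0"; use good_mode[OF gX] in simp)+

lemma support:
  assumes "\<bar>k\<bar> > int n"
  shows "cg (X n) k = 0" "cp (X n) k y = 0" "cp' (X n) k y = 0" "cv (X n) k y = 0" "cv' (X n) k y = 0" "cu (X n) k y = 0"
  by (cases "n = 0"; use good_mode(12)[OF gX assms] in simp)+

text \<open>\<open>good\<close> provides the equations for nonnegative frequencies. For
  \<open>k = - j\<close> the sources \<open>sA\<close> and \<open>sD\<close> change sign and the
  others do not, which matches the odd and even powers of \<open>k\<close> in the equations.\<close>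

lemma order_eqs_conj:
  assumes k: "\<bar>k\<bar> \<le> int n" and y: "y \<in> {0..1}"
  shows "cu' (X n) k y = cp (X n) k y + cg (X n) k * U' y + sC X n k y \<and>
    of_int k * cu (X n) k y = of_int k * cv (X n) k y + y * of_int k * cg (X n) k * U' y + sD X n k y \<and>
    of_int k * cv' (X n) k y = of_int k * cp (X n) k y - y * of_int k * cg (X n) k * U'' y + sA X n k y \<and>
    y * cp' (X n) k y + (real N - 1) * cp (X n) k y + y * Lam * (cu (X n) k y + cg (X n) k * U y)
       - y * M0 * (of_int k)\<^sup>2 * cv (X n) k y + y * sS X n k y = 0"
proof (cases "n = 0")
  case True
  then show ?thesis by (simp add: sA_def sC_def sD_def sS_def sH_def sG_def cnv_def)
next
  case False
  then have n: "n \<ge> 1" by simp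
  have gd: "\<forall>m. 1 \<le> m \<and> m < n' \<longrightarrow> good X m" for n' using gX by blast
  have r: "real (nat \<bar>k\<bar>) = \<bar>of_int k\<bar>" by simp
  have sSe: "sS X n (- k) = sS X n k" for k
  proof -
    have "sH X n (- k) = sH X n k" "\<And>m. sG X m (- k) = sG X m k" "\<And>m. cv (X m) (- k) = cv (X m) k"
      by (auto simp: src_facts[OF gd] parity)
    then show ?thesis by (simp add: sS_def fun_eq_iff)
  qed
  note m = good_mode_eqs[OF gX[OF n] k, unfolded mode_eqs_def r]
  have "k \<ge> 0 \<or> (\<exists>j. k = - j \<and> j > 0)" by (cases "k \<ge> 0") (auto intro: exI[of _ "- k"])
  then show ?thesis
  proof
    assume "k \<ge> 0"
    then show ?thesis using m y by simp
  next
    assume "\<exists>j. k = - j \<and> j > 0"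
    then obtain j where j: "k = - j" "j > 0" by blast
    have *: "cu' (X n) k y = cp (X n) k y + cg (X n) k * U' y + sC X n j y"
      "of_int j * cu (X n) k y = of_int j * cv (X n) k y + y * of_int j * cg (X n) k * U' y + sD X n j y"
      "of_int j * cv' (X n) k y = of_int j * cp (X n) k y - y * of_int j * cg (X n) k * U'' y + sA X n j y"
      "y * cp' (X n) k y + (real N - 1) * cp (X n) k y + y * Lam * (cu (X n) k y + cg (X n) k * U y)
       - y * M0 * (of_int j)\<^sup>2 * cv (X n) k y + y * sS X n j y = 0"
      using m y j by simp_all
    have s: "sC X n k = sC X n j" "sD X n k = (\<lambda>y. - sD X n j y)" "sA X n k = (\<lambda>y. - sA X n j y)" "sS X n k = sS X n j"
      unfolding j(1) by (rule src_facts[OF gd] sSe)+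
    show ?thesis unfolding s using * by (simp add: j(1))
  qed
qed

lemmas order_eqs = order_eqs_conj[THEN conjunct1] order_eqs_conj[THEN conjunct2, THEN conjunct1]
  order_eqs_conj[THEN conjunct2, THEN conjunct2, THEN conjunct1] order_eqs_conj[THEN conjunct2, THEN conjunct2, THEN conjunct2]

end

section \<open>The summed series satisfy the flattened system\<close>

context expansion
begin

text \<open>The full unknowns are \<open>1 + gam\<close>, \<open>U + fU\<close>,
  \<open>U' + fP\<close> and \<open>eta\<close>. The coefficients \<open>cv\<close> belong to a
  potential of which \<open>eta\<close> is the derivative in \<open>x\<close>, hence its factor
  \<open>k\<close> and its phase.\<close>

definition "gam s x = ts 0 (\<lambda>n k. cg (X n) k) s x"
definition "gam' s x = ts (pi / 2) (\<lambda>n k. of_int k * cg (X n) k) s x"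
definition "fP s y x = ts 0 (\<lambda>n k. cp (X n) k y) s x"
definition "fPx s y x = ts (pi / 2) (\<lambda>n k. of_int k * cp (X n) k y) s x"
definition "fPy s y x = ts 0 (\<lambda>n k. cp' (X n) k y) s x"
definition "fU s y x = ts 0 (\<lambda>n k. cu (X n) k y) s x"
definition "fUx s y x = ts (pi / 2) (\<lambda>n k. of_int k * cu (X n) k y) s x"
definition "fUy s y x = ts 0 (\<lambda>n k. cu' (X n) k y) s x"
definition "eta s y x = ts (pi / 2) (\<lambda>n k. of_int k * cv (X n) k y) s x"
definition "etax s y x = - ts 0 (\<lambda>n k. (of_int k)\<^sup>2 * cv (X n) k y) s x"
definition "etay s y x = ts (pi / 2) (\<lambda>n k. of_int k * cv' (X n) k y) s x"
text \<open>The coefficient of \<open>s ^ i\<close> in \<open>M\<close> is stored with order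
  \<open>i + 1\<close>, the order at which it is determined. Index \<open>0\<close> is cleared
  because \<open>M0\<close> is added separately in \<open>MM\<close>.\<close>

definition "mh i = (if i = 0 then 0 else cm (X (Suc i)))"
definition "MM s = M0 + (\<Sum>i. mh i * s ^ i)"

lemma sum_mh: "summable (\<lambda>i. \<bar>mh i\<bar> * e ^ i)"
  by (rule summable_comparison_test'[OF sum_cm, of 0]) (use e in \<open>auto simp: mh_def\<close>)

lemma ts_sums:
  assumes "\<And>n. (\<Sum>k\<in>freqs n. \<bar>a n k\<bar>) \<le> tot X n" "\<bar>s\<bar> \<le> e"
  shows "tst \<delta> a s x sums ts \<delta> a s x"
  unfolding ts_def by (rule summable_sums) (rule ts_summable(2)[OF assms(1) sum_tot assms(2)])

lemma tsum:
  assumes y: "y \<in> {0..1}" and s: "\<bar>s\<bar> \<le> e"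
  shows "tst 0 (\<lambda>n k. cg (X n) k) s x sums gam s x" "tst (pi / 2) (\<lambda>n k. of_int k * cg (X n) k) s x sums gam' s x"
    "tst 0 (\<lambda>n k. cp (X n) k y) s x sums fP s y x" "tst (pi / 2) (\<lambda>n k. of_int k * cp (X n) k y) s x sums fPx s y x"
    "tst 0 (\<lambda>n k. cp' (X n) k y) s x sums fPy s y x" "tst 0 (\<lambda>n k. cu (X n) k y) s x sums fU s y x"
    "tst (pi / 2) (\<lambda>n k. of_int k * cu (X n) k y) s x sums fUx s y x" "tst 0 (\<lambda>n k. cu' (X n) k y) s x sums fUy s y x"
    "tst (pi / 2) (\<lambda>n k. of_int k * cv (X n) k y) s x sums eta s y x"
    "tst 0 (\<lambda>n k. (of_int k)\<^sup>2 * cv (X n) k y) s x sums - etax s y x"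
    "tst (pi / 2) (\<lambda>n k. of_int k * cv' (X n) k y) s x sums etay s y x"
  unfolding gam_def gam'_def fP_def fPx_def fPy_def fU_def fUx_def fUy_def eta_def etax_def etay_def minus_minus
  by (rule ts_sums[OF _ s], rule tot_bounds[OF y])+

lemma src_sums:
  assumes y: "y \<in> {0..1}" and s: "\<bar>s\<bar> \<le> e"
  shows "tst 0 (\<lambda>n k. sC X n k y) s x sums (gam s x * fP s y x)"
    "tst (pi / 2) (\<lambda>n k. sA X n k y) s x sums (gam s x * fPx s y x - y * (gam' s x * fPy s y x))"
    "tst (pi / 2) (\<lambda>n k. sD X n k y) s x sums (y * (gam' s x * fP s y x))"
    "tst 0 (\<lambda>n k. sG X n k y) s x sums (gam s x * etax s y x - y * (gam' s x * etay s y x))"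
    "tst 0 (\<lambda>n k. sH X n k y) s x sums (gam s x * fU s y x)"
proof -
  note B = tot_bounds[OF y]
  have M: "tst (\<delta> + \<delta>') (cnv a g) s x sums (ts \<delta> a s x * ts \<delta>' g s x)"
    if "\<And>n. (\<Sum>k\<in>freqs n. \<bar>a n k\<bar>) \<le> tot X n" "\<And>n. (\<Sum>k\<in>freqs n. \<bar>g n k\<bar>) \<le> tot X n"
      "\<And>n l. g n (- l) = \<sigma> * g n l" "\<sigma> = 1 \<and> \<delta>' = 0 \<or> \<sigma> = -1 \<and> \<delta>' = pi / 2" "\<And>n l. \<bar>l\<bar> > int n \<Longrightarrow> g n l = 0"
      "\<And>k. a 0 k = 0" "\<And>k. g 0 k = 0" for \<delta> \<delta>' a g \<sigma>
    by (rule ts_mult[OF that(1,2) sum_tot sum_tot s that(3-7)])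
  have C: "tst (0 + 0) (cnv (\<lambda>m j. cg (X m) j) (\<lambda>m l. cp (X m) l y)) s x sums (gam s x * fP s y x)"
    using M[where a="\<lambda>m j. cg (X m) j" and g="\<lambda>m l. cp (X m) l y" and \<delta>="0" and \<delta>'="0" and \<sigma>="1", OF B(1) B(3)]
    by (simp add: parity support gam_def fP_def)
  have H: "tst (0 + 0) (cnv (\<lambda>m j. cg (X m) j) (\<lambda>m l. cu (X m) l y)) s x sums (gam s x * fU s y x)"
    using M[where a="\<lambda>m j. cg (X m) j" and g="\<lambda>m l. cu (X m) l y" and \<delta>="0" and \<delta>'="0" and \<sigma>="1", OF B(1) B(9)]
    by (simp add: parity support gam_def fU_def)
  have gP': "tst (pi / 2 + 0) (cnv (\<lambda>m j. of_int j * cg (X m) j) (\<lambda>m l. cp' (X m) l y)) s x sums (gam' s x * fPy s y x)"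
    using M[where a="\<lambda>m j. of_int j * cg (X m) j" and g="\<lambda>m l. cp' (X m) l y" and \<delta>="pi / 2" and \<delta>'="0" and \<sigma>="1", OF B(2) B(5)]
    by (simp add: parity support gam'_def fPy_def)
  have gP: "tst (pi / 2 + 0) (cnv (\<lambda>m j. of_int j * cg (X m) j) (\<lambda>m l. cp (X m) l y)) s x sums (gam' s x * fP s y x)"
    using M[where a="\<lambda>m j. of_int j * cg (X m) j" and g="\<lambda>m l. cp (X m) l y" and \<delta>="pi / 2" and \<delta>'="0" and \<sigma>="1", OF B(2) B(3)]
    by (simp add: parity support gam'_def fP_def)
  have gPx: "tst (0 + pi / 2) (cnv (\<lambda>m j. cg (X m) j) (\<lambda>m l. of_int l * cp (X m) l y)) s x sums (gam s x * fPx s y x)"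
    using M[where a="\<lambda>m j. cg (X m) j" and g="\<lambda>m l. of_int l * cp (X m) l y" and \<delta>="0" and \<delta>'="pi / 2" and \<sigma>="-1", OF B(1) B(4)]
    by (simp add: parity support gam_def fPx_def)
  have ge: "tst (pi / 2 + pi / 2) (cnv (\<lambda>m j. of_int j * cg (X m) j) (\<lambda>m l. of_int l * cv' (X m) l y)) s x sums (gam' s x * etay s y x)"
    using M[where a="\<lambda>m j. of_int j * cg (X m) j" and g="\<lambda>m l. of_int l * cv' (X m) l y" and \<delta>="pi / 2" and \<delta>'="pi / 2" and \<sigma>="-1", OF B(2) B(8)]
    by (simp add: parity support gam'_def etay_def)
  have gx: "tst (0 + 0) (cnv (\<lambda>m j. cg (X m) j) (\<lambda>m l. (of_int l)\<^sup>2 * cv (X m) l y)) s x sums - (gam s x * etax s y x)"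
    using M[where a="\<lambda>m j. cg (X m) j" and g="\<lambda>m l. (of_int l)\<^sup>2 * cv (X m) l y" and \<delta>="0" and \<delta>'="0" and \<sigma>="1", OF B(1) B(7)]
    by (simp add: parity support gam_def etax_def)
  have ge: "tst 0 (cnv (\<lambda>m j. of_int j * cg (X m) j) (\<lambda>m l. of_int l * cv' (X m) l y)) s x sums - (gam' s x * etay s y x)"
    using sums_minus[OF ge] by (simp add: tst_pi[of 0, simplified])
  show "tst 0 (\<lambda>n k. sC X n k y) s x sums (gam s x * fP s y x)" using C by (simp add: sC_def)
  show "tst 0 (\<lambda>n k. sH X n k y) s x sums (gam s x * fU s y x)" using H by (simp add: sH_def)
  have D: "tst \<delta> (\<lambda>n k. a n k - z * b n k) s x n = tst \<delta> a s x n - z * tst \<delta> b s x n" for \<delta> a b z n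
    by (simp add: tst_def sum_subtractf sum_distrib_left algebra_simps)
  have D': "tst \<delta> (\<lambda>n k. z * b n k - a n k) s x n = z * tst \<delta> b s x n - tst \<delta> a s x n" for \<delta> a b z n
    by (simp add: tst_def sum_subtractf sum_distrib_left algebra_simps)
  show "tst (pi / 2) (\<lambda>n k. sA X n k y) s x sums (gam s x * fPx s y x - y * (gam' s x * fPy s y x))"
    using sums_diff[OF gPx sums_mult[OF gP', of y], simplified] unfolding sA_def by (simp add: D[abs_def])
  show "tst (pi / 2) (\<lambda>n k. sD X n k y) s x sums (y * (gam' s x * fP s y x))"
    using sums_mult[OF gP, of y, simplified] unfolding sD_def by (simp add: tst_cmult[abs_def])
  show "tst 0 (\<lambda>n k. sG X n k y) s x sums (gam s x * etax s y x - y * (gam' s x * etay s y x))"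
    using sums_diff[OF sums_mult[OF ge, of y] gx, simplified] unfolding sG_def by (simp add: D'[abs_def])
qed

text \<open>Summation of the order equations: the linear terms and the Cauchy products of the
  deviations combine to products with \<open>1 + gam\<close>, and the equation of \<open>U\<close>
  supplies the order zero part.\<close>

lemma flat_eqs:
  assumes y: "y \<in> {0..1}" and s: "\<bar>s\<bar> < e"
  shows "fUy s y x = (1 + gam s x) * (U' y + fP s y x) - U' y"
    "fUx s y x = eta s y x + y * gam' s x * (U' y + fP s y x)"
    "etay s y x = (1 + gam s x) * fPx s y x - y * gam' s x * (U'' y + fPy s y x)"
    "y * (U'' y + fPy s y x) + (real N - 1) * (U' y + fP s y x) + y * Lam * (1 + gam s x) * (U y + fU s y x)
      + y * MM s * ((1 + gam s x) * etax s y x - y * gam' s x * etay s y x) = 0"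
proof -
  have s': "\<bar>s\<bar> \<le> e" using s by simp
  note T = tsum[OF y s', of x] and SS = src_sums[OF y s', of x]
  have "tst 0 (\<lambda>n k. cu' (X n) k y) s x = (\<lambda>n. tst 0 (\<lambda>n k. cp (X n) k y) s x n + U' y * tst 0 (\<lambda>n k. cg (X n) k) s x n
     + tst 0 (\<lambda>n k. sC X n k y) s x n)"
    unfolding fun_eq_iff tst_add[symmetric] tst_cmult[symmetric] by (intro allI tst_cong) (simp add: order_eqs(1)[OF _ y])
  then have "tst 0 (\<lambda>n k. cu' (X n) k y) s x sums (fP s y x + U' y * gam s x + gam s x * fP s y x)"
    by (simp only:) (intro sums_add sums_mult T SS)
  from sums_unique2[OF T(8) this] show "fUy s y x = (1 + gam s x) * (U' y + fP s y x) - U' y" by (simp add: algebra_simps)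
  have "tst (pi / 2) (\<lambda>n k. of_int k * cu (X n) k y) s x = (\<lambda>n. tst (pi / 2) (\<lambda>n k. of_int k * cv (X n) k y) s x n
     + (y * U' y) * tst (pi / 2) (\<lambda>n k. of_int k * cg (X n) k) s x n + tst (pi / 2) (\<lambda>n k. sD X n k y) s x n)"
    unfolding fun_eq_iff tst_add[symmetric] tst_cmult[symmetric] by (intro allI tst_cong) (simp add: order_eqs(2)[OF _ y])
  then have "tst (pi / 2) (\<lambda>n k. of_int k * cu (X n) k y) s x sums (eta s y x + (y * U' y) * gam' s x + y * (gam' s x * fP s y x))"
    by (simp only:) (intro sums_add sums_mult T SS)
  from sums_unique2[OF T(7) this] show "fUx s y x = eta s y x + y * gam' s x * (U' y + fP s y x)" by (simp add: algebra_simps)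
  have "tst (pi / 2) (\<lambda>n k. of_int k * cv' (X n) k y) s x = (\<lambda>n. tst (pi / 2) (\<lambda>n k. of_int k * cp (X n) k y) s x n
     + (- y * U'' y) * tst (pi / 2) (\<lambda>n k. of_int k * cg (X n) k) s x n + tst (pi / 2) (\<lambda>n k. sA X n k y) s x n)"
    unfolding fun_eq_iff tst_add[symmetric] tst_cmult[symmetric] by (intro allI tst_cong) (simp add: order_eqs(3)[OF _ y])
  then have "tst (pi / 2) (\<lambda>n k. of_int k * cv' (X n) k y) s x sums (fPx s y x + (- y * U'' y) * gam' s x + (gam s x * fPx s y x - y * (gam' s x * fPy s y x)))"
    by (simp only:) (intro sums_add sums_mult T SS)
  from sums_unique2[OF T(11) this] show "etay s y x = (1 + gam s x) * fPx s y x - y * gam' s x * (U'' y + fPy s y x)" by (simp add: algebra_simps)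
  \<comment> \<open>Everything that is multiplied by \<open>M\<close> in the last equation, so that
    the product with the series of \<open>M\<close> is a single Cauchy product.\<close>
  define E where "E n k = sG X n k y - (of_int k)\<^sup>2 * cv (X n) k y" for n k
  have Esub: "tst 0 E s x = (\<lambda>n. tst 0 (\<lambda>n k. sG X n k y) s x n - tst 0 (\<lambda>n k. (of_int k)\<^sup>2 * cv (X n) k y) s x n)" for s x
    unfolding E_def by (simp add: tst_def sum_subtractf algebra_simps fun_eq_iff)
  define \<Xi> where "\<Xi> = (1 + gam s x) * etax s y x - y * gam' s x * etay s y x"
  have Es: "tst 0 E s x sums \<Xi>"
    using sums_diff[OF SS(4) T(10)] by (simp add: Esub \<Xi>_def algebra_simps)
  \<comment> \<open>Convergence at the radius \<open>e\<close> itself gives absolute convergence at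
    the smaller \<open>s\<close>, as the Cauchy product requires.\<close>
  have "summable (tst 0 E e x)"
    using sums_diff[OF src_sums(4)[OF y, of e x] tsum(10)[OF y, of e x]] e unfolding Esub by (auto simp: sums_iff)
  then have tab: "summable (\<lambda>n. norm (tst 0 E s x n))"
    using powser_insidea[of "\<lambda>n. \<Sum>k\<in>freqs n. E n k * cos (of_int k * x + 0)" e s] s e
    by (simp add: tst_def[abs_def] mult.commute)
  have mab: "summable (\<lambda>i. norm (mh i * s ^ i))"
    by (rule summable_comparison_test'[OF sum_mh, of 0]) (use s in \<open>auto simp: abs_mult power_abs intro!: mult_left_mono power_mono\<close>)
  have "(\<lambda>n. \<Sum>i\<le>n. (mh i * s ^ i) * tst 0 E s x (n - i)) sums ((\<Sum>i. mh i * s ^ i) * (\<Sum>n. tst 0 E s x n))"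
    by (rule Cauchy_product_sums[OF mab tab])
  then have ms: "(\<lambda>n. \<Sum>i\<le>n. (mh i * s ^ i) * tst 0 E s x (n - i)) sums ((MM s - M0) * \<Xi>)"
    using Es by (simp add: MM_def sums_iff)
  have E0: "E 0 k = 0" for k by (simp add: E_def sG_def cnv_def)
  have Esupp: "E n k = 0" if "\<bar>k\<bar> > int n" for n k
  proof -
    have "cnv (\<lambda>m j. of_int j * cg (X m) j) (\<lambda>m l. of_int l * cv' (X m) l y) n k = 0"
      "cnv (\<lambda>m j. cg (X m) j) (\<lambda>m l. (of_int l)\<^sup>2 * cv (X m) l y) n k = 0"
      by (rule cnv_support[OF _ that]; simp add: support)+
    then show ?thesis using that by (simp add: E_def sG_def support)
  qed
  have mt: "(\<Sum>i\<le>n. (mh i * s ^ i) * tst 0 E s x (n - i)) = tst 0 (\<lambda>n k. \<Sum>i\<in>{1..<n}. cm (X (Suc i)) * E (n - i) k) s x n" for n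
  proof -
    have "(mh i * s ^ i) * tst 0 E s x (n - i) = s ^ n * (\<Sum>k\<in>freqs n. cm (X (Suc i)) * E (n - i) k * cos (of_int k * x))"
      if i: "i \<in> {1..<n}" for i
    proof -
      have "(\<Sum>k\<in>freqs (n - i). E (n - i) k * cos (of_int k * x)) = (\<Sum>k\<in>freqs n. E (n - i) k * cos (of_int k * x))"
        by (rule sum.mono_neutral_left) (auto intro!: Esupp)
      moreover have "s ^ n = s ^ i * s ^ (n - i)" using i by (simp flip: power_add)
      ultimately show ?thesis using i by (simp add: tst_def mh_def sum_distrib_left mult_ac)
    qed
    then have "(\<Sum>i\<in>{1..<n}. (mh i * s ^ i) * tst 0 E s x (n - i))
      = (\<Sum>i\<in>{1..<n}. s ^ n * (\<Sum>k\<in>freqs n. cm (X (Suc i)) * E (n - i) k * cos (of_int k * x)))" by (intro sum.cong refl)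
    also have "\<dots> = s ^ n * (\<Sum>i\<in>{1..<n}. \<Sum>k\<in>freqs n. cm (X (Suc i)) * E (n - i) k * cos (of_int k * x))"
      by (simp add: sum_distrib_left)
    also have "\<dots> = tst 0 (\<lambda>n k. \<Sum>i\<in>{1..<n}. cm (X (Suc i)) * E (n - i) k) s x n"
      unfolding tst_def by (subst sum.swap) (simp add: sum_distrib_right)
    moreover have "(\<Sum>i\<le>n. (mh i * s ^ i) * tst 0 E s x (n - i)) = (\<Sum>i\<in>{1..<n}. (mh i * s ^ i) * tst 0 E s x (n - i))"
      by (rule sum.mono_neutral_right) (auto simp: mh_def tst_def E0)
    ultimately show ?thesis by simp
  qed
  define Z where "Z n = y * tst 0 (\<lambda>n k. cp' (X n) k y) s x n + (real N - 1) * tst 0 (\<lambda>n k. cp (X n) k y) s x n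
      + y * Lam * (tst 0 (\<lambda>n k. cu (X n) k y) s x n + U y * tst 0 (\<lambda>n k. cg (X n) k) s x n)
      + y * Lam * tst 0 (\<lambda>n k. sH X n k y) s x n + y * M0 * tst 0 E s x n
      + y * tst 0 (\<lambda>n k. \<Sum>i\<in>{1..<n}. cm (X (Suc i)) * E (n - i) k) s x n" for n
  have z: "Z n = 0" for n
  proof -
    have "tst 0 (\<lambda>n k. y * cp' (X n) k y + (real N - 1) * cp (X n) k y + y * Lam * (cu (X n) k y + U y * cg (X n) k)
      + y * Lam * sH X n k y + y * M0 * E n k + y * (\<Sum>i\<in>{1..<n}. cm (X (Suc i)) * E (n - i) k)) s x n = tst 0 (\<lambda>n k. 0) s x n"
    proof (rule tst_cong)
      fix k assume k: "\<bar>k\<bar> \<le> int n"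
      have "y * sS X n k y = y * Lam * sH X n k y + y * M0 * sG X n k y + y * (\<Sum>i\<in>{1..<n}. cm (X (Suc i)) * E (n - i) k)"
        unfolding sS_def E_def by (simp add: algebra_simps)
      moreover have "y * M0 * E n k = y * M0 * sG X n k y - y * M0 * (of_int k)\<^sup>2 * cv (X n) k y"
        by (simp add: E_def algebra_simps)
      ultimately show "y * cp' (X n) k y + (real N - 1) * cp (X n) k y + y * Lam * (cu (X n) k y + U y * cg (X n) k)
        + y * Lam * sH X n k y + y * M0 * E n k + y * (\<Sum>i\<in>{1..<n}. cm (X (Suc i)) * E (n - i) k) = 0"
        using order_eqs(4)[OF k y] by (simp add: mult.commute[of _ "U y"])
    qed
    also have "tst 0 (\<lambda>n k. 0) s x n = 0" by (simp add: tst_def)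
    finally show ?thesis unfolding tst_add tst_cmult Z_def .
  qed
  have "Z sums
     (y * fPy s y x + (real N - 1) * fP s y x + y * Lam * (fU s y x + U y * gam s x) + y * Lam * (gam s x * fU s y x)
      + y * M0 * \<Xi> + y * ((MM s - M0) * \<Xi>))"
    unfolding Z_def by (intro sums_add sums_mult T SS Es ms[unfolded mt])
  then have "y * fPy s y x + (real N - 1) * fP s y x + y * Lam * (fU s y x + U y * gam s x) + y * Lam * (gam s x * fU s y x)
      + y * M0 * \<Xi> + y * ((MM s - M0) * \<Xi>) = 0"
    unfolding z using sums_unique2[OF sums_zero] by metis
  then show "y * (U'' y + fPy s y x) + (real N - 1) * (U' y + fP s y x) + y * Lam * (1 + gam s x) * (U y + fU s y x)
      + y * MM s * ((1 + gam s x) * etax s y x - y * gam' s x * etay s y x) = 0"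
    using U_ode[of y] unfolding \<Xi>_def[symmetric] by (simp add: algebra_simps)
qed

end

lemma tst_even_periodic:
  shows "tst 0 a s (- x) = tst 0 a s x" "tst 0 a s (x + 2 * pi) = tst 0 a s x"
proof -
  have "cos (of_int k * (x + 2 * pi)) = cos (of_int k * x)" for k :: int
  proof -
    have "cos (of_int k * (x + 2 * pi)) = cos (of_int k * x + of_int k * (2 * pi))" by (simp add: algebra_simps)
    also have "\<dots> = cos (of_int k * x)" using cos_int_2pin[of k] sin_int_2pin[of k] by (simp add: cos_add mult.commute)
    finally show ?thesis .
  qed
  then show "tst 0 a s (x + 2 * pi) = tst 0 a s x" by (simp add: tst_def fun_eq_iff)
  show "tst 0 a s (- x) = tst 0 a s x" by (simp add: tst_def fun_eq_iff)
qed

section \<open>Derivatives, continuity, boundary values and symmetries of the sums\<close>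

context expansion
begin

lemma flat_derivs:
  assumes s: "\<bar>s\<bar> < e" and y: "y \<in> {0..1}"
  shows "(gam s has_real_derivative gam' s x) (at x)"
    "((\<lambda>y. fU s y x) has_real_derivative fUy s y x) (at y within {0..1})" "(fU s y has_real_derivative fUx s y x) (at x)"
    "((\<lambda>y. fP s y x) has_real_derivative fPy s y x) (at y within {0..1})" "(fP s y has_real_derivative fPx s y x) (at x)"
    "((\<lambda>y. eta s y x) has_real_derivative etay s y x) (at y within {0..1})" "(eta s y has_real_derivative etax s y x) (at x)"
proof -
  have s': "\<bar>s\<bar> \<le> e" using s by simp
  note B = tot_bounds
  have reg: "(cp (X n) k has_real_derivative cp' (X n) k z) (at z within {0..1}) \<and>
    (cv (X n) k has_real_derivative cv' (X n) k z) (at z within {0..1}) \<and>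
    (cu (X n) k has_real_derivative cu' (X n) k z) (at z within {0..1})" if "z \<in> {0..1}" for n k z
    by (cases "n = 0") (use good_regular(1-3)[OF gX that] in simp_all)
  have dx: "((\<lambda>x. ts \<delta> a s x) has_real_derivative ts (\<delta> + pi / 2) (\<lambda>n k. of_int k * a n k) s x) (at x)"
    if "\<And>n. (\<Sum>k\<in>freqs n. \<bar>a n k\<bar>) \<le> tot X n" "\<And>n. (\<Sum>k\<in>freqs n. \<bar>of_int k * a n k\<bar>) \<le> tot X n" for \<delta> a
    by (rule ts_DERIV_x[OF that(1) sum_tot s' that(2)])
  have dy: "((\<lambda>y. ts \<delta> (\<lambda>n k. f n k y) s x) has_real_derivative ts \<delta> (\<lambda>n k. f' n k y) s x) (at y within {0..1})"
    if "\<And>n y. y \<in> {0..1} \<Longrightarrow> (\<Sum>k\<in>freqs n. \<bar>f n k y\<bar>) \<le> tot X n" "\<And>n y. y \<in> {0..1} \<Longrightarrow> (\<Sum>k\<in>freqs n. \<bar>f' n k y\<bar>) \<le> tot X n"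
      "\<And>n k y. y \<in> {0..1} \<Longrightarrow> (f n k has_real_derivative f' n k y) (at y within {0..1})" for \<delta> f f'
    by (rule ts_DERIV_y[OF that(1) sum_tot s' that(2,3) _ y]) auto
  show "(gam s has_real_derivative gam' s x) (at x)"
    using dx[OF B(1,2)[OF y], of 0] by (simp add: gam_def[abs_def] gam'_def)
  show "(fU s y has_real_derivative fUx s y x) (at x)"
    using dx[OF B(9,10)[OF y], of 0] by (simp add: fU_def[abs_def] fUx_def)
  show "(fP s y has_real_derivative fPx s y x) (at x)"
    using dx[OF B(3,4)[OF y], of 0] by (simp add: fP_def[abs_def] fPx_def)
  \<comment> \<open>Two derivatives in \<open>x\<close> shift the phase by \<open>pi\<close>, which
    reverses the sign; this is the minus sign in \<open>etax\<close>.\<close>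
  have ep: "ts pi (\<lambda>n k. of_int k * (of_int k * cv (X n) k y)) s x = - ts 0 (\<lambda>n k. (of_int k)\<^sup>2 * cv (X n) k y) s x"
  proof -
    have "tst pi a s x = (\<lambda>n. - tst 0 a s x n)" for a by (simp add: fun_eq_iff tst_pi[of 0, simplified])
    then show ?thesis
      unfolding ts_def using ts_summable(2)[OF B(7)[OF y] sum_tot s', of 0 x]
      by (simp add: suminf_minus power2_eq_square mult.assoc)
  qed
  show "(eta s y has_real_derivative etax s y x) (at x)"
    using dx[OF B(6)[OF y], of "pi / 2"] B(7)[OF y] ep by (simp add: eta_def[abs_def] etax_def power2_eq_square mult.assoc)
  show "((\<lambda>y. fU s y x) has_real_derivative fUy s y x) (at y within {0..1})"
    unfolding fU_def fUy_def by (rule dy[OF B(9) B(11)]) (use reg in auto)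
  show "((\<lambda>y. fP s y x) has_real_derivative fPy s y x) (at y within {0..1})"
    unfolding fP_def fPy_def by (rule dy[OF B(3) B(5)]) (use reg in auto)
  show "((\<lambda>y. eta s y x) has_real_derivative etay s y x) (at y within {0..1})"
    unfolding eta_def etay_def by (rule dy[OF B(6) B(8)]) (use reg in \<open>auto intro!: DERIV_cmult\<close>)
qed

lemma flat_continuous:
  assumes s: "\<bar>s\<bar> < e"
  shows "continuous_on UNIV (gam' s)" "continuous_on ({0..1} \<times> UNIV) (\<lambda>z. fP s (fst z) (snd z))"
    "continuous_on ({0..1} \<times> UNIV) (\<lambda>z. fPx s (fst z) (snd z))" "continuous_on ({0..1} \<times> UNIV) (\<lambda>z. fPy s (fst z) (snd z))"
    "continuous_on ({0..1} \<times> UNIV) (\<lambda>z. eta s (fst z) (snd z))" "continuous_on ({0..1} \<times> UNIV) (\<lambda>z. etax s (fst z) (snd z))"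
proof -
  have s': "\<bar>s\<bar> \<le> e" using s by simp
  have c: "continuous_on ({0..1} \<times> UNIV) (\<lambda>z. ts \<delta> (\<lambda>n k. f n k (fst z)) s (snd z))"
    if "\<And>n y. y \<in> {0..1} \<Longrightarrow> (\<Sum>k\<in>freqs n. \<bar>f n k y\<bar>) \<le> tot X n" "\<And>n k. continuous_on {0..1} (f n k)" for \<delta> and f :: "nat \<Rightarrow> int \<Rightarrow> real \<Rightarrow> real"
    by (rule ts_continuous[OF that(1) sum_tot s' that(2)])
  have reg: "continuous_on {0..1} (cp (X n) k) \<and> continuous_on {0..1} (cp' (X n) k) \<and> continuous_on {0..1} (cv (X n) k)" for n k
    by (cases "n = 0") (use good_regular(4)[OF gX] good_continuous[OF gX] in simp_all)
  have "continuous_on ({0..1::real} \<times> UNIV) (\<lambda>z. gam' s (snd z))"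
    unfolding gam'_def by (rule c[where f="\<lambda>n k _. of_int k * cg (X n) k", OF tot_bounds(2)]) auto
  then have "continuous_on UNIV (\<lambda>x. gam' s (snd (0::real, x)))"
    by (rule continuous_on_compose2) (auto intro!: continuous_intros)
  then show "continuous_on UNIV (gam' s)" by simp
  show "continuous_on ({0..1} \<times> UNIV) (\<lambda>z. fP s (fst z) (snd z))"
    unfolding fP_def by (rule c[OF tot_bounds(3)]) (use reg in auto)
  show "continuous_on ({0..1} \<times> UNIV) (\<lambda>z. fPx s (fst z) (snd z))"
    unfolding fPx_def by (rule c[OF tot_bounds(4)]) (use reg in \<open>auto intro!: continuous_intros\<close>)
  show "continuous_on ({0..1} \<times> UNIV) (\<lambda>z. fPy s (fst z) (snd z))"
    unfolding fPy_def by (rule c[OF tot_bounds(5)]) (use reg in auto)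
  show "continuous_on ({0..1} \<times> UNIV) (\<lambda>z. eta s (fst z) (snd z))"
    unfolding eta_def by (rule c[OF tot_bounds(6)]) (use reg in \<open>auto intro!: continuous_intros\<close>)
  show "continuous_on ({0..1} \<times> UNIV) (\<lambda>z. etax s (fst z) (snd z))"
    unfolding etax_def by (intro continuous_on_minus c[OF tot_bounds(7)]) (use reg in \<open>auto intro!: continuous_intros\<close>)
qed

lemma flat_boundary:
  "fU s 1 x = 0" "fP s 1 x = 0" "eta s 1 x = 0" "fP s 0 x = 0" "etay s 0 x = 0"
proof -
  have z: "cu (X n) k 1 = 0 \<and> cp (X n) k 1 = 0 \<and> cv (X n) k 1 = 0 \<and> cp (X n) k 0 = 0 \<and> cv' (X n) k 0 = 0" for n k
    by (cases "n = 0") (use good_regular(7-11)[OF gX] in simp_all)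
  then show "fU s 1 x = 0" "fP s 1 x = 0" "eta s 1 x = 0" "fP s 0 x = 0" "etay s 0 x = 0"
    by (simp_all add: fU_def fP_def eta_def etay_def ts_def tst_def)
qed

lemma flat_even_periodic:
  "gam s (- x) = gam s x" "gam s (x + 2 * pi) = gam s x" "fU s y (- x) = fU s y x" "fU s y (x + 2 * pi) = fU s y x"
  unfolding gam_def fU_def ts_def by (simp_all only: tst_even_periodic)

lemma first_order_expansion:
  assumes s: "\<bar>s\<bar> < e" and y: "y \<in> {0..1}"
  shows "\<bar>gam s x - s * gh * cos x\<bar> \<le> s\<^sup>2 * ((\<Sum>n. tot X n * e ^ n) / e\<^sup>2)"
    "\<bar>fU s y x - s * (rad N (- l1) y + gh * y * U' y) * cos x\<bar> \<le> s\<^sup>2 * ((\<Sum>n. tot X n * e ^ n) / e\<^sup>2)"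
  unfolding gam_def fU_def
  by (rule ts_first_order[OF tot_bounds(1)[OF y] sum_tot e] ts_first_order[OF tot_bounds(9)[OF y] sum_tot e];
    use s X1 in \<open>auto simp: first_order_def\<close>)+

lemma MM_0: "MM 0 = M0"
  by (simp add: MM_def mh_def)

end

text \<open>A merely continuous factor times a linear function that vanishes at the point is
  differentiable there: the increment of the factor is multiplied by something of first order. This
  provides second derivatives on the axis, where quotients such as \<open>P / y\<close> are only
  known to be continuous.\<close>

lemma has_derivative_mult_vanishing:
  fixes k L :: "'a::real_normed_vector \<Rightarrow> real"
  assumes k: "continuous (at z within S) k" and L: "bounded_linear L" "L z = 0"
  shows "((\<lambda>w. k w * L w) has_derivative (\<lambda>d. k z * L d)) (at z within S)"
proof -
  interpret bounded_linear L by fact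
  obtain K where K: "K > 0" "\<And>x. norm (L x) \<le> norm x * K" using pos_bounded by blast
  show ?thesis
    unfolding has_derivative_within_alt
  proof (intro conjI allI impI)
    show "bounded_linear (\<lambda>d. k z * L d)" by (intro bounded_linear_const_mult L)
    fix \<epsilon> :: real assume "\<epsilon> > 0"
    then obtain d where d: "d > 0" "\<And>w. w \<in> S \<Longrightarrow> dist w z < d \<Longrightarrow> dist (k w) (k z) < \<epsilon> / K"
      using k K(1) unfolding continuous_within_eps_delta by (meson divide_pos_pos)
    show "\<exists>d>0. \<forall>y\<in>S. norm (y - z) < d \<longrightarrow> norm (k y * L y - k z * L z - k z * L (y - z)) \<le> \<epsilon> * norm (y - z)"
    proof (intro exI[of _ d] conjI ballI impI d(1))
      fix w assume w: "w \<in> S" "norm (w - z) < d"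
      have "k w * L w - k z * L z - k z * L (w - z) = (k w - k z) * L (w - z)"
        by (simp add: L(2) diff algebra_simps)
      also have "norm \<dots> \<le> \<epsilon> / K * (norm (w - z) * K)"
        unfolding norm_mult using d(2)[OF w(1)] w(2) K(2)[of "w - z"] by (intro mult_mono) (auto simp: dist_norm)
      finally show "norm (k w * L w - k z * L z - k z * L (w - z)) \<le> \<epsilon> * norm (w - z)" using K(1) by simp
    qed
  qed
qed

text \<open>One partial derivative at the point and a continuous other one suffice for total
  differentiability; this fits sums that are differentiable in \<open>y\<close> only within
  \<open>[0, 1]\<close>.\<close>

lemma joint_derivative:
  fixes F Fx :: "real \<Rightarrow> real \<Rightarrow> real"
  assumes y: "((\<lambda>y. F y x) has_real_derivative Fy) (at y within {0..1})" "y \<in> {0..1}"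
    and x: "\<And>y x. y \<in> {0..1} \<Longrightarrow> (F y has_real_derivative Fx y x) (at x)"
    and c: "continuous_on ({0..1} \<times> UNIV) (\<lambda>z. Fx (fst z) (snd z))"
  shows "((\<lambda>z. F (fst z) (snd z)) has_derivative (\<lambda>d. Fy * fst d + Fx y x * snd d)) (at (y, x) within {0..1} \<times> UNIV)"
proof -
  have "((\<lambda>(y, x). F y x) has_derivative (\<lambda>(ty, tx). Fy * ty + blinfun_mult_right (Fx y x) tx)) (at (y, x) within {0..1} \<times> UNIV)"
  proof (rule has_derivative_partialsI[where fy="\<lambda>y x. blinfun_mult_right (Fx y x)"])
    show "((\<lambda>y. F y x) has_derivative (*) Fy) (at y within {0..1})" using y(1) by (simp add: has_field_derivative_def)
    show "(F y has_derivative blinfun_apply (blinfun_mult_right (Fx y x))) (at x)" if "y \<in> {0..1}" for y x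
      using x[OF that] by (simp add: has_field_derivative_def)
    have "continuous (at (y, x) within {0..1} \<times> UNIV) (\<lambda>z. Fx (fst z) (snd z))"
      using c y(2) by (simp add: continuous_on_eq_continuous_within)
    then show "continuous (at (y, x) within {0..1} \<times> UNIV) (\<lambda>(y, x). blinfun_mult_right (Fx y x))"
      unfolding case_prod_beta
      by (rule continuous_within_compose3[rotated, where g="blinfun_mult_right"]) (auto intro!: bounded_linear_intros linear_continuous_at bounded_linear_blinfun_mult_right)
  qed auto
  then show ?thesis by (simp only: case_prod_beta' blinfun_mult_right.rep_eq)
qed

section \<open>From the flattened system to the overdetermined problem\<close>

text \<open>
  In terms of the solution \<open>w\<close> and \<open>\<sigma> = 1 / sqrt M\<close>: \<open>y = |t| h(x)\<close>, \<open>h = \<sigma> / g\<close>, \<open>u = w\<close>, \<open>P = \<partial>\<^sub>r w / \<sigma>\<close>, \<open>v = \<partial>\<^sub>x w\<close>.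
\<close>

locale flat =
  fixes n :: nat and Lam M K :: real and g g' :: "real \<Rightarrow> real" and u P Py Px v vx :: "real \<Rightarrow> real \<Rightarrow> real"
  assumes pos: "Lam > 0" "M > 0" "\<And>x. g x \<ge> 1 / 2"
    and g: "\<And>x. (g has_real_derivative g' x) (at x)" "continuous_on UNIV g'" "\<And>x. \<bar>g' x\<bar> \<le> K"
      "\<And>x. g (- x) = g x" "\<And>x. g (x + 2 * pi) = g x"
    and u: "\<And>y x. y \<in> {0..1} \<Longrightarrow> ((\<lambda>y. u y x) has_real_derivative g x * P y x) (at y within {0..1})"
      "\<And>y x. y \<in> {0..1} \<Longrightarrow> (u y has_real_derivative v y x + y * g' x * P y x) (at x)"
      "\<And>y x. u y (- x) = u y x" "\<And>y x. u y (x + 2 * pi) = u y x"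
    and P: "\<And>y x. y \<in> {0..1} \<Longrightarrow> ((\<lambda>y. P y x) has_real_derivative Py y x) (at y within {0..1})"
      "\<And>y x. y \<in> {0..1} \<Longrightarrow> (P y has_real_derivative Px y x) (at x)"
    and v: "\<And>y x. y \<in> {0..1} \<Longrightarrow> ((\<lambda>y. v y x) has_real_derivative g x * Px y x - y * g' x * Py y x) (at y within {0..1})"
      "\<And>y x. y \<in> {0..1} \<Longrightarrow> (v y has_real_derivative vx y x) (at x)"
    and cont: "continuous_on ({0..1} \<times> UNIV) (\<lambda>z. P (fst z) (snd z))" "continuous_on ({0..1} \<times> UNIV) (\<lambda>z. Px (fst z) (snd z))"
      "continuous_on ({0..1} \<times> UNIV) (\<lambda>z. Py (fst z) (snd z))" "continuous_on ({0..1} \<times> UNIV) (\<lambda>z. v (fst z) (snd z))"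
      "continuous_on ({0..1} \<times> UNIV) (\<lambda>z. vx (fst z) (snd z))"
    and pde: "\<And>y x. y \<in> {0..1} \<Longrightarrow> y * Py y x + (real n - 1) * P y x + y * Lam * g x * u y x
      + y * M * (g x * vx y x - y * g' x * (g x * Px y x - y * g' x * Py y x)) = 0"
    and bc: "\<And>x. u 1 x = 1" "\<And>x. P 1 x = 0" "\<And>x. v 1 x = 0" "\<And>x. P 0 x = 0"
begin

text \<open>The directions orthogonal to \<open>t\<close> contribute the radial derivative divided
  by the radius to the Laplacian. The quotient extends to the axis because \<open>P\<close> vanishes
  there.\<close>

definition "q y x = (if y = 0 then Py 0 x else P y x / y)"
definition "vy y x = g x * Px y x - y * g' x * Py y x"

lemma gc: "continuous_on S g"
  using g(1) by (meson DERIV_continuous_on has_field_derivative_at_within)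

lemma P_q: "P y x = y * q y x"
  by (simp add: q_def bc)

lemma Px_0: "Px 0 x = 0"
proof -
  have "(\<lambda>x. P 0 x) = (\<lambda>_. 0)" by (simp add: bc)
  then show ?thesis using P(2)[of 0 x] DERIV_unique[OF _ DERIV_const] by fastforce
qed

lemma vy_0: "vy 0 x = 0"
  by (simp add: vy_def Px_0)

lemma cont_vy: "continuous_on ({0..1} \<times> UNIV) (\<lambda>z. vy (fst z) (snd z))"
proof -
  have "continuous_on ({0..1} \<times> UNIV) (\<lambda>z. g (snd z))" "continuous_on ({0..1} \<times> UNIV) (\<lambda>z. g' (snd z))" for S
    by (rule continuous_on_compose2[OF gc[of UNIV]] continuous_on_compose2[OF g(2)]; auto intro!: continuous_intros)+
  then show ?thesis unfolding vy_def by (intro continuous_intros cont)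
qed

text \<open>By the mean value theorem \<open>q y x\<close> is a value of \<open>Py\<close> at a
  point between the axis and \<open>y\<close> with the same \<open>x\<close>. That point is at least
  as close to the axis point \<open>(0, x)\<close>, so continuity of \<open>Py\<close> carries
  over.\<close>

lemma cont_q: "continuous_on ({0..1} \<times> UNIV) (\<lambda>z. q (fst z) (snd z))"
  unfolding continuous_on_eq_continuous_within
proof safe
  fix y x :: real assume y: "y \<in> {0..1}"
  show "continuous (at (y, x) within {0..1} \<times> UNIV) (\<lambda>z. q (fst z) (snd z))"
  proof (cases "y = 0")
    case False
    have "continuous_on ({0<..1} \<times> UNIV) (\<lambda>z. P (fst z) (snd z) / fst z)"
      by (intro continuous_intros continuous_on_subset[OF cont(1)]) auto
    then have "continuous_on ({0<..1} \<times> UNIV) (\<lambda>z. q (fst z) (snd z))"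
      by (rule continuous_on_eq) (auto simp: q_def)
    then have 1: "continuous (at (y, x) within {0<..1} \<times> UNIV) (\<lambda>z. q (fst z) (snd z))"
      using False y by (simp add: continuous_on_eq_continuous_within)
    have "at (y, x) within {0<..1} \<times> UNIV = at (y, x) within {0..1} \<times> UNIV"
      by (rule at_within_nhd[of _ "{0<..} \<times> UNIV"]) (use False y in \<open>auto intro!: open_Times\<close>)
    then show ?thesis using 1 by simp
  next
    case True
    have "continuous (at (0, x) within {0..1} \<times> UNIV) (\<lambda>z. Py (fst z) (snd z))"
      using cont(3) by (simp add: continuous_on_eq_continuous_within)
    then show ?thesis
      unfolding True continuous_within_eps_delta
    proof (intro allI impI)
      fix \<epsilon> :: real assume "\<forall>\<epsilon>>0. \<exists>d>0. \<forall>z\<in>{0..1} \<times> UNIV. dist z (0, x) < d \<longrightarrow> dist (Py (fst z) (snd z)) (Py (fst (0, x)) (snd (0, x))) < \<epsilon>" "\<epsilon> > 0"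
      then obtain d where d: "d > 0" "\<And>z. z \<in> {0..1} \<times> UNIV \<Longrightarrow> dist z (0, x) < d \<Longrightarrow> dist (Py (fst z) (snd z)) (Py 0 x) < \<epsilon>" by auto
      show "\<exists>d>0. \<forall>z\<in>{0..1} \<times> UNIV. dist z (0, x) < d \<longrightarrow> dist (q (fst z) (snd z)) (q (fst (0, x)) (snd (0, x))) < \<epsilon>"
      proof (intro exI[of _ d] conjI d(1) ballI impI)
        fix z :: "real \<times> real" assume z: "z \<in> {0..1} \<times> UNIV" "dist z (0, x) < d"
        obtain y' x' where z': "z = (y', x')" by (cases z)
        have "\<exists>\<theta>\<in>{0..y'}. q y' x' = Py \<theta> x'"
        proof (cases "y' = 0")
          case False
          have c: "continuous_on {0..y'} (\<lambda>y. P y x')"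
            by (rule DERIV_continuous_on[of _ _ "\<lambda>y. Py y x'"], rule DERIV_subset[OF P(1)]) (use z(1) z' in auto)
          obtain \<theta> where "0 < \<theta>" "\<theta> < y'" "P y' x' - P 0 x' = Py \<theta> x' * (y' - 0)"
          proof (rule mvt[of 0 y' "\<lambda>y. P y x'" "\<lambda>\<theta> h. Py \<theta> x' * h"])
            show "0 < y'" using False z(1) z' by auto
            show "continuous_on {0..y'} (\<lambda>y. P y x')" by (rule c)
            fix \<theta> assume t: "0 < \<theta>" "\<theta> < y'"
            have "((\<lambda>y. P y x') has_real_derivative Py \<theta> x') (at \<theta> within {0..1})" using t z(1) z' by (intro P(1)) auto
            moreover have "at \<theta> within {0..1} = at \<theta>" using t z(1) z' by (intro at_within_interior) auto
            ultimately show "((\<lambda>y. P y x') has_derivative (\<lambda>h. Py \<theta> x' * h)) (at \<theta>)" by (simp add: has_field_derivative_def)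
          qed
          then show ?thesis using False by (auto simp: q_def bc field_simps intro!: bexI)
        qed (auto simp: q_def)
        then obtain \<theta> where \<theta>: "\<theta> \<in> {0..y'}" "q y' x' = Py \<theta> x'" by blast
        have "dist (\<theta>, x') (0, x) \<le> dist (y', x') (0, x)"
          using \<theta>(1) by (auto simp: dist_Pair_Pair dist_real_def intro!: power_mono)
        then have "dist (Py \<theta> x') (Py 0 x) < \<epsilon>" using d(2)[of "(\<theta>, x')"] z z' \<theta>(1) by auto
        then show "dist (q (fst z) (snd z)) (q (fst (0, x)) (snd (0, x))) < \<epsilon>"
          using \<theta>(2) z' by (simp add: q_def)
      qed
    qed
  qed
qed

text \<open>Division of the equation by \<open>y\<close> for \<open>y > 0\<close>; all terms are
  continuous up to the axis, so the value \<open>0\<close> persists at \<open>y = 0\<close>.\<close>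

lemma pde_q:
  assumes y: "y \<in> {0..1}"
  shows "Py y x + (real n - 1) * q y x + Lam * g x * u y x + M * (g x * vx y x - y * g' x * vy y x) = 0" (is "?\<Phi> y = 0")
proof -
  have nz: "?\<Phi> y = 0" if "y \<in> {0..1}" "y \<noteq> 0" for y
  proof -
    have *: "y * (a + c * b + d + M * (e - w)) = y * a + c * (y * b) + y * d + y * M * (e - w)" for a b c d e w :: real
      by (simp add: algebra_simps)
    have "y * ?\<Phi> y = 0" using pde[OF that(1), of x] unfolding * vy_def[symmetric] P_q[symmetric] by (simp only: mult.assoc)
    then show ?thesis unfolding mult_eq_0_iff using that(2) by blast
  qed
  have c: "continuous_on {0..1} (\<lambda>y. F y x)" if "continuous_on ({0..1} \<times> UNIV) (\<lambda>z. F (fst z) (snd z))" for F :: "real \<Rightarrow> real \<Rightarrow> real"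
  proof -
    have "continuous_on {0..1} (\<lambda>y. F (fst (y, x)) (snd (y, x)))"
      by (rule continuous_on_compose2[OF that]) (auto intro!: continuous_intros)
    then show ?thesis by simp
  qed
  have uc: "continuous_on {0..1} (\<lambda>y. u y x)" by (rule DERIV_continuous_on) (rule u(1))
  have "continuous_on {0..1} ?\<Phi>"
    by (intro continuous_intros c cont cont_q cont_vy uc)
  then have 1: "(?\<Phi> \<longlongrightarrow> ?\<Phi> 0) (at 0 within {0..1})" unfolding continuous_on_def by (rule bspec) simp
  have 2: "(?\<Phi> \<longlongrightarrow> 0) (at 0 within {0..1})"
    by (rule tendsto_eventually) (auto simp: eventually_at intro!: exI[of _ 1] nz)
  have "at (0::real) within {0..1} \<noteq> bot" by (simp add: at_within_Icc_at_right)
  from tendsto_unique[OF this 1 2] have z: "?\<Phi> 0 = 0" .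
  show ?thesis
  proof (cases "y = 0")
    case True
    show ?thesis unfolding True by (rule z)
  next
    case False
    show ?thesis by (rule nz[OF y False])
  qed
qed

end

section \<open>Functions of \<open>|t| h(x)\<close> and \<open>x\<close> near the axis\<close>

lemma continuous_within_mult_bounded:
  fixes k f :: "'a::metric_space \<Rightarrow> real"
  assumes "continuous (at z within S) k" "k z = 0" "\<And>w. \<bar>f w\<bar> \<le> 1"
  shows "continuous (at z within S) (\<lambda>w. k w * f w)"
proof -
  have "(k \<longlongrightarrow> 0) (at z within S)" using assms(1,2) by (simp add: continuous_within)
  then have "((\<lambda>w. k w * f w) \<longlongrightarrow> 0) (at z within S)"
    by (rule Lim_null_comparison[rotated, OF tendsto_rabs_zero]) (auto simp: abs_mult assms(3) mult_left_le)
  then show ?thesis using assms(2) by (simp add: continuous_within)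
qed

lemma abs_sgn_inner_le: "norm b \<le> 1 \<Longrightarrow> \<bar>sgn t \<bullet> b\<bar> \<le> 1"
  using Cauchy_Schwarz_ineq2[of "sgn t" b] by (simp add: norm_sgn split: if_splits)

text \<open>The value \<open>sgn 0 = 0\<close> makes the formula correct on the axis as well.\<close>

lemma radial_derivative:
  fixes F :: "real \<Rightarrow> real \<Rightarrow> real" and S :: "('a::euclidean_space \<times> real) set"
  assumes F: "((\<lambda>z. F (fst z) (snd z)) has_derivative (\<lambda>d. A * fst d + B * snd d)) (at (norm t * h x, x) within {0..1} \<times> UNIV)"
    and h: "(h has_real_derivative h') (at x)" and hb: "\<And>x. 0 \<le> h x" "\<And>x. h x \<le> H"
    and S: "\<And>z. z \<in> S \<Longrightarrow> norm (fst z) * h (snd z) \<le> 1"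
    and t: "t \<noteq> 0 \<or> A = 0"
  shows "((\<lambda>z. F (norm (fst z) * h (snd z)) (snd z)) has_derivative (\<lambda>d. ((A * h x) *\<^sub>R sgn t, A * norm t * h' + B) \<bullet> d)) (at (t, x) within S)"
proof (cases "t = 0")
  case False
  have hd: "((\<lambda>z. h (snd z)) has_derivative (\<lambda>d. h' * snd d)) (at (t, x) within S)"
    using has_derivative_compose[OF has_derivative_snd[OF has_derivative_ident], of h "(*) h'" "(t, x)" S] h
    by (simp add: has_field_derivative_def)
  have nd: "((\<lambda>z. norm (fst z)) has_derivative (\<lambda>d. sgn t \<bullet> fst d)) (at (t, x) within S)"
    using has_derivative_compose[OF has_derivative_fst[OF has_derivative_ident], of norm "\<lambda>d. sgn t \<bullet> d" "(t, x)" S] has_derivative_norm[OF False]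
    by (simp add: inner_commute)
  have Y: "((\<lambda>z. (norm (fst z) * h (snd z), snd z)) has_derivative (\<lambda>d. (norm t * (h' * snd d) + (sgn t \<bullet> fst d) * h x, snd d))) (at (t, x) within S)"
    using has_derivative_Pair[OF has_derivative_mult[OF nd hd] has_derivative_snd[OF has_derivative_ident]] by simp
  have img: "(\<lambda>z. (norm (fst z) * h (snd z), snd z)) ` S \<subseteq> {0..1} \<times> UNIV"
    using S hb(1) by auto
  have "((\<lambda>z. F (fst z) (snd z)) has_derivative (\<lambda>d. A * fst d + B * snd d))
    (at (norm (fst (t, x)) * h (snd (t, x)), snd (t, x)) within (\<lambda>z. (norm (fst z) * h (snd z), snd z)) ` S)"
    unfolding fst_conv snd_conv by (rule has_derivative_subset[OF F img])
  from has_derivative_in_compose[OF Y this]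
  have "((\<lambda>z. F (norm (fst z) * h (snd z)) (snd z)) has_derivative
    (\<lambda>d. A * (norm t * (h' * snd d) + sgn t \<bullet> fst d * h x) + B * snd d)) (at (t, x) within S)"
    unfolding fst_conv snd_conv .
  moreover have "(\<lambda>d. A * (norm t * (h' * snd d) + sgn t \<bullet> fst d * h x) + B * snd d)
     = (\<lambda>d. ((A * h x) *\<^sub>R sgn t, A * norm t * h' + B) \<bullet> d)"
    by (simp add: fun_eq_iff inner_prod_def algebra_simps)
  ultimately show ?thesis by simp
next
  case True
  then have A: "A = 0" using t by simp
  \<comment> \<open>On the axis \<open>A = 0\<close>, so the derivative of \<open>F\<close> has no
    radial part. The estimate for \<open>F\<close> is transported by the map
    \<open>z \<mapsto> (norm (fst z) * h (snd z), snd z)\<close>, whose distance from the axis point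
    grows at most by the factor \<open>H + 1\<close>.\<close>
  have H: "H \<ge> 0" using hb order_trans by blast
  show ?thesis
    unfolding True A has_derivative_within_alt
  proof (intro conjI allI impI)
    show "bounded_linear (\<lambda>d. ((0 * h x) *\<^sub>R sgn 0, 0 * norm (0::'a) * h' + B) \<bullet> d)" by (rule bounded_linear_inner_right)
    fix \<epsilon> :: real assume \<epsilon>: "\<epsilon> > 0"
    have "\<forall>\<epsilon>>0. \<exists>d>0. \<forall>y\<in>{0..1} \<times> UNIV. norm (y - (0, x)) < d \<longrightarrow> norm (F (fst y) (snd y) - F 0 x - B * snd (y - (0, x))) \<le> \<epsilon> * norm (y - (0, x))"
      using F unfolding True A has_derivative_within_alt by simp
    moreover have "\<epsilon> / (H + 1) > 0" using \<epsilon> H by simp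
    ultimately obtain d where d: "d > 0" and dd: "\<And>y. y \<in> {0..1} \<times> UNIV \<Longrightarrow> norm (y - (0, x)) < d \<Longrightarrow>
        norm (F (fst y) (snd y) - F 0 x - B * snd (y - (0, x))) \<le> \<epsilon> / (H + 1) * norm (y - (0, x))" by blast
    show "\<exists>d>0. \<forall>y\<in>S. norm (y - (0, x)) < d \<longrightarrow>
      norm (F (norm (fst y) * h (snd y)) (snd y) - F (norm (fst (0::'a, x)) * h (snd (0::'a, x))) (snd (0::'a, x)) -
        ((0 * h x) *\<^sub>R sgn 0, 0 * norm (0::'a) * h' + B) \<bullet> (y - (0, x))) \<le> \<epsilon> * norm (y - (0, x))"
    proof (intro exI[of _ "d / (H + 1)"] conjI ballI impI)
      show "0 < d / (H + 1)" using d H by simp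
      fix z :: "'a \<times> real" assume z: "z \<in> S" "norm (z - (0, x)) < d / (H + 1)"
      define y where "y = (norm (fst z) * h (snd z), snd z)"
      have y01: "y \<in> {0..1} \<times> UNIV" using S[OF z(1)] hb(1) by (simp add: y_def)
      have "norm (y - (0, x)) \<le> norm (norm (fst z) * h (snd z)) + norm (snd z - x)"
        unfolding y_def using norm_Pair_le[of "norm (fst z) * h (snd z)" "snd z - x"] by simp
      also have "norm (norm (fst z) * h (snd z)) \<le> norm (fst z) * H"
        using hb(1) hb(2)[of "snd z"] by (simp add: abs_mult mult_left_mono)
      also have "norm (fst z) * H \<le> norm (z - (0, x)) * H"
        using norm_fst_le[of "fst z" "snd z - x"] H by (intro mult_right_mono) (cases z, simp_all)
      also have "norm (snd z - x) \<le> norm (z - (0, x))" using norm_snd_le[of "snd z - x" "fst z"] by (cases z) simp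
      finally have n: "norm (y - (0, x)) \<le> norm (z - (0, x)) * (H + 1)" using H by (simp add: algebra_simps)
      also have "\<dots> < d" using z(2) H by (simp add: pos_less_divide_eq)
      finally have "norm (F (fst y) (snd y) - F 0 x - B * snd (y - (0, x))) \<le> \<epsilon> / (H + 1) * norm (y - (0, x))" by (rule dd[OF y01])
      also have "\<dots> \<le> \<epsilon> / (H + 1) * (norm (z - (0, x)) * (H + 1))" using n \<epsilon> H by (intro mult_left_mono) auto
      also have "\<dots> = \<epsilon> * norm (z - (0, x))" using H by simp
      finally show "norm (F (norm (fst z) * h (snd z)) (snd z) - F (norm (fst (0::'a, x)) * h (snd (0::'a, x))) (snd (0::'a, x)) -
        ((0 * h x) *\<^sub>R sgn 0, 0 * norm (0::'a) * h' + B) \<bullet> (z - (0, x))) \<le> \<epsilon> * norm (z - (0, x))"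
        by (cases z) (simp add: y_def)
    qed
  qed
qed

lemma sgn_inner_derivative:
  fixes t b :: "'a::euclidean_space"
  assumes t: "t \<noteq> 0"
  shows "((\<lambda>z. sgn (fst z) \<bullet> b) has_derivative (\<lambda>d. (inverse (norm t) *\<^sub>R (b - (sgn t \<bullet> b) *\<^sub>R sgn t), 0) \<bullet> d)) (at (t, x) within S)"
proof -
  have f: "(fst has_derivative fst) (at (t, x) within S)" by (rule has_derivative_fst[OF has_derivative_ident, simplified])
  have nd: "((\<lambda>z. norm (fst z)) has_derivative (\<lambda>d. sgn t \<bullet> fst d)) (at (t, x) within S)"
    using has_derivative_compose[OF f, of norm "\<lambda>d. sgn t \<bullet> d"] has_derivative_norm[OF t] by (simp add: inner_commute)
  have D: "((\<lambda>z. inverse (norm (fst z)) * (fst z \<bullet> b)) has_derivative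
    (\<lambda>d. inverse (norm t) * (fst d \<bullet> b) + (- (inverse (norm t) * (sgn t \<bullet> fst d) * inverse (norm t))) * (t \<bullet> b))) (at (t, x) within S)"
    using has_derivative_mult[OF Deriv.has_derivative_inverse[OF _ nd] has_derivative_inner_left[OF f]] t by simp
  have e1: "(\<lambda>z. sgn (fst z) \<bullet> b) = (\<lambda>z. inverse (norm (fst z)) * (fst z \<bullet> b))"
    by (simp add: fun_eq_iff sgn_div_norm)
  have e2: "(\<lambda>d. inverse (norm t) * (fst d \<bullet> b) + (- (inverse (norm t) * (sgn t \<bullet> fst d) * inverse (norm t))) * (t \<bullet> b))
    = (\<lambda>d. (inverse (norm t) *\<^sub>R (b - (sgn t \<bullet> b) *\<^sub>R sgn t), 0) \<bullet> d)"
    by (auto simp: fun_eq_iff inner_prod_def sgn_div_norm inner_diff_left inner_commute algebra_simps)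
  show ?thesis unfolding e1 using D unfolding e2 .
qed

text \<open>Directional factors built from \<open>sgn\<close> jump across the axis but stay bounded;
  a continuous factor that vanishes on the axis removes the jump.\<close>

lemma continuous_on_axis:
  fixes k f :: "'a::euclidean_space \<times> real \<Rightarrow> real"
  assumes k: "continuous_on S k" "\<And>z. z \<in> S \<Longrightarrow> fst z = 0 \<Longrightarrow> k z = 0"
    and f: "\<And>z. fst z \<noteq> 0 \<Longrightarrow> isCont f z" "\<And>z. \<bar>f z\<bar> \<le> 1"
  shows "continuous_on S (\<lambda>z. k z * f z)"
  unfolding continuous_on_eq_continuous_within
proof
  fix z assume z: "z \<in> S"
  then have kz: "continuous (at z within S) k" using k(1) by (simp add: continuous_on_eq_continuous_within)
  show "continuous (at z within S) (\<lambda>z. k z * f z)"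
  proof (cases "fst z = 0")
    case True
    show ?thesis by (rule continuous_within_mult_bounded[OF kz k(2)[OF z True] f(2)])
  next
    case False
    show ?thesis by (rule continuous_mult[OF kz continuous_at_imp_continuous_at_within[OF f(1)[OF False]]])
  qed
qed

lemma sum_Basis_prod_real:
  fixes f :: "'a::euclidean_space \<times> real \<Rightarrow> real"
  shows "sum f Basis = (\<Sum>b\<in>Basis. f (b, 0)) + f (0, 1)"
proof -
  have e: "(Basis :: ('a \<times> real) set) = insert (0, 1) ((\<lambda>b. (b, 0)) ` Basis)" by (auto simp: Basis_prod_def)
  have "(0, 1) \<notin> (\<lambda>b::'a. (b, 0::real)) ` Basis" by auto
  moreover have "inj_on (\<lambda>b::'a. (b, 0::real)) Basis" by (simp add: inj_on_def)
  ultimately show ?thesis unfolding e by (subst sum.insert) (simp_all add: sum.reindex)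
qed

section \<open>The solution in the original variables and its first and second derivatives\<close>

context flat
begin

definition "sg = 1 / sqrt M"
definition "h x = sg / g x"
definition "h' x = - sg * g' x / (g x)\<^sup>2"
abbreviation Y :: "'a::euclidean_space \<times> real \<Rightarrow> real" where "Y z \<equiv> norm (fst z) * h (snd z)"
text \<open>A closed set that contains both the domain and its closure and on which \<open>Y\<close>
  takes values in \<open>[0, 1]\<close>. Stating the derivative formulas within subsets of it serves
  the interior and the closure at once.\<close>

definition dom :: "('a::euclidean_space \<times> real) set" where "dom = {z. Y z \<le> 1}"

lemma g_pos: "g x > 0" "g x \<noteq> 0"
proof -
  show "g x > 0" using pos(3)[of x] by linarith
  then show "g x \<noteq> 0" by simp
qed

lemma sg: "sg > 0" "sg * sg = 1 / M"
proof -
  show "sg > 0" using pos(2) by (simp add: sg_def)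
  have "sg * sg = 1 / (sqrt M * sqrt M)" by (simp add: sg_def)
  then show "sg * sg = 1 / M" using pos(2) by simp
qed

lemma h_bounds: "h x > 0" "0 \<le> h x" "h x \<le> 2 * sg"
proof -
  show "h x > 0" using sg g_pos by (simp add: h_def)
  then show "0 \<le> h x" by simp
  have "sg * 1 \<le> sg * (2 * g x)" using pos(3)[of x] sg by (intro mult_left_mono) auto
  then show "h x \<le> 2 * sg" using g_pos[of x] by (simp add: h_def divide_le_eq algebra_simps)
qed

lemma h_deriv: "(h has_real_derivative h' x) (at x)"
proof -
  have "((\<lambda>x. sg * inverse (g x)) has_real_derivative sg * - (inverse (g x) * g' x * inverse (g x))) (at x)"
    by (rule DERIV_cmult[OF DERIV_inverse'[OF g(1) g_pos(2)]])
  then show ?thesis by (simp add: h_def[abs_def] h'_def field_simps power2_eq_square)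
qed

lemma h_cont: "continuous_on S h"
  using h_deriv by (meson DERIV_continuous_on has_field_derivative_at_within)

lemma dom_comp:
  fixes F :: "real \<Rightarrow> real \<Rightarrow> real" and S :: "('a::euclidean_space \<times> real) set"
  assumes F: "continuous_on ({0..1} \<times> UNIV) (\<lambda>z. F (fst z) (snd z))" and S: "S \<subseteq> dom"
  shows "continuous_on S (\<lambda>z. F (Y z) (snd z))"
proof -
  have "continuous_on S (\<lambda>z. h (snd z))" by (rule continuous_on_compose2[OF h_cont[of UNIV]]) (auto intro!: continuous_intros)
  then have "continuous_on S (\<lambda>z. F (fst (Y z, snd z)) (snd (Y z, snd z)))"
    using S h_bounds(2) by (intro continuous_on_compose2[OF F]) (auto intro!: continuous_intros simp: dom_def)
  then show ?thesis by simp
qed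

lemma dom_comp_x:
  fixes S :: "('a::euclidean_space \<times> real) set"
  assumes "continuous_on UNIV f" shows "continuous_on S (\<lambda>z. f (snd z))"
  by (rule continuous_on_compose2[OF assms]) (auto intro!: continuous_intros)

text \<open>\<open>G\<close> is the gradient; \<open>He\<close> and \<open>Hb b\<close> below are the gradients of its components.\<close>

definition G :: "'a::euclidean_space \<times> real \<Rightarrow> 'a \<times> real" where
  "G z = ((sg * P (Y z) (snd z)) *\<^sub>R sgn (fst z), v (Y z) (snd z))"

text \<open>The chain rule, where \<open>h' / h = - g' / g\<close> turns the radial derivative of
  \<open>h\<close> into the correction \<open>- y g' / g\<close> in the axial component.\<close>

lemma dom_deriv:
  fixes F Fx :: "real \<Rightarrow> real \<Rightarrow> real" and z :: "'a::euclidean_space \<times> real"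
  defines "y \<equiv> Y z"
  assumes F: "\<And>y x. y \<in> {0..1} \<Longrightarrow> ((\<lambda>y. F y x) has_real_derivative Fy y x) (at y within {0..1})"
    "\<And>y x. y \<in> {0..1} \<Longrightarrow> (F y has_real_derivative Fx y x) (at x)"
    "continuous_on ({0..1} \<times> UNIV) (\<lambda>z. Fx (fst z) (snd z))"
    and z: "z \<in> S" "S \<subseteq> dom" and t: "fst z \<noteq> 0 \<or> Fy y (snd z) = 0"
  shows "((\<lambda>z. F (Y z) (snd z)) has_derivative
     (\<lambda>d. ((Fy y (snd z) * h (snd z)) *\<^sub>R sgn (fst z), Fx y (snd z) - y * g' (snd z) / g (snd z) * Fy y (snd z)) \<bullet> d)) (at z within S)"
proof -
  have y: "y \<in> {0..1}" using z h_bounds(2) by (auto simp: y_def dom_def)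
  have "((\<lambda>z. F (Y z) (snd z)) has_derivative
     (\<lambda>d. ((Fy y (snd z) * h (snd z)) *\<^sub>R sgn (fst z), Fy y (snd z) * norm (fst z) * h' (snd z) + Fx y (snd z)) \<bullet> d)) (at (fst z, snd z) within S)"
  proof (rule radial_derivative[where A="Fy y (snd z)" and B="Fx y (snd z)" and H="2 * sg"])
    show "((\<lambda>z. F (fst z) (snd z)) has_derivative (\<lambda>d. Fy y (snd z) * fst d + Fx y (snd z) * snd d))
      (at (Y z, snd z) within {0..1} \<times> UNIV)"
      unfolding y_def[symmetric] by (rule joint_derivative[where F=F and Fx=Fx, OF F(1)[OF y] y F(2,3)])
    show "Y w \<le> 1" if "w \<in> S" for w using that z(2) by (auto simp: dom_def)
  qed (rule h_deriv h_bounds(2,3) t)+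
  moreover have "Fy y (snd z) * norm (fst z) * h' (snd z) + Fx y (snd z) = Fx y (snd z) - y * g' (snd z) / g (snd z) * Fy y (snd z)"
    using g_pos[of "snd z"] by (simp add: h'_def y_def h_def power2_eq_square)
  ultimately show ?thesis by simp
qed

text \<open>Here the unknowns \<open>P\<close> and \<open>v\<close> pay off:
  \<open>h g = sg\<close>, and the term \<open>y g' P\<close> in the equation for \<open>u_x\<close>
  cancels the axial correction, so the gradient contains no derivative of the boundary.\<close>

lemma G_deriv:
  fixes z :: "'a::euclidean_space \<times> real"
  assumes z: "z \<in> S" "S \<subseteq> dom"
  shows "((\<lambda>z. u (Y z) (snd z)) has_derivative (\<lambda>d. G z \<bullet> d)) (at z within S)"
proof -
  define y where "y = Y z"
  have "continuous_on ({0..1::real} \<times> UNIV) (\<lambda>z. g' (snd z))" by (rule dom_comp_x[OF g(2)])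
  then have c: "continuous_on ({0..1} \<times> UNIV) (\<lambda>z. v (fst z) (snd z) + fst z * g' (snd z) * P (fst z) (snd z))"
    by (intro continuous_intros cont)
  have "((\<lambda>z. u (Y z) (snd z)) has_derivative
     (\<lambda>d. ((g (snd z) * P y (snd z) * h (snd z)) *\<^sub>R sgn (fst z),
       v y (snd z) + y * g' (snd z) * P y (snd z) - y * g' (snd z) / g (snd z) * (g (snd z) * P y (snd z))) \<bullet> d)) (at z within S)"
    unfolding y_def by (rule dom_deriv[where F=u and Fy="\<lambda>y x. g x * P y x" and Fx="\<lambda>y x. v y x + y * g' x * P y x", OF u(1,2) c z]) (simp_all add: bc)
  then show ?thesis using g_pos[of "snd z"] by (simp add: G_def y_def h_def mult.commute)
qed

definition He :: "'a::euclidean_space \<times> real \<Rightarrow> 'a \<times> real" where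
  "He z = (let y = Y z in
     ((h (snd z) * vy y (snd z)) *\<^sub>R sgn (fst z), vx y (snd z) - y * (g' (snd z) / g (snd z)) * vy y (snd z)))"
definition Hb :: "'a \<Rightarrow> 'a::euclidean_space \<times> real \<Rightarrow> 'a \<times> real" where
  "Hb b z = (let y = Y z in
     ((sg * h (snd z) * (Py y (snd z) - q y (snd z)) * (sgn (fst z) \<bullet> b)) *\<^sub>R sgn (fst z) + (sg * h (snd z) * q y (snd z)) *\<^sub>R b,
      h (snd z) * vy y (snd z) * (sgn (fst z) \<bullet> b)))"

lemma He_deriv:
  fixes z :: "'a::euclidean_space \<times> real"
  assumes z: "z \<in> S" "S \<subseteq> dom"
  shows "((\<lambda>z. v (Y z) (snd z)) has_derivative (\<lambda>d. He z \<bullet> d)) (at z within S)"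
proof -
  define y where "y = Y z"
  have "((\<lambda>z. v (Y z) (snd z)) has_derivative
     (\<lambda>d. ((vy y (snd z) * h (snd z)) *\<^sub>R sgn (fst z), vx y (snd z) - y * g' (snd z) / g (snd z) * vy y (snd z)) \<bullet> d)) (at z within S)"
    unfolding y_def by (rule dom_deriv[where F=v and Fy=vy and Fx=vx, OF v(1)[folded vy_def] v(2) cont(5) z]) (auto simp: vy_0)
  then show ?thesis by (simp add: He_def Let_def y_def mult.commute)
qed

lemma Hb_deriv:
  fixes z :: "'a::euclidean_space \<times> real"
  assumes z: "z \<in> S" "S \<subseteq> dom"
  shows "((\<lambda>z. sg * P (Y z) (snd z) * (sgn (fst z) \<bullet> b)) has_derivative (\<lambda>d. Hb b z \<bullet> d)) (at z within S)"
proof (cases "fst z = 0")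
  case True
  \<comment> \<open>On the axis the component is rewritten as
    \<open>sg * h * q * (fst z \<bullet> b)\<close>, a continuous factor times a linear function
    vanishing there, so that \<open>has_derivative_mult_vanishing\<close> applies.\<close>
  have "continuous_on S (\<lambda>z. sg * h (snd z) * q (Y z) (snd z))"
    by (intro continuous_intros dom_comp[where F=q, OF cont_q z(2)] dom_comp_x[OF h_cont])
  then have k: "continuous (at z within S) (\<lambda>z. sg * h (snd z) * q (Y z) (snd z))"
    using z(1) by (simp add: continuous_on_eq_continuous_within)
  have "((\<lambda>z. sg * h (snd z) * q (Y z) (snd z) * (fst z \<bullet> b)) has_derivative
     (\<lambda>d. sg * h (snd z) * q (Y z) (snd z) * (fst d \<bullet> b))) (at z within S)"
    by (rule has_derivative_mult_vanishing[where L="\<lambda>d. fst d \<bullet> b", OF k])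
      (auto simp: True intro: bounded_linear_inner_left_comp bounded_linear_fst)
  moreover have "(\<lambda>z. sg * P (Y z) (snd z) * (sgn (fst z) \<bullet> b))
     = (\<lambda>z. sg * h (snd z) * q (Y z) (snd z) * (fst z \<bullet> b))"
  proof
    show "sg * P (Y w) (snd w) * (sgn (fst w) \<bullet> b)
      = sg * h (snd w) * q (Y w) (snd w) * (fst w \<bullet> b)" for w :: "'a \<times> real"
      by (cases "fst w = 0") (simp_all add: P_q sgn_div_norm)
  qed
  moreover have "(\<lambda>d. sg * h (snd z) * q (Y z) (snd z) * (fst d \<bullet> b)) = (\<lambda>d. Hb b z \<bullet> d)"
    by (simp add: fun_eq_iff Hb_def Let_def True inner_prod_def inner_commute)
  ultimately show ?thesis by simp
next
  case False
  define y where "y = Y z"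
  define p where "p = ((Py y (snd z) * h (snd z)) *\<^sub>R sgn (fst z), Px y (snd z) - y * g' (snd z) / g (snd z) * Py y (snd z))"
  define s where "s = (inverse (norm (fst z)) *\<^sub>R (b - (sgn (fst z) \<bullet> b) *\<^sub>R sgn (fst z)), 0 :: real)"
  have 1: "((\<lambda>z. P (Y z) (snd z)) has_derivative (\<lambda>d. p \<bullet> d)) (at z within S)"
    unfolding y_def p_def by (rule dom_deriv[where F=P and Fy=Py and Fx=Px, OF P cont(2) z]) (use False in auto)
  have 2: "((\<lambda>z. sgn (fst z) \<bullet> b) has_derivative (\<lambda>d. s \<bullet> d)) (at z within S)"
    using sgn_inner_derivative[OF False, of b "snd z" S] by (simp add: s_def)
  have "((\<lambda>z. sg * (P (Y z) (snd z) * (sgn (fst z) \<bullet> b))) has_derivative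
    (\<lambda>d. sg * (P y (snd z) * (s \<bullet> d) + p \<bullet> d * (sgn (fst z) \<bullet> b)))) (at z within S)"
    using has_derivative_mult_right[OF has_derivative_mult[OF 1 2], of sg] by (simp add: y_def)
  moreover have "sg * (P y (snd z) * (s \<bullet> d) + p \<bullet> d * (sgn (fst z) \<bullet> b)) = Hb b z \<bullet> d" for d
  proof -
    have Pq: "P y (snd z) * inverse (norm (fst z)) = h (snd z) * q y (snd z)"
      using False by (simp add: P_q y_def)
    \<comment> \<open>The symmetry of the mixed second derivatives, which the equation for
      \<open>v_y\<close> encodes.\<close>
    have Pv: "sg * (Px y (snd z) - y * g' (snd z) / g (snd z) * Py y (snd z)) = h (snd z) * vy y (snd z)"
      using g_pos[of "snd z"] by (simp add: h_def vy_def field_simps)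
    have "sg * (P y (snd z) * (s \<bullet> d) + p \<bullet> d * (sgn (fst z) \<bullet> b))
      = sg * (P y (snd z) * inverse (norm (fst z))) * (b \<bullet> fst d - (sgn (fst z) \<bullet> b) * (sgn (fst z) \<bullet> fst d))
       + sg * Py y (snd z) * h (snd z) * (sgn (fst z) \<bullet> fst d) * (sgn (fst z) \<bullet> b)
       + (sg * (Px y (snd z) - y * g' (snd z) / g (snd z) * Py y (snd z))) * snd d * (sgn (fst z) \<bullet> b)"
      by (simp add: p_def s_def inner_prod_def inner_diff_left algebra_simps)
    also have "\<dots> = Hb b z \<bullet> d"
      unfolding Pq Pv by (simp add: Hb_def Let_def y_def[symmetric] inner_prod_def inner_add_left algebra_simps)
    finally show ?thesis .
  qed
  ultimately show ?thesis by (simp add: mult.assoc)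
qed

end

section \<open>The domain and the overdetermined problem\<close>

context flat
begin

lemma Omega_dom: "Omega h \<subseteq> (dom :: ('a::euclidean_space \<times> real) set)" "closure (Omega h) \<subseteq> (dom :: ('a \<times> real) set)"
  "open (Omega h :: ('a \<times> real) set)" "z \<in> frontier (Omega h :: ('a \<times> real) set) \<Longrightarrow> Y z = 1"
proof -
  have Om: "(Omega h :: ('a \<times> real) set) = {z. Y z < 1}"
    using h_bounds(1) by (auto simp: Omega_def pos_less_divide_eq)
  have c: "continuous_on UNIV (\<lambda>z::'a \<times> real. Y z)"
    by (intro continuous_intros dom_comp_x h_cont)
  show o: "open (Omega h :: ('a \<times> real) set)"
    unfolding Om by (intro open_Collect_less c continuous_intros)
  show s: "Omega h \<subseteq> (dom :: ('a \<times> real) set)" by (auto simp: Om dom_def)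
  have cl: "closed (dom :: ('a \<times> real) set)"
    unfolding dom_def by (intro closed_Collect_le c continuous_intros)
  show "closure (Omega h) \<subseteq> (dom :: ('a \<times> real) set)" by (rule closure_minimal[OF s cl])
  then show "Y z = 1" if "z \<in> frontier (Omega h :: ('a \<times> real) set)" for z
    using that interior_open[OF o] by (auto simp: frontier_def Om dom_def)
qed

text \<open>The boundary is the graph of \<open>1 / h = g / sg\<close>, which is Lipschitz by the
  bound on \<open>g'\<close>. Hence directions close to the inward one \<open>(- t, 0)\<close> lead
  into the domain.\<close>

lemma cone_at_closure:
  assumes z: "z \<in> closure (Omega h :: ('a::euclidean_space \<times> real) set)"
  shows "cone_at (closure (Omega h)) z"
proof (cases "z \<in> Omega h")
  case True
  then show ?thesis using cone_at_mono[OF cone_at_open[OF Omega_dom(3) True] closure_subset] by blast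
next
  case False
  then have "z \<in> frontier (Omega h)" using z False by (simp add: frontier_def interior_open[OF Omega_dom(3)])
  then have 1: "Y z = 1" by (rule Omega_dom(4))
  define L where "L = K / sg"
  have K: "K \<ge> 0" using g(3)[of 0] by linarith
  then have L: "L \<ge> 0" using sg(1) by (simp add: L_def)
  have nz: "norm (fst z) > 0" using 1 by (cases "fst z = 0") auto
  have inv: "1 / h x = g x / sg" for x by (simp add: h_def)
  have lip: "\<bar>1 / h x - 1 / h x'\<bar> \<le> L * \<bar>x - x'\<bar>" for x x'
  proof -
    have "norm (g x - g x') \<le> K * norm (x - x')"
      by (rule field_differentiable_bound[where S=UNIV and f'=g']) (use g in \<open>auto\<close>)
    then have "\<bar>g x - g x'\<bar> / sg \<le> K * \<bar>x - x'\<bar> / sg" using sg(1) by (intro divide_right_mono) auto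
    then show ?thesis using sg(1) by (simp add: inv L_def abs_divide flip: diff_divide_distrib)
  qed
  \<comment> \<open>With \<open>norm (fst z) = (L + 1) \<epsilon>\<close> the shrinking of
    \<open>t\<close> pays for both errors, the deviation \<open>\<epsilon>\<close> of the direction
    in \<open>t\<close> and the slope \<open>L \<epsilon>\<close> caused by its deviation in
    \<open>x\<close>.\<close>
  define \<epsilon> where "\<epsilon> = norm (fst z) / (L + 1)"
  have e: "\<epsilon> > 0" using nz L by (simp add: \<epsilon>_def add_nonneg_pos)
  have "\<exists>d>0. \<forall>\<tau>\<in>{0<..<d}. z + \<tau> *\<^sub>R v' \<in> closure (Omega h)" if v': "v' \<in> ball (- fst z, 0) \<epsilon>" for v'
  proof (intro exI[of _ 1] conjI ballI)
    fix \<tau> :: real assume t: "\<tau> \<in> {0<..<1}"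
    have eq: "v' - (- fst z, 0) = v' + (fst z, 0)" by (cases v') simp
    have d: "norm (v' + (fst z, 0)) < \<epsilon>" using v' unfolding eq[symmetric] by (simp add: dist_norm norm_minus_commute)
    have n1: "norm (fst v' + fst z) < \<epsilon>" using norm_fst_le[of "fst v' + fst z" "snd v'"] d by (cases v') auto
    have n2: "\<bar>snd v'\<bar> < \<epsilon>" using norm_snd_le[of "snd v'" "fst v' + fst z"] d by (cases v') auto
    have "fst (z + \<tau> *\<^sub>R v') = (1 - \<tau>) *\<^sub>R fst z + \<tau> *\<^sub>R (fst v' + fst z)" by (simp add: algebra_simps)
    then have "norm (fst (z + \<tau> *\<^sub>R v')) \<le> (1 - \<tau>) * norm (fst z) + \<tau> * norm (fst v' + fst z)"
      using t norm_triangle_ineq[of "(1 - \<tau>) *\<^sub>R fst z" "\<tau> *\<^sub>R (fst v' + fst z)"] by simp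
    also have "\<dots> < (1 - \<tau>) * norm (fst z) + \<tau> * \<epsilon>" using t n1 by simp
    also have "\<dots> = norm (fst z) - \<tau> * (L * \<epsilon>)"
    proof -
      have "norm (fst z) = (L + 1) * \<epsilon>" using L by (simp add: \<epsilon>_def)
      then show ?thesis by (simp add: algebra_simps)
    qed
    also have "\<dots> \<le> 1 / h (snd z) - L * \<bar>\<tau> * snd v'\<bar>"
    proof -
      have "norm (fst z) = 1 / h (snd z)" using 1 h_bounds(1)[of "snd z"] by (simp add: field_simps)
      moreover have "L * \<bar>\<tau> * snd v'\<bar> \<le> \<tau> * (L * \<epsilon>)"
        using t n2 L by (simp add: abs_mult mult.left_commute mult_left_mono)
      ultimately show ?thesis by linarith
    qed
    also have "\<dots> \<le> 1 / h (snd (z + \<tau> *\<^sub>R v'))" using lip[of "snd z" "snd (z + \<tau> *\<^sub>R v')"] by simp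
    finally have "z + \<tau> *\<^sub>R v' \<in> Omega h" by (simp add: Omega_def case_prod_beta)
    then show "z + \<tau> *\<^sub>R v' \<in> closure (Omega h)" using closure_subset by blast
  qed simp
  then show ?thesis unfolding cone_at_def using e by (intro exI[of _ "(- fst z, 0)"] exI[of _ \<epsilon>]) auto
qed

lemma isCont_sgn_inner:
  fixes z :: "'a::euclidean_space \<times> real"
  assumes "fst z \<noteq> 0" shows "isCont (\<lambda>z. sgn (fst z) \<bullet> b) z"
  using assms by (auto intro!: continuous_intros)

lemma G_cont: "continuous_on S (G :: 'a::euclidean_space \<times> real \<Rightarrow> _)" if "S \<subseteq> dom"
proof -
  have "continuous_on S (\<lambda>z::'a \<times> real. (sg * P (Y z) (snd z)) *\<^sub>R sgn (fst z))"
    unfolding continuous_on_componentwise[of S "\<lambda>z. (sg * P (Y z) (snd z)) *\<^sub>R sgn (fst z)"] inner_scaleR_left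
  proof
    fix b :: 'a assume b: "b \<in> Basis"
    show "continuous_on S (\<lambda>z. sg * P (Y z) (snd z) * (sgn (fst z) \<bullet> b))"
      by (rule continuous_on_axis)
        (use b in \<open>auto intro!: continuous_on_mult continuous_on_const dom_comp[where F=P, OF cont(1) that] isCont_sgn_inner abs_sgn_inner_le simp: bc\<close>)
  qed
  then show ?thesis unfolding G_def[abs_def] by (intro continuous_on_Pair dom_comp[where F=v, OF cont(4) that])
qed

text \<open>Every occurrence of \<open>sgn\<close> carries a factor that vanishes on the axis:
  \<open>vy 0 = 0\<close>, and \<open>Py - q = 0\<close> at \<open>y = 0\<close>.\<close>

lemma H_cont:
  assumes S: "S \<subseteq> dom"
  shows "continuous_on S (He :: 'a::euclidean_space \<times> real \<Rightarrow> _)" "norm b \<le> 1 \<Longrightarrow> continuous_on S (Hb (b :: 'a))"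
proof -
  note c = continuous_on_mult continuous_on_diff continuous_on_const dom_comp[where F=vy, OF cont_vy S] dom_comp[where F=vx, OF cont(5) S]
    dom_comp[where F=Py, OF cont(3) S] dom_comp[where F=q, OF cont_q S] dom_comp_x[OF h_cont]
  have g'g: "continuous_on S (\<lambda>z::'a \<times> real. g' (snd z) / g (snd z))"
    by (intro continuous_on_divide dom_comp_x g(2) gc) (use g_pos in auto)
  have n: "continuous_on S (\<lambda>z::'a \<times> real. Y z)" by (intro continuous_intros dom_comp_x h_cont)
  have "continuous_on S (\<lambda>z::'a \<times> real. (h (snd z) * vy (Y z) (snd z)) *\<^sub>R sgn (fst z))"
    unfolding continuous_on_componentwise[of S "\<lambda>z::'a \<times> real. (h (snd z) * vy (Y z) (snd z)) *\<^sub>R sgn (fst z)"] inner_scaleR_left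
  proof
    fix b :: 'a assume b: "b \<in> Basis"
    show "continuous_on S (\<lambda>z. h (snd z) * vy (Y z) (snd z) * (sgn (fst z) \<bullet> b))"
      by (rule continuous_on_axis) (use b in \<open>auto intro!: c isCont_sgn_inner abs_sgn_inner_le simp: vy_0\<close>)
  qed
  then show "continuous_on S (He :: 'a \<times> real \<Rightarrow> _)"
    unfolding He_def[abs_def] Let_def by (intro continuous_on_Pair c g'g n)
  assume b: "norm b \<le> 1"
  have a1: "continuous_on S (\<lambda>z::'a \<times> real. (sg * h (snd z) * (Py (Y z) (snd z) - q (Y z) (snd z)) * (sgn (fst z) \<bullet> b)) *\<^sub>R sgn (fst z))"
    unfolding continuous_on_componentwise[of S "\<lambda>z::'a \<times> real. (sg * h (snd z) * (Py (Y z) (snd z) - q (Y z) (snd z)) * (sgn (fst z) \<bullet> b)) *\<^sub>R sgn (fst z)"]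
      inner_scaleR_left mult.assoc[of _ "sgn (fst _) \<bullet> b"]
  proof
    fix i :: 'a assume i: "i \<in> Basis"
    have "\<bar>(sgn (fst z) \<bullet> b) * (sgn (fst z) \<bullet> i)\<bar> \<le> 1 * 1" for z :: "'a \<times> real"
      unfolding abs_mult using b i by (intro mult_mono abs_sgn_inner_le) auto
    then show "continuous_on S (\<lambda>z. sg * h (snd z) * (Py (Y z) (snd z) - q (Y z) (snd z)) * ((sgn (fst z) \<bullet> b) * (sgn (fst z) \<bullet> i)))"
      by (intro continuous_on_axis[where f="\<lambda>z. (sgn (fst z) \<bullet> b) * (sgn (fst z) \<bullet> i)"]) (auto intro!: c isCont_sgn_inner continuous_mult simp: q_def[of 0])
  qed
  have a2: "continuous_on S (\<lambda>z::'a \<times> real. h (snd z) * vy (Y z) (snd z) * (sgn (fst z) \<bullet> b))"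
    by (rule continuous_on_axis) (use b in \<open>auto intro!: c isCont_sgn_inner abs_sgn_inner_le simp: vy_0\<close>)
  show "continuous_on S (Hb b)"
    unfolding Hb_def[abs_def] Let_def
    by (rule continuous_on_Pair[OF continuous_on_add[OF a1 continuous_on_scaleR[OF _ continuous_on_const]] a2]) (intro c)
qed

text \<open>The trace of the second derivatives is \<open>sg * h\<close> times the radial operator
  plus the axial part; as \<open>sg^2 = 1 / M\<close>, multiplication by \<open>M g\<close> gives
  \<open>pde_q\<close>. On the frontier \<open>y = 1\<close>, where \<open>P\<close> and
  \<open>v\<close>, the two parts of the gradient, vanish.\<close>

theorem overdetermined:
  fixes w :: "'a::euclidean_space \<times> real \<Rightarrow> real"
  defines "w \<equiv> (\<lambda>z. u (Y z) (snd z))"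
  assumes dim: "DIM('a) = n"
  shows "overdetermined_solution (Lam / M) h w" "radial_periodic_even_on S w"
proof -
  let ?O = "Omega h :: ('a \<times> real) set"
  define H where "H B z = Hb (fst B) z + snd B *\<^sub>R He z" for B z :: "'a \<times> real"
  have bn: "norm (fst b) \<le> 1" if "b \<in> Basis" for b :: "'a \<times> real"
    using that by (auto simp: Basis_prod_def)
  have cone: "cone_at ?O z" if "z \<in> ?O" for z by (rule cone_at_open[OF Omega_dom(3) that])
  have ud: "(w has_derivative (\<lambda>d. G z \<bullet> d)) (at z within S)" if "z \<in> S" "S \<subseteq> dom" for z and S :: "('a \<times> real) set"
    unfolding w_def by (rule G_deriv[OF that])
  have Gd: "((\<lambda>z. G z \<bullet> b) has_derivative (\<lambda>d. H b z \<bullet> d)) (at z within ?O)" if z: "z \<in> ?O" for z b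
    unfolding H_def inner_add_left inner_scaleR_left
    using has_derivative_add[OF Hb_deriv[OF z Omega_dom(1), of "fst b"] has_derivative_mult_right[OF He_deriv[OF z Omega_dom(1)], of "snd b"]]
    by (simp add: G_def inner_prod_def mult.commute)
  have Hc: "continuous_on ?O (H b)" if "b \<in> Basis" for b
    unfolding H_def[abs_def] by (intro continuous_intros H_cont[OF Omega_dom(1)] bn that)
  note C2 = C2_onI[OF cone ud[OF _ Omega_dom(1)] Gd Hc]
  note C1 = C1_onI[OF cone_at_closure ud[OF _ Omega_dom(2)] G_cont[OF Omega_dom(2)]]
  have lap: "laplacian ?O w z + Lam / M * w z = 0" if z: "z \<in> ?O" for z
  proof -
    define y x where "y = Y z" "x = snd z"
    have y: "y \<in> {0..1}" using z Omega_dom(1) h_bounds(2) by (auto simp: y_x_def dom_def)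
    have "H (b, 0) z \<bullet> (b, 0) = sg * h x * (Py y x - q y x) * (sgn (fst z) \<bullet> b)\<^sup>2 + sg * h x * q y x" if "b \<in> Basis" for b
      using that by (simp add: H_def Hb_def Let_def inner_prod_def inner_add_left y_x_def power2_eq_square)
    then have "(\<Sum>b\<in>Basis. H (b, 0) z \<bullet> (b, 0)) = (\<Sum>b\<in>Basis. sg * h x * (Py y x - q y x) * (sgn (fst z) \<bullet> b)\<^sup>2 + sg * h x * q y x)"
      by (intro sum.cong refl)
    also have "\<dots> = sg * h x * (Py y x - q y x) * (\<Sum>b\<in>Basis. (sgn (fst z) \<bullet> b)\<^sup>2) + real n * (sg * h x * q y x)"
      by (simp add: sum.distrib sum_distrib_left dim)
    also have "(\<Sum>b\<in>Basis. (sgn (fst z) \<bullet> b)\<^sup>2) = sgn (fst z) \<bullet> sgn (fst z)"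
      using euclidean_inner[of "sgn (fst z)" "sgn (fst z)"] by (simp add: power2_eq_square)
    \<comment> \<open>Off the axis \<open>sgn (fst z)\<close> is a unit vector. On the axis it is
      \<open>0\<close>, but \<open>Py - q\<close> is \<open>0\<close> there too, so the formula
      persists.\<close>
    also have "sg * h x * (Py y x - q y x) * (sgn (fst z) \<bullet> sgn (fst z)) = sg * h x * (Py y x - q y x)"
      by (cases "fst z = 0") (simp_all add: y_x_def q_def norm_sgn flip: power2_norm_eq_inner)
    finally have t: "(\<Sum>b\<in>Basis. H (b, 0) z \<bullet> (b, 0)) = sg * h x * (Py y x + (real n - 1) * q y x)" by (simp add: algebra_simps)
    have x: "H (0, 1) z \<bullet> (0, 1) = vx y x - y * (g' x / g x) * vy y x"
      by (simp add: H_def Hb_def He_def Let_def inner_prod_def y_x_def)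
    have "laplacian ?O w z = sg * h x * (Py y x + (real n - 1) * q y x) + (vx y x - y * (g' x / g x) * vy y x)"
      using C2(2)[OF _ _ _ _ z] t x by (simp add: sum_Basis_prod_real)
    moreover have "sg * h x = 1 / (M * g x)" using sg(2) by (simp add: h_def)
    moreover have "w z = u y x" by (simp add: w_def y_x_def)
    ultimately have "laplacian ?O w z + Lam / M * w z = 1 / (M * g x) * (Py y x + (real n - 1) * q y x) + (vx y x - y * (g' x / g x) * vy y x) + Lam / M * u y x"
      by simp
    also have "\<dots> = 1 / (M * g x) * (Py y x + (real n - 1) * q y x + Lam * g x * u y x + M * (g x * vx y x - y * g' x * vy y x))"
      using pos(2) g_pos[of x] by (simp add: field_simps)
    also have "\<dots> = 0" unfolding pde_q[OF y] by simp
    finally show ?thesis .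
  qed
  show "overdetermined_solution (Lam / M) h w"
    unfolding overdetermined_solution_def
  proof (intro conjI ballI)
    show "C2_on ?O w" using C2(1) by blast
    show "C1_on (closure ?O) w" using C1(1) by blast
    show "laplacian ?O w z + Lam / M * w z = 0" if "z \<in> ?O" for z by (rule lap[OF that])
    fix z assume z: "z \<in> frontier ?O"
    have 1: "Y z = 1" by (rule Omega_dom(4)[OF z])
    show "w z = 1" by (simp add: w_def 1 bc)
    have "z \<in> closure ?O" using z by (simp add: frontier_def)
    then have "grad (closure ?O) w z = G z" using C1(2) by blast
    then show "norm (grad (closure ?O) w z) = 0" by (simp add: G_def 1 bc)
  qed
  have he: "h (x + 2 * pi) = h x" "h (- x) = h x" for x by (simp_all add: h_def g)
  show "radial_periodic_even_on S w"
    by (simp add: radial_periodic_even_on_def w_def u he)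
qed

end

section \<open>Smoothness of the curve\<close>

text \<open>By induction every iterated derivative is again the sum of a power series on the same
  interval.\<close>

lemma smooth_real_on_power_series:
  fixes f :: "real \<Rightarrow> real"
  assumes f: "\<And>s. \<bar>s\<bar> < \<rho> \<Longrightarrow> (\<lambda>n. c n * s ^ n) sums f s"
  shows "smooth_real_on {-\<rho><..<\<rho>} f"
proof -
  have *: "(deriv ^^ k) f differentiable at s \<and> (\<exists>c. \<forall>s. \<bar>s\<bar> < \<rho> \<longrightarrow> (\<lambda>n. c n * s ^ n) sums (deriv ^^ k) f s)" if s: "\<bar>s\<bar> < \<rho>" for k s
  proof -
    have step: "(F has_real_derivative (\<Sum>n. diffs c n * s ^ n)) (at s) \<and> summable (\<lambda>n. diffs c n * s ^ n)"
      if F: "\<And>s. \<bar>s\<bar> < \<rho> \<Longrightarrow> (\<lambda>n. c n * s ^ n) sums F s" and s: "\<bar>s\<bar> < \<rho>" for F :: "real \<Rightarrow> real" and c s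
    proof
      have sm: "summable (\<lambda>n. c n * z ^ n)" if "norm z < \<rho>" for z :: real using F[of z] that by (simp add: sums_iff)
      show "summable (\<lambda>n. diffs c n * s ^ n)" by (rule termdiff_converges[where K=\<rho>]) (use s sm in auto)
      have "((\<lambda>z. \<Sum>n. c n * z ^ n) has_real_derivative (\<Sum>n. diffs c n * s ^ n)) (at s)"
        by (rule termdiffs_strong'[where K=\<rho>]) (use s sm in auto)
      then show "(F has_real_derivative (\<Sum>n. diffs c n * s ^ n)) (at s)"
        by (rule has_field_derivative_transform_within_open[where S="{-\<rho><..<\<rho>}"]) (use s F in \<open>auto simp: sums_iff abs_less_iff\<close>)
    qed
    have ex: "\<exists>c. \<forall>s. \<bar>s\<bar> < \<rho> \<longrightarrow> (\<lambda>n. c n * s ^ n) sums (deriv ^^ k) f s"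
    proof (induction k)
      case 0
      then show ?case using f by auto
    next
      case (Suc k)
      then obtain c where c: "\<And>s. \<bar>s\<bar> < \<rho> \<Longrightarrow> (\<lambda>n. c n * s ^ n) sums (deriv ^^ k) f s" by blast
      have "(\<lambda>n. diffs c n * s ^ n) sums (deriv ^^ Suc k) f s" if "\<bar>s\<bar> < \<rho>" for s
        using step[OF c that] DERIV_imp_deriv[OF conjunct1[OF step[OF c that]]] by (simp add: sums_iff)
      then show ?case by blast
    qed
    then obtain c where c: "\<And>s. \<bar>s\<bar> < \<rho> \<Longrightarrow> (\<lambda>n. c n * s ^ n) sums (deriv ^^ k) f s" by blast
    show ?thesis using ex step[OF c s] by (auto simp: real_differentiable_def)
  qed
  show ?thesis unfolding smooth_real_on_def using * by auto
qed

text \<open>The detour through complex functions yields power series of compositions such as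
  \<open>1 / sqrt (MM s)\<close> without any estimate of composed coefficients.\<close>

lemma real_power_series_of_holomorphic:
  fixes f :: "real \<Rightarrow> real"
  assumes F: "F holomorphic_on ball 0 \<rho>" and f: "\<And>s. \<bar>s\<bar> < \<rho> \<Longrightarrow> F (of_real s) = of_real (f s)"
  shows "\<exists>c. \<forall>s. \<bar>s\<bar> < \<rho> \<longrightarrow> (\<lambda>n. c n * s ^ n) sums f s"
proof (intro exI allI impI)
  fix s :: real assume s: "\<bar>s\<bar> < \<rho>"
  have "(\<lambda>n. (deriv ^^ n) F 0 / fact n * of_real s ^ n) sums F (of_real s)"
    using holomorphic_power_series[OF F, of "of_real s"] s by simp
  then have "(\<lambda>n. Re ((deriv ^^ n) F 0 / fact n * of_real s ^ n)) sums Re (F (of_real s))" by (rule sums_Re)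
  moreover have "Re (z * of_real s ^ n) = Re z * s ^ n" for z n by (simp flip: of_real_power)
  ultimately show "(\<lambda>n. Re ((deriv ^^ n) F 0 / fact n) * s ^ n) sums f s"
    by (simp only: f[OF s] Re_complex_of_real)
qed

section \<open>Power series with values in the Hoelder space\<close>

lemma weighted_series_DERIV:
  fixes H H1 :: "nat \<Rightarrow> real \<Rightarrow> real"
  assumes d: "\<And>n x. (H n has_real_derivative H1 n x) (at x)" and b: "\<And>n x. \<bar>H n x\<bar> \<le> c n" "\<And>n x. \<bar>H1 n x\<bar> \<le> c n"
    and s: "summable (\<lambda>n. \<bar>w n\<bar> * c n)"
  shows "((\<lambda>x. \<Sum>n. w n * H n x) has_real_derivative (\<Sum>n. w n * H1 n x)) (at x)"
proof -
  have b': "norm (w n * H n x) \<le> \<bar>w n\<bar> * c n" "norm (w n * H1 n x) \<le> \<bar>w n\<bar> * c n" for n x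
    using b[of n x] by (simp_all add: abs_mult mult_left_mono)
  have "\<exists>g. \<forall>x\<in>UNIV. (\<lambda>n. w n * H n x) sums g x \<and> (g has_field_derivative (\<Sum>n. w n * H1 n x)) (at x within UNIV)"
  proof (rule has_field_derivative_series)
    show "((\<lambda>x. w n * H n x) has_field_derivative w n * H1 n x) (at x within UNIV)" for n x
      using d by (intro DERIV_cmult) auto
    show "uniform_limit UNIV (\<lambda>n x. \<Sum>i<n. w i * H1 i x) (\<lambda>x. \<Sum>n. w n * H1 n x) sequentially"
      by (rule Weierstrass_m_test[OF b'(2) s])
    show "summable (\<lambda>n. w n * H n 0)" by (rule summable_comparison_test'[OF s, of 0]) (rule b'(1))
  qed auto
  then obtain g where g: "\<And>x. (\<lambda>n. w n * H n x) sums g x" "\<And>x. (g has_field_derivative (\<Sum>n. w n * H1 n x)) (at x)" by auto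
  have "g = (\<lambda>x. \<Sum>n. w n * H n x)" using g(1) by (auto simp: sums_iff)
  then show ?thesis using g(2) by simp
qed

text \<open>The Hoelder quotient of \<open>f2\<close> is at most \<open>2 E\<close>: for
  \<open>\<bar>x - y\<bar> \<le> 1\<close> the third derivative bounds it, for larger distances the
  triangle inequality does. With the three suprema this gives the factor \<open>5\<close>.\<close>

lemma C2a_bounds:
  fixes f f1 f2 f3 :: "real \<Rightarrow> real"
  assumes d: "\<And>x. (f has_real_derivative f1 x) (at x)" "\<And>x. (f1 has_real_derivative f2 x) (at x)" "\<And>x. (f2 has_real_derivative f3 x) (at x)"
    and b: "\<And>x. \<bar>f x\<bar> \<le> E" "\<And>x. \<bar>f1 x\<bar> \<le> E" "\<And>x. \<bar>f2 x\<bar> \<le> E" "\<And>x. \<bar>f3 x\<bar> \<le> E"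
    and per: "\<And>x. f (x + 2 * pi) = f x" "\<And>x. f (- x) = f x" and \<alpha>: "0 < \<alpha>" "\<alpha> < 1"
  shows "f \<in> C2a_per \<alpha>" "0 \<le> C2a_norm \<alpha> f" "C2a_norm \<alpha> f \<le> 5 * E"
proof -
  have E: "E \<ge> 0" using order_trans[OF abs_ge_zero b(1)[of 0]] .
  have e: "deriv f = f1" "deriv f1 = f2" using d by (auto intro!: DERIV_imp_deriv)
  have hol: "\<bar>f2 x - f2 y\<bar> \<le> 2 * E * \<bar>x - y\<bar> powr \<alpha>" for x y
  proof (cases "\<bar>x - y\<bar> \<le> 1")
    case True
    have "norm (f2 x - f2 y) \<le> E * norm (x - y)"
      by (rule field_differentiable_bound[where S=UNIV and f'=f3]) (use d(3) b(4) in auto)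
    also have "norm (x - y) \<le> \<bar>x - y\<bar> powr \<alpha>"
    proof (cases "x = y")
      case False
      then have "\<bar>x - y\<bar> powr 1 \<le> \<bar>x - y\<bar> powr \<alpha>" using True \<alpha> by (intro powr_mono') auto
      then show ?thesis using False by simp
    qed simp
    finally have "norm (f2 x - f2 y) \<le> E * \<bar>x - y\<bar> powr \<alpha>" using E by (simp add: mult_left_mono)
    also have "\<dots> \<le> 2 * E * \<bar>x - y\<bar> powr \<alpha>" using E by (intro mult_right_mono) auto
    finally show ?thesis by simp
  next
    case False
    have "\<bar>f2 x - f2 y\<bar> \<le> 2 * E * 1" using b(3)[of x] b(3)[of y] by linarith
    also have "\<dots> \<le> 2 * E * \<bar>x - y\<bar> powr \<alpha>" using False \<alpha> E by (intro mult_left_mono ge_one_powr_ge_zero) auto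
    finally show ?thesis .
  qed
  show "f \<in> C2a_per \<alpha>"
    unfolding C2a_per_def mem_Collect_eq e
  proof (intro conjI allI)
    show "f differentiable at x" "f1 differentiable at x" for x
      using d by (auto simp: real_differentiable_def)
    show "\<exists>C. \<forall>x y. \<bar>f2 x - f2 y\<bar> \<le> C * \<bar>x - y\<bar> powr \<alpha>" using hol by blast
  qed (rule per)+
  define q where "q p = \<bar>f2 (fst p) - f2 (snd p)\<bar> / \<bar>fst p - snd p\<bar> powr \<alpha>" for p :: "real \<times> real"
  have q: "q p \<le> 2 * E" "0 \<le> q p" if "p \<in> {(x, y). x \<noteq> y}" for p
    using that hol[of "fst p" "snd p"] by (auto simp: q_def case_prod_beta divide_le_eq)
  have bdd: "bdd_above (range (\<lambda>x. \<bar>g x\<bar>))" if "\<And>x. \<bar>g x\<bar> \<le> E" for g :: "real \<Rightarrow> real"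
    using that by (intro bdd_aboveI2[where M=E]) auto
  have qb: "bdd_above (q ` {(x, y). x \<noteq> y})" using q(1) by (intro bdd_aboveI2[where M="2 * E"]) auto
  have ne: "(0, 1) \<in> {(x::real, y). x \<noteq> y}" by simp
  have sup: "0 \<le> (SUP x. \<bar>g x\<bar>)" "(SUP x. \<bar>g x\<bar>) \<le> E" if "\<And>x. \<bar>g x\<bar> \<le> E" for g :: "real \<Rightarrow> real"
  proof -
    show "0 \<le> (SUP x. \<bar>g x\<bar>)" by (rule order_trans[OF abs_ge_zero cSUP_upper[OF UNIV_I bdd[OF that]]])
    show "(SUP x. \<bar>g x\<bar>) \<le> E" by (rule cSUP_least) (use that in auto)
  qed
  have "0 \<le> (SUP p\<in>{(x, y). x \<noteq> y}. q p)" by (rule order_trans[OF q(2)[OF ne] cSUP_upper[OF ne qb]])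
  moreover have "(SUP p\<in>{(x, y). x \<noteq> y}. q p) \<le> 2 * E" by (rule cSUP_least) (use q(1) ne in \<open>blast+\<close>)
  ultimately show "0 \<le> C2a_norm \<alpha> f" "C2a_norm \<alpha> f \<le> 5 * E"
    unfolding C2a_norm_def e q_def[symmetric] using sup[of f, OF b(1)] sup[of f1, OF b(2)] sup[of f2, OF b(3)] by linarith+
qed

definition conv_at :: "real \<Rightarrow> (nat \<Rightarrow> real) \<Rightarrow> bool" where
  "conv_at \<rho> c \<longleftrightarrow> (\<forall>n. 0 \<le> c n) \<and> (\<forall>r. \<bar>r\<bar> < \<rho> \<longrightarrow> summable (\<lambda>n. c n * \<bar>r\<bar> ^ n))"

lemma conv_at_diffs:
  assumes c: "conv_at \<rho> c"
  shows "conv_at \<rho> (diffs c)" "\<bar>r\<bar> < \<rho> \<Longrightarrow> summable (\<lambda>n. real n * c n * \<bar>r\<bar> ^ (n - 1))"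
    "conv_at \<rho> (\<lambda>n. (1 + real n) * c n)"
proof -
  have c0: "c n \<ge> 0" for n using c by (simp add: conv_at_def)
  have sm: "summable (\<lambda>n. c n * x ^ n)" if "norm x < \<rho>" for x :: real
  proof (rule summable_rabs_cancel)
    show "summable (\<lambda>n. \<bar>c n * x ^ n\<bar>)" using c that c0 by (simp add: conv_at_def abs_mult power_abs)
  qed
  have d: "summable (\<lambda>n. diffs c n * \<bar>r\<bar> ^ n)" if "\<bar>r\<bar> < \<rho>" for r
    by (rule termdiff_converges[where K=\<rho>]) (use that sm in auto)
  then show "conv_at \<rho> (diffs c)" using c0 by (simp add: conv_at_def diffs_def)
  show n: "summable (\<lambda>n. real n * c n * \<bar>r\<bar> ^ (n - 1))" if "\<bar>r\<bar> < \<rho>" for r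
    using sums_summable[OF diffs_equiv[OF d[OF that]]] by simp
  have "summable (\<lambda>n. (1 + real n) * c n * \<bar>r\<bar> ^ n)" if r: "\<bar>r\<bar> < \<rho>" for r
  proof -
    have "summable (\<lambda>n. c n * \<bar>r\<bar> ^ n + real n * c n * \<bar>r\<bar> ^ (n - 1) * \<bar>r\<bar>)"
      using c r by (intro summable_add summable_mult2 n) (auto simp: conv_at_def)
    moreover have "c n * \<bar>r\<bar> ^ n + real n * c n * \<bar>r\<bar> ^ (n - 1) * \<bar>r\<bar> = (1 + real n) * c n * \<bar>r\<bar> ^ n" for n
      by (cases n) (simp_all add: algebra_simps)
    ultimately show ?thesis by (simp only:)
  qed
  then show "conv_at \<rho> (\<lambda>n. (1 + real n) * c n)" using c0 by (simp add: conv_at_def)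
qed

text \<open>The third derivatives serve to bound the Hoelder seminorm of the second ones.\<close>

definition power_curve :: "real \<Rightarrow> (nat \<Rightarrow> real \<Rightarrow> real) \<Rightarrow> bool" where
  "power_curve \<rho> H \<longleftrightarrow> (\<forall>n x. H n (x + 2 * pi) = H n x \<and> H n (- x) = H n x) \<and>
     (\<exists>H1 H2 H3 c. conv_at \<rho> c \<and> (\<forall>n x. (H n has_real_derivative H1 n x) (at x) \<and> (H1 n has_real_derivative H2 n x) (at x) \<and>
        (H2 n has_real_derivative H3 n x) (at x) \<and> \<bar>H n x\<bar> \<le> c n \<and> \<bar>H1 n x\<bar> \<le> c n \<and> \<bar>H2 n x\<bar> \<le> c n \<and> \<bar>H3 n x\<bar> \<le> c n))"

lemma power_curve_weighted:
  assumes H: "power_curve \<rho> H"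
  obtains c where "conv_at \<rho> c" "\<And>n x. \<bar>H n x\<bar> \<le> c n"
    "\<And>w \<alpha>. summable (\<lambda>n. \<bar>w n\<bar> * c n) \<Longrightarrow> 0 < \<alpha> \<Longrightarrow> \<alpha> < 1 \<Longrightarrow> (\<lambda>x. \<Sum>n. w n * H n x) \<in> C2a_per \<alpha> \<and>
        0 \<le> C2a_norm \<alpha> (\<lambda>x. \<Sum>n. w n * H n x) \<and> C2a_norm \<alpha> (\<lambda>x. \<Sum>n. w n * H n x) \<le> 5 * (\<Sum>n. \<bar>w n\<bar> * c n)"
proof -
  obtain H1 H2 H3 c where c: "conv_at \<rho> c" and d: "\<And>n x. (H n has_real_derivative H1 n x) (at x)"
      "\<And>n x. (H1 n has_real_derivative H2 n x) (at x)" "\<And>n x. (H2 n has_real_derivative H3 n x) (at x)"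
    and b: "\<And>n x. \<bar>H n x\<bar> \<le> c n" "\<And>n x. \<bar>H1 n x\<bar> \<le> c n" "\<And>n x. \<bar>H2 n x\<bar> \<le> c n" "\<And>n x. \<bar>H3 n x\<bar> \<le> c n"
    using H unfolding power_curve_def by (elim conjE exE) blast
  have per: "H n (x + 2 * pi) = H n x" "H n (- x) = H n x" for n x using H by (auto simp: power_curve_def)
  show thesis
  proof (rule that[OF c b(1)])
    fix w :: "nat \<Rightarrow> real" and \<alpha> :: real assume s: "summable (\<lambda>n. \<bar>w n\<bar> * c n)" and \<alpha>: "0 < \<alpha>" "\<alpha> < 1"
    have wb: "\<bar>\<Sum>n. w n * F n x\<bar> \<le> (\<Sum>n. \<bar>w n\<bar> * c n)" if "\<And>n x. \<bar>F n x\<bar> \<le> c n" for F :: "nat \<Rightarrow> real \<Rightarrow> real" and x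
      using norm_suminf_le[of "\<lambda>n. w n * F n x" "\<lambda>n. \<bar>w n\<bar> * c n", OF _ s] that by (simp add: abs_mult mult_left_mono)
    show "(\<lambda>x. \<Sum>n. w n * H n x) \<in> C2a_per \<alpha> \<and>
        0 \<le> C2a_norm \<alpha> (\<lambda>x. \<Sum>n. w n * H n x) \<and> C2a_norm \<alpha> (\<lambda>x. \<Sum>n. w n * H n x) \<le> 5 * (\<Sum>n. \<bar>w n\<bar> * c n)"
      by (intro conjI; rule C2a_bounds[where f="\<lambda>x. \<Sum>n. w n * H n x" and ?f1.0="\<lambda>x. \<Sum>n. w n * H1 n x"
        and ?f2.0="\<lambda>x. \<Sum>n. w n * H2 n x" and ?f3.0="\<lambda>x. \<Sum>n. w n * H3 n x"];
        (rule weighted_series_DERIV[OF d(1) b(1,2) s] weighted_series_DERIV[OF d(2) b(2,3) s]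
          weighted_series_DERIV[OF d(3) b(3,4) s] wb[OF b(1)] wb[OF b(2)] wb[OF b(3)] wb[OF b(4)] \<alpha> | simp add: per))
  qed
qed

lemma power_curve_diffs:
  assumes "power_curve \<rho> H" shows "power_curve \<rho> (\<lambda>n x. (1 + real n) * H (Suc n) x)"
proof -
  obtain H1 H2 H3 c where c: "conv_at \<rho> c" and d: "\<And>n x. (H n has_real_derivative H1 n x) (at x)"
      "\<And>n x. (H1 n has_real_derivative H2 n x) (at x)" "\<And>n x. (H2 n has_real_derivative H3 n x) (at x)"
    and b: "\<And>n x. \<bar>H n x\<bar> \<le> c n" "\<And>n x. \<bar>H1 n x\<bar> \<le> c n" "\<And>n x. \<bar>H2 n x\<bar> \<le> c n" "\<And>n x. \<bar>H3 n x\<bar> \<le> c n"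
    using assms unfolding power_curve_def by (elim conjE exE) blast
  have "\<bar>(1 + real n) * y\<bar> \<le> diffs c n" if "\<bar>y\<bar> \<le> c (Suc n)" for n y
    using that by (simp add: diffs_def abs_mult mult_left_mono)
  then show ?thesis
    unfolding power_curve_def
    using assms[unfolded power_curve_def] conv_at_diffs(1)[OF c] b
    by (intro conjI exI[of _ "\<lambda>n x. (1 + real n) * H1 (Suc n) x"] exI[of _ "\<lambda>n x. (1 + real n) * H2 (Suc n) x"]
        exI[of _ "\<lambda>n x. (1 + real n) * H3 (Suc n) x"] exI[of _ "diffs c"]) (auto intro!: DERIV_cmult d)
qed

text \<open>The difference quotient minus the formal derivative is again a weighted series, with
  weights \<open>q n\<close> of size at most \<open>\<bar>r - s\<bar>\<close> times a second
  derivative of the powers. The norm bound for weighted series thus gives convergence at the rate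
  \<open>\<bar>r - s\<bar>\<close>.\<close>

lemma power_curve_derivative:
  assumes H: "power_curve \<rho> H" and s: "\<bar>s\<bar> < \<rho>" and \<alpha>: "0 < \<alpha>" "\<alpha> < 1"
  shows "(\<lambda>x. \<Sum>n. s ^ n * H n x) \<in> C2a_per \<alpha>"
    "((\<lambda>r. C2a_norm \<alpha> (\<lambda>x. ((\<Sum>n. r ^ n * H n x) - (\<Sum>n. s ^ n * H n x)) / (r - s) - (\<Sum>n. s ^ n * ((1 + real n) * H (Suc n) x)))) \<longlongrightarrow> 0) (at s)"
proof -
  obtain c where c: "conv_at \<rho> c" and b: "\<And>n x. \<bar>H n x\<bar> \<le> c n"
    and w: "\<And>w \<alpha>. summable (\<lambda>n. \<bar>w n\<bar> * c n) \<Longrightarrow> 0 < \<alpha> \<Longrightarrow> \<alpha> < 1 \<Longrightarrow> (\<lambda>x. \<Sum>n. w n * H n x) \<in> C2a_per \<alpha> \<and>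
        0 \<le> C2a_norm \<alpha> (\<lambda>x. \<Sum>n. w n * H n x) \<and> C2a_norm \<alpha> (\<lambda>x. \<Sum>n. w n * H n x) \<le> 5 * (\<Sum>n. \<bar>w n\<bar> * c n)"
    using power_curve_weighted[OF H] by blast
  have c0: "c n \<ge> 0" for n using c by (simp add: conv_at_def)
  have sc: "summable (\<lambda>n. \<bar>r ^ n\<bar> * c n)" if "\<bar>r\<bar> < \<rho>" for r using c that by (simp add: conv_at_def power_abs mult.commute)
  show "(\<lambda>x. \<Sum>n. s ^ n * H n x) \<in> C2a_per \<alpha>" using w[OF sc[OF s] \<alpha>] by blast
  \<comment> \<open>A radius strictly between \<open>\<bar>s\<bar>\<close> and
    \<open>\<rho>\<close>, at which the twice differentiated majorant still converges.\<close>
  define R where "R = (\<bar>s\<bar> + \<rho>) / 2"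
  have R: "\<bar>s\<bar> < R" "R < \<rho>" "R > 0" using s by (auto simp: R_def)
  have sn: "summable (\<lambda>n. r ^ n * H n x)" if "\<bar>r\<bar> < \<rho>" for r x
    by (rule summable_comparison_test'[OF sc[OF that], of 0]) (simp add: abs_mult b mult_left_mono)
  have sd: "(\<lambda>n. real n * s ^ (n - 1) * H n x) sums (\<Sum>n. s ^ n * ((1 + real n) * H (Suc n) x))" for x
  proof -
    have "norm (real n * c n * s ^ (n - 1)) = real n * c n * \<bar>s\<bar> ^ (n - 1)" for n using c0 by (simp add: abs_mult power_abs)
    have "summable (\<lambda>n. diffs (\<lambda>n. H n x) n * s ^ n)"
      by (rule termdiff_converges[where K=\<rho>]) (use s sn in \<open>auto simp: mult.commute\<close>)
    from diffs_equiv[OF this] show ?thesis by (simp add: diffs_def mult_ac)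
  qed
  define W where "W = (\<Sum>n. real n * real (n - 1) * R ^ (n - 2) * c n)"
  have sW: "summable (\<lambda>n. real n * real (n - 1) * R ^ (n - 2) * c n)"
  proof -
    have "summable (\<lambda>n. real n * diffs c n * \<bar>R\<bar> ^ (n - 1))" by (rule conv_at_diffs(2)[OF conv_at_diffs(1)[OF c]]) (use R in auto)
    then have "summable (\<lambda>n. real (Suc n) * real n * R ^ (n - 1) * c (Suc n))" using R by (simp add: diffs_def mult_ac)
    then have "summable (\<lambda>n. real (Suc n) * real (Suc n - 1) * R ^ (Suc n - 2) * c (Suc n))" by simp
    then show ?thesis using summable_Suc_iff[of "\<lambda>n. real n * real (n - 1) * R ^ (n - 2) * c n"] by blast
  qed
  have main: "0 \<le> C2a_norm \<alpha> (\<lambda>x. ((\<Sum>n. r ^ n * H n x) - (\<Sum>n. s ^ n * H n x)) / (r - s) - (\<Sum>n. s ^ n * ((1 + real n) * H (Suc n) x))) \<and>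
     C2a_norm \<alpha> (\<lambda>x. ((\<Sum>n. r ^ n * H n x) - (\<Sum>n. s ^ n * H n x)) / (r - s) - (\<Sum>n. s ^ n * ((1 + real n) * H (Suc n) x))) \<le> 5 * (\<bar>r - s\<bar> * W)"
    if r: "r \<noteq> s" "\<bar>r\<bar> \<le> R" for r
  proof -
    define q where "q n = (r ^ n - s ^ n) / (r - s) - real n * s ^ (n - 1)" for n
    have qb: "\<bar>q n\<bar> \<le> real n * real (n - 1) * R ^ (n - 2) * \<bar>r - s\<bar>" for n
      using lemma_termdiff3[of "r - s" s R n] r R by (simp add: q_def)
    have qc: "\<bar>q n\<bar> * c n \<le> real n * real (n - 1) * R ^ (n - 2) * c n * \<bar>r - s\<bar>" for n
      using mult_right_mono[OF qb c0, of n n] by (simp add: mult_ac)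
    have qs: "summable (\<lambda>n. \<bar>q n\<bar> * c n)"
      by (rule summable_comparison_test'[OF summable_mult2[OF sW, of "\<bar>r - s\<bar>"], of 0]) (use qc c0 in auto)
    have "(\<Sum>n. \<bar>q n\<bar> * c n) \<le> (\<Sum>n. real n * real (n - 1) * R ^ (n - 2) * c n * \<bar>r - s\<bar>)"
      by (rule suminf_le[OF qc qs summable_mult2[OF sW]])
    also have "\<dots> = \<bar>r - s\<bar> * W" using suminf_mult2[OF sW, of "\<bar>r - s\<bar>"] by (simp add: W_def mult.commute)
    finally have qW: "(\<Sum>n. \<bar>q n\<bar> * c n) \<le> \<bar>r - s\<bar> * W" .
    have eq: "((\<Sum>n. r ^ n * H n x) - (\<Sum>n. s ^ n * H n x)) / (r - s) - (\<Sum>n. s ^ n * ((1 + real n) * H (Suc n) x)) = (\<Sum>n. q n * H n x)" for x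
    proof -
      have "(\<lambda>n. (r ^ n * H n x - s ^ n * H n x) / (r - s) - real n * s ^ (n - 1) * H n x) sums
        (((\<Sum>n. r ^ n * H n x) - (\<Sum>n. s ^ n * H n x)) / (r - s) - (\<Sum>n. s ^ n * ((1 + real n) * H (Suc n) x)))"
        using r R s by (intro sums_diff sums_divide summable_sums sn sd) auto
      moreover have "(r ^ n * H n x - s ^ n * H n x) / (r - s) - real n * s ^ (n - 1) * H n x = q n * H n x" for n
        by (simp add: q_def algebra_simps diff_divide_distrib)
      ultimately show ?thesis by (simp add: sums_iff)
    qed
    show ?thesis unfolding eq using w[OF qs \<alpha>] qW by linarith
  qed
  show "((\<lambda>r. C2a_norm \<alpha> (\<lambda>x. ((\<Sum>n. r ^ n * H n x) - (\<Sum>n. s ^ n * H n x)) / (r - s) - (\<Sum>n. s ^ n * ((1 + real n) * H (Suc n) x)))) \<longlongrightarrow> 0) (at s)"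
  proof (rule real_tendsto_sandwich)
    have ev: "\<forall>\<^sub>F r in at s. r \<noteq> s \<and> \<bar>r\<bar> \<le> R"
      unfolding eventually_at using R by (intro exI[of _ "R - \<bar>s\<bar>"]) (auto simp: dist_real_def)
    show "\<forall>\<^sub>F r in at s. 0 \<le> C2a_norm \<alpha> (\<lambda>x. ((\<Sum>n. r ^ n * H n x) - (\<Sum>n. s ^ n * H n x)) / (r - s) - (\<Sum>n. s ^ n * ((1 + real n) * H (Suc n) x)))"
      using ev by eventually_elim (use main in blast)
    show "\<forall>\<^sub>F r in at s. C2a_norm \<alpha> (\<lambda>x. ((\<Sum>n. r ^ n * H n x) - (\<Sum>n. s ^ n * H n x)) / (r - s) - (\<Sum>n. s ^ n * ((1 + real n) * H (Suc n) x))) \<le> 5 * (\<bar>r - s\<bar> * W)"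
      using ev by eventually_elim (use main in blast)
    have "((\<lambda>r. 5 * (\<bar>r - s\<bar> * W)) \<longlongrightarrow> 5 * (\<bar>s - s\<bar> * W)) (at s)" by (intro tendsto_intros)
    then show "((\<lambda>r. 5 * (\<bar>r - s\<bar> * W)) \<longlongrightarrow> 0) (at s)" by simp
  qed auto
qed

text \<open>The formal derivative shifts the coefficients and keeps them in the class
  \<open>power_curve\<close>, so all higher derivatives come from iterating one step.\<close>

lemma power_curve_smooth:
  assumes H: "power_curve \<rho> H" and h: "\<And>s x. \<bar>s\<bar> < \<rho> \<Longrightarrow> h s x = (\<Sum>n. s ^ n * H n x)" and \<alpha>: "0 < \<alpha>" "\<alpha> < 1"
  shows "smooth_curve_C2a \<alpha> {-\<rho><..<\<rho>} h"
proof -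
  define HD where "HD k = ((\<lambda>H n x. (1 + real n) * H (Suc n) x) ^^ k) H" for k
  have HD: "power_curve \<rho> (HD k)" for k
    unfolding HD_def by (induction k) (simp_all add: H power_curve_diffs)
  have Suc: "HD (Suc k) n x = (1 + real n) * HD k (Suc n) x" for k n x by (simp add: HD_def)
  show ?thesis
    unfolding smooth_curve_C2a_def
  proof (rule exI[of _ "\<lambda>k s x. \<Sum>n. s ^ n * HD k n x"], intro conjI ballI allI)
    show "(\<lambda>x. \<Sum>n. s ^ n * HD 0 n x) = h s" if "s \<in> {-\<rho><..<\<rho>}" for s
      using that h[of s] by (simp add: HD_def fun_eq_iff abs_less_iff)
    fix k s assume "s \<in> {-\<rho><..<\<rho>}"
    then have s: "\<bar>s\<bar> < \<rho>" by auto
    show "(\<lambda>x. \<Sum>n. s ^ n * HD k n x) \<in> C2a_per \<alpha>" by (rule power_curve_derivative(1)[OF HD s \<alpha>])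
    show "((\<lambda>r. C2a_norm \<alpha> (\<lambda>x. ((\<Sum>n. r ^ n * HD k n x) - (\<Sum>n. s ^ n * HD k n x)) / (r - s) - (\<Sum>n. s ^ n * HD (Suc k) n x))) \<longlongrightarrow> 0) (at s)"
      unfolding Suc by (rule power_curve_derivative(2)[OF HD s \<alpha>])
  qed
qed

text \<open>The coefficients of \<open>1 / (1 + \<Sum>m\<ge>1. s ^ m * (\<Sum>j. G m j * cos (j x)))\<close>.\<close>

fun inv_coefs :: "(nat \<Rightarrow> int \<Rightarrow> real) \<Rightarrow> nat \<Rightarrow> int \<Rightarrow> real" where
  "inv_coefs G n k = (if n = 0 then (if k = 0 then 1 else 0)
     else - (\<Sum>m\<in>{1..n}. \<Sum>j\<in>freqs m. G m j * inv_coefs G (n - m) (k - j)))"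

declare inv_coefs.simps [simp del]

lemma inv_coefs_even:
  assumes G: "\<And>m j. G m (- j) = G m j"
  shows "inv_coefs G n (- k) = inv_coefs G n k"
proof (induction n arbitrary: k rule: less_induct)
  case (less n)
  have "(\<Sum>j\<in>freqs m. G m j * inv_coefs G (n - m) (- k - j)) = (\<Sum>j\<in>freqs m. G m j * inv_coefs G (n - m) (k - j))"
    if m: "m \<in> {1..n}" for m
  proof (rule sum.reindex_bij_witness[of _ uminus uminus])
    fix j
    have "inv_coefs G (n - m) (- (k + j)) = inv_coefs G (n - m) (k + j)" using m by (intro less.IH) auto
    moreover have "- k - j = - (k + j)" "k - - j = k + j" by simp_all
    ultimately show "G m (- j) * inv_coefs G (n - m) (k - - j) = G m j * inv_coefs G (n - m) (- k - j)" by (simp only: G)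
  qed auto
  then show ?case by (simp add: inv_coefs.simps[of G n])
qed

lemma inv_coefs_support: "\<bar>k\<bar> > int n \<Longrightarrow> inv_coefs G n k = 0"
proof (induction n arbitrary: k rule: less_induct)
  case (less n)
  have "inv_coefs G (n - m) (k - j) = 0" if "m \<in> {1..n}" "j \<in> freqs m" for m j
    using that less.prems by (intro less.IH) auto
  then show ?case using less.prems by (simp add: inv_coefs.simps[of G n])
qed

text \<open>Induction along the recursion: if all earlier norms times powers of \<open>r\<close> are
  at most \<open>1\<close>, the next one is at most the sum of \<open>g m * r ^ m\<close>, which is
  at most \<open>1\<close> again.\<close>

lemma inv_coefs_bound:
  assumes g: "\<And>n. (\<Sum>k\<in>freqs n. \<bar>G n k\<bar>) \<le> g n" and r: "r > 0"
    and s: "\<And>n. (\<Sum>m\<in>{1..n}. g m * r ^ m) \<le> 1"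
  shows "(\<Sum>k\<in>freqs n. \<bar>inv_coefs G n k\<bar>) * r ^ n \<le> 1"
proof (induction n rule: less_induct)
  case (less n)
  show ?case
  proof (cases "n = 0")
    case True
    then show ?thesis by (simp add: inv_coefs.simps)
  next
    case False
    define b where "b m = (\<Sum>k\<in>freqs m. \<bar>inv_coefs G m k\<bar>)" for m
    have "b n \<le> (\<Sum>k\<in>freqs n. \<Sum>m\<in>{1..n}. \<Sum>j\<in>freqs m. \<bar>G m j\<bar> * \<bar>inv_coefs G (n - m) (k - j)\<bar>)"
      unfolding b_def
    proof (rule sum_mono)
      fix k
      have "\<bar>inv_coefs G n k\<bar> = \<bar>\<Sum>m\<in>{1..n}. \<Sum>j\<in>freqs m. G m j * inv_coefs G (n - m) (k - j)\<bar>"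
        using False by (simp add: inv_coefs.simps[of G n])
      also have "\<dots> \<le> (\<Sum>m\<in>{1..n}. \<Sum>j\<in>freqs m. \<bar>G m j * inv_coefs G (n - m) (k - j)\<bar>)"
        by (intro order_trans[OF sum_abs] sum_mono order_refl)
      finally show "\<bar>inv_coefs G n k\<bar> \<le> (\<Sum>m\<in>{1..n}. \<Sum>j\<in>freqs m. \<bar>G m j\<bar> * \<bar>inv_coefs G (n - m) (k - j)\<bar>)" by (simp add: abs_mult)
    qed
    also have "\<dots> = (\<Sum>m\<in>{1..n}. \<Sum>k\<in>freqs n. \<Sum>j\<in>freqs m. \<bar>G m j\<bar> * \<bar>inv_coefs G (n - m) (k - j)\<bar>)"
      by (rule sum.swap)
    also have "\<dots> = (\<Sum>m\<in>{1..n}. \<Sum>j\<in>freqs m. \<Sum>k\<in>freqs n. \<bar>G m j\<bar> * \<bar>inv_coefs G (n - m) (k - j)\<bar>)"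
      by (rule sum.cong[OF refl], rule sum.swap)
    also have "\<dots> \<le> (\<Sum>m\<in>{1..n}. g m * b (n - m))"
    proof (rule sum_mono)
      fix m assume m: "m \<in> {1..n}"
      have "(\<Sum>k\<in>freqs n. \<bar>inv_coefs G (n - m) (k - j)\<bar>) \<le> b (n - m)" for j
        unfolding b_def by (rule shifted_sum_le) (simp_all add: inv_coefs_support)
      then have "(\<Sum>j\<in>freqs m. \<bar>G m j\<bar> * (\<Sum>k\<in>freqs n. \<bar>inv_coefs G (n - m) (k - j)\<bar>)) \<le> (\<Sum>j\<in>freqs m. \<bar>G m j\<bar> * b (n - m))"
        by (intro sum_mono mult_left_mono) auto
      also have "\<dots> \<le> g m * b (n - m)"
        unfolding sum_distrib_right[symmetric] using g[of m] by (intro mult_right_mono) (auto simp: b_def sum_nonneg)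
      finally show "(\<Sum>j\<in>freqs m. \<Sum>k\<in>freqs n. \<bar>G m j\<bar> * \<bar>inv_coefs G (n - m) (k - j)\<bar>) \<le> g m * b (n - m)"
        by (simp add: sum_distrib_left)
    qed
    finally have "b n * r ^ n \<le> (\<Sum>m\<in>{1..n}. g m * b (n - m)) * r ^ n" using r by (intro mult_right_mono) auto
    also have "\<dots> = (\<Sum>m\<in>{1..n}. g m * r ^ m * (b (n - m) * r ^ (n - m)))"
      unfolding sum_distrib_right
    proof (rule sum.cong[OF refl])
      fix m assume "m \<in> {1..n}"
      then have "r ^ n = r ^ m * r ^ (n - m)" by (simp flip: power_add)
      then show "g m * b (n - m) * r ^ n = g m * r ^ m * (b (n - m) * r ^ (n - m))" by simp
    qed
    also have "\<dots> \<le> (\<Sum>m\<in>{1..n}. g m * r ^ m * 1)"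
    proof (intro sum_mono mult_left_mono)
      fix m assume "m \<in> {1..n}"
      then show "b (n - m) * r ^ (n - m) \<le> 1" unfolding b_def by (intro less.IH) auto
      have "0 \<le> g m" by (rule order_trans[OF sum_nonneg g]) simp
      then show "0 \<le> g m * r ^ m" using r by simp
    qed
    also have "\<dots> \<le> 1" using s[of n] by simp
    finally show ?thesis by (simp add: b_def)
  qed
qed

text \<open>With \<open>E\<close> the coefficients of the constant \<open>1\<close>, the recursion
  says that the product of \<open>G\<close> with the inverse is \<open>E\<close> minus the inverse
  at every order.\<close>

lemma inv_coefs_series:
  assumes g: "\<And>n. (\<Sum>k\<in>freqs n. \<bar>G n k\<bar>) \<le> g n" and sg: "summable (\<lambda>n. g n * r ^ n)"
    and G0: "\<And>k. G 0 k = 0" and G: "\<And>m j. G m (- j) = G m j"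
    and b: "\<And>n. (\<Sum>k\<in>freqs n. \<bar>inv_coefs G n k\<bar>) \<le> b n" "summable (\<lambda>n. b n * r ^ n)" and s: "\<bar>s\<bar> \<le> r"
  shows "ts 0 (inv_coefs G) s x * (1 + ts 0 G s x) = 1"
proof -
  define E where "E = (\<lambda>(n::nat) (k::int). if n = 0 \<and> k = 0 then 1 else (0::real))"
  have Esum: "(\<lambda>n. tst 0 E s x n) sums 1"
  proof -
    have "tst 0 E s x n = (if n = 0 then 1 else 0)" for n by (simp add: tst_def E_def)
    then show ?thesis using sums_single[of 0 "\<lambda>_. 1::real"] by simp
  qed
  have "(\<lambda>n. tst (0 + 0) (\<lambda>n k. \<Sum>m\<le>n. \<Sum>j\<in>freqs m. G m j * inv_coefs G (n - m) (k - j)) s x n) sums (ts 0 G s x * ts 0 (inv_coefs G) s x)"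
    by (rule ts_mult_sums[where \<sigma>=1, OF g b(1) sg b(2) s]) (auto simp: inv_coefs_even[where G=G, OF G] inv_coefs_support)
  moreover have "tst 0 (\<lambda>n k. \<Sum>m\<le>n. \<Sum>j\<in>freqs m. G m j * inv_coefs G (n - m) (k - j)) s x n = tst 0 E s x n - tst 0 (inv_coefs G) s x n" for n
  proof -
    have "(\<Sum>m\<le>n. \<Sum>j\<in>freqs m. G m j * inv_coefs G (n - m) (k - j)) = E n k - inv_coefs G n k" for k
    proof (cases "n = 0")
      case True
      then show ?thesis by (simp add: G0 E_def inv_coefs.simps)
    next
      case False
      have "(\<Sum>m\<le>n. \<Sum>j\<in>freqs m. G m j * inv_coefs G (n - m) (k - j)) = (\<Sum>m\<in>{1..n}. \<Sum>j\<in>freqs m. G m j * inv_coefs G (n - m) (k - j))"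
        by (rule sum.mono_neutral_right) (auto simp: G0 not_less_eq_eq)
      then show ?thesis using False by (simp add: E_def inv_coefs.simps[of G n])
    qed
    then show ?thesis by (simp only: tst_def left_diff_distrib sum_subtractf right_diff_distrib)
  qed
  moreover have "(\<lambda>n. tst 0 E s x n - tst 0 (inv_coefs G) s x n) sums (1 - ts 0 (inv_coefs G) s x)"
    unfolding ts_def by (intro sums_diff Esum summable_sums ts_summable(2)[OF b s])
  ultimately have "ts 0 G s x * ts 0 (inv_coefs G) s x = 1 - ts 0 (inv_coefs G) s x" by (simp add: sums_unique2)
  then show ?thesis by (simp add: algebra_simps)
qed

lemma ts_scalar_mult:
  assumes A: "\<And>n. (\<Sum>k\<in>freqs n. \<bar>a n k\<bar>) \<le> B n" "summable (\<lambda>n. B n * e ^ n)" and s: "\<bar>s\<bar> \<le> e"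
    and supp: "\<And>n k. \<bar>k\<bar> > int n \<Longrightarrow> a n k = 0" and c: "summable (\<lambda>n. \<bar>c n\<bar> * e ^ n)"
  shows "(\<Sum>n. c n * s ^ n) * ts 0 a s x = ts 0 (\<lambda>n k. \<Sum>m\<le>n. c m * a (n - m) k) s x"
    "\<And>n. (\<Sum>k\<in>freqs n. \<bar>\<Sum>m\<le>n. c m * a (n - m) k\<bar>) \<le> (\<Sum>m\<le>n. \<bar>c m\<bar> * B (n - m))"
    "summable (\<lambda>n. (\<Sum>m\<le>n. \<bar>c m\<bar> * B (n - m)) * e ^ n)"
proof -
  have e: "e \<ge> 0" using s by linarith
  have B0: "B n \<ge> 0" for n using order_trans[OF sum_nonneg A(1)] by simp
  have ab: "summable (\<lambda>n. norm (c n * s ^ n))"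
    by (rule summable_comparison_test'[OF c, of 0]) (use s in \<open>auto simp: abs_mult power_abs intro!: mult_left_mono power_mono\<close>)
  have "(\<lambda>n. \<Sum>m\<le>n. (c m * s ^ m) * tst 0 a s x (n - m)) sums ((\<Sum>n. c n * s ^ n) * ts 0 a s x)"
    unfolding ts_def by (rule Cauchy_product_sums[OF ab]) (use ts_summable(1)[OF A s] in simp)
  moreover have "(\<Sum>m\<le>n. (c m * s ^ m) * tst 0 a s x (n - m)) = tst 0 (\<lambda>n k. \<Sum>m\<le>n. c m * a (n - m) k) s x n" for n
  proof -
    have "(c m * s ^ m) * tst 0 a s x (n - m) = s ^ n * (\<Sum>k\<in>freqs n. c m * a (n - m) k * cos (of_int k * x))" if m: "m \<le> n" for m
    proof -
      have "(\<Sum>k\<in>freqs (n - m). a (n - m) k * cos (of_int k * x)) = (\<Sum>k\<in>freqs n. a (n - m) k * cos (of_int k * x))"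
        by (rule sum.mono_neutral_left) (auto intro!: supp)
      moreover have "s ^ n = s ^ m * s ^ (n - m)" using m by (simp flip: power_add)
      ultimately show ?thesis by (simp add: tst_def sum_distrib_left mult_ac)
    qed
    then have "(\<Sum>m\<le>n. (c m * s ^ m) * tst 0 a s x (n - m)) = (\<Sum>m\<le>n. s ^ n * (\<Sum>k\<in>freqs n. c m * a (n - m) k * cos (of_int k * x)))"
      by (intro sum.cong refl) auto
    also have "\<dots> = s ^ n * (\<Sum>m\<le>n. \<Sum>k\<in>freqs n. c m * a (n - m) k * cos (of_int k * x))" by (simp add: sum_distrib_left)
    also have "\<dots> = tst 0 (\<lambda>n k. \<Sum>m\<le>n. c m * a (n - m) k) s x n"
      unfolding tst_def by (subst sum.swap) (simp add: sum_distrib_right)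
    finally show ?thesis .
  qed
  ultimately show "(\<Sum>n. c n * s ^ n) * ts 0 a s x = ts 0 (\<lambda>n k. \<Sum>m\<le>n. c m * a (n - m) k) s x"
    by (simp add: sums_iff ts_def)
  show "(\<Sum>k\<in>freqs n. \<bar>\<Sum>m\<le>n. c m * a (n - m) k\<bar>) \<le> (\<Sum>m\<le>n. \<bar>c m\<bar> * B (n - m))" for n
  proof -
    have "(\<Sum>k\<in>freqs n. \<bar>\<Sum>m\<le>n. c m * a (n - m) k\<bar>) \<le> (\<Sum>k\<in>freqs n. \<Sum>m\<le>n. \<bar>c m\<bar> * \<bar>a (n - m) k\<bar>)"
      by (intro sum_mono order_trans[OF sum_abs]) (simp add: abs_mult)
    also have "\<dots> = (\<Sum>m\<le>n. \<bar>c m\<bar> * (\<Sum>k\<in>freqs n. \<bar>a (n - m) k\<bar>))"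
      by (subst sum.swap) (simp add: sum_distrib_left)
    also have "\<dots> \<le> (\<Sum>m\<le>n. \<bar>c m\<bar> * B (n - m))"
    proof (intro sum_mono mult_left_mono)
      fix m assume "m \<in> {..n}"
      have "(\<Sum>k\<in>freqs n. \<bar>a (n - m) k\<bar>) = (\<Sum>k\<in>freqs (n - m). \<bar>a (n - m) k\<bar>)"
        by (rule sum.mono_neutral_right) (auto intro!: supp)
      then show "(\<Sum>k\<in>freqs n. \<bar>a (n - m) k\<bar>) \<le> B (n - m)" using A(1) by simp
    qed simp
    finally show ?thesis .
  qed
  have "(\<lambda>n. \<Sum>m\<le>n. (\<bar>c m\<bar> * e ^ m) * (B (n - m) * e ^ (n - m))) sums ((\<Sum>n. \<bar>c n\<bar> * e ^ n) * (\<Sum>n. B n * e ^ n))"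
    by (rule Cauchy_product_sums) (use c A(2) B0 e in simp_all)
  moreover have "(\<Sum>m\<le>n. (\<bar>c m\<bar> * e ^ m) * (B (n - m) * e ^ (n - m))) = (\<Sum>m\<le>n. \<bar>c m\<bar> * B (n - m)) * e ^ n" for n
    unfolding sum_distrib_right
  proof (rule sum.cong[OF refl])
    fix m assume "m \<in> {..n}"
    then have "e ^ n = e ^ m * e ^ (n - m)" by (simp flip: power_add)
    then show "(\<bar>c m\<bar> * e ^ m) * (B (n - m) * e ^ (n - m)) = \<bar>c m\<bar> * B (n - m) * e ^ n" by simp
  qed
  ultimately show "summable (\<lambda>n. (\<Sum>m\<le>n. \<bar>c m\<bar> * B (n - m)) * e ^ n)" by (simp add: sums_iff)
qed

text \<open>At order \<open>n\<close> only frequencies up to \<open>n\<close> occur, so each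
  derivative in \<open>x\<close> costs at most a factor \<open>1 + n\<close>, which does not change
  the radius of convergence.\<close>

lemma ts_power_curve:
  assumes A: "\<And>n. (\<Sum>k\<in>freqs n. \<bar>a n k\<bar>) \<le> B n" "summable (\<lambda>n. B n * e ^ n)"
  obtains H where "power_curve e H" "\<And>s x. ts 0 a s x = (\<Sum>n. s ^ n * H n x)"
proof -
  define Hi where "Hi i n x = (\<Sum>k\<in>freqs n. of_int k ^ i * a n k * cos (of_int k * x + real i * (pi / 2)))" for i n x
  \<comment> \<open>The cubic factor covers the function and its first three derivatives; it is
    written as a nested product so that \<open>conv_at_diffs\<close> can be applied three
    times.\<close>
  define c where "c n = (1 + real n) * ((1 + real n) * ((1 + real n) * B n))" for n
  have B0: "B n \<ge> 0" for n using order_trans[OF sum_nonneg A(1)] by simp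
  have cB: "conv_at e B"
    unfolding conv_at_def
  proof (intro conjI allI impI B0)
    fix r assume r: "\<bar>r\<bar> < e"
    show "summable (\<lambda>n. B n * \<bar>r\<bar> ^ n)"
      by (rule summable_comparison_test'[OF A(2), of 0]) (use r B0 in \<open>auto simp: abs_mult intro!: mult_left_mono power_mono\<close>)
  qed
  have cc: "conv_at e c" unfolding c_def by (intro conv_at_diffs(3) cB)
  have b: "\<bar>Hi i n x\<bar> \<le> c n" if "i \<le> 3" for i n x
  proof -
    have "\<bar>Hi i n x\<bar> \<le> (\<Sum>k\<in>freqs n. (1 + real n) ^ 3 * \<bar>a n k\<bar>)"
      unfolding Hi_def
    proof (intro order_trans[OF sum_abs] sum_mono)
      fix k assume k: "k \<in> freqs n"
      have "\<bar>of_int k :: real\<bar> \<le> 1 + real n" using k by auto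
      then have "\<bar>of_int k :: real\<bar> ^ i \<le> (1 + real n) ^ i" by (intro power_mono) auto
      also have "\<dots> \<le> (1 + real n) ^ 3" using that by (intro power_increasing) auto
      finally have "\<bar>of_int k :: real\<bar> ^ i * \<bar>a n k\<bar> * \<bar>cos (of_int k * x + real i * (pi / 2))\<bar> \<le> (1 + real n) ^ 3 * \<bar>a n k\<bar> * 1"
        by (intro mult_mono mult_right_mono) auto
      then show "\<bar>of_int k ^ i * a n k * cos (of_int k * x + real i * (pi / 2))\<bar> \<le> (1 + real n) ^ 3 * \<bar>a n k\<bar>"
        by (simp add: abs_mult power_abs)
    qed
    also have "\<dots> = (1 + real n) ^ 3 * (\<Sum>k\<in>freqs n. \<bar>a n k\<bar>)" by (simp add: sum_distrib_left)
    also have "\<dots> \<le> (1 + real n) ^ 3 * B n" by (intro mult_left_mono A(1)) auto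
    finally show ?thesis by (simp add: c_def power3_eq_cube mult.assoc)
  qed
  have d: "(Hi i n has_real_derivative Hi (Suc i) n x) (at x)" for i n x
  proof -
    have "cos (of_int k * x + real (Suc i) * (pi / 2)) = - sin (of_int k * x + real i * (pi / 2))" for k :: int
    proof -
      have "of_int k * x + real (Suc i) * (pi / 2) = (of_int k * x + real i * (pi / 2)) + pi / 2" by (simp add: field_simps)
      moreover have "cos (z + pi / 2) = - sin z" for z :: real by (simp add: cos_add)
      ultimately show ?thesis by (simp only:)
    qed
    then show ?thesis
      unfolding Hi_def[abs_def] by (auto intro!: derivative_eq_intros simp: mult_ac)
  qed
  have per: "Hi 0 n (x + 2 * pi) = Hi 0 n x" "Hi 0 n (- x) = Hi 0 n x" for n x
    using fun_cong[OF tst_even_periodic(1)[of a 1 x], of n] fun_cong[OF tst_even_periodic(2)[of a 1 x], of n]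
    by (simp_all add: tst_def Hi_def)
  show thesis
  proof (rule that[of "Hi 0"])
    show "power_curve e (Hi 0)"
      unfolding power_curve_def
      by (intro conjI exI[of _ "Hi (Suc 0)"] exI[of _ "Hi (Suc (Suc 0))"] exI[of _ "Hi (Suc (Suc (Suc 0)))"] exI[of _ c] allI per cc d b) auto
    show "ts 0 a s x = (\<Sum>n. s ^ n * Hi 0 n x)" for s x by (simp add: ts_def tst_def Hi_def)
  qed
qed

section \<open>Radii of convergence and the curve of domains\<close>

context expansion
begin

lemma tot_nonneg: "tot X n \<ge> 0"
  by (rule order_trans[OF sum_nonneg tot_bounds(1)[of 0]]) auto

lemma tot_0: "tot X 0 = 0"
  by (simp add: tot_def X0 zero_coefs_def)

text \<open>The majorant has no term of order zero, so shrinking the radius by the factor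
  \<open>\<theta> \<le> 1\<close> shrinks its sum at least by that factor. The choice of
  \<open>\<theta>\<close> makes the sum at most one half, which serves both the bound on
  \<open>gam\<close> and the reciprocal.\<close>

lemma inverse_radius:
  obtains r where "0 < r" "r < e" "\<And>n. (\<Sum>m\<in>{1..n}. tot X m * r ^ m) \<le> 1" "\<And>s x. \<bar>s\<bar> \<le> r \<Longrightarrow> \<bar>gam s x\<bar> \<le> 1 / 2"
proof -
  define S where "S = (\<Sum>n. tot X n * e ^ n)"
  have S: "S \<ge> 0" unfolding S_def by (rule suminf_nonneg[OF sum_tot]) (use tot_nonneg e in auto)
  define \<theta> where "\<theta> = 1 / (2 * (S + 1))"
  have \<theta>: "\<theta> > 0" "\<theta> \<le> 1 / 2" "\<theta> * S \<le> 1 / 2" using S by (auto simp: \<theta>_def field_simps)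
  have le: "tot X n * (\<theta> * e) ^ n \<le> \<theta> * (tot X n * e ^ n)" for n
  proof (cases "n = 0")
    case True
    then show ?thesis using tot_0 by simp
  next
    case False
    have "\<theta> ^ n \<le> \<theta> ^ 1" using \<theta> False by (intro power_decreasing) auto
    then have "\<theta> ^ n * (tot X n * e ^ n) \<le> \<theta> * (tot X n * e ^ n)" using tot_nonneg e by (intro mult_right_mono) auto
    then show ?thesis by (simp add: power_mult_distrib mult_ac)
  qed
  have sm: "summable (\<lambda>n. tot X n * (\<theta> * e) ^ n)"
    by (rule summable_comparison_test'[OF summable_mult[OF sum_tot, of \<theta>], of 0]) (use le tot_nonneg \<theta> e in auto)
  have "(\<Sum>n. tot X n * (\<theta> * e) ^ n) \<le> (\<Sum>n. \<theta> * (tot X n * e ^ n))"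
    by (rule suminf_le[OF le sm summable_mult[OF sum_tot]])
  also have "\<dots> = \<theta> * S" unfolding S_def by (rule suminf_mult[OF sum_tot])
  finally have tl: "(\<Sum>n. tot X n * (\<theta> * e) ^ n) \<le> 1 / 2" using \<theta> by linarith
  show thesis
  proof (rule that[of "\<theta> * e"])
    show "0 < \<theta> * e" using \<theta> e by simp
    show "\<theta> * e < e" using \<theta> e by (simp add: mult_less_cancel_right1)
    have p: "(\<Sum>m\<in>{1..n}. tot X m * (\<theta> * e) ^ m) \<le> (\<Sum>n. tot X n * (\<theta> * e) ^ n)" for n
      by (rule sum_le_suminf[OF sm]) (use tot_nonneg \<theta> e in auto)
    show "(\<Sum>m\<in>{1..n}. tot X m * (\<theta> * e) ^ m) \<le> 1" for n by (rule order_trans[OF order_trans[OF p tl]]) simp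
    have "\<bar>ts 0 (\<lambda>n k. cg (X n) k) s x\<bar> \<le> (\<Sum>n. tot X n * (\<theta> * e) ^ n)" if "\<bar>s\<bar> \<le> \<theta> * e" for s x
      by (rule ts_summable(3)[OF tot_bounds(1)[of 0] sm that]) simp
    then show "\<bar>gam s x\<bar> \<le> 1 / 2" if "\<bar>s\<bar> \<le> \<theta> * e" for s x
      unfolding gam_def using tl that by (meson order_trans)
  qed
qed

text \<open>The series of \<open>MM\<close> extends to a holomorphic \<open>F\<close> with
  \<open>F 0 = M0 > 0\<close>. Near \<open>0\<close> its values stay in the right half plane, where
  \<open>1 / csqrt\<close> and division are holomorphic.\<close>

lemma sigma_series:
  obtains \<rho> c d where "0 < \<rho>" "\<And>s. \<bar>s\<bar> < \<rho> \<Longrightarrow> MM s > 0" "\<And>s. \<bar>s\<bar> < \<rho> \<Longrightarrow> (\<lambda>n. c n * s ^ n) sums (1 / sqrt (MM s))"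
    "\<And>s. \<bar>s\<bar> < \<rho> \<Longrightarrow> (\<lambda>n. d n * s ^ n) sums (Lam / MM s)"
proof -
  define F where "F z = of_real M0 + (\<Sum>n. of_real (mh n) * z ^ n)" for z :: complex
  have sm: "summable (\<lambda>n. of_real (mh n) * z ^ n)" if "norm z < e" for z :: complex
  proof (rule summable_norm_cancel, rule summable_comparison_test'[OF sum_mh, of 0])
    fix n
    have "norm z ^ n \<le> e ^ n" using that by (intro power_mono) auto
    then show "norm (norm (of_real (mh n) * z ^ n)) \<le> \<bar>mh n\<bar> * e ^ n" by (simp add: norm_mult norm_power mult_left_mono)
  qed
  have D: "(F has_field_derivative (\<Sum>n. diffs (\<lambda>n. of_real (mh n)) n * z ^ n)) (at z)" if "norm z < e" for z
    unfolding F_def[abs_def] using termdiffs_strong'[where K=e and c="\<lambda>n. of_real (mh n)", OF sm that] by (auto intro!: derivative_eq_intros)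
  have F0: "F 0 = of_real M0" by (simp add: F_def mh_def)
  have FM: "F (of_real s) = of_real (MM s)" if "\<bar>s\<bar> < e" for s
  proof -
    have "summable (\<lambda>n. mh n * s ^ n)"
    proof (rule summable_comparison_test'[OF sum_mh, of 0])
      fix n
      have "\<bar>s\<bar> ^ n \<le> e ^ n" using that by (intro power_mono) auto
      then show "norm (mh n * s ^ n) \<le> \<bar>mh n\<bar> * e ^ n" by (simp add: abs_mult power_abs mult_left_mono)
    qed
    from suminf_of_real[OF this, where 'a=complex] show ?thesis by (simp add: F_def MM_def)
  qed
  have "isCont F 0" using D[of 0] e DERIV_isCont by force
  then have "\<exists>d>0. \<forall>z. dist z 0 < d \<longrightarrow> dist (F z) (F 0) < M0" using M0 by (simp add: continuous_at_eps_delta)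
  then obtain d where d: "d > 0" "\<And>z. norm z < d \<Longrightarrow> norm (F z - of_real M0) < M0" by (auto simp: F0 dist_norm)
  define \<rho> where "\<rho> = min d e"
  have \<rho>: "\<rho> > 0" using d e by (simp add: \<rho>_def)
  have RF: "Re (F z) > 0" if "z \<in> ball 0 \<rho>" for z
    using d(2)[of z] abs_Re_le_cmod[of "F z - of_real M0"] that by (auto simp: \<rho>_def)
  have holF: "F holomorphic_on ball 0 \<rho>"
    unfolding holomorphic_on_def field_differentiable_def
  proof
    fix z :: complex assume "z \<in> ball 0 \<rho>"
    then have "norm z < e" by (simp add: \<rho>_def)
    from has_field_derivative_at_within[OF D[OF this]]
    show "\<exists>f'. (F has_field_derivative f') (at z within ball 0 \<rho>)" by (rule exI)
  qed
  have MMp: "MM s > 0" if "\<bar>s\<bar> < \<rho>" for s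
    using RF[of "of_real s"] FM[of s] that by (auto simp: \<rho>_def)
  have "\<exists>c. \<forall>s. \<bar>s\<bar> < \<rho> \<longrightarrow> (\<lambda>n. c n * s ^ n) sums (1 / sqrt (MM s))"
  proof (rule real_power_series_of_holomorphic)
    show "(\<lambda>z. 1 / csqrt (F z)) holomorphic_on ball 0 \<rho>"
      using RF by (intro holomorphic_intros holF) (force simp: complex_nonpos_Reals_iff)+
    show "1 / csqrt (F (of_real s)) = of_real (1 / sqrt (MM s))" if "\<bar>s\<bar> < \<rho>" for s
      using FM[of s] MMp[OF that] that by (simp add: \<rho>_def csqrt_of_real_nonneg)
  qed
  then obtain c where c: "\<And>s. \<bar>s\<bar> < \<rho> \<Longrightarrow> (\<lambda>n. c n * s ^ n) sums (1 / sqrt (MM s))" by blast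
  have "\<exists>d. \<forall>s. \<bar>s\<bar> < \<rho> \<longrightarrow> (\<lambda>n. d n * s ^ n) sums (Lam / MM s)"
  proof (rule real_power_series_of_holomorphic)
    show "(\<lambda>z. of_real Lam / F z) holomorphic_on ball 0 \<rho>"
      using RF by (intro holomorphic_intros holF) force
    show "of_real Lam / F (of_real s) = of_real (Lam / MM s)" if "\<bar>s\<bar> < \<rho>" for s
      using FM[of s] that by (simp add: \<rho>_def)
  qed
  then obtain d where "\<And>s. \<bar>s\<bar> < \<rho> \<Longrightarrow> (\<lambda>n. d n * s ^ n) sums (Lam / MM s)" by blast
  from that[OF \<rho> MMp c this] show thesis by blast
qed

lemma flat:
  assumes s: "\<bar>s\<bar> < e" and M: "MM s > 0" and g: "\<And>x. \<bar>gam s x\<bar> \<le> 1 / 2"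
  shows "flat N Lam (MM s) (\<Sum>n. tot X n * e ^ n) (\<lambda>x. 1 + gam s x) (gam' s) (\<lambda>y x. U y + fU s y x) (\<lambda>y x. U' y + fP s y x)
    (\<lambda>y x. U'' y + fPy s y x) (fPx s) (eta s) (etax s)"
proof
  have s': "\<bar>s\<bar> \<le> e" using s by simp
  show "Lam > 0" "MM s > 0" by (rule Lam M)+
  show "1 / 2 \<le> 1 + gam s x" for x using g[of x] by linarith
  show "((\<lambda>x. 1 + gam s x) has_real_derivative gam' s x) (at x)" for x
    using flat_derivs(1)[OF s, of 0 x] by (auto intro!: derivative_eq_intros)
  show "continuous_on UNIV (gam' s)" by (rule flat_continuous(1)[OF s])
  show "\<bar>gam' s x\<bar> \<le> (\<Sum>n. tot X n * e ^ n)" for x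
    unfolding gam'_def by (rule ts_summable(3)[OF tot_bounds(2)[of 0] sum_tot s']) simp
  show "1 + gam s (- x) = 1 + gam s x" "1 + gam s (x + 2 * pi) = 1 + gam s x" for x by (simp_all add: flat_even_periodic)
  have UP: "continuous_on ({0..1} \<times> UNIV) (\<lambda>z::real \<times> real. U' (fst z))" "continuous_on ({0..1} \<times> UNIV) (\<lambda>z::real \<times> real. U'' (fst z))"
    by (rule continuous_on_compose2[OF continuous_U(2)[of UNIV]] continuous_on_compose2[OF continuous_U(3)[of UNIV]]; auto intro!: continuous_intros)+
  show "continuous_on ({0..1} \<times> UNIV) (\<lambda>z. U' (fst z) + fP s (fst z) (snd z))"
    by (intro continuous_intros UP flat_continuous[OF s])
  show "continuous_on ({0..1} \<times> UNIV) (\<lambda>z. U'' (fst z) + fPy s (fst z) (snd z))"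
    by (intro continuous_intros UP flat_continuous[OF s])
  show "continuous_on ({0..1} \<times> UNIV) (\<lambda>z. fPx s (fst z) (snd z))" "continuous_on ({0..1} \<times> UNIV) (\<lambda>z. eta s (fst z) (snd z))"
    "continuous_on ({0..1} \<times> UNIV) (\<lambda>z. etax s (fst z) (snd z))" by (rule flat_continuous[OF s])+
  show "U y + fU s y (- x) = U y + fU s y x" "U y + fU s y (x + 2 * pi) = U y + fU s y x" for y x by (simp_all add: flat_even_periodic)
  show "U 1 + fU s 1 x = 1" "U' 1 + fP s 1 x = 0" "eta s 1 x = 0" "U' 0 + fP s 0 x = 0" for x by (simp_all add: flat_boundary)
  fix y x :: real assume y: "y \<in> {0..1}"
  note E = flat_eqs[OF y s, of x] and D = flat_derivs[OF s y, of x]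
  show "((\<lambda>y. U y + fU s y x) has_real_derivative (1 + gam s x) * (U' y + fP s y x)) (at y within {0..1})"
    using DERIV_add[OF DERIV_U(1) D(2)] E(1) by simp
  show "((\<lambda>x. U y + fU s y x) has_real_derivative eta s y x + y * gam' s x * (U' y + fP s y x)) (at x)"
    using DERIV_add[OF DERIV_const D(3), of "U y"] E(2) by simp
  show "((\<lambda>y. U' y + fP s y x) has_real_derivative U'' y + fPy s y x) (at y within {0..1})"
    by (rule DERIV_add[OF DERIV_U(2) D(4)])
  show "((\<lambda>x. U' y + fP s y x) has_real_derivative fPx s y x) (at x)"
    using DERIV_add[OF DERIV_const D(5), of "U' y"] by simp
  show "((\<lambda>y. eta s y x) has_real_derivative (1 + gam s x) * fPx s y x - y * gam' s x * (U'' y + fPy s y x)) (at y within {0..1})"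
    using D(6) unfolding E(3) .
  show "(eta s y has_real_derivative etax s y x) (at x)" by (rule D(7))
  show "y * (U'' y + fPy s y x) + (real N - 1) * (U' y + fP s y x) + y * Lam * (1 + gam s x) * (U y + fU s y x) +
      y * MM s * ((1 + gam s x) * etax s y x - y * gam' s x * ((1 + gam s x) * fPx s y x - y * gam' s x * (U'' y + fPy s y x))) = 0"
    using E(4) unfolding E(3) .
qed

definition "hh s x = (1 / sqrt (MM s)) / (1 + gam s x)"

text \<open>\<open>hh\<close> is the product of the power series of \<open>1 / sqrt (MM s)\<close>
  with the reciprocal series of \<open>1 + gam\<close>. Written as one trigonometric series with a
  convergent majorant, it is a smooth curve for every exponent on the same interval.\<close>

lemma curve:
  obtains r where "0 < r" "r \<le> e" "\<And>s. \<bar>s\<bar> < r \<Longrightarrow> MM s > 0" "\<And>s x. \<bar>s\<bar> < r \<Longrightarrow> \<bar>gam s x\<bar> \<le> 1 / 2"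
    "smooth_real_on {-r<..<r} (\<lambda>s. Lam / MM s)" "\<And>\<alpha>. 0 < \<alpha> \<Longrightarrow> \<alpha> < 1 \<Longrightarrow> smooth_curve_C2a \<alpha> {-r<..<r} hh"
    "\<And>\<alpha> s. 0 < \<alpha> \<Longrightarrow> \<alpha> < 1 \<Longrightarrow> \<bar>s\<bar> < r \<Longrightarrow> hh s \<in> P2a_per \<alpha>" "isCont (\<lambda>s. 1 / sqrt (MM s)) 0"
proof -
  obtain r0 where r0: "0 < r0" "r0 < e" "\<And>n. (\<Sum>m\<in>{1..n}. tot X m * r0 ^ m) \<le> 1" "\<And>s x. \<bar>s\<bar> \<le> r0 \<Longrightarrow> \<bar>gam s x\<bar> \<le> 1 / 2"
    using inverse_radius by blast
  obtain \<rho> c d where \<rho>: "0 < \<rho>" "\<And>s. \<bar>s\<bar> < \<rho> \<Longrightarrow> MM s > 0" and c: "\<And>s. \<bar>s\<bar> < \<rho> \<Longrightarrow> (\<lambda>n. c n * s ^ n) sums (1 / sqrt (MM s))"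
    and d: "\<And>s. \<bar>s\<bar> < \<rho> \<Longrightarrow> (\<lambda>n. d n * s ^ n) sums (Lam / MM s)" using sigma_series by blast
  \<comment> \<open>The factor one half leaves room below both radii: the reciprocal is then
    dominated by a geometric series with quotient \<open>r / r0 < 1\<close>, and the coefficients
    \<open>c\<close> converge absolutely at \<open>r < \<rho>\<close>.\<close>
  define r where "r = min r0 \<rho> / 2"
  have r: "0 < r" "r < \<rho>" "2 * r \<le> r0" "r < r0" "r \<le> e" using r0 \<rho> by (auto simp: r_def)
  define G where "G = (\<lambda>n k. cg (X n) k)"
  have G: "\<And>k. G 0 k = 0" "\<And>m j. G m (- j) = G m j" by (auto simp: G_def parity)
  define b where "b n = inverse r0 ^ n" for n
  have b: "(\<Sum>k\<in>freqs n. \<bar>inv_coefs G n k\<bar>) \<le> b n" for n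
    using inv_coefs_bound[of G "tot X" r0 n] tot_bounds(1)[of 0] r0 by (simp add: G_def b_def power_inverse field_simps)
  have "\<bar>r / r0\<bar> < 1" using r r0 by simp
  then have "summable (\<lambda>n. (r / r0) ^ n)" by (intro summable_geometric) simp
  then have bs: "summable (\<lambda>n. b n * r ^ n)" by (simp add: b_def power_divide field_simps power_inverse)
  have ts: "summable (\<lambda>n. tot X n * r ^ n)"
    by (rule summable_comparison_test'[OF sum_tot, of 0]) (use r tot_nonneg in \<open>auto simp: abs_mult intro!: mult_left_mono power_mono\<close>)
  have cs: "summable (\<lambda>n. \<bar>c n\<bar> * r ^ n)"
  proof -
    have "\<bar>(r + \<rho>) / 2\<bar> < \<rho>" using r by auto
    from powser_insidea[OF sums_summable[OF c[OF this]], of r] show ?thesis using r by (simp add: abs_mult power_abs)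
  qed
  define a where "a n k = (\<Sum>m\<le>n. c m * inv_coefs G (n - m) k)" for n k
  have hs: "hh s x = ts 0 a s x" if s: "\<bar>s\<bar> < r" for s x
  proof -
    have s': "\<bar>s\<bar> \<le> r" using s by simp
    have "ts 0 (inv_coefs G) s x * (1 + ts 0 G s x) = 1"
      by (rule inv_coefs_series[OF _ ts G b bs s']) (use tot_bounds(1)[of 0] in \<open>simp add: G_def\<close>)
    then have i: "ts 0 (inv_coefs G) s x * (1 + gam s x) = 1" by (simp add: G_def gam_def)
    then have "1 + gam s x \<noteq> 0" by auto
    then have i: "ts 0 (inv_coefs G) s x = 1 / (1 + gam s x)" using i by (simp add: field_simps)
    have "(\<Sum>n. c n * s ^ n) = 1 / sqrt (MM s)" using c[of s] s r by (simp add: sums_iff)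
    then have "hh s x = (\<Sum>n. c n * s ^ n) * ts 0 (inv_coefs G) s x" by (simp add: hh_def i)
    also have "\<dots> = ts 0 a s x" unfolding a_def[abs_def] by (rule ts_scalar_mult(1)[OF b bs s' inv_coefs_support cs])
    finally show ?thesis .
  qed
  have r': "\<bar>r\<bar> \<le> r" using r by simp
  have ab: "(\<Sum>k\<in>freqs n. \<bar>a n k\<bar>) \<le> (\<Sum>m\<le>n. \<bar>c m\<bar> * b (n - m))" for n
    unfolding a_def by (rule ts_scalar_mult(2)[OF b bs r' inv_coefs_support cs])
  obtain H where H: "power_curve r H" "\<And>s x. ts 0 a s x = (\<Sum>n. s ^ n * H n x)"
    by (rule ts_power_curve[OF ab ts_scalar_mult(3)[OF b bs r' inv_coefs_support cs]], assumption) (rule that)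
  have hH: "hh s x = (\<Sum>n. s ^ n * H n x)" if "\<bar>s\<bar> < r" for s x using hs[OF that] H(2) by simp
  show thesis
  proof (rule that[of r])
    show "smooth_real_on {-r<..<r} (\<lambda>s. Lam / MM s)"
      by (rule smooth_real_on_power_series[where c=d]) (use d r in auto)
    show "smooth_curve_C2a \<alpha> {-r<..<r} hh" if "0 < \<alpha>" "\<alpha> < 1" for \<alpha>
      by (rule power_curve_smooth[OF H(1) hH that])
    show "hh s \<in> P2a_per \<alpha>" if "0 < \<alpha>" "\<alpha> < 1" "\<bar>s\<bar> < r" for \<alpha> s
    proof -
      have "hh s = (\<lambda>x. \<Sum>n. s ^ n * H n x)" using hH[OF that(3)] by auto
      then have "hh s \<in> C2a_per \<alpha>" using power_curve_derivative(1)[OF H(1) that(3,1,2)] by simp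
      moreover have "hh s x > 0" for x
        using \<rho>(2)[of s] r0(4)[of s x] that r by (auto simp: hh_def intro!: divide_pos_pos)
      ultimately show ?thesis by (simp add: P2a_per_def)
    qed
    have "((\<lambda>s. 1 / sqrt (MM s)) has_real_derivative (\<Sum>n. diffs c n * 0 ^ n)) (at 0)"
    proof (rule has_field_derivative_transform_within_open[where S="{-\<rho><..<\<rho>}"])
      show "((\<lambda>z. \<Sum>n. c n * z ^ n) has_real_derivative (\<Sum>n. diffs c n * 0 ^ n)) (at 0)"
        by (rule termdiffs_strong'[where K=\<rho>]) (use c \<rho> in \<open>auto simp: sums_iff\<close>)
      show "(\<Sum>n. c n * x ^ n) = 1 / sqrt (MM x)" if "x \<in> {-\<rho><..<\<rho>}" for x
        using c[of x] that by (auto simp: sums_iff)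
    qed (use \<rho> in auto)
    then show "isCont (\<lambda>s. 1 / sqrt (MM s)) 0" by (rule DERIV_isCont)
  qed (use r r0 \<rho> in auto)
qed

end

section \<open>First order expansions and the conclusion\<close>

lemma uniformly_small_oI:
  fixes R :: "real \<Rightarrow> 'b \<Rightarrow> real"
  assumes r: "r > 0" and R: "\<And>s z. \<bar>s\<bar> < r \<Longrightarrow> z \<in> S \<Longrightarrow> \<bar>R s z\<bar> \<le> \<Psi> s * \<bar>s\<bar>" and \<Psi>: "isCont \<Psi> 0" "\<Psi> 0 = 0"
  shows "uniformly_small_o S R"
  unfolding uniformly_small_o_def
proof (intro allI impI)
  fix \<epsilon> :: real assume \<epsilon>: "\<epsilon> > 0"
  have "\<exists>d>0. \<forall>s. dist s 0 < d \<longrightarrow> dist (\<Psi> s) (\<Psi> 0) < \<epsilon>" using \<Psi>(1) \<epsilon> by (simp add: continuous_at_eps_delta)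
  then obtain d where d: "d > 0" "\<And>s. \<bar>s\<bar> < d \<Longrightarrow> \<bar>\<Psi> s\<bar> < \<epsilon>" by (auto simp: \<Psi>(2) dist_real_def)
  show "\<forall>\<^sub>F s in nhds 0. \<forall>z\<in>S. \<bar>R s z\<bar> \<le> \<epsilon> * \<bar>s\<bar>"
    unfolding eventually_nhds_metric
  proof (intro exI[of _ "min d r"] conjI allI impI ballI)
    show "0 < min d r" using d r by simp
    fix s :: real and z assume s: "dist s 0 < min d r" and z: "z \<in> S"
    have "\<Psi> s \<le> \<epsilon>" using d(2)[of s] s by (simp add: dist_real_def)
    then have "\<Psi> s * \<bar>s\<bar> \<le> \<epsilon> * \<bar>s\<bar>" by (simp add: mult_right_mono)
    moreover have "\<bar>R s z\<bar> \<le> \<Psi> s * \<bar>s\<bar>" using s by (intro R z) (simp add: dist_real_def)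
    ultimately show "\<bar>R s z\<bar> \<le> \<epsilon> * \<bar>s\<bar>" by linarith
  qed
qed

context expansion
begin

text \<open>The leading term is the radius for the current parameter, so its variation with
  \<open>s\<close> is not expanded. Only the factor of \<open>cos x\<close> is frozen at
  \<open>s = 0\<close>, and for that continuity of \<open>1 / sqrt (MM s)\<close> is enough.\<close>

lemma boundary_expansion:
  assumes r: "0 < r" "r \<le> e" "\<And>s. \<bar>s\<bar> < r \<Longrightarrow> MM s > 0" "\<And>s x. \<bar>s\<bar> < r \<Longrightarrow> \<bar>gam s x\<bar> \<le> 1 / 2"
    and c: "isCont (\<lambda>s. 1 / sqrt (MM s)) 0"
  shows "uniformly_small_o UNIV (\<lambda>s x. hh s x - (1 / sqrt (MM s) + s * (- gh / sqrt M0) * cos x))"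
proof -
  define \<sigma> where "\<sigma> s = 1 / sqrt (MM s)" for s
  define C where "C = (\<Sum>n. tot X n * e ^ n) / e\<^sup>2"
  define \<Psi> where "\<Psi> s = 2 * \<bar>\<sigma> s\<bar> * (C * \<bar>s\<bar>) + \<bar>gh\<bar> * (2 * \<bar>\<sigma> s - \<sigma> 0\<bar> + 2 * \<bar>\<sigma> 0\<bar> * (\<bar>s\<bar> * \<bar>gh\<bar> + s\<^sup>2 * C))" for s
  show ?thesis
  proof (rule uniformly_small_oI[OF r(1)])
    have "isCont \<sigma> 0" using c by (simp add: \<sigma>_def[abs_def])
    then show "isCont \<Psi> 0" unfolding \<Psi>_def[abs_def] by (intro continuous_intros)
    show "\<Psi> 0 = 0" by (simp add: \<Psi>_def)
    fix s x assume s: "\<bar>s\<bar> < r"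
    then have se: "\<bar>s\<bar> < e" using r by simp
    define \<gamma> where "\<gamma> = gam s x"
    have \<gamma>1: "\<bar>\<gamma> - s * gh * cos x\<bar> \<le> s\<^sup>2 * C"
      using first_order_expansion(1)[OF se, of 0 x] by (simp add: \<gamma>_def C_def)
    have "\<bar>s * gh * cos x\<bar> \<le> \<bar>s\<bar> * \<bar>gh\<bar> * 1" unfolding abs_mult by (intro mult_left_mono) auto
    then have \<gamma>2: "\<bar>\<gamma>\<bar> \<le> \<bar>s\<bar> * \<bar>gh\<bar> + s\<^sup>2 * C" using \<gamma>1 by linarith
    have "\<bar>\<gamma>\<bar> \<le> 1 / 2" using r(4)[OF s] by (simp add: \<gamma>_def)
    then have g: "1 + \<gamma> \<ge> 1 / 2" by linarith
    define q where "q = 1 / (1 + \<gamma>)"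
    have q: "0 \<le> q" "q \<le> 2" "q * (1 + \<gamma>) = 1" using g by (auto simp: q_def field_simps)
    \<comment> \<open>The error is split into the quadratic remainder of \<open>gam\<close> and the
      change of \<open>\<sigma> q\<close> from \<open>\<sigma> 0\<close> in the factor of
      \<open>cos x\<close>; both are \<open>\<bar>s\<bar>\<close> times something that tends to
      \<open>0\<close>.\<close>
    have "hh s x - (\<sigma> s + s * (- gh * \<sigma> 0) * cos x)
       = - (\<sigma> s * q * (\<gamma> - s * gh * cos x)) - s * gh * cos x * (q * (\<sigma> s - \<sigma> 0) - \<sigma> 0 * q * \<gamma>)"
    proof -
      have "hh s x = \<sigma> s * q" by (simp add: hh_def \<sigma>_def q_def \<gamma>_def)
      moreover have "\<sigma> s = \<sigma> s * (q * (1 + \<gamma>))" "\<sigma> 0 = \<sigma> 0 * (q * (1 + \<gamma>))" using q(3) by simp_all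
      ultimately show ?thesis using q(3) by algebra
    qed
    also have "\<bar>\<dots>\<bar> \<le> \<bar>\<sigma> s * q * (\<gamma> - s * gh * cos x)\<bar> + \<bar>s * gh * cos x * (q * (\<sigma> s - \<sigma> 0) - \<sigma> 0 * q * \<gamma>)\<bar>"
      by linarith
    also have "\<bar>\<sigma> s * q * (\<gamma> - s * gh * cos x)\<bar> \<le> \<bar>\<sigma> s\<bar> * 2 * (s\<^sup>2 * C)"
      unfolding abs_mult using q \<gamma>1 by (intro mult_mono) auto
    also have "\<bar>s * gh * cos x * (q * (\<sigma> s - \<sigma> 0) - \<sigma> 0 * q * \<gamma>)\<bar> \<le> \<bar>s\<bar> * \<bar>gh\<bar> * 1 * (2 * \<bar>\<sigma> s - \<sigma> 0\<bar> + 2 * \<bar>\<sigma> 0\<bar> * (\<bar>s\<bar> * \<bar>gh\<bar> + s\<^sup>2 * C))"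
    proof -
      have "\<bar>q * (\<sigma> s - \<sigma> 0)\<bar> \<le> 2 * \<bar>\<sigma> s - \<sigma> 0\<bar>" unfolding abs_mult using q by (intro mult_right_mono) auto
      moreover have "\<bar>\<sigma> 0 * q * \<gamma>\<bar> \<le> \<bar>\<sigma> 0\<bar> * 2 * (\<bar>s\<bar> * \<bar>gh\<bar> + s\<^sup>2 * C)"
        unfolding abs_mult using q \<gamma>2 by (intro mult_mono) auto
      moreover have "\<bar>\<sigma> 0\<bar> * 2 = 2 * \<bar>\<sigma> 0\<bar>" by simp
      ultimately have "\<bar>q * (\<sigma> s - \<sigma> 0) - \<sigma> 0 * q * \<gamma>\<bar> \<le> 2 * \<bar>\<sigma> s - \<sigma> 0\<bar> + 2 * \<bar>\<sigma> 0\<bar> * (\<bar>s\<bar> * \<bar>gh\<bar> + s\<^sup>2 * C)"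
        using abs_triangle_ineq4[of "q * (\<sigma> s - \<sigma> 0)" "\<sigma> 0 * q * \<gamma>"] by linarith
      then show ?thesis unfolding abs_mult by (intro mult_mono) auto
    qed
    also have "\<bar>\<sigma> s\<bar> * 2 * (s\<^sup>2 * C) + \<bar>s\<bar> * \<bar>gh\<bar> * 1 * (2 * \<bar>\<sigma> s - \<sigma> 0\<bar> + 2 * \<bar>\<sigma> 0\<bar> * (\<bar>s\<bar> * \<bar>gh\<bar> + s\<^sup>2 * C)) = \<Psi> s * \<bar>s\<bar>"
    proof -
      have "A * 2 * (a * a * C) + a * B * 1 * D = (2 * A * (C * a) + B * D) * a" for a A B D by algebra
      moreover have "s\<^sup>2 * C = \<bar>s\<bar> * \<bar>s\<bar> * C" by (simp add: power2_eq_square)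
      ultimately show ?thesis unfolding \<Psi>_def by (simp only:)
    qed
    finally have "\<bar>hh s x - (\<sigma> s + s * (- gh * \<sigma> 0) * cos x)\<bar> \<le> \<Psi> s * \<bar>s\<bar>" by simp
    then show "\<bar>hh s x - (1 / sqrt (MM s) + s * (- gh / sqrt M0) * cos x)\<bar> \<le> \<Psi> s * \<bar>s\<bar>"
      by (simp add: \<sigma>_def MM_0)
  qed
qed

text \<open>Inserting \<open>t / h\<close> undoes the flattening exactly, since \<open>y\<close>
  becomes \<open>norm t\<close>; what remains is the first order expansion of \<open>fU\<close>,
  uniform on the closed unit interval.\<close>

lemma solution_expansion:
  assumes r: "0 < r" "r \<le> e" and h: "\<And>s x. \<bar>s\<bar> < r \<Longrightarrow> hh s x > 0"
  shows "uniformly_small_o (ball 0 1 \<times> UNIV) (\<lambda>s (t :: 'a::euclidean_space, x).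
     (\<lambda>z. U (norm (fst z) * hh s (snd z)) + fU s (norm (fst z) * hh s (snd z)) (snd z)) (t /\<^sub>R hh s x, x) -
     (U (norm t) + s * (rad N (- l1) (norm t) + gh * norm t * deriv U (norm t)) * cos x))"
proof (rule uniformly_small_oI[OF r(1)])
  define C where "C = (\<Sum>n. tot X n * e ^ n) / e\<^sup>2"
  show "isCont (\<lambda>s. C * \<bar>s\<bar>) 0" by (intro continuous_intros)
  show "C * \<bar>0\<bar> = 0" by simp
  fix s and z :: "'a \<times> real" assume s: "\<bar>s\<bar> < r" and z: "z \<in> ball 0 1 \<times> UNIV"
  obtain t x where tx: "z = (t, x)" by (cases z)
  have t: "norm t \<in> {0..1}" using z by (simp add: tx)
  have n: "norm (t /\<^sub>R hh s x) * hh s x = norm t" using h[OF s, of x] by simp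
  have dU: "deriv U (norm t) = U' (norm t)" by (rule DERIV_imp_deriv[OF DERIV_U(1)])
  have "\<bar>fU s (norm t) x - s * (rad N (- l1) (norm t) + gh * norm t * U' (norm t)) * cos x\<bar> \<le> s\<^sup>2 * C"
    unfolding C_def by (rule first_order_expansion(2)) (use s r t in auto)
  then show "\<bar>case z of (t, x) \<Rightarrow> (\<lambda>z. U (norm (fst z) * hh s (snd z)) + fU s (norm (fst z) * hh s (snd z)) (snd z)) (t /\<^sub>R hh s x, x) -
     (U (norm t) + s * (rad N (- l1) (norm t) + gh * norm t * deriv U (norm t)) * cos x)\<bar> \<le> C * \<bar>s\<bar> * \<bar>s\<bar>"
    unfolding tx case_prod_conv fst_conv snd_conv n dU by (simp add: power2_eq_square mult_ac)
qed

end

theorem theorem1p2: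
  fixes m :: nat
  assumes "m \<ge> 1"
  shows "\<exists>(\<mu>0::real) (\<kappa>::real) (\<beta>::real) (\<gamma>::real) (U :: real \<Rightarrow> real) (\<phi>1 :: real \<Rightarrow> real).
    \<mu>0 > 0 \<and> \<kappa> > 0 \<and> \<beta> \<noteq> 0 \<and> \<gamma> \<noteq> 0 \<and>
    nth_radial_neumann_eigenfunction TYPE(real ^ 'n::finite) m U \<and> U 1 = 1 \<and>
    positive_first_dirichlet_eigenfunction (\<lambda>t::real ^ 'n. \<phi>1 (norm t)) \<and>
    (\<forall>\<alpha>::real. 0 < \<alpha> \<and> \<alpha> < 1 \<longrightarrow>
      (\<exists>(\<epsilon>::real) (\<mu> :: real \<Rightarrow> real) (h :: real \<Rightarrow> real \<Rightarrow> real)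
         (w :: real \<Rightarrow> (real ^ 'n) \<times> real \<Rightarrow> real).
        \<epsilon> > 0 \<and>
        (\<forall>s\<in>{-\<epsilon><..<\<epsilon>}. \<mu> s > 0 \<and> h s \<in> P2a_per \<alpha>) \<and>
        smooth_real_on {-\<epsilon><..<\<epsilon>} \<mu> \<and>
        smooth_curve_C2a \<alpha> {-\<epsilon><..<\<epsilon>} h \<and>
        \<mu> 0 = \<mu>0 \<and>
        uniformly_small_o UNIV (\<lambda>s x. h s x - (\<kappa> * sqrt (\<mu> s) + s * \<beta> * cos x)) \<and>
        (\<forall>s\<in>{-\<epsilon><..<\<epsilon>}.
           overdetermined_solution (\<mu> s) (h s) (w s) \<and>
           radial_periodic_even_on (closure (Omega (h s))) (w s)) \<and>
        uniformly_small_o (ball 0 1 \<times> UNIV)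
          (\<lambda>s (t, x). w s (t /\<^sub>R h s x, x) -
             (U (norm t) + s * (\<phi>1 (norm t) + \<gamma> * norm t * deriv U (norm t)) * cos x))))"
proof -
  define N where "N = DIM(real ^ 'n)"
  have N: "N \<ge> 1" by (simp add: N_def DIM_positive Suc_leI)
  obtain l1 where l1: "l1 > 0" "bes N (- l1) = 0" "\<And>x. 0 \<le> x \<Longrightarrow> x < l1 \<Longrightarrow> bes N (- x) > 0"
    using first_bes_zero[OF N] by blast
  obtain Lam where L: "Lam > 0" "bes1 N (- Lam) = 0"
    "finite ({l. 0 < l \<and> bes1 N (- l) = 0} \<inter> {..Lam})" "card ({l. 0 < l \<and> bes1 N (- l) = 0} \<inter> {..Lam}) = m"
    using bes1_zero_nth[OF N assms] by blast
  interpret schiffer N l1 Lam by unfold_locales (rule N l1 L | assumption)+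
  obtain X e where X: "e > 0" "X 0 = zero_coefs" "first_order (X 1)" "\<forall>n\<ge>1. good X n"
    "summable (\<lambda>n. tot X n * e ^ n)" "summable (\<lambda>n. \<bar>cm (X (Suc n))\<bar> * e ^ n)"
    using expansion_exists by blast
  interpret expansion N l1 Lam X e by unfold_locales (use X in auto)
  obtain r where r: "0 < r" "r \<le> e" "\<And>s. \<bar>s\<bar> < r \<Longrightarrow> MM s > 0" "\<And>s x. \<bar>s\<bar> < r \<Longrightarrow> \<bar>gam s x\<bar> \<le> 1 / 2"
    and sm: "smooth_real_on {-r<..<r} (\<lambda>s. Lam / MM s)" "\<And>\<alpha>. 0 < \<alpha> \<Longrightarrow> \<alpha> < 1 \<Longrightarrow> smooth_curve_C2a \<alpha> {-r<..<r} hh"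
    and P: "\<And>\<alpha> s. 0 < \<alpha> \<Longrightarrow> \<alpha> < 1 \<Longrightarrow> \<bar>s\<bar> < r \<Longrightarrow> hh s \<in> P2a_per \<alpha>" and c: "isCont (\<lambda>s. 1 / sqrt (MM s)) 0"
    using curve by blast
  define w where "w s z = U (norm (fst z) * hh s (snd z)) + fU s (norm (fst z) * hh s (snd z)) (snd z)" for s and z :: "(real ^ 'n) \<times> real"
  \<comment> \<open>The exponent \<open>1 / 2\<close> is an arbitrary admissible choice; positivity
    does not depend on it.\<close>
  have hpos: "hh s x > 0" if "\<bar>s\<bar> < r" for s x using P[of "1 / 2" s] that by (simp add: P2a_per_def)
  have sol: "overdetermined_solution (Lam / MM s) (hh s) (w s) \<and> radial_periodic_even_on (closure (Omega (hh s))) (w s)" if s: "\<bar>s\<bar> < r" for s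
  proof -
    have fl: "flat N Lam (MM s) (\<Sum>n. tot X n * e ^ n) (\<lambda>x. 1 + gam s x) (gam' s) (\<lambda>y x. U y + fU s y x) (\<lambda>y x. U' y + fP s y x)
      (\<lambda>y x. U'' y + fPy s y x) (fPx s) (eta s) (etax s)" by (rule flat) (use s r in auto)
    have h: "flat.h (MM s) (\<lambda>x. 1 + gam s x) = hh s"
      by (simp add: fun_eq_iff flat.h_def[OF fl] flat.sg_def[OF fl] hh_def)
    have "w s = (\<lambda>z. U (norm (fst z) * hh s (snd z)) + fU s (norm (fst z) * hh s (snd z)) (snd z))"
      by (rule ext) (rule w_def)
    then show ?thesis
      using flat.overdetermined[OF fl N_def[symmetric]] unfolding h by simp
  qed
  have neum: "nth_radial_neumann_eigenfunction TYPE(real ^ 'n) m U"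
  proof -
    have "{l \<in> radial_neumann_eigenvalues TYPE(real ^ 'n). 0 < l \<and> l \<le> Lam} = {l. 0 < l \<and> bes1 N (- l) = 0} \<inter> {..Lam}"
      using radial_neumann_eigenvalues_eq(1)[where 'a="real ^ 'n", folded N_def] by blast
    moreover have "neumann_eigenfunction Lam (\<lambda>t::real ^ 'n. U (norm t))"
      using radial_neumann_eigenvalues_eq(2)[where 'a="real ^ 'n" and l=Lam and c="1 / bes N (- Lam)", folded N_def] Lam(2) bes_Lam
      by (simp add: U_def)
    ultimately show ?thesis
      unfolding nth_radial_neumann_eigenfunction_def
      by (intro exI[of _ Lam] conjI L(1)) (simp_all only: L)
  qed
  have dir: "positive_first_dirichlet_eigenfunction (\<lambda>t::real ^ 'n. rad N (- l1) (norm t))"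
    using positive_first_dirichlet_rad[where 'a="real ^ 'n", folded N_def] l1 by blast
  \<comment> \<open>With \<open>\<mu> = Lam / M\<close> the radius factor \<open>1 / sqrt M\<close>
    is \<open>sqrt \<mu> / sqrt Lam\<close>, which gives the constant
    \<open>\<kappa>\<close>.\<close>
  have \<kappa>: "1 / sqrt Lam * sqrt (Lam / MM s) = 1 / sqrt (MM s)" for s
    using Lam(1) by (simp add: real_sqrt_divide)
  \<comment> \<open>The value for \<open>\<beta>\<close> comes from
    \<open>h = \<sigma> / (1 + gam)\<close>, whose first order term is
    \<open>- \<sigma> gh cos x\<close> with \<open>\<sigma> = 1 / sqrt M0\<close> at
    \<open>s = 0\<close>.\<close>
  have pos: "Lam / M0 > 0" "1 / sqrt Lam > 0" "- gh / sqrt M0 \<noteq> 0" using Lam M0 gh_nonzero by simp_all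
  note bnd = boundary_expansion[OF r c] solution_expansion[where 'a="real ^ 'n", OF r(1,2) hpos]
  have M: "Lam / MM 0 = Lam / M0" by (simp add: MM_0)
  show ?thesis
    by (rule exI[of _ "Lam / M0"], rule exI[of _ "1 / sqrt Lam"], rule exI[of _ "- gh / sqrt M0"], rule exI[of _ gh],
      rule exI[of _ U], rule exI[of _ "rad N (- l1)"], intro conjI allI impI, rule pos, rule pos, rule pos, rule gh_nonzero,
      rule neum, rule U_1, rule dir, rule exI[of _ r], rule exI[of _ "\<lambda>s. Lam / MM s"], rule exI[of _ hh], rule exI[of _ w],
      intro conjI ballI, unfold \<kappa>)
      (use r sm P sol M Lam bnd[unfolded w_def[symmetric]] in \<open>auto simp: abs_less_iff\<close>)
qed

end
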